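(* Let $d\ge 2$ and consider $H=L^2(\mathbb{R}^d,\mu)$ where $\mu=\rho\,dx$, $\rho=\varphi^2$ for some $\varphi\in H^{1,2}_{\mathrm{loc}}(\mathbb{R}^d)$ such that $\frac1\rho\in L^\infty_{\mathrm{loc}}(\mathbb{R}^d)$. Let $A=(a_{ij})_{1\le i,j\le d}:\mathbb{R}^d\to\mathbb{R}^{d\times d}$ be symmetric and locally strictly elliptic with $a_{ij}\in L^\infty(\mathbb{R}^d)$ for all $1\le i,j\le d$. Assume there is some $p>d$ such that $a_{ij}\in H^{1,p}_{\mathrm{loc}}(\mathbb{R}^d)$ for all $1\le i,j\le d$ and that $|\nabla\rho|\in L^p_{\mathrm{loc}}(\mathbb{R}^d)$. Consider the bilinear form $(B,D)$ given by $D=C_c^\infty(\mathbb{R}^d)$ and $$B(f,g):=(\nabla f,A\nabla g)_H=\int_{\mathbb{R}^d}(\nabla f(x),A(x)\nabla g(x))_{\mathrm{euc}}\,\rho(x)\,dx,\qquad f,g\in D.$$ Define further the linear operator $(S,D)$ via $$Sf:=\sum_{i,j=1}^da_{ij}\partial_j\partial_if+\sum_{i=1}^db_i\partial_if,\qquad f\in D,$$ where $b_i=\sum_{j=1}^d\big(\partial_ja_{ij}+a_{ij}\frac{\partial_j\rho}{\rho}\big)\in L^p_{\mathrm{loc}}(\mathbb{R}^d)$, so that $B(f,g)=(-Sf,g)_H$ for $f,g\in D$. Then $(S,D)$ is essentially self-adjoint on $H$.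
   Context: $(\cdot,\cdot)_{\mathrm{euc}}$ is the Euclidean inner product. $H^{1,q}_{\mathrm{loc}}(\mathbb{R}^d)$ is the local Sobolev space of functions which, together with their first weak derivatives, are in $L^q_{\mathrm{loc}}(\mathbb{R}^d)$ (with respect to Lebesgue measure). Locally strictly elliptic means: for each compact $K\subset\mathbb{R}^d$ there is $c_K>0$ with $(y,A(x)y)_{\mathrm{euc}}\ge c_K|y|^2$ for all $x\in K$, $y\in\mathbb{R}^d$. *)

theory Defs
  imports "HOL-Analysis.Analysis"
begin

text \<open>
  Measurability and integrals refer to the completed measure \<^const>\<open>lebesgue\<close>, so that all
  Lebesgue measurable functions are covered; elements of $L^q$-type spaces are represented by
  functions, and every notion below that concerns such elements is invariant under changes on
  null sets.
\<close>

section \<open>Lebesgue and Sobolev spaces\<close>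

definition Lloc :: "real \<Rightarrow> ('a::euclidean_space \<Rightarrow> real) set" where
  "Lloc q = {f \<in> borel_measurable lebesgue.
     \<forall>K. compact K \<longrightarrow> set_integrable lebesgue K (\<lambda>x. \<bar>f x\<bar> powr q)}"

definition Linf :: "('a::euclidean_space \<Rightarrow> real) set" where
  "Linf = {f \<in> borel_measurable lebesgue. \<exists>C. AE x in lebesgue. \<bar>f x\<bar> \<le> C}"

definition Linf_loc :: "('a::euclidean_space \<Rightarrow> real) set" where
  "Linf_loc = {f \<in> borel_measurable lebesgue.
     \<forall>K. compact K \<longrightarrow> (\<exists>C. AE x in lebesgue. x \<in> K \<longrightarrow> \<bar>f x\<bar> \<le> C)}"

text \<open>
  $1/\rho \in L^\infty_{\mathrm{loc}}$ includes that $1/\rho$ is defined almost everywhere. This has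
  to be said separately, because division by zero yields zero in HOL.
\<close>
definition recip_Linf_loc :: "('a::euclidean_space \<Rightarrow> real) \<Rightarrow> bool" where
  "recip_Linf_loc \<rho> \<longleftrightarrow> (AE x in lebesgue. \<rho> x \<noteq> 0) \<and> (\<lambda>x. 1 / \<rho> x) \<in> Linf_loc"

definition pd :: "'n \<Rightarrow> (real^'n \<Rightarrow> real) \<Rightarrow> real^'n \<Rightarrow> real" where
  "pd i f x = frechet_derivative f (at x) (axis i 1)"

definition grad :: "(real^'n \<Rightarrow> real) \<Rightarrow> real^'n \<Rightarrow> real^'n" where
  "grad f x = (\<chi> i. pd i f x)"

primrec Ck :: "nat \<Rightarrow> (real^'n \<Rightarrow> real) \<Rightarrow> bool" where
  "Ck 0 f \<longleftrightarrow> continuous_on UNIV f"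
| "Ck (Suc k) f \<longleftrightarrow> (\<forall>x. f differentiable (at x)) \<and> (\<forall>i. Ck k (pd i f))"

definition Cc_infty :: "(real^'n \<Rightarrow> real) set" where
  "Cc_infty = {f. (\<forall>k. Ck k f) \<and> compact (closure {x. f x \<noteq> 0})}"

definition has_weak_partial :: "'n \<Rightarrow> (real^'n \<Rightarrow> real) \<Rightarrow> (real^'n \<Rightarrow> real) \<Rightarrow> bool" where
  "has_weak_partial i f g \<longleftrightarrow> f \<in> Lloc 1 \<and> g \<in> Lloc 1 \<and>
     (\<forall>\<psi>\<in>Cc_infty. (LINT x|lebesgue. f x * pd i \<psi> x) = - (LINT x|lebesgue. g x * \<psi> x))"

text \<open>
  Weak derivatives are unique almost everywhere; \<open>weak_pd\<close> selects one version and is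
  unspecified if there is none.
\<close>
definition weak_pd :: "'n \<Rightarrow> (real^'n \<Rightarrow> real) \<Rightarrow> real^'n \<Rightarrow> real" where
  "weak_pd i f = (SOME g. has_weak_partial i f g)"

definition weak_grad :: "(real^'n \<Rightarrow> real) \<Rightarrow> real^'n \<Rightarrow> real^'n" where
  "weak_grad f x = (\<chi> i. weak_pd i f x)"

definition H1loc :: "real \<Rightarrow> (real^'n \<Rightarrow> real) set" where
  "H1loc q = {f \<in> Lloc q. \<forall>i. \<exists>g\<in>Lloc q. has_weak_partial i f g}"

section \<open>Unbounded operators on a real $L^2$-space\<close>

definition L2 :: "'a measure \<Rightarrow> ('a \<Rightarrow> real) set" where
  "L2 M = {f \<in> borel_measurable M. integrable M (\<lambda>x. (f x)\<^sup>2)}"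

definition L2_inner :: "'a measure \<Rightarrow> ('a \<Rightarrow> real) \<Rightarrow> ('a \<Rightarrow> real) \<Rightarrow> real" where
  "L2_inner M f g = (LINT x|M. f x * g x)"

definition L2_norm :: "'a measure \<Rightarrow> ('a \<Rightarrow> real) \<Rightarrow> real" where
  "L2_norm M f = sqrt (L2_inner M f f)"

definition L2_tendsto :: "'a measure \<Rightarrow> (nat \<Rightarrow> 'a \<Rightarrow> real) \<Rightarrow> ('a \<Rightarrow> real) \<Rightarrow> bool" where
  "L2_tendsto M f u \<longleftrightarrow> (\<lambda>n. L2_norm M (\<lambda>x. f n x - u x)) \<longlonglongrightarrow> 0"

text \<open>
  The last condition says that \<open>T\<close> is well defined on equivalence classes; together with
  linearity it suffices to require it at zero.
\<close>
definition L2_operator ::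
  "'a measure \<Rightarrow> ('a \<Rightarrow> real) set \<Rightarrow> (('a \<Rightarrow> real) \<Rightarrow> 'a \<Rightarrow> real) \<Rightarrow> bool" where
  "L2_operator M D T \<longleftrightarrow>
     D \<subseteq> L2 M \<and> T ` D \<subseteq> L2 M \<and> (\<lambda>x. 0) \<in> D \<and>
     (\<forall>f\<in>D. \<forall>g\<in>D. \<forall>a b. (\<lambda>x. a * f x + b * g x) \<in> D \<and>
        (AE x in M. T (\<lambda>x. a * f x + b * g x) x = a * T f x + b * T g x)) \<and>
     (\<forall>f\<in>D. (AE x in M. f x = 0) \<longrightarrow> (AE x in M. T f x = 0))"

definition L2_dense :: "'a measure \<Rightarrow> ('a \<Rightarrow> real) set \<Rightarrow> bool" where
  "L2_dense M D \<longleftrightarrow> D \<subseteq> L2 M \<and>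
     (\<forall>u\<in>L2 M. \<exists>f. (\<forall>n. f n \<in> D) \<and> L2_tendsto M f u)"

text \<open>
  Closures and adjoints are given by their graphs. Both are saturated under almost everywhere
  equality in either component, so equality of these sets of pairs of representatives is equality
  of the corresponding graphs in the Hilbert space.
\<close>
definition graph_on :: "('a \<Rightarrow> real) set \<Rightarrow> (('a \<Rightarrow> real) \<Rightarrow> 'a \<Rightarrow> real)
    \<Rightarrow> (('a \<Rightarrow> real) \<times> ('a \<Rightarrow> real)) set" where
  "graph_on D T = {(f, T f) |f. f \<in> D}"

definition L2_closure :: "'a measure \<Rightarrow> (('a \<Rightarrow> real) \<times> ('a \<Rightarrow> real)) set
    \<Rightarrow> (('a \<Rightarrow> real) \<times> ('a \<Rightarrow> real)) set" where
  "L2_closure M G = {(u, v). u \<in> L2 M \<and> v \<in> L2 M \<and>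
     (\<exists>f g. (\<forall>n. (f n, g n) \<in> G) \<and> L2_tendsto M f u \<and> L2_tendsto M g v)}"

definition L2_adjoint :: "'a measure \<Rightarrow> (('a \<Rightarrow> real) \<times> ('a \<Rightarrow> real)) set
    \<Rightarrow> (('a \<Rightarrow> real) \<times> ('a \<Rightarrow> real)) set" where
  "L2_adjoint M G = {(u, v). u \<in> L2 M \<and> v \<in> L2 M \<and>
     (\<forall>(f, g)\<in>G. L2_inner M g u = L2_inner M f v)}"

text \<open>
  Since \<open>D\<close> is dense, the adjoint is single-valued up to null sets. Hence so is the closure
  once it equals its adjoint, and closability need not be required separately.
\<close>
definition essentially_self_adjoint ::
  "'a measure \<Rightarrow> ('a \<Rightarrow> real) set \<Rightarrow> (('a \<Rightarrow> real) \<Rightarrow> 'a \<Rightarrow> real) \<Rightarrow> bool" where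
  "essentially_self_adjoint M D T \<longleftrightarrow>
     L2_operator M D T \<and> L2_dense M D \<and>
     L2_adjoint M (L2_closure M (graph_on D T)) = L2_closure M (graph_on D T)"

section \<open>The coefficients, the bilinear form and the operator\<close>

definition weighted :: "('a::euclidean_space \<Rightarrow> real) \<Rightarrow> 'a measure" where
  "weighted \<rho> = density lebesgue (\<lambda>x. ennreal (\<rho> x))"

definition locally_strictly_elliptic :: "(real^'n \<Rightarrow> real^'n^'n) \<Rightarrow> bool" where
  "locally_strictly_elliptic A \<longleftrightarrow>
     (\<forall>K. compact K \<longrightarrow> (\<exists>c>0. \<forall>x\<in>K. \<forall>y. y \<bullet> (A x *v y) \<ge> c * (norm y)\<^sup>2))"

definition form_B :: "(real^'n \<Rightarrow> real^'n^'n) \<Rightarrow> (real^'n \<Rightarrow> real)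
    \<Rightarrow> (real^'n \<Rightarrow> real) \<Rightarrow> (real^'n \<Rightarrow> real) \<Rightarrow> real" where
  "form_B A \<rho> f g = (LINT x|lebesgue. (grad f x \<bullet> (A x *v grad g x)) * \<rho> x)"

definition drift :: "(real^'n \<Rightarrow> real^'n^'n) \<Rightarrow> (real^'n \<Rightarrow> real) \<Rightarrow> 'n \<Rightarrow> real^'n \<Rightarrow> real" where
  "drift A \<rho> i x =
     (\<Sum>j\<in>UNIV. weak_pd j (\<lambda>z. A z $ i $ j) x + A x $ i $ j * (weak_pd j \<rho> x / \<rho> x))"

definition op_S :: "(real^'n \<Rightarrow> real^'n^'n) \<Rightarrow> (real^'n \<Rightarrow> real)
    \<Rightarrow> (real^'n \<Rightarrow> real) \<Rightarrow> real^'n \<Rightarrow> real" where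
  "op_S A \<rho> f x =
     (\<Sum>i\<in>UNIV. \<Sum>j\<in>UNIV. A x $ i $ j * pd j (pd i f) x) + (\<Sum>i\<in>UNIV. drift A \<rho> i x * pd i f x)"

end

theory Submission
  imports Defs
begin

text \<open>
  Let \<open>c = \<rho> A\<close> and let \<open>u \<in> L\<^sup>2(\<mu>)\<close> be orthogonal to the range of \<open>S - 1\<close>, so that
  \<open>\<integral> u div (c \<nabla>f) dx = \<integral> u f \<rho> dx\<close> for all test functions \<open>f\<close>. Once \<open>u = 0\<close> is known, the range is
  dense, and since \<open>S\<close> is symmetric and dissipative its closure is self-adjoint.

  To test the equation with \<open>f = \<theta>\<^sup>2 u\<close>, the function \<open>w = \<eta> u\<close> (with a cutoff \<open>\<eta>\<close>) is written, up to a small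
  error, as \<open>w = v - \<epsilon> \<Delta>v\<close> with a test function \<open>v\<close>. In \<open>-\<integral> w div (c \<nabla>v) = \<integral> c \<nabla>v \<nabla>v + \<epsilon> \<integral> \<Delta>v div (c \<nabla>v)\<close>
  the second term equals \<open>\<epsilon> \<integral> c \<nabla>\<partial>\<^sub>kv \<nabla>\<partial>\<^sub>kv\<close> up to terms with \<open>\<epsilon> \<bar>\<nabla>c\<bar> \<bar>\<nabla>v\<bar> \<bar>D\<^sup>2v\<bar>\<close>. Because \<open>\<nabla>c \<in> L\<^sup>p\<close> with \<open>p > d\<close>,
  they are of smaller order, so that \<open>v\<close> stays bounded in \<open>H\<^sup>1\<close> and \<open>\<epsilon>\<^sup>1\<^sup>/\<^sup>2 D\<^sup>2v\<close> in \<open>L\<^sup>2\<close> as \<open>\<epsilon> \<rightarrow> 0\<close>. No regularity theory is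
  needed: testing with \<open>f = \<theta>\<^sup>2 v\<close> and letting \<open>\<epsilon> \<rightarrow> 0\<close> gives
  \<open>\<integral> \<theta>\<^sup>2 u\<^sup>2 d\<mu> \<le> \<integral> u\<^sup>2 (A \<nabla>\<theta>, \<nabla>\<theta>) d\<mu>\<close>, and \<open>u = 0\<close> follows since \<open>A\<close> is bounded and \<open>\<nabla>\<theta>\<close> can be made small.

  That the functions \<open>v - \<epsilon> \<Delta>v\<close> are dense in \<open>L\<^sup>2\<close> is a maximum principle, and the local boundedness of
  \<open>\<rho>\<close> is Morrey's inequality, applied to \<open>\<integral> \<rho> \<psi>(\<cdot> - s y) dx\<close> as a function of \<open>s\<close>.
\<close>

section \<open>Smooth functions\<close>

text \<open>The equation for \<open>u\<close> is known only against test functions, and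
  \<open>u\<close> is merely square integrable, so no cutoff of \<open>u\<close> may be inserted;
  convolving \<open>u\<close> would create commutators with the rough coefficients. With
  \<open>v - \<epsilon> \<Delta>v\<close> the operator acts on \<open>v\<close> itself and the extra
  term is coercive. The price is that \<open>v\<close> has no prescribed support. Therefore the
  coefficients are deformed to the identity matrix outside a large ball: bounds and ellipticity
  become global, and the derivatives of the coefficients get compact support.

  The range of \<open>1 - \<epsilon> \<Delta>\<close> on test functions is only dense. With
  \<open>\<epsilon> = \<sigma>\<^sup>2\<close>, an error of size \<open>\<sigma>\<^sup>2\<close> in
  L2 is harmless, because the operator applied to \<open>v\<close> has norm of order at most
  1/\<sigma>.

  The condition p > d enters through one inequality: for compactly supported \<open>b\<close> in Lp
  and 0 < t \<le> 1, the norm of \<open>b g\<close> is at most a constant times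
  \<open>t powr (\<kappa> - 1)\<close> times the norm of \<open>g\<close> plus
  \<open>t powr \<kappa>\<close> times the norm of its gradient, where \<kappa> = 1 - d/p. It comes
  from averaging over cubes, as does the bound for \<rho>; taking t = \<sigma> makes every
  lower-order term gain \<open>\<sigma> powr \<kappa>\<close>.\<close>

definition smooth :: "(real^'n \<Rightarrow> real) \<Rightarrow> bool" where
  "smooth f \<longleftrightarrow> (\<forall>k. Ck k f)"

lemma pd_eqI: "(f has_derivative D) (at x) \<Longrightarrow> pd i f x = D (axis i 1)"
  unfolding pd_def by (metis frechet_derivative_at)

lemma Ck_Suc_imp_Ck: "Ck (Suc k) f \<Longrightarrow> Ck k f"
proof (induction k arbitrary: f)
  case 0
  then show ?case by (auto simp: continuous_on_eq_continuous_at differentiable_imp_continuous_within)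
next
  case (Suc k)
  then show ?case by (metis Ck.simps(2))
qed

lemma has_derivative_pd:
  assumes "f differentiable (at x)"
  shows "(f has_derivative (\<lambda>y. \<Sum>i\<in>UNIV. y $ i * pd i f x)) (at x)"
proof -
  have D: "(f has_derivative frechet_derivative f (at x)) (at x)"
    using assms by (simp add: frechet_derivative_works)
  then have lin: "linear (frechet_derivative f (at x))"
    by (simp add: has_derivative_linear)
  have "frechet_derivative f (at x) y = (\<Sum>i\<in>UNIV. y $ i * pd i f x)" for y
  proof -
    have "y = (\<Sum>i\<in>UNIV. y $ i *\<^sub>R axis i 1)"
      by (simp add: vec_eq_iff sum_component axis_def if_distrib cong: if_cong)
    then have "frechet_derivative f (at x) y = (\<Sum>i\<in>UNIV. frechet_derivative f (at x) (y $ i *\<^sub>R axis i 1))"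
      by (metis lin linear_sum)
    then show ?thesis
      by (simp add: linear_scale[OF lin] pd_def)
  qed
  then show ?thesis using D by presburger
qed

lemma sum_axis: "(\<Sum>j\<in>UNIV. axis i 1 $ j * g j) = (g i :: real)"
proof -
  have "(\<Sum>j\<in>UNIV. axis i 1 $ j * g j) = (\<Sum>j\<in>UNIV. if j = i then g j else 0)"
    by (intro sum.cong) (auto simp: axis_def)
  then show ?thesis by simp
qed

section \<open>Calculus rules for partial derivatives and smooth functions\<close>

lemma pd_add: "f differentiable (at x) \<Longrightarrow> g differentiable (at x) \<Longrightarrow>
    pd i (\<lambda>x. f x + g x) x = pd i f x + pd i g x"
  by (rule trans, rule pd_eqI, rule has_derivative_add, (rule has_derivative_pd, assumption)+)
     (simp add: sum_axis)

lemma pd_mult: "f differentiable (at x) \<Longrightarrow> g differentiable (at x) \<Longrightarrow>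
    pd i (\<lambda>x. f x * g x) x = pd i f x * g x + f x * pd i g x"
  by (rule trans, rule pd_eqI, rule has_derivative_mult, (rule has_derivative_pd, assumption)+)
     (simp add: sum_axis)

lemma pd_const [simp]: "pd i (\<lambda>x. c) = (\<lambda>x. 0)"
  by (rule ext, rule pd_eqI) (rule has_derivative_const)

lemma pd_component: "pd i (\<lambda>x. x $ j) = (\<lambda>x. if i = j then 1 else 0)"
  by (rule ext, rule trans, rule pd_eqI, rule bounded_linear.has_derivative[OF bounded_linear_vec_nth], rule has_derivative_ident)
     (simp add: axis_def)

lemma pd_compose_real:
  assumes "(h has_real_derivative h') (at (q x))" "q differentiable (at x)"
  shows "pd i (\<lambda>x. h (q x)) x = h' * pd i q x"
  by (rule trans, rule pd_eqI, rule has_derivative_compose, rule has_derivative_pd[OF assms(2)],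
     rule assms(1)[unfolded has_field_derivative_def])
     (simp add: sum_axis)

lemma Ck_const: "Ck k (\<lambda>x. c)"
  by (induction k arbitrary: c) auto

lemma Ck_component: "Ck k (\<lambda>x. x $ j)"
proof (cases k)
  case 0 then show ?thesis by (auto intro: continuous_intros)
next
  case (Suc m)
  have "(\<lambda>x. x $ j) differentiable (at x)" for x :: "real^'a"
    by (rule bounded_linear_imp_differentiable) (rule bounded_linear_vec_nth)
  then show ?thesis using Suc by (auto simp: pd_component Ck_const)
qed

lemma Ck_add: "Ck k f \<Longrightarrow> Ck k g \<Longrightarrow> Ck k (\<lambda>x. f x + g x)"
proof (induction k arbitrary: f g)
  case 0 then show ?case by (auto intro: continuous_intros)
next
  case (Suc k)
  then have "pd i (\<lambda>x. f x + g x) = (\<lambda>x. pd i f x + pd i g x)" for i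
    by (intro ext pd_add) auto
  then show ?case using Suc by auto
qed

lemma Ck_mult: "Ck k f \<Longrightarrow> Ck k g \<Longrightarrow> Ck k (\<lambda>x. f x * g x)"
proof (induction k arbitrary: f g)
  case 0 then show ?case by (auto intro: continuous_intros)
next
  case (Suc k)
  then have *: "pd i (\<lambda>x. f x * g x) = (\<lambda>x. pd i f x * g x + f x * pd i g x)" for i
    by (intro ext pd_mult) auto
  have "Ck k f" "Ck k g" using Suc.prems Ck_Suc_imp_Ck by blast+
  then show ?case using Suc.prems by (auto simp: * intro!: Ck_add Suc.IH)
qed

lemma Ck_inverse: "Ck k f \<Longrightarrow> (\<And>x. f x \<noteq> 0) \<Longrightarrow> Ck k (\<lambda>x. inverse (f x))"
proof (induction k arbitrary: f)
  case 0 then show ?case by (auto intro!: continuous_intros)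
next
  case (Suc k)
  have *: "pd i (\<lambda>x. inverse (f x)) = (\<lambda>x. (-1) * ((inverse (f x) * inverse (f x)) * pd i f x))" for i
  proof
    fix x
    show "pd i (\<lambda>x. inverse (f x)) x = (-1) * ((inverse (f x) * inverse (f x)) * pd i f x)"
      using Suc.prems pd_compose_real[where h = inverse and q = f and x = x and i = i, OF DERIV_inverse]
      by simp
  qed
  have "Ck k f" using Suc.prems Ck_Suc_imp_Ck by blast
  then have "Ck k (\<lambda>x. inverse (f x))" using Suc by blast
  moreover have "(\<lambda>x. inverse (f x)) differentiable (at x)" for x
    using Suc.prems by (intro differentiable_inverse) auto
  ultimately show ?case using Suc.prems by (auto simp only: * Ck.simps intro!: Ck_mult Ck_const)
qed

lemma smooth_const [simp]: "smooth (\<lambda>x. c)" by (simp add: smooth_def Ck_const)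
lemma smooth_component: "smooth (\<lambda>x. x $ j)" by (simp add: smooth_def Ck_component)
lemma smooth_add: "smooth f \<Longrightarrow> smooth g \<Longrightarrow> smooth (\<lambda>x. f x + g x)" by (simp add: smooth_def Ck_add)
lemma smooth_mult: "smooth f \<Longrightarrow> smooth g \<Longrightarrow> smooth (\<lambda>x. f x * g x)" by (simp add: smooth_def Ck_mult)
lemma smooth_cmult: "smooth f \<Longrightarrow> smooth (\<lambda>x. c * f x)" by (simp add: smooth_mult)
lemma smooth_diff: "smooth f \<Longrightarrow> smooth g \<Longrightarrow> smooth (\<lambda>x. f x - g x)"
  using smooth_add[OF _ smooth_cmult[of g "-1"], of f] by simp
lemma smooth_power: "smooth f \<Longrightarrow> smooth (\<lambda>x. f x ^ n)"
  by (induction n) (auto intro: smooth_mult)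
lemma smooth_inverse: "smooth f \<Longrightarrow> (\<And>x. f x \<noteq> 0) \<Longrightarrow> smooth (\<lambda>x. inverse (f x))"
  by (simp add: smooth_def Ck_inverse)
lemma smooth_sum: "(\<And>j. j \<in> J \<Longrightarrow> smooth (f j)) \<Longrightarrow> smooth (\<lambda>x. \<Sum>j\<in>J. f j x)"
  by (induction J rule: infinite_finite_induct) (auto intro: smooth_add)
lemma smooth_pd: "smooth f \<Longrightarrow> smooth (pd i f)"
  unfolding smooth_def by (metis Ck.simps(2))
lemma smooth_differentiable: "smooth f \<Longrightarrow> f differentiable (at x)"
  unfolding smooth_def by (metis Ck.simps(2))
lemma smooth_continuous: "smooth f \<Longrightarrow> continuous_on S f"
  unfolding smooth_def by (metis Ck.simps(1) continuous_on_subset subset_UNIV)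
lemma smooth_isCont: "smooth f \<Longrightarrow> isCont f x"
  using smooth_continuous[of f UNIV] by (simp add: continuous_on_eq_continuous_at)

lemma smooth_pd_add: "smooth f \<Longrightarrow> smooth g \<Longrightarrow> pd i (\<lambda>x. f x + g x) = (\<lambda>x. pd i f x + pd i g x)"
  by (intro ext pd_add smooth_differentiable)
lemma smooth_pd_mult: "smooth f \<Longrightarrow> smooth g \<Longrightarrow>
    pd i (\<lambda>x. f x * g x) = (\<lambda>x. pd i f x * g x + f x * pd i g x)"
  by (intro ext pd_mult smooth_differentiable)
lemma smooth_pd_cmult: "smooth f \<Longrightarrow> pd i (\<lambda>x. c * f x) = (\<lambda>x. c * pd i f x)"
  by (subst smooth_pd_mult) auto
lemma has_derivative_affine:
  fixes a :: "real^'n"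
  assumes "f differentiable (at (c *\<^sub>R x + a))"
  shows "((\<lambda>x. f (c *\<^sub>R x + a)) has_derivative (\<lambda>y. c * (\<Sum>i\<in>UNIV. y $ i * pd i f (c *\<^sub>R x + a)))) (at x)"
proof -
  have "((\<lambda>x. c *\<^sub>R x + a) has_derivative (\<lambda>y. c *\<^sub>R y)) (at x)"
    by (auto intro!: derivative_eq_intros)
  from has_derivative_compose[OF this has_derivative_pd[OF assms]]
  show ?thesis by (simp add: sum_distrib_left algebra_simps)
qed

lemma pd_affine:
  "f differentiable (at (c *\<^sub>R x + a)) \<Longrightarrow> pd i (\<lambda>x. f (c *\<^sub>R x + a)) x = c * pd i f (c *\<^sub>R x + a)"
  by (rule trans, rule pd_eqI, rule has_derivative_affine, assumption)
     (simp add: sum_axis)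

lemma Ck_affine: "Ck k f \<Longrightarrow> Ck k (\<lambda>x. f (c *\<^sub>R x + a))"
proof (induction k arbitrary: f)
  case 0
  have "continuous_on UNIV (\<lambda>x. c *\<^sub>R x + a)" by (intro continuous_intros)
  from continuous_on_compose2[OF 0[simplified] this] show ?case by simp
next
  case (Suc k)
  have "pd i (\<lambda>x. f (c *\<^sub>R x + a)) = (\<lambda>x. c * pd i f (c *\<^sub>R x + a))" for i
    by (intro ext pd_affine) (use Suc.prems in auto)
  then show ?case
    using Suc has_derivative_affine[of f c _ a]
    by (auto intro!: Ck_mult Ck_const simp: differentiable_def)
qed

lemma smooth_affine: "smooth f \<Longrightarrow> smooth (\<lambda>x. f (c *\<^sub>R x + a))"
  by (simp add: smooth_def Ck_affine)

lemma smooth_pd_affine: "smooth f \<Longrightarrow> pd i (\<lambda>x. f (c *\<^sub>R x + a)) = (\<lambda>x. c * pd i f (c *\<^sub>R x + a))"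
  by (intro ext pd_affine smooth_differentiable)

lemma smooth_translate: "smooth f \<Longrightarrow> smooth (\<lambda>x. f (x - a))"
  using smooth_affine[of f 1 "-a"] by simp

lemma smooth_pd_translate: "smooth f \<Longrightarrow> pd i (\<lambda>x. f (x - a)) = (\<lambda>x. pd i f (x - a))"
  using smooth_pd_affine[of f i 1 "-a"] by simp

section \<open>Derivatives along lines and symmetry of mixed derivatives\<close>

lemma line_derivative:
  assumes "smooth f"
  shows "((\<lambda>t. f (x + t *\<^sub>R y)) has_real_derivative (\<Sum>i\<in>UNIV. y $ i * pd i f (x + t *\<^sub>R y))) (at t)"
proof -
  have "((\<lambda>t. x + t *\<^sub>R y) has_derivative (\<lambda>s. s *\<^sub>R y)) (at t)"
    by (auto intro!: derivative_eq_intros)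
  from has_derivative_compose[OF this has_derivative_pd[OF smooth_differentiable[OF assms]]]
  show ?thesis
    unfolding has_field_derivative_def
    by (rule has_derivative_eq_rhs) (auto simp: sum_distrib_left sum_distrib_right mult_ac)
qed

lemma line_derivative_axis:
  assumes "smooth f"
  shows "((\<lambda>t. f (x + t *\<^sub>R axis i 1)) has_real_derivative pd i f (x + t *\<^sub>R axis i 1)) (at t)"
  using line_derivative[OF assms, of x "axis i 1"]
  by (simp add: sum_axis)

text \<open>Two applications of the mean value theorem: in direction \<open>i\<close> to the
  difference of \<open>f\<close> along two parallel lines, then in direction \<open>j\<close> to
  \<open>pd i f\<close>. The intermediate points depend on the order of the directions, whereas the
  left side is symmetric in \<open>i\<close> and \<open>j\<close>.\<close>

lemma second_difference_mvt:
  fixes f :: "real^'n \<Rightarrow> real"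
  assumes f: "smooth f" and s: "s > 0"
  obtains \<xi> \<eta> where "0 < \<xi>" "\<xi> < s" "0 < \<eta>" "\<eta> < s"
    "f (x + s *\<^sub>R axis i 1 + s *\<^sub>R axis j 1) - f (x + s *\<^sub>R axis i 1) - f (x + s *\<^sub>R axis j 1) + f x
     = s\<^sup>2 * pd j (pd i f) (x + \<xi> *\<^sub>R axis i 1 + \<eta> *\<^sub>R axis j 1)"
proof -
  define g where "g a = f ((x + s *\<^sub>R axis j 1) + a *\<^sub>R axis i 1) - f (x + a *\<^sub>R axis i 1)" for a
  have "(g has_real_derivative pd i f ((x + s *\<^sub>R axis j 1) + a *\<^sub>R axis i 1) - pd i f (x + a *\<^sub>R axis i 1)) (at a)" for a
    unfolding g_def by (intro DERIV_diff line_derivative_axis f)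
  then obtain \<xi> where xi: "0 < \<xi>" "\<xi> < s"
    "g s - g 0 = s * (pd i f ((x + s *\<^sub>R axis j 1) + \<xi> *\<^sub>R axis i 1) - pd i f (x + \<xi> *\<^sub>R axis i 1))"
    using MVT2[OF s, of g "\<lambda>a. pd i f ((x + s *\<^sub>R axis j 1) + a *\<^sub>R axis i 1) - pd i f (x + a *\<^sub>R axis i 1)"] by auto
  define h where "h b = pd i f ((x + \<xi> *\<^sub>R axis i 1) + b *\<^sub>R axis j 1)" for b
  have "(h has_real_derivative pd j (pd i f) ((x + \<xi> *\<^sub>R axis i 1) + b *\<^sub>R axis j 1)) (at b)" for b
    unfolding h_def by (intro line_derivative_axis smooth_pd f)
  then obtain \<eta> where eta: "0 < \<eta>" "\<eta> < s"
    "h s - h 0 = s * pd j (pd i f) ((x + \<xi> *\<^sub>R axis i 1) + \<eta> *\<^sub>R axis j 1)"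
    using MVT2[OF s, of h "\<lambda>b. pd j (pd i f) ((x + \<xi> *\<^sub>R axis i 1) + b *\<^sub>R axis j 1)"] by auto
  have "g s - g 0 = s * (h s - h 0)"
    using xi(3) by (simp add: h_def algebra_simps)
  then have "g s - g 0 = s\<^sup>2 * pd j (pd i f) (x + \<xi> *\<^sub>R axis i 1 + \<eta> *\<^sub>R axis j 1)"
    using eta(3) by (simp add: power2_eq_square)
  then show thesis
    using that[OF xi(1,2) eta(1,2)] by (simp add: g_def algebra_simps)
qed

text \<open>One and the same second difference is expressed through either mixed derivative, at
  points that tend to \<open>x\<close>; continuity of the second derivatives identifies the
  limits.\<close>

lemma pd_commute:
  fixes f :: "real^'n \<Rightarrow> real"
  assumes f: "smooth f"
  shows "pd i (pd j f) = pd j (pd i f)"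
proof
  fix x
  define s where "s n = inverse (real (Suc n))" for n
  have sp: "s n > 0" for n by (simp add: s_def)
  define \<Delta> where "\<Delta> n = f (x + s n *\<^sub>R axis i 1 + s n *\<^sub>R axis j 1) - f (x + s n *\<^sub>R axis i 1) - f (x + s n *\<^sub>R axis j 1) + f x" for n
  have "\<exists>\<xi> \<eta>. 0 < \<xi> \<and> \<xi> < s n \<and> 0 < \<eta> \<and> \<eta> < s n \<and> \<Delta> n = (s n)\<^sup>2 * pd j (pd i f) (x + \<xi> *\<^sub>R axis i 1 + \<eta> *\<^sub>R axis j 1)" for n
    using second_difference_mvt[OF f sp[of n], of x i j] unfolding \<Delta>_def by metis
  then obtain \<xi> \<eta> where 1: "\<And>n. 0 < \<xi> n \<and> \<xi> n < s n \<and> 0 < \<eta> n \<and> \<eta> n < s n \<and> \<Delta> n = (s n)\<^sup>2 * pd j (pd i f) (x + \<xi> n *\<^sub>R axis i 1 + \<eta> n *\<^sub>R axis j 1)"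
    by metis
  have "\<exists>\<xi> \<eta>. 0 < \<xi> \<and> \<xi> < s n \<and> 0 < \<eta> \<and> \<eta> < s n \<and> \<Delta> n = (s n)\<^sup>2 * pd i (pd j f) (x + \<xi> *\<^sub>R axis j 1 + \<eta> *\<^sub>R axis i 1)" for n
    using second_difference_mvt[OF f sp[of n], of x j i] unfolding \<Delta>_def
    by (smt (verit) add.assoc add.commute)
  then obtain \<xi>' \<eta>' where 2: "\<And>n. 0 < \<xi>' n \<and> \<xi>' n < s n \<and> 0 < \<eta>' n \<and> \<eta>' n < s n \<and> \<Delta> n = (s n)\<^sup>2 * pd i (pd j f) (x + \<xi>' n *\<^sub>R axis j 1 + \<eta>' n *\<^sub>R axis i 1)"
    by metis
  have s0: "s \<longlonglongrightarrow> 0" unfolding s_def by (rule LIMSEQ_inverse_real_of_nat)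
  have lim0: "a \<longlonglongrightarrow> 0" if "\<And>n. 0 < a n \<and> a n < s n" for a
    by (rule tendsto_sandwich[of "\<lambda>_. 0" _ _ s]) (use that s0 in \<open>auto intro!: always_eventually less_imp_le\<close>)
  have xl: "(\<lambda>n. x + a n *\<^sub>R axis k 1 + b n *\<^sub>R axis l 1) \<longlonglongrightarrow> x" if "a \<longlonglongrightarrow> 0" "b \<longlonglongrightarrow> 0" for a b k l
  proof -
    have "(\<lambda>n. x + a n *\<^sub>R axis k 1 + b n *\<^sub>R axis l 1) \<longlonglongrightarrow> x + 0 *\<^sub>R axis k 1 + 0 *\<^sub>R axis l 1"
      by (intro tendsto_intros that)
    then show ?thesis by simp
  qed
  have "(\<lambda>n. pd j (pd i f) (x + \<xi> n *\<^sub>R axis i 1 + \<eta> n *\<^sub>R axis j 1)) \<longlonglongrightarrow> pd j (pd i f) x"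
    by (rule isCont_tendsto_compose[OF smooth_isCont xl]) (use f 1 in \<open>auto intro!: smooth_pd lim0\<close>)
  moreover have "(\<lambda>n. pd i (pd j f) (x + \<xi>' n *\<^sub>R axis j 1 + \<eta>' n *\<^sub>R axis i 1)) \<longlonglongrightarrow> pd i (pd j f) x"
    by (rule isCont_tendsto_compose[OF smooth_isCont xl]) (use f 2 in \<open>auto intro!: smooth_pd lim0\<close>)
  moreover have "pd j (pd i f) (x + \<xi> n *\<^sub>R axis i 1 + \<eta> n *\<^sub>R axis j 1) = pd i (pd j f) (x + \<xi>' n *\<^sub>R axis j 1 + \<eta>' n *\<^sub>R axis i 1)" for n
  proof -
    have "(s n)\<^sup>2 * pd j (pd i f) (x + \<xi> n *\<^sub>R axis i 1 + \<eta> n *\<^sub>R axis j 1) = (s n)\<^sup>2 * pd i (pd j f) (x + \<xi>' n *\<^sub>R axis j 1 + \<eta>' n *\<^sub>R axis i 1)"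
      using 1[of n] 2[of n] by simp
    then show ?thesis using sp[of n] by auto
  qed
  ultimately show "pd i (pd j f) x = pd j (pd i f) x"
    using LIMSEQ_unique by auto
qed

section \<open>Test functions\<close>

text \<open>\<open>flat n\<close> is \<open>t powr -n * exp (-1/t)\<close> on the positive axis; the family is closed under
  differentiation up to linear combinations, whence \<open>flat 0\<close> is smooth.\<close>
definition flat :: "nat \<Rightarrow> real \<Rightarrow> real" where
  "flat n t = (if t > 0 then inverse t ^ n * exp (- inverse t) else 0)"

text \<open>Since \<open>flat n 0 = 0\<close>, this is the difference quotient at the origin, the
  only point near which \<open>flat\<close> is not given by one elementary formula. On the right, y
  = 1/t turns it into y^(n+1) / exp y.\<close>

lemma flat_div_tendsto_0: "(\<lambda>t. flat n t / t) \<midarrow>0\<rightarrow> 0"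
proof -
  have "((\<lambda>y::real. y ^ Suc n / exp y) \<longlongrightarrow> 0) at_top" by (rule tendsto_power_div_exp_0)
  from filterlim_compose[OF this filterlim_inverse_at_top_right]
  have "((\<lambda>t::real. inverse t ^ Suc n / exp (inverse t)) \<longlongrightarrow> 0) (at_right 0)" .
  moreover have "\<forall>\<^sub>F t in at_right 0. inverse t ^ Suc n / exp (inverse t) = flat n t / t"
    by (auto simp: eventually_at_right_field flat_def exp_minus field_simps intro!: exI[of _ 1])
  ultimately have R: "((\<lambda>t. flat n t / t) \<longlongrightarrow> 0) (at_right 0)"
    by (rule Lim_transform_eventually)
  have L: "((\<lambda>t. flat n t / t) \<longlongrightarrow> 0) (at_left 0)"
    by (rule tendsto_eventually) (auto simp: eventually_at_left_field flat_def intro!: exI[of _ "-1"])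
  show ?thesis using L R by (simp add: filterlim_split_at)
qed

lemma DERIV_flat: "(flat n has_real_derivative - (real n * flat (Suc n) t) + flat (Suc (Suc n)) t) (at t)"
proof -
  consider "t < 0" | "t = 0" | "t > 0" by linarith
  then show ?thesis
  proof cases
    case 1
    have "((\<lambda>_. 0) has_real_derivative 0) (at t)" by simp
    then have "(flat n has_real_derivative 0) (at t)"
      by (rule has_field_derivative_transform_within_open[of _ _ _ "{..<0}"]) (use 1 in \<open>auto simp: flat_def\<close>)
    then show ?thesis using 1 by (simp add: flat_def)
  next
    case 2
    have "(flat n has_real_derivative 0) (at 0)"
      using flat_div_tendsto_0[of n] by (simp add: has_field_derivative_iff flat_def[of n 0])
    then show ?thesis using 2 by (simp add: flat_def)
  next
    case 3
    have "((\<lambda>t. inverse t ^ n * exp (- inverse t)) has_real_derivative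
        - (real n * flat (Suc n) t) + flat (Suc (Suc n)) t) (at t)"
    proof (rule DERIV_cong)
      show "((\<lambda>t. inverse t ^ n * exp (- inverse t)) has_real_derivative
        (real n * (- (inverse t)\<^sup>2 * inverse t ^ (n - 1))) * exp (- inverse t)
          + inverse t ^ n * (exp (- inverse t) * (inverse t)\<^sup>2)) (at t)"
        using 3 by (auto intro!: derivative_eq_intros simp: power2_eq_square)
      show "(real n * (- (inverse t)\<^sup>2 * inverse t ^ (n - 1))) * exp (- inverse t)
          + inverse t ^ n * (exp (- inverse t) * (inverse t)\<^sup>2)
          = - (real n * flat (Suc n) t) + flat (Suc (Suc n)) t"
        using 3 by (cases n) (auto simp: flat_def power2_eq_square)
    qed
    then show ?thesis
      by (rule has_field_derivative_transform_within_open[of _ _ _ "{0<..}"]) (use 3 in \<open>auto simp: flat_def\<close>)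
  qed
qed

text \<open>The induction must leave \<open>n\<close> free, because each derivative trades
  \<open>flat n\<close> for \<open>flat (Suc n)\<close> and
  \<open>flat (Suc (Suc n))\<close>.\<close>

lemma Ck_flat_compose:
  assumes "smooth q" shows "Ck k (\<lambda>x. flat n (q x))"
proof (induction k arbitrary: n)
  case 0
  have "continuous_on UNIV (flat n)"
    by (rule continuous_at_imp_continuous_on) (use DERIV_flat DERIV_isCont in blast)
  from continuous_on_compose2[OF this smooth_continuous[OF assms]] show ?case by simp
next
  case (Suc k)
  have *: "pd i (\<lambda>x. flat n (q x)) = (\<lambda>x. ((- real n) * flat (Suc n) (q x) + flat (Suc (Suc n)) (q x)) * pd i q x)" for i
    by (rule ext, subst pd_compose_real[OF DERIV_flat smooth_differentiable[OF assms]]) simp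
  have "Ck k (pd i q)" for i using smooth_pd[OF assms] by (simp add: smooth_def)
  moreover have "(\<lambda>x. flat n (q x)) differentiable (at x)" for x
  proof -
    have "flat n differentiable (at (q x))"
      using DERIV_flat real_differentiable_def by blast
    from differentiable_chain_at[OF smooth_differentiable[OF assms] this]
    show ?thesis by (simp add: o_def)
  qed
  ultimately show ?case using Suc by (auto simp only: * Ck.simps intro!: Ck_mult Ck_add Ck_const)
qed

lemma smooth_flat_compose: "smooth q \<Longrightarrow> smooth (\<lambda>x. flat n (q x))"
  using Ck_flat_compose smooth_def by blast

text \<open>The usual smooth transition from 0 to 1; the denominator never vanishes, because
  \<open>t\<close> or \<open>1 - t\<close> is positive. Writing the quotient with
  \<open>inverse\<close> lets the product and inverse rules for \<open>smooth\<close> apply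
  directly.\<close>

definition step :: "real \<Rightarrow> real" where
  "step t = flat 0 t * inverse (flat 0 t + flat 0 (1 - t))"

lemma flat_nonneg: "flat n t \<ge> 0" by (simp add: flat_def)

lemma flat_denom_pos: "flat 0 t + flat 0 (1 - t) > 0"
  by (cases "t > 0") (auto simp: flat_def intro: add_pos_nonneg)

lemma step_ge_0: "step t \<ge> 0"
  using flat_denom_pos[of t] by (simp add: step_def flat_nonneg)

lemma step_le_1: "step t \<le> 1"
proof -
  have "flat 0 t / (flat 0 t + flat 0 (1 - t)) \<le> 1"
    using flat_denom_pos[of t] flat_nonneg[of 0 "1-t"] by (simp add: pos_divide_le_eq)
  then show ?thesis by (simp add: step_def divide_inverse)
qed

lemma step_eq_0: "t \<le> 0 \<Longrightarrow> step t = 0" by (simp add: step_def flat_def)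
lemma step_eq_1: "t \<ge> 1 \<Longrightarrow> step t = 1" by (simp add: step_def flat_def)

lemma smooth_step_compose: "smooth q \<Longrightarrow> smooth (\<lambda>x. step (q x))"
  unfolding step_def
  by (intro smooth_mult smooth_inverse smooth_add smooth_flat_compose smooth_diff smooth_const)
     (simp_all add: flat_denom_pos less_imp_neq[symmetric])

lemma smooth_norm_sq: "smooth (\<lambda>x::real^'a::finite. (norm (x - a))\<^sup>2)"
proof -
  have "(\<lambda>x::real^'a. (norm x)\<^sup>2) = (\<lambda>x. \<Sum>i\<in>UNIV. (x $ i)\<^sup>2)"
    by (simp add: norm_vec_def L2_set_def sum_nonneg)
  then have "smooth (\<lambda>x::real^'a. (norm x)\<^sup>2)"
    by (simp only:) (intro smooth_sum smooth_power smooth_component)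
  then show ?thesis by (rule smooth_translate)
qed

lemma Cc_smooth: "f \<in> Cc_infty \<Longrightarrow> smooth f"
  by (simp add: Cc_infty_def smooth_def)

lemma CcI:
  assumes "smooth f" "bounded S" "\<And>x. x \<notin> S \<Longrightarrow> f x = 0"
  shows "f \<in> Cc_infty"
proof -
  have "{x. f x \<noteq> 0} \<subseteq> S" using assms(3) by auto
  then have "bounded {x. f x \<noteq> 0}" by (rule bounded_subset[OF assms(2)])
  then show ?thesis using assms(1) by (simp add: Cc_infty_def smooth_def compact_closure)
qed

lemma Cc_bounded_support: "f \<in> Cc_infty \<Longrightarrow> bounded {x. f x \<noteq> 0}"
  by (simp add: Cc_infty_def compact_closure)

lemma pd_eq_0_open:
  assumes "open S" "x \<in> S" "\<And>y. y \<in> S \<Longrightarrow> f y = c"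
  shows "pd i f x = 0"
proof -
  have "((\<lambda>_. c) has_derivative (\<lambda>_. 0)) (at x)" by simp
  then have "(f has_derivative (\<lambda>_. 0)) (at x)"
    by (rule has_derivative_transform_within_open[OF _ assms(1,2)]) (use assms(3) in auto)
  from pd_eqI[OF this] show ?thesis by simp
qed

lemma Cc_compact_support:
  assumes "f \<in> Cc_infty"
  obtains K where "compact K" "\<And>x. x \<notin> K \<Longrightarrow> f x = 0" "\<And>i x. x \<notin> K \<Longrightarrow> pd i f x = 0"
proof -
  let ?K = "closure {x. f x \<noteq> 0}"
  have 0: "f x = 0" if "x \<in> - ?K" for x
  proof (rule ccontr)
    assume "f x \<noteq> 0"
    then have "x \<in> ?K" by (intro subsetD[OF closure_subset]) simp
    then show False using that by simp
  qed
  have 1: "pd i f x = 0" if "x \<in> - ?K" for i x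
    by (rule pd_eq_0_open[of "- ?K" x f 0]) (simp_all only: that 0 open_Compl closed_closure)
  show thesis
  proof (rule that)
    show "compact ?K" using assms by (simp add: Cc_infty_def)
    show "f x = 0" if "x \<notin> ?K" for x by (rule 0) (rule ComplI, rule notE[OF that])
    show "pd i f x = 0" if "x \<notin> ?K" for i x by (rule 1) (rule ComplI, rule notE[OF that])
  qed
qed

lemma Cc_pd: assumes "f \<in> Cc_infty" shows "pd i f \<in> Cc_infty"
proof -
  obtain K where "compact K" "\<And>i x. x \<notin> K \<Longrightarrow> pd i f x = 0"
    using Cc_compact_support[OF assms] by metis
  moreover have "smooth (pd i f)" by (rule smooth_pd[OF Cc_smooth[OF assms]])
  ultimately show ?thesis
    using CcI[of "pd i f" K] compact_imp_bounded by blast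
qed

lemma Cc_smooth_mult: "f \<in> Cc_infty \<Longrightarrow> smooth g \<Longrightarrow> (\<lambda>x. f x * g x) \<in> Cc_infty"
  by (rule CcI[of _ "{x. f x \<noteq> 0}"]) (simp_all add: smooth_mult Cc_smooth Cc_bounded_support)
lemma smooth_Cc_mult: "smooth g \<Longrightarrow> f \<in> Cc_infty \<Longrightarrow> (\<lambda>x. g x * f x) \<in> Cc_infty"
  by (rule CcI[of _ "{x. f x \<noteq> 0}"]) (simp_all add: smooth_mult Cc_smooth Cc_bounded_support)
lemma Cc_mult: "f \<in> Cc_infty \<Longrightarrow> g \<in> Cc_infty \<Longrightarrow> (\<lambda>x. f x * g x) \<in> Cc_infty"
  by (simp add: Cc_smooth_mult Cc_smooth)
lemma Cc_cmult: "f \<in> Cc_infty \<Longrightarrow> (\<lambda>x. c * f x) \<in> Cc_infty"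
  by (simp add: smooth_Cc_mult)
lemma Cc_add: "f \<in> Cc_infty \<Longrightarrow> g \<in> Cc_infty \<Longrightarrow> (\<lambda>x. f x + g x) \<in> Cc_infty"
  by (rule CcI[of _ "{x. f x \<noteq> 0} \<union> {x. g x \<noteq> 0}"]) (simp_all add: smooth_add Cc_smooth Cc_bounded_support)
lemma Cc_diff: "f \<in> Cc_infty \<Longrightarrow> g \<in> Cc_infty \<Longrightarrow> (\<lambda>x. f x - g x) \<in> Cc_infty"
  using Cc_add[OF _ Cc_cmult[of g "-1"], of f] by simp
lemma Cc_zero [simp]: "(\<lambda>x. 0) \<in> Cc_infty"
  by (rule CcI[of _ "{}"]) auto
lemma Cc_sum: "(\<And>j. j \<in> J \<Longrightarrow> f j \<in> Cc_infty) \<Longrightarrow> (\<lambda>x. \<Sum>j\<in>J. f j x) \<in> Cc_infty"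
  by (induction J rule: infinite_finite_induct) (auto intro: Cc_add)

lemma Cc_translate:
  assumes "f \<in> Cc_infty" shows "(\<lambda>x. f (x - a)) \<in> Cc_infty"
proof (rule CcI)
  show "smooth (\<lambda>x. f (x - a))" by (intro smooth_translate Cc_smooth assms)
  show "bounded ((+) a ` {x. f x \<noteq> 0})" by (rule bounded_translation[OF Cc_bounded_support[OF assms]])
  show "f (x - a) = 0" if "x \<notin> (+) a ` {x. f x \<noteq> 0}" for x
  proof (rule ccontr)
    assume "f (x - a) \<noteq> 0"
    then have "a + (x - a) \<in> (+) a ` {x. f x \<noteq> 0}" by (intro imageI) simp
    then show False using that by simp
  qed
qed

lemma Cc_bounded:
  assumes "f \<in> Cc_infty" obtains B where "B > 0" "\<And>x. \<bar>f x\<bar> \<le> B"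
proof -
  obtain K where K: "compact K" "\<And>x. x \<notin> K \<Longrightarrow> f x = 0"
    using Cc_compact_support[OF assms] by metis
  have "bounded (f ` K)"
    by (intro compact_imp_bounded compact_continuous_image K smooth_continuous Cc_smooth assms)
  then obtain B where "B > 0" "\<forall>y\<in>f ` K. norm y \<le> B" by (auto simp: bounded_pos)
  moreover have "\<bar>f x\<bar> \<le> B" for x
    using calculation K(2)[of x] by (cases "x \<in> K") auto
  ultimately show thesis using that by blast
qed

text \<open>A finite cover of \<open>K\<close> by balls inside \<open>V\<close> carries a sum
  \<open>F\<close> of bumps that is positive exactly on the union of the balls. On \<open>K\<close>
  it is bounded below by some \<open>m > 0\<close>, so \<open>step\<close> of \<open>F / m\<close>
  is 1 there and vanishes wherever \<open>F\<close> does.\<close>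

lemma smooth_urysohn:
  fixes K :: "(real^'n) set"
  assumes K: "compact K" and V: "open V" "K \<subseteq> V"
  obtains \<psi> where "\<psi> \<in> Cc_infty" "\<And>x. 0 \<le> \<psi> x" "\<And>x. \<psi> x \<le> 1" "\<And>x. x \<in> K \<Longrightarrow> \<psi> x = 1"
    "\<And>x. x \<notin> V \<Longrightarrow> \<psi> x = 0"
proof -
  have "\<exists>r>0. r \<le> 1 \<and> ball x r \<subseteq> V" if xK: "x \<in> K" for x
  proof -
    obtain e where "e > 0" "ball x e \<subseteq> V" by (rule openE[OF V(1) subsetD[OF V(2) xK]])
    moreover have "ball x (min e 1) \<subseteq> ball x e" by (rule subset_ball) simp
    ultimately have "min e 1 > 0 \<and> min e 1 \<le> 1 \<and> ball x (min e 1) \<subseteq> V" by auto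
    then show ?thesis by blast
  qed
  then have "\<exists>r. \<forall>x\<in>K. r x > 0 \<and> r x \<le> 1 \<and> ball x (r x) \<subseteq> V" by (intro bchoice) blast
  then obtain r where r: "\<And>x. x \<in> K \<Longrightarrow> r x > 0 \<and> r x \<le> 1 \<and> ball x (r x) \<subseteq> V" by blast
  have "x \<in> ball x (r x)" if "x \<in> K" for x using r[OF that] by simp
  then have "K \<subseteq> (\<Union>x\<in>K. ball x (r x))" by blast
  then obtain C where C: "C \<subseteq> K" "finite C" "K \<subseteq> (\<Union>x\<in>C. ball x (r x))"
    by (rule compactE_image[OF K open_ball])
  define F where "F z = (\<Sum>x\<in>C. flat 0 ((r x)\<^sup>2 - (norm (z - x))\<^sup>2))" for z
  have sF: "smooth F" unfolding F_def
    by (intro smooth_sum smooth_flat_compose smooth_diff smooth_const smooth_norm_sq)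
  have flat_iff: "flat 0 ((r x)\<^sup>2 - (norm (z - x))\<^sup>2) > 0 \<longleftrightarrow> z \<in> ball x (r x)" if "x \<in> C" for x z
  proof -
    have "(norm (z - x))\<^sup>2 < (r x)\<^sup>2 \<longleftrightarrow> norm (z - x) < r x"
      using r[of x] that C(1) power_mono_iff[of "r x" "norm (z - x)" 2] by (auto simp: not_le[symmetric] less_imp_le)
    then show ?thesis by (auto simp: flat_def dist_norm norm_minus_commute)
  qed
  have Fpos: "F z > 0 \<longleftrightarrow> z \<in> (\<Union>x\<in>C. ball x (r x))" for z
  proof
    assume "F z > 0"
    then obtain x where "x \<in> C" "flat 0 ((r x)\<^sup>2 - (norm (z - x))\<^sup>2) \<noteq> 0"
      unfolding F_def using sum.neutral[of C "\<lambda>x. flat 0 ((r x)\<^sup>2 - (norm (z - x))\<^sup>2)"] by fastforce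
    then have "flat 0 ((r x)\<^sup>2 - (norm (z - x))\<^sup>2) > 0"
      using flat_nonneg[of 0 "(r x)\<^sup>2 - (norm (z - x))\<^sup>2"] by linarith
    then show "z \<in> (\<Union>x\<in>C. ball x (r x))"
      using flat_iff[OF \<open>x \<in> C\<close>] \<open>x \<in> C\<close> by blast
  next
    assume "z \<in> (\<Union>x\<in>C. ball x (r x))"
    then obtain x where "x \<in> C" "flat 0 ((r x)\<^sup>2 - (norm (z - x))\<^sup>2) > 0" using flat_iff by blast
    then show "F z > 0" unfolding F_def by (rule sum_pos2[OF C(2)]) (rule flat_nonneg)
  qed
  have F0: "F z \<ge> 0" for z unfolding F_def by (intro sum_nonneg flat_nonneg)
  \<comment> \<open>For empty \<open>K\<close> there is no minimum, and any positive constant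
    serves.\<close>
  obtain m where m: "m > 0" "\<And>x. x \<in> K \<Longrightarrow> m \<le> F x"
  proof (cases "K = {}")
    case True then show ?thesis using that[of 1] by auto
  next
    case False
    obtain x where "x \<in> K" "\<forall>y\<in>K. F x \<le> F y"
      using continuous_attains_inf[OF K False smooth_continuous[OF sF]] by auto
    then show ?thesis using that[of "F x"] Fpos[of x] C(3) by blast
  qed
  define \<psi> where "\<psi> z = step (inverse m * F z)" for z
  show thesis
  proof (rule that[of \<psi>])
    have 0: "\<psi> z = 0" if "z \<notin> (\<Union>x\<in>C. ball x (r x))" for z
    proof -
      have "F z = 0" using that Fpos[of z] F0[of z] by linarith
      then show ?thesis by (simp add: \<psi>_def step_eq_0)
    qed
    show "\<psi> \<in> Cc_infty"
    proof (rule CcI)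
      show "smooth \<psi>" unfolding \<psi>_def by (intro smooth_step_compose smooth_cmult sF)
      show "bounded (\<Union>x\<in>C. ball x (r x))" using C(2) by blast
    qed (rule 0)
    show "\<psi> x = 0" if "x \<notin> V" for x
      by (rule 0) (use that r C(1) in blast)
    show "\<psi> x = 1" if "x \<in> K" for x
      unfolding \<psi>_def using m(1) m(2)[OF that] by (intro step_eq_1) (simp add: field_simps)
  qed (auto simp: \<psi>_def step_ge_0 step_le_1)
qed

text \<open>All cutoffs are dilations of one bump, which is why a single \<open>C\<close> serves all
  radii and all directions. The decay of the gradient like 1/R is what finally forces the energy to
  vanish.\<close>

lemma cutoff_exists:
  obtains \<eta> :: "real \<Rightarrow> real^'n \<Rightarrow> real" and C where
    "\<And>R. R > 0 \<Longrightarrow> \<eta> R \<in> Cc_infty"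
    "\<And>R x. 0 \<le> \<eta> R x" "\<And>R x. \<eta> R x \<le> 1"
    "\<And>R x. R > 0 \<Longrightarrow> norm x \<le> R \<Longrightarrow> \<eta> R x = 1"
    "\<And>R x. R > 0 \<Longrightarrow> norm x \<ge> 2 * R \<Longrightarrow> \<eta> R x = 0"
    "\<And>R x i. R > 0 \<Longrightarrow> \<bar>pd i (\<eta> R) x\<bar> \<le> C / R"
proof -
  obtain \<psi> :: "real^'n \<Rightarrow> real" where \<psi>: "\<psi> \<in> Cc_infty" "\<And>x. 0 \<le> \<psi> x" "\<And>x. \<psi> x \<le> 1"
     "\<And>x. x \<in> cball 0 1 \<Longrightarrow> \<psi> x = 1" "\<And>x. x \<notin> ball 0 2 \<Longrightarrow> \<psi> x = 0"
    by (rule smooth_urysohn[of "cball 0 1" "ball 0 2"]) auto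
  have "\<exists>B. \<forall>x. \<bar>pd i \<psi> x\<bar> \<le> B" for i
    using Cc_bounded[OF Cc_pd[OF \<psi>(1)]] by metis
  then obtain B where B: "\<And>i x. \<bar>pd i \<psi> x\<bar> \<le> B i" by metis
  define C where "C = Max (range B)"
  have C: "\<bar>pd i \<psi> x\<bar> \<le> C" for i x
    unfolding C_def by (rule order_trans[OF B Max_ge]) auto
  \<comment> \<open>The summand 0 makes the dilation a literal instance of
    \<open>smooth_affine\<close> and \<open>smooth_pd_affine\<close>.\<close>
  define \<eta> where "\<eta> R x = \<psi> (inverse R *\<^sub>R x + 0)" for R :: real and x
  have s: "smooth (\<eta> R)" for R unfolding \<eta>_def by (intro smooth_affine Cc_smooth \<psi>)
  have 0: "\<eta> R x = 0" if "R > 0" "norm x \<ge> 2 * R" for R x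
    unfolding \<eta>_def by (rule \<psi>(5)) (use that in \<open>simp add: field_simps\<close>)
  show thesis
  proof (rule that[of \<eta> C])
    show "\<eta> R \<in> Cc_infty" if "R > 0" for R
      by (rule CcI[OF s, of "ball 0 (2 * R)"]) (use 0 that in auto)
    show "\<eta> R x = 1" if "R > 0" "norm x \<le> R" for R x
      unfolding \<eta>_def by (rule \<psi>(4)) (use that in \<open>simp add: field_simps\<close>)
    show "\<bar>pd i (\<eta> R) x\<bar> \<le> C / R" if "R > 0" for R x i
      using C[of i "inverse R *\<^sub>R x"] that
      unfolding \<eta>_def by (simp only: smooth_pd_affine[OF Cc_smooth[OF \<psi>(1)]]) (simp add: abs_mult field_simps)
  qed (use 0 \<psi> in \<open>auto simp: \<eta>_def\<close>)
qed

section \<open>The Hilbert space $L^2$\<close>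

lemma L2I: "f \<in> borel_measurable M \<Longrightarrow> integrable M (\<lambda>x. (f x)\<^sup>2) \<Longrightarrow> f \<in> L2 M"
  by (simp add: L2_def)

lemma L2_measurable [measurable_dest]: "f \<in> L2 M \<Longrightarrow> f \<in> borel_measurable M"
  and L2_integrable: "f \<in> L2 M \<Longrightarrow> integrable M (\<lambda>x. (f x)\<^sup>2)"
  by (simp_all add: L2_def)

lemma abs_mult_le_sum_squares: "\<bar>a * b\<bar> \<le> a\<^sup>2 + (b::real)\<^sup>2"
proof -
  have "0 \<le> (\<bar>a\<bar> - \<bar>b\<bar>)\<^sup>2" by simp
  then have "2 * \<bar>a * b\<bar> \<le> a\<^sup>2 + b\<^sup>2" by (simp add: power2_diff abs_mult)
  then show ?thesis using abs_ge_zero[of "a * b"] by linarith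
qed

lemma L2_mult_integrable:
  assumes "f \<in> L2 M" "g \<in> L2 M" shows "integrable M (\<lambda>x. f x * g x)"
proof (rule Bochner_Integration.integrable_bound)
  show "integrable M (\<lambda>x. (f x)\<^sup>2 + (g x)\<^sup>2)"
    using assms by (simp add: L2_def)
  show "(\<lambda>x. f x * g x) \<in> borel_measurable M"
    using assms by measurable
  show "AE x in M. norm (f x * g x) \<le> norm ((f x)\<^sup>2 + (g x)\<^sup>2)"
    using abs_mult_le_sum_squares by (intro AE_I2) (simp only: real_norm_def, smt (verit))
qed

lemma L2_lin:
  assumes "f \<in> L2 M" "g \<in> L2 M" shows "(\<lambda>x. a * f x + b * g x) \<in> L2 M"
proof (rule L2I)
  show "(\<lambda>x. a * f x + b * g x) \<in> borel_measurable M"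
    using assms by measurable
  have "integrable M (\<lambda>x. a\<^sup>2 * (f x)\<^sup>2 + (2 * a * b) * (f x * g x) + b\<^sup>2 * (g x)\<^sup>2)"
    using assms by (intro Bochner_Integration.integrable_add integrable_mult_right L2_mult_integrable L2_integrable)
  then show "integrable M (\<lambda>x. (a * f x + b * g x)\<^sup>2)"
    by (simp add: power2_sum power_mult_distrib algebra_simps)
qed

lemma L2_add: "f \<in> L2 M \<Longrightarrow> g \<in> L2 M \<Longrightarrow> (\<lambda>x. f x + g x) \<in> L2 M"
  using L2_lin[of f M g 1 1] by simp
lemma L2_diff: "f \<in> L2 M \<Longrightarrow> g \<in> L2 M \<Longrightarrow> (\<lambda>x. f x - g x) \<in> L2 M"
  using L2_lin[of f M g 1 "-1"] by simp
lemma L2_cmult: "f \<in> L2 M \<Longrightarrow> (\<lambda>x. c * f x) \<in> L2 M"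
  using L2_lin[of f M f c 0] by simp
lemma L2_zero: "(\<lambda>x. 0) \<in> L2 M" by (simp add: L2_def)
lemma L2_sum: "(\<And>j. j \<in> J \<Longrightarrow> f j \<in> L2 M) \<Longrightarrow> (\<lambda>x. \<Sum>j\<in>J. f j x) \<in> L2 M"
  by (induction J rule: infinite_finite_induct) (simp_all add: L2_add L2_zero)

lemma L2_bound:
  assumes "f \<in> L2 M" "g \<in> borel_measurable M" "AE x in M. \<bar>g x\<bar> \<le> C * \<bar>f x\<bar>" shows "g \<in> L2 M"
proof (rule L2I)
  have "integrable M (\<lambda>x. C\<^sup>2 * (f x)\<^sup>2)" using assms(1) by (simp add: L2_def)
  then show "integrable M (\<lambda>x. (g x)\<^sup>2)"
  proof (rule Bochner_Integration.integrable_bound)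
    show "AE x in M. norm ((g x)\<^sup>2) \<le> norm (C\<^sup>2 * (f x)\<^sup>2)"
      using assms(3)
    proof eventually_elim
      case (elim x)
      then have "\<bar>g x\<bar>\<^sup>2 \<le> (C * \<bar>f x\<bar>)\<^sup>2" by (intro power_mono) auto
      then show ?case by (simp add: power_mult_distrib)
    qed
  qed (use assms(2) in simp)
qed (fact assms)

lemma L2_mult_bounded:
  assumes "f \<in> L2 M" "g \<in> borel_measurable M" "AE x in M. \<bar>g x\<bar> \<le> C"
  shows "(\<lambda>x. g x * f x) \<in> L2 M"
proof (rule L2_bound[OF assms(1), of _ C])
  show "AE x in M. \<bar>g x * f x\<bar> \<le> C * \<bar>f x\<bar>"
    using assms(3) by eventually_elim (simp add: abs_mult mult_right_mono)
qed (use assms in measurable)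

lemma L2_norm_eq: "L2_norm M f = sqrt (LINT x|M. (f x)\<^sup>2)"
  by (simp add: L2_norm_def L2_inner_def power2_eq_square)

lemma L2_norm_nonneg [simp]: "0 \<le> L2_norm M f"
  by (simp add: L2_norm_eq)

lemma L2_norm_sq: "(L2_norm M f)\<^sup>2 = (LINT x|M. (f x)\<^sup>2)"
  by (simp add: L2_norm_eq)

lemma L2_norm_sq_lin:
  assumes "f \<in> L2 M" "g \<in> L2 M"
  shows "(L2_norm M (\<lambda>x. a * f x + b * g x))\<^sup>2 =
    a\<^sup>2 * (L2_norm M f)\<^sup>2 + 2 * a * b * L2_inner M f g + b\<^sup>2 * (L2_norm M g)\<^sup>2"
proof -
  have "(\<lambda>x. (a * f x + b * g x)\<^sup>2) = (\<lambda>x. a\<^sup>2 * (f x)\<^sup>2 + (2 * a * b) * (f x * g x) + b\<^sup>2 * (g x)\<^sup>2)"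
    by (auto simp: power2_sum power_mult_distrib algebra_simps)
  then show ?thesis unfolding L2_norm_sq L2_inner_def
    using assms by (simp add: L2_mult_integrable L2_integrable)
qed

lemma L2_inner_commute: "L2_inner M f g = L2_inner M g f"
  by (simp add: L2_inner_def mult.commute)

lemma L2_inner_lin:
  assumes "f \<in> L2 M" "g \<in> L2 M" "h \<in> L2 M"
  shows "L2_inner M (\<lambda>x. a * f x + b * g x) h = a * L2_inner M f h + b * L2_inner M g h"
proof -
  have "(\<lambda>x. (a * f x + b * g x) * h x) = (\<lambda>x. a * (f x * h x) + b * (g x * h x))"
    by (auto simp: algebra_simps)
  then show ?thesis unfolding L2_inner_def
    using assms by (simp add: L2_mult_integrable)
qed

lemma L2_inner_diff: "f \<in> L2 M \<Longrightarrow> g \<in> L2 M \<Longrightarrow> h \<in> L2 M \<Longrightarrow>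
    L2_inner M (\<lambda>x. f x - g x) h = L2_inner M f h - L2_inner M g h"
  using L2_inner_lin[of f M g h 1 "-1"] by simp

text \<open>Admitting \<open>a = 0\<close> spares a case distinction for functions of norm zero.
  Besides Cauchy-Schwarz it yields the near-orthogonality of an almost minimal residual.\<close>

lemma nonneg_quadratic_discriminant:
  fixes a b c :: real
  assumes "\<And>t. 0 \<le> a * t\<^sup>2 + 2 * b * t + c" "0 \<le> a"
  shows "b\<^sup>2 \<le> a * c"
proof (cases "a = 0")
  case True
  have "b = 0"
  proof (rule ccontr)
    assume "b \<noteq> 0"
    \<comment> \<open>At this argument the remaining linear function takes the value -1.\<close>
    then show False using assms(1)[of "- (c + 1) / (2 * b)"] True by (simp add: field_simps)
  qed
  then show ?thesis using True by simp
next
  case False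
  then have "a * (- b / a)\<^sup>2 + 2 * b * (- b / a) + c = c - b\<^sup>2 / a"
    by (simp add: field_simps power2_eq_square)
  then have "b\<^sup>2 / a \<le> c" using assms(1)[of "- b / a"] by simp
  then show ?thesis using False assms(2) by (simp add: field_simps)
qed

lemma L2_Cauchy_Schwarz:
  assumes "f \<in> L2 M" "g \<in> L2 M"
  shows "\<bar>L2_inner M f g\<bar> \<le> L2_norm M f * L2_norm M g"
proof -
  have "0 \<le> (L2_norm M f)\<^sup>2 * t\<^sup>2 + 2 * L2_inner M f g * t + (L2_norm M g)\<^sup>2" for t
    using L2_norm_sq_lin[OF assms, of t 1] zero_le_power2[of "L2_norm M (\<lambda>x. t * f x + 1 * g x)"]
    by (simp add: algebra_simps)
  then have "(L2_inner M f g)\<^sup>2 \<le> (L2_norm M f)\<^sup>2 * (L2_norm M g)\<^sup>2"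
    by (intro nonneg_quadratic_discriminant) auto
  then have "\<bar>L2_inner M f g\<bar>\<^sup>2 \<le> (L2_norm M f * L2_norm M g)\<^sup>2"
    by (simp add: power_mult_distrib)
  then show ?thesis by (rule power2_le_imp_le) simp
qed

lemma L2_norm_cmult: "L2_norm M (\<lambda>x. c * f x) = \<bar>c\<bar> * L2_norm M f"
  by (simp add: L2_norm_eq power_mult_distrib real_sqrt_mult)

lemma L2_norm_minus_commute: "L2_norm M (\<lambda>x. f x - g x) = L2_norm M (\<lambda>x. g x - f x)"
  by (simp add: L2_norm_eq power2_commute)

lemma L2_norm_triangle:
  assumes "f \<in> L2 M" "g \<in> L2 M"
  shows "L2_norm M (\<lambda>x. f x + g x) \<le> L2_norm M f + L2_norm M g"
proof (rule power2_le_imp_le)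
  have "(L2_norm M (\<lambda>x. f x + g x))\<^sup>2 = (L2_norm M f)\<^sup>2 + 2 * L2_inner M f g + (L2_norm M g)\<^sup>2"
    using L2_norm_sq_lin[OF assms, of 1 1] by simp
  also have "\<dots> \<le> (L2_norm M f + L2_norm M g)\<^sup>2"
    using L2_Cauchy_Schwarz[OF assms] by (simp add: power2_sum)
  finally show "(L2_norm M (\<lambda>x. f x + g x))\<^sup>2 \<le> (L2_norm M f + L2_norm M g)\<^sup>2" .
qed simp

lemma L2_norm_triangle_diff:
  assumes "f \<in> L2 M" "g \<in> L2 M" "h \<in> L2 M"
  shows "L2_norm M (\<lambda>x. f x - h x) \<le> L2_norm M (\<lambda>x. f x - g x) + L2_norm M (\<lambda>x. g x - h x)"
  using L2_norm_triangle[OF L2_diff[OF assms(1,2)] L2_diff[OF assms(2,3)]] by simp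

lemma L2_norm_le_add:
  assumes "f \<in> L2 M" "g \<in> L2 M"
  shows "L2_norm M f \<le> L2_norm M g + L2_norm M (\<lambda>x. f x - g x)"
  using L2_norm_triangle[OF assms(2) L2_diff[OF assms]] by simp

lemma L2_norm_sum:
  assumes "\<And>j. j \<in> J \<Longrightarrow> f j \<in> L2 M"
  shows "L2_norm M (\<lambda>x. \<Sum>j\<in>J. f j x) \<le> (\<Sum>j\<in>J. L2_norm M (f j))"
  using assms
proof (induction J rule: infinite_finite_induct)
  case (insert j J)
  then have "L2_norm M (\<lambda>x. f j x + (\<Sum>j\<in>J. f j x)) \<le> L2_norm M (f j) + L2_norm M (\<lambda>x. \<Sum>j\<in>J. f j x)"
    by (intro L2_norm_triangle L2_sum) auto
  with insert show ?case by simp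
qed (simp_all add: L2_norm_eq)

lemma L2_norm_mono:
  assumes "f \<in> L2 M" "g \<in> borel_measurable M" "AE x in M. \<bar>g x\<bar> \<le> \<bar>f x\<bar>"
  shows "L2_norm M g \<le> L2_norm M f"
proof -
  have "g \<in> L2 M" by (rule L2_bound[OF assms(1,2), of 1]) (use assms(3) in simp)
  then have "(LINT x|M. (g x)\<^sup>2) \<le> (LINT x|M. (f x)\<^sup>2)"
    using assms by (intro integral_mono_AE L2_integrable) (auto simp: abs_le_square_iff)
  then show ?thesis by (simp add: L2_norm_eq)
qed

lemma L2_norm_bounded_mult:
  assumes "f \<in> L2 M" "g \<in> borel_measurable M" "AE x in M. \<bar>g x\<bar> \<le> C" "0 \<le> C"
  shows "L2_norm M (\<lambda>x. g x * f x) \<le> C * L2_norm M f"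
proof -
  have "L2_norm M (\<lambda>x. g x * f x) \<le> L2_norm M (\<lambda>x. C * f x)"
  proof (rule L2_norm_mono[OF L2_cmult[OF assms(1)]])
    show "AE x in M. \<bar>g x * f x\<bar> \<le> \<bar>C * f x\<bar>"
      using assms(3) by eventually_elim (use assms(4) in \<open>simp add: abs_mult mult_right_mono\<close>)
  qed (use assms in measurable)
  then show ?thesis using assms(4) by (simp add: L2_norm_cmult)
qed

lemma L2_norm_cong_AE:
  assumes "f \<in> borel_measurable M" "g \<in> borel_measurable M" "AE x in M. f x = g x"
  shows "L2_norm M f = L2_norm M g"
  unfolding L2_norm_eq using assms
  by (intro arg_cong[where f = sqrt] integral_cong_AE) auto

lemma L2_inner_tendsto:
  assumes "L2_tendsto M f u" "\<And>n. f n \<in> L2 M" "u \<in> L2 M" "g \<in> L2 M"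
  shows "(\<lambda>n. L2_inner M (f n) g) \<longlonglongrightarrow> L2_inner M u g"
proof (rule Lim_null[THEN iffD2], rule Lim_null_comparison)
  show "\<forall>\<^sub>F n in sequentially. norm (L2_inner M (f n) g - L2_inner M u g)
        \<le> L2_norm M (\<lambda>x. f n x - u x) * L2_norm M g"
    using assms L2_Cauchy_Schwarz[OF L2_diff[OF assms(2,3)] assms(4)]
    by (simp add: L2_inner_diff)
  show "(\<lambda>n. L2_norm M (\<lambda>x. f n x - u x) * L2_norm M g) \<longlonglongrightarrow> 0"
    using tendsto_mult_left_zero[OF assms(1)[unfolded L2_tendsto_def]] .
qed

lemma L2_norm_tendsto:
  assumes "L2_tendsto M f u" "\<And>n. f n \<in> L2 M" "u \<in> L2 M"
  shows "(\<lambda>n. L2_norm M (f n)) \<longlonglongrightarrow> L2_norm M u"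
proof (rule Lim_null[THEN iffD2], rule Lim_null_comparison)
  show "\<forall>\<^sub>F n in sequentially. norm (L2_norm M (f n) - L2_norm M u) \<le> L2_norm M (\<lambda>x. f n x - u x)"
  proof (rule always_eventually, rule allI)
    fix n
    show "norm (L2_norm M (f n) - L2_norm M u) \<le> L2_norm M (\<lambda>x. f n x - u x)"
      using L2_norm_le_add[OF assms(2)[of n] assms(3)] L2_norm_le_add[OF assms(3) assms(2)[of n]]
        L2_norm_minus_commute[of M "f n" u] by simp
  qed
qed (use assms(1) in \<open>simp add: L2_tendsto_def\<close>)

section \<open>Completeness and orthogonal projection\<close>

lemma L2_nn_integral_sq: "f \<in> L2 M \<Longrightarrow> (\<integral>\<^sup>+x. ennreal ((f x)\<^sup>2) \<partial>M) = ennreal ((L2_norm M f)\<^sup>2)"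
  by (simp add: L2_norm_sq nn_integral_eq_integral L2_integrable)

lemma L2I_nn_integral:
  assumes "f \<in> borel_measurable M" "(\<integral>\<^sup>+x. ennreal ((f x)\<^sup>2) \<partial>M) \<le> ennreal (B\<^sup>2)" "0 \<le> B"
  shows "f \<in> L2 M" "L2_norm M f \<le> B"
proof -
  show 1: "f \<in> L2 M"
  proof (rule L2I[OF assms(1)])
    show "integrable M (\<lambda>x. (f x)\<^sup>2)"
      using assms by (intro integrableI_bounded) (auto simp: top.extremum_strict intro: le_less_trans)
  qed
  then have "ennreal ((L2_norm M f)\<^sup>2) \<le> ennreal (B\<^sup>2)" using assms(2) by (simp add: L2_nn_integral_sq)
  then show "L2_norm M f \<le> B" using assms(3) by (simp add: abs_le_square_iff[symmetric])
qed

text \<open>Along a rapidly converging subsequence the weighted squares of the increments have a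
  finite integral of their sum, so the subsequence converges almost everywhere.\<close>
lemma L2_complete:
  assumes f: "\<And>n. f n \<in> L2 M"
    and Cauchy: "\<And>e. e > 0 \<Longrightarrow> \<exists>N. \<forall>m\<ge>N. \<forall>n\<ge>N. L2_norm M (\<lambda>x. f m x - f n x) < e"
  obtains u where "u \<in> L2 M" "L2_tendsto M f u"
proof -
  \<comment> \<open>The rate 4^-k leaves room for the weight 4^k: squared increments are at most
    16^-k, so the weighted sum has a finite integral, and bounded weighted squares still give
    increments of order 2^-k.\<close>
  have "\<exists>N. \<forall>m\<ge>N. \<forall>n\<ge>N. L2_norm M (\<lambda>x. f m x - f n x) < (1/4)^k" for k :: nat
    by (rule Cauchy) simp
  then obtain N where N: "\<And>k m n. m \<ge> N k \<Longrightarrow> n \<ge> N k \<Longrightarrow> L2_norm M (\<lambda>x. f m x - f n x) < (1/4)^k"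
    by metis
  \<comment> \<open>Partial sums make the indices monotone while keeping \<open>r k\<close> above
    \<open>N k\<close>.\<close>
  define r where "r k = (\<Sum>j\<le>k. N j)" for k
  have rN: "r k \<ge> N k" for k unfolding r_def by (rule member_le_sum) auto
  have rS: "r (Suc k) \<ge> r k" for k by (simp add: r_def)
  have rmono: "r j \<ge> r k" if "j \<ge> k" for j k
    using lift_Suc_mono_le[of r, OF rS that] .
  define d where "d k x = f (r (Suc k)) x - f (r k) x" for k x
  have d: "d k \<in> L2 M" for k unfolding d_def by (intro L2_diff f)
  note meas [measurable] = L2_measurable[OF f] L2_measurable[OF d]
  have dn: "(L2_norm M (d k))\<^sup>2 \<le> (1/16)^k" for k
  proof -
    have "L2_norm M (d k) \<le> (1/4)^k"
      unfolding d_def using N[of k "r (Suc k)" "r k"] rN[of k] rS[of k] by simp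
    then have "(L2_norm M (d k))\<^sup>2 \<le> ((1/4)^k)\<^sup>2" by (intro power_mono) auto
    also have "((1/4)^k)\<^sup>2 = ((1/4)\<^sup>2 :: real)^k" by (simp only: power_mult[symmetric] mult.commute)
    finally show ?thesis by (simp add: power_divide)
  qed
  have "(\<integral>\<^sup>+x. (\<Sum>k. ennreal (4^k * (d k x)\<^sup>2)) \<partial>M) = (\<Sum>k. \<integral>\<^sup>+x. ennreal (4^k * (d k x)\<^sup>2) \<partial>M)"
    by (rule nn_integral_suminf) measurable
  also have "\<dots> \<le> (\<Sum>k. ennreal ((1/4)^k))"
  proof (intro suminf_le)
    fix k
    have "(\<integral>\<^sup>+x. ennreal (4^k * (d k x)\<^sup>2) \<partial>M) = ennreal (4^k) * (\<integral>\<^sup>+x. ennreal ((d k x)\<^sup>2) \<partial>M)"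
      by (subst nn_integral_cmult[symmetric]) (auto simp: ennreal_mult)
    also have "\<dots> = ennreal (4^k * (L2_norm M (d k))\<^sup>2)"
      by (simp add: L2_nn_integral_sq[OF d] ennreal_mult)
    also have "\<dots> \<le> ennreal (4^k * (1/16)^k)" using dn[of k] by (intro ennreal_leI mult_left_mono) auto
    also have "(4::real)^k * (1/16)^k = (1/4)^k" by (simp add: power_mult_distrib[symmetric])
    finally show "(\<integral>\<^sup>+x. ennreal (4^k * (d k x)\<^sup>2) \<partial>M) \<le> ennreal ((1/4)^k)" .
  qed auto
  also have "\<dots> < \<infinity>"
    by (subst suminf_ennreal2) (auto intro: summable_geometric)
  finally have "AE x in M. (\<Sum>k. ennreal (4^k * (d k x)\<^sup>2)) \<noteq> \<infinity>"
    by (intro nn_integral_noteq_infinite) auto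
  then have conv: "AE x in M. convergent (\<lambda>k. f (r k) x)"
  proof eventually_elim
    case (elim x)
    then have "summable (\<lambda>k. 4^k * (d k x)\<^sup>2)"
      by (intro summable_suminf_not_top) auto
    then have "(\<lambda>k. 4^k * (d k x)\<^sup>2) \<longlonglongrightarrow> 0" by (rule summable_LIMSEQ_zero)
    then have "Bseq (\<lambda>k. 4^k * (d k x)\<^sup>2)" by (intro convergent_imp_Bseq) (auto simp: convergent_def)
    then obtain B where B: "B > 0" "\<And>k. norm (4^k * (d k x)\<^sup>2) \<le> B" by (auto elim: BseqE)
    have "\<bar>d k x\<bar> \<le> sqrt B * (1/2)^k" for k
    proof -
      have "(2^k * \<bar>d k x\<bar>)\<^sup>2 = 4^k * (d k x)\<^sup>2"
        using power_mult_distrib[of "2::real" 2 k] by (simp add: power_mult_distrib power2_eq_square)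
      then have "(2^k * \<bar>d k x\<bar>)\<^sup>2 \<le> B" using B(2)[of k] by simp
      then have "2^k * \<bar>d k x\<bar> \<le> sqrt B" by (rule real_le_rsqrt)
      then show ?thesis by (simp add: field_simps)
    qed
    moreover have "summable (\<lambda>k. sqrt B * (1/2)^k)" by (intro summable_mult summable_geometric) simp
    ultimately have "summable (\<lambda>k. d k x)"
      by - (rule summable_comparison_test'[of "\<lambda>k. sqrt B * (1/2)^k" 0], auto)
    then have "convergent (\<lambda>n. \<Sum>k<n. d k x)" by (simp add: summable_iff_convergent)
    moreover have "(\<Sum>k<n. d k x) = f (r n) x - f (r 0) x" for n
      unfolding d_def by (rule sum_lessThan_telescope)
    ultimately have "convergent (\<lambda>n. f (r n) x - f (r 0) x)" by simp
    then show ?case using convergent_add[OF _ convergent_const[of "f (r 0) x"]] by fastforce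
  qed
  define u where "u x = lim (\<lambda>k. f (r k) x)" for x
  have [measurable]: "u \<in> borel_measurable M" unfolding u_def by measurable
  have lim: "AE x in M. (\<lambda>k. f (r k) x) \<longlonglongrightarrow> u x"
    using conv unfolding u_def by eventually_elim (simp add: convergent_LIMSEQ_iff)
  \<comment> \<open>Fatou's lemma along the subsequence bounds the distance to the limit for every
    late \<open>f n\<close>, so the whole sequence converges.\<close>
  have est: "(\<integral>\<^sup>+x. ennreal ((f n x - u x)\<^sup>2) \<partial>M) \<le> ennreal (((1/4)^k)\<^sup>2)" if "n \<ge> N k" for n k
  proof -
    have "(\<integral>\<^sup>+x. ennreal ((f n x - u x)\<^sup>2) \<partial>M) = (\<integral>\<^sup>+x. liminf (\<lambda>j. ennreal ((f n x - f (r j) x)\<^sup>2)) \<partial>M)"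
    proof (rule nn_integral_cong_AE)
      show "AE x in M. ennreal ((f n x - u x)\<^sup>2) = liminf (\<lambda>j. ennreal ((f n x - f (r j) x)\<^sup>2))"
        using lim
      proof eventually_elim
        case (elim x)
        have "(\<lambda>j. ennreal ((f n x - f (r j) x)\<^sup>2)) \<longlonglongrightarrow> ennreal ((f n x - u x)\<^sup>2)"
          by (intro tendsto_intros elim)
        then show ?case by (rule lim_imp_Liminf[symmetric, rotated]) simp
      qed
    qed
    also have "\<dots> \<le> liminf (\<lambda>j. \<integral>\<^sup>+x. ennreal ((f n x - f (r j) x)\<^sup>2) \<partial>M)"
      by (rule nn_integral_liminf) measurable
    also have "\<dots> \<le> ennreal (((1/4)^k)\<^sup>2)"
    proof (rule Liminf_le)
      show "\<forall>\<^sub>F j in sequentially. (\<integral>\<^sup>+x. ennreal ((f n x - f (r j) x)\<^sup>2) \<partial>M) \<le> ennreal (((1/4)^k)\<^sup>2)"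
      proof (rule eventually_sequentiallyI[of k])
        fix j assume "j \<ge> k"
        then have "L2_norm M (\<lambda>x. f n x - f (r j) x) \<le> (1/4)^k"
          using N[of k n "r j"] that rN[of k] rmono[of k j] by simp
        then show "(\<integral>\<^sup>+x. ennreal ((f n x - f (r j) x)\<^sup>2) \<partial>M) \<le> ennreal (((1/4)^k)\<^sup>2)"
          by (subst L2_nn_integral_sq[OF L2_diff[OF f f]]) (intro ennreal_leI power_mono, auto)
      qed
    qed simp
    finally show ?thesis .
  qed
  have est': "(\<lambda>x. f n x - u x) \<in> L2 M" "L2_norm M (\<lambda>x. f n x - u x) \<le> (1/4)^k" if "n \<ge> N k" for n k
    using L2I_nn_integral[OF _ est[OF that]] by simp_all
  have "u \<in> L2 M"
    using L2_diff[OF f[of "N 0"] est'(1)[of 0 "N 0"]] by simp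
  moreover have "L2_tendsto M f u"
    unfolding L2_tendsto_def
  proof (rule LIMSEQ_I)
    fix e :: real assume "e > 0"
    then obtain k where k: "(1/4::real)^k < e" using real_arch_pow_inv[of e "1/4"] by auto
    show "\<exists>no. \<forall>n\<ge>no. norm (L2_norm M (\<lambda>x. f n x - u x) - 0) < e"
      using est'(2)[of k] k by (intro exI[of _ "N k"]) (auto intro: le_less_trans)
  qed
  ultimately show thesis by (rule that)
qed

text \<open>The projection argument, carried out without forming a closed subspace: a minimising
  sequence in \<open>D\<close> for the distance to \<open>u\<close> is Cauchy, the residual
  \<open>u - g\<close> at its limit \<open>g\<close> is orthogonal to \<open>D\<close>, and
  \<open>orth\<close> makes that residual vanish. Density of test functions, of the resolvent range
  and of the range of \<open>T - 1\<close> are all obtained from it.\<close>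

lemma L2_dense_if_orthogonal_trivial:
  assumes D: "D \<subseteq> L2 M" "(\<lambda>x. 0) \<in> D"
    and lin: "\<And>f g a b. f \<in> D \<Longrightarrow> g \<in> D \<Longrightarrow> (\<lambda>x. a * f x + b * g x) \<in> D"
    and orth: "\<And>w. w \<in> L2 M \<Longrightarrow> (\<And>f. f \<in> D \<Longrightarrow> L2_inner M f w = 0) \<Longrightarrow> AE x in M. w x = 0"
  shows "L2_dense M D"
  unfolding L2_dense_def
proof (intro conjI ballI)
  fix u assume u: "u \<in> L2 M"
  define Q where "Q f = (L2_norm M (\<lambda>x. u x - f x))\<^sup>2" for f
  define \<delta> where "\<delta> = (INF f\<in>D. Q f)"
  have Q0: "0 \<le> Q f" for f by (simp add: Q_def)
  have bdd: "bdd_below (Q ` D)" using Q0 by (auto intro!: bdd_belowI[of _ 0])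
  have Qge: "\<delta> \<le> Q f" if "f \<in> D" for f
    unfolding \<delta>_def by (rule cINF_lower[OF bdd that])
  have "\<exists>f\<in>D. Q f < \<delta> + inverse (real (Suc n))" for n
  proof -
    have "\<delta> < \<delta> + inverse (real (Suc n))" by simp
    then show ?thesis using cINF_less_iff[OF _ bdd, of "\<delta> + inverse (real (Suc n))"] D(2)
      unfolding \<delta>_def by blast
  qed
  then obtain f where f: "\<And>n. f n \<in> D" and Qf: "\<And>n. Q (f n) < \<delta> + inverse (real (Suc n))"
    by metis
  have fL: "f n \<in> L2 M" for n using f D(1) by auto
  \<comment> \<open>Parallelogram identity for \<open>u - f m\<close> and \<open>u - f n\<close>.
    The midpoint lies in \<open>D\<close> again, so its value of \<open>Q\<close> is at least
    \<open>\<delta>\<close>.\<close>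
  have ident: "(L2_norm M (\<lambda>x. f m x - f n x))\<^sup>2 = 2 * Q (f m) + 2 * Q (f n) - 4 * Q (\<lambda>x. 1/2 * f m x + 1/2 * f n x)" for m n
  proof -
    have um: "(\<lambda>x. u x - f m x) \<in> L2 M" and un: "(\<lambda>x. u x - f n x) \<in> L2 M"
      by (intro L2_diff u fL)+
    have "(L2_norm M (\<lambda>x. f m x - f n x))\<^sup>2 = Q (f n) - 2 * L2_inner M (\<lambda>x. u x - f n x) (\<lambda>x. u x - f m x) + Q (f m)"
      using L2_norm_sq_lin[OF un um, of 1 "-1"] by (simp add: Q_def)
    moreover have "Q (\<lambda>x. 1/2 * f m x + 1/2 * f n x) = 1/4 * Q (f n) + 1/2 * L2_inner M (\<lambda>x. u x - f n x) (\<lambda>x. u x - f m x) + 1/4 * Q (f m)"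
      using L2_norm_sq_lin[OF un um, of "1/2" "1/2"]
      by (simp add: Q_def algebra_simps power_divide)
    ultimately show ?thesis by (simp add: algebra_simps)
  qed
  have fC: "(L2_norm M (\<lambda>x. f m x - f n x))\<^sup>2 < 2 * inverse (real (Suc m)) + 2 * inverse (real (Suc n))" for m n
    using ident[of m n] Qge[OF lin[OF f f, of "1/2" m "1/2" n]] Qf[of m] Qf[of n] by linarith
  obtain g where g: "g \<in> L2 M" "L2_tendsto M f g"
  proof (rule L2_complete[OF fL])
    fix e :: real assume e: "e > 0"
    obtain N where N: "inverse (real (Suc N)) < e\<^sup>2 / 4"
      using reals_Archimedean[of "e\<^sup>2/4"] e by auto
    have "L2_norm M (\<lambda>x. f m x - f n x) < e" if "m \<ge> N" "n \<ge> N" for m n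
    proof (rule power2_less_imp_less)
      have "inverse (real (Suc m)) \<le> inverse (real (Suc N))" "inverse (real (Suc n)) \<le> inverse (real (Suc N))"
        using that by (auto intro!: le_imp_inverse_le)
      then show "(L2_norm M (\<lambda>x. f m x - f n x))\<^sup>2 < e\<^sup>2" using fC[of m n] N by linarith
    qed (use e in simp)
    then show "\<exists>N. \<forall>m\<ge>N. \<forall>n\<ge>N. L2_norm M (\<lambda>x. f m x - f n x) < e" by blast
  qed
  have "AE x in M. u x - g x = 0"
  proof (rule orth)
    show "(\<lambda>x. u x - g x) \<in> L2 M" by (intro L2_diff u g)
    fix h assume h: "h \<in> D"
    then have hL: "h \<in> L2 M" using D by auto
    \<comment> \<open>Passing from \<open>f n\<close> to \<open>f n - t h\<close> cannot bring
      \<open>Q\<close> below \<open>\<delta>\<close>, and \<open>Q (f n)\<close> exceeds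
      \<open>\<delta>\<close> by less than 1/(n+1); hence a quadratic in \<open>t\<close> is
      nonnegative.\<close>
    have bound: "(L2_inner M (\<lambda>x. u x - f n x) h)\<^sup>2 \<le> (L2_norm M h)\<^sup>2 * inverse (real (Suc n))" for n
    proof (rule nonneg_quadratic_discriminant)
      fix t
      have "Q (\<lambda>x. 1 * f n x + (-t) * h x) = Q (f n) + 2 * t * L2_inner M (\<lambda>x. u x - f n x) h + t\<^sup>2 * (L2_norm M h)\<^sup>2"
        using L2_norm_sq_lin[OF L2_diff[OF u fL[of n]] hL, of 1 t]
        by (simp add: Q_def algebra_simps)
      then show "0 \<le> (L2_norm M h)\<^sup>2 * t\<^sup>2 + 2 * L2_inner M (\<lambda>x. u x - f n x) h * t + inverse (real (Suc n))"
        using Qge[OF lin[OF f[of n] h, of 1 "-t"]] Qf[of n] by (simp add: algebra_simps)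
    qed simp
    have "(\<lambda>n. (L2_inner M u h - L2_inner M (f n) h)\<^sup>2) \<longlonglongrightarrow> (L2_inner M u h - L2_inner M g h)\<^sup>2"
      by (intro tendsto_intros L2_inner_tendsto g fL hL)
    moreover have "(\<lambda>n. (L2_inner M u h - L2_inner M (f n) h)\<^sup>2) \<longlonglongrightarrow> 0"
    proof (rule tendsto_sandwich[OF _ _ tendsto_const])
      show "\<forall>\<^sub>F n in sequentially. (L2_inner M u h - L2_inner M (f n) h)\<^sup>2 \<le> (L2_norm M h)\<^sup>2 * inverse (real (Suc n))"
        using bound by (simp add: L2_inner_diff u fL hL)
      show "(\<lambda>n. (L2_norm M h)\<^sup>2 * inverse (real (Suc n))) \<longlonglongrightarrow> 0"
        using tendsto_mult_right_zero[OF LIMSEQ_inverse_real_of_nat] .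
    qed simp
    ultimately have "(L2_inner M u h - L2_inner M g h)\<^sup>2 = 0" by (rule LIMSEQ_unique)
    then show "L2_inner M h (\<lambda>x. u x - g x) = 0"
      by (subst L2_inner_commute) (simp add: L2_inner_diff u g hL)
  qed
  then have "L2_norm M (\<lambda>x. f n x - u x) = L2_norm M (\<lambda>x. f n x - g x)" for n
    using L2_measurable[OF u] L2_measurable[OF g(1)] L2_measurable[OF fL[of n]]
    by (intro L2_norm_cong_AE borel_measurable_diff) auto
  then have "L2_tendsto M f u" using g(2) by (simp add: L2_tendsto_def)
  then show "\<exists>f. (\<forall>n. f n \<in> D) \<and> L2_tendsto M f u" using f by blast
qed (fact D(1))

section \<open>Integration of test functions\<close>

lemma distr_lebesgue_translate: "distr lebesgue lebesgue ((+) a) = (lebesgue :: 'a::euclidean_space measure)"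
  and measurable_lebesgue_translate [measurable]: "(+) a \<in> (lebesgue :: 'a::euclidean_space measure) \<rightarrow>\<^sub>M lebesgue"
proof -
  have *: "(\<lambda>x::'a. a + (\<Sum>j\<in>Basis. (1 * (x \<bullet> j)) *\<^sub>R j)) = (+) a"
    by (simp add: euclidean_representation fun_eq_iff)
  show "distr lebesgue lebesgue ((+) a) = (lebesgue :: 'a measure)"
    using lebesgue_affine_euclidean[where c = "\<lambda>_::'a. 1" and t = a] unfolding * by (simp add: density_1)
  show "(+) a \<in> (lebesgue :: 'a measure) \<rightarrow>\<^sub>M lebesgue"
    using lebesgue_affine_measurable[where c = "\<lambda>_::'a. 1" and t = a] unfolding * by simp
qed

lemma measurable_compose_translate:
  "f \<in> borel_measurable lebesgue \<Longrightarrow> (\<lambda>x. f (a + x)) \<in> borel_measurable lebesgue"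
  by (rule measurable_compose[OF measurable_lebesgue_translate])

lemma integrable_translate_iff:
  fixes f :: "'a::euclidean_space \<Rightarrow> real"
  assumes "f \<in> borel_measurable lebesgue"
  shows "integrable lebesgue (\<lambda>x. f (a + x)) \<longleftrightarrow> integrable lebesgue f"
  using integrable_distr_eq[OF measurable_lebesgue_translate, of f a] assms
  by (simp add: distr_lebesgue_translate)

lemma integral_translate:
  fixes f :: "'a::euclidean_space \<Rightarrow> real"
  assumes "f \<in> borel_measurable lebesgue"
  shows "(LINT x|lebesgue. f (a + x)) = (LINT x|lebesgue. f x)"
  using integral_distr[OF measurable_lebesgue_translate, of f a] assms
  by (simp add: distr_lebesgue_translate)

lemma smooth_measurable: "smooth f \<Longrightarrow> f \<in> borel_measurable lebesgue"
  by (intro measurable_completion) (simp add: borel_measurable_continuous_onI smooth_continuous)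

lemma smooth_borel_measurable: "smooth f \<Longrightarrow> f \<in> borel_measurable borel"
  by (simp add: borel_measurable_continuous_onI smooth_continuous)

lemma Cc_measurable [measurable_dest]: "f \<in> Cc_infty \<Longrightarrow> f \<in> borel_measurable lebesgue"
  by (simp add: smooth_measurable Cc_smooth)

lemma Lloc_measurable [measurable_dest]: "f \<in> Lloc q \<Longrightarrow> f \<in> borel_measurable lebesgue"
  by (simp add: Lloc_def)

lemma compact_sets_lebesgue: "compact K \<Longrightarrow> K \<in> sets (lebesgue :: 'a::euclidean_space measure)"
  by (rule fmeasurableD[OF lmeasurable_compact])

lemma integrable_indicator_compact:
  assumes "compact K" shows "integrable lebesgue (indicator K :: 'a::euclidean_space \<Rightarrow> real)"
  using lmeasurable_compact[OF assms]
  by (intro integrable_real_indicator) (auto simp: fmeasurable_def)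

lemma Lloc_one_iff:
  "f \<in> Lloc 1 \<longleftrightarrow> f \<in> borel_measurable lebesgue \<and> (\<forall>K. compact K \<longrightarrow> set_integrable lebesgue K f)"
proof -
  have "set_integrable lebesgue K f \<longleftrightarrow> set_integrable lebesgue K (\<lambda>x. \<bar>f x\<bar>)"
    if "f \<in> borel_measurable lebesgue" "compact K" for K
  proof
    assume "set_integrable lebesgue K (\<lambda>x. \<bar>f x\<bar>)"
    then have "integrable lebesgue (\<lambda>x. indicator K x * \<bar>f x\<bar>)" by (simp add: set_integrable_def)
    then have "integrable lebesgue (\<lambda>x. indicator K x * f x)"
    proof (rule Bochner_Integration.integrable_bound)
      show "(\<lambda>x. indicator K x * f x) \<in> borel_measurable lebesgue"
        using that(1) compact_sets_lebesgue[OF that(2)] by measurable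
    qed (auto simp: abs_mult)
    then show "set_integrable lebesgue K f" by (simp add: set_integrable_def)
  qed (simp add: set_integrable_abs)
  then show ?thesis unfolding Lloc_def by auto
qed

lemma Lloc_integrable_mult:
  assumes f: "f \<in> Lloc 1" and g: "g \<in> borel_measurable lebesgue" and K: "compact K"
    and 0: "\<And>x. x \<notin> K \<Longrightarrow> g x = 0" and B: "AE x in lebesgue. \<bar>g x\<bar> \<le> B"
  shows "integrable lebesgue (\<lambda>x. f x * g x)"
proof -
  have "integrable lebesgue (\<lambda>x. B * (indicator K x * \<bar>f x\<bar>))"
    using f K by (intro integrable_mult_right) (auto simp: Lloc_def set_integrable_def)
  then show ?thesis
  proof (rule Bochner_Integration.integrable_bound)
    show "AE x in lebesgue. norm (f x * g x) \<le> norm (B * (indicator K x * \<bar>f x\<bar>))"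
      using B
    proof eventually_elim
      case (elim x)
      show ?case
      proof (cases "x \<in> K")
        case True
        have "\<bar>f x\<bar> * \<bar>g x\<bar> \<le> \<bar>f x\<bar> * \<bar>B\<bar>" using elim by (intro mult_left_mono) auto
        then show ?thesis using True by (simp add: abs_mult mult.commute)
      qed (simp add: 0)
    qed
  qed (use f g in measurable)
qed

lemma Lloc_Cc_integrable:
  assumes "f \<in> Lloc 1" "\<psi> \<in> Cc_infty" shows "integrable lebesgue (\<lambda>x. f x * \<psi> x)"
proof -
  obtain K where K: "compact K" "\<And>x. x \<notin> K \<Longrightarrow> \<psi> x = 0" using Cc_compact_support[OF assms(2)] by metis
  obtain B where B: "\<And>x. \<bar>\<psi> x\<bar> \<le> B" using Cc_bounded[OF assms(2)] by metis
  show ?thesis by (rule Lloc_integrable_mult[OF assms(1) _ K, where B = B]) (use assms B in auto)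
qed

lemma Lloc_one_const: "(\<lambda>x. c) \<in> Lloc 1"
  unfolding Lloc_one_iff by (auto simp: set_integrable_def intro!: integrable_mult_left integrable_indicator_compact)

lemma Cc_integrable: "f \<in> Cc_infty \<Longrightarrow> integrable lebesgue f"
  using Lloc_Cc_integrable[OF Lloc_one_const[of 1]] by fastforce

lemma Cc_L2: "f \<in> Cc_infty \<Longrightarrow> f \<in> L2 lebesgue"
  by (rule L2I) (auto simp: power2_eq_square intro: Cc_integrable Cc_mult)

lemma L2_Lloc_one:
  assumes "u \<in> L2 lebesgue" shows "u \<in> Lloc 1"
  unfolding Lloc_one_iff
proof (intro conjI allI impI)
  show m: "u \<in> borel_measurable lebesgue" using assms by measurable
  fix K :: "'a set" assume K: "compact K"
  have "integrable lebesgue (\<lambda>x. indicator K x + (u x)\<^sup>2)"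
    by (intro Bochner_Integration.integrable_add integrable_indicator_compact K L2_integrable assms)
  then have "integrable lebesgue (\<lambda>x. indicator K x * u x)"
  proof (rule Bochner_Integration.integrable_bound)
    show "(\<lambda>x. indicator K x * u x) \<in> borel_measurable lebesgue" using m compact_sets_lebesgue[OF K] by measurable
    show "AE x in lebesgue. norm (indicator K x * u x) \<le> norm (indicator K x + (u x)\<^sup>2)"
    proof (rule AE_I2)
      fix x show "norm (indicator K x * u x) \<le> norm (indicator K x + (u x)\<^sup>2)"
        using abs_mult_le_sum_squares[of 1 "u x"] by (simp add: indicator_def)
    qed
  qed
  then show "set_integrable lebesgue K u" by (simp add: set_integrable_def)
qed

section \<open>The fundamental lemma of the calculus of variations\<close>

text \<open>Urysohn functions for the neighbourhoods of width 1/(n+1), intersected with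
  \<open>V\<close>. They share one compact \<open>L\<close> outside which they vanish, as dominated
  convergence against a locally integrable function requires.\<close>

lemma smooth_approx_indicator:
  fixes K :: "(real^'n) set"
  assumes K: "compact K" and V: "open V" "K \<subseteq> V"
  obtains \<psi> L where "\<And>n::nat. \<psi> n \<in> Cc_infty" "\<And>n x. 0 \<le> \<psi> n x" "\<And>n x. \<psi> n x \<le> 1"
    "\<And>n x. x \<notin> V \<Longrightarrow> \<psi> n x = 0" "compact L" "\<And>n x. x \<notin> L \<Longrightarrow> \<psi> n x = 0"
    "\<And>x. (\<lambda>n. \<psi> n x) \<longlonglongrightarrow> indicator K x"
proof -
  obtain R where R: "\<And>x. x \<in> K \<Longrightarrow> norm x \<le> R"
    using compact_imp_bounded[OF K] unfolding bounded_iff by blast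
  define W where "W n = V \<inter> (\<Union>x\<in>K. ball x (inverse (real (Suc n))))" for n
  have "open (W n)" "K \<subseteq> W n" for n
    using V by (auto simp: W_def)
  then have "\<exists>\<psi>. \<psi> \<in> Cc_infty \<and> (\<forall>x. 0 \<le> \<psi> x \<and> \<psi> x \<le> 1) \<and> (\<forall>x\<in>K. \<psi> x = 1) \<and> (\<forall>x. x \<notin> W n \<longrightarrow> \<psi> x = 0)" for n
    using smooth_urysohn[OF K, of "W n"] by metis
  then obtain \<psi> where \<psi>: "\<And>n. \<psi> n \<in> Cc_infty" "\<And>n x. 0 \<le> \<psi> n x \<and> \<psi> n x \<le> 1"
    "\<And>n x. x \<in> K \<Longrightarrow> \<psi> n x = 1" "\<And>n x. x \<notin> W n \<Longrightarrow> \<psi> n x = 0" by metis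
  show thesis
  proof (rule that[of \<psi> "cball 0 (R + 1)"])
    show "\<psi> n x = 0" if "x \<notin> cball 0 (R + 1)" for n x
    proof (rule \<psi>(4))
      show "x \<notin> W n"
      proof
        assume "x \<in> W n"
        then obtain y where y: "y \<in> K" "dist y x < inverse (real (Suc n))" by (auto simp: W_def)
        have "inverse (real (Suc n)) \<le> 1" by (simp add: field_simps)
        moreover have "norm y \<le> R" using R y(1) by auto
        moreover have "norm x \<le> norm y + dist y x" 
          by (metis add.commute dist_commute dist_norm norm_triangle_sub)
        ultimately show False using that y(2) by simp
      qed
    qed
    show "(\<lambda>n. \<psi> n x) \<longlonglongrightarrow> indicator K x" for x
    proof (cases "x \<in> K")
      case False
      have "open (- K)" using K by (simp add: compact_imp_closed open_Compl)
      then obtain e where e: "e > 0" "ball x e \<subseteq> - K" using False by (meson ComplI openE)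
      obtain N where N: "inverse (real (Suc N)) < e" using reals_Archimedean[OF e(1)] by auto
      have "\<psi> n x = 0" if "n \<ge> N" for n
      proof (rule \<psi>(4), rule notI)
        assume "x \<in> W n"
        then obtain y where y: "y \<in> K" "dist y x < inverse (real (Suc n))" by (auto simp: W_def)
        have "inverse (real (Suc n)) \<le> inverse (real (Suc N))" using that by (intro le_imp_inverse_le) auto
        then have "y \<in> ball x e" using y(2) N unfolding mem_ball by (subst dist_commute) linarith
        then show False using e(2) y(1) by blast
      qed
      then have "\<forall>\<^sub>F n in sequentially. \<psi> n x = indicator K x"
        using False by (auto simp: eventually_sequentially)
      then show ?thesis by (rule tendsto_eventually)
    qed (simp add: \<psi>(3))
    show "\<psi> n x = 0" if "x \<notin> V" for n x by (rule \<psi>(4)) (use that in \<open>auto simp: W_def\<close>)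
  qed (use \<psi> in auto)
qed

text \<open>Approximating indicators by test functions shows that \<open>g\<close> has nonpositive
  integral over every compact subset of \<open>U\<close>; a compact set on which \<open>g\<close> is
  positive must therefore be null. The open set \<open>U\<close> is there for the local bound on the
  weight, where only test functions supported in a ball are available.\<close>

lemma nonpos_if_integral_nonpos:
  fixes g :: "real^'n \<Rightarrow> real"
  assumes g: "g \<in> Lloc 1" and U: "open U"
    and le: "\<And>\<psi>. \<psi> \<in> Cc_infty \<Longrightarrow> (\<And>x. 0 \<le> \<psi> x) \<Longrightarrow> (\<And>x. x \<notin> U \<Longrightarrow> \<psi> x = 0) \<Longrightarrow>
      (LINT x|lebesgue. g x * \<psi> x) \<le> 0"
  shows "AE x in lebesgue. x \<in> U \<longrightarrow> g x \<le> 0"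
proof -
  note [measurable] = Lloc_measurable[OF g]
  have K: "(LINT x|lebesgue. g x * indicator K x) \<le> 0" if K: "compact K" "K \<subseteq> U" for K
  proof -
    obtain \<psi> L where \<psi>: "\<And>n::nat. \<psi> n \<in> Cc_infty" "\<And>n x. 0 \<le> \<psi> n x" "\<And>n x. \<psi> n x \<le> 1"
      "\<And>n x. x \<notin> U \<Longrightarrow> \<psi> n x = 0" and L: "compact L" "\<And>n x. x \<notin> L \<Longrightarrow> \<psi> n x = 0"
      and lim: "\<And>x. (\<lambda>n. \<psi> n x) \<longlonglongrightarrow> indicator K x"
      using smooth_approx_indicator[OF K(1) U K(2)] by metis
    have [measurable]: "\<psi> n \<in> borel_measurable lebesgue" for n using \<psi>(1) by measurable
    have [measurable]: "K \<in> sets lebesgue" using compact_sets_lebesgue[OF K(1)] .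
    have "(\<lambda>n. LINT x|lebesgue. g x * \<psi> n x) \<longlonglongrightarrow> (LINT x|lebesgue. g x * indicator K x)"
    proof (rule integral_dominated_convergence)
      show "integrable lebesgue (\<lambda>x. indicator L x * \<bar>g x\<bar>)"
        using g L(1) by (auto simp: Lloc_def set_integrable_def)
      show "AE x in lebesgue. (\<lambda>n. g x * \<psi> n x) \<longlonglongrightarrow> g x * indicator K x"
        by (intro AE_I2 tendsto_intros lim)
      show "AE x in lebesgue. norm (g x * \<psi> n x) \<le> indicator L x * \<bar>g x\<bar>" for n
      proof (rule AE_I2)
        fix x
        have "\<bar>g x\<bar> * \<bar>\<psi> n x\<bar> \<le> \<bar>g x\<bar> * 1" using \<psi>(2,3)[of n x] by (intro mult_left_mono) auto
        then show "norm (g x * \<psi> n x) \<le> indicator L x * \<bar>g x\<bar>"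
          using L(2)[of x n] by (cases "x \<in> L") (auto simp: abs_mult)
      qed
    qed measurable
    then show ?thesis by (rule LIMSEQ_le_const2) (use le \<psi> in blast)
  qed
  define S where "S = {x \<in> U. g x > 0}"
  have [measurable]: "U \<in> sets lebesgue" using U by auto
  have S: "S \<in> sets lebesgue" unfolding S_def by measurable
  have nullK: "K \<in> null_sets lebesgue" if "compact K" "K \<subseteq> S" for K
  proof -
    have [measurable]: "K \<in> sets lebesgue" using compact_sets_lebesgue[OF that(1)] .
    have int: "integrable lebesgue (\<lambda>x. g x * indicator K x)"
      using g that(1) by (auto simp: Lloc_one_iff set_integrable_def mult.commute)
    have pos: "0 \<le> g x * indicator K x" for x using that(2) by (auto simp: S_def indicator_def less_imp_le)
    have "(LINT x|lebesgue. g x * indicator K x) = 0"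
    proof (rule antisym)
      show "(LINT x|lebesgue. g x * indicator K x) \<le> 0"
        by (rule K[OF that(1)]) (use that(2) in \<open>auto simp: S_def\<close>)
    qed (rule Bochner_Integration.integral_nonneg, rule pos)
    then have "AE x in lebesgue. g x * indicator K x = 0"
      using integral_nonneg_eq_0_iff_AE[OF int] pos by simp
    then have "AE x in lebesgue. x \<notin> K"
      by eventually_elim (use that(2) in \<open>auto simp: S_def\<close>)
    then show ?thesis by (simp add: AE_iff_null_sets)
  qed
  have null: "T \<in> null_sets lebesgue" if T: "closed T" "T \<subseteq> S" for T
  proof -
    have "T = (\<Union>n::nat. T \<inter> cball 0 (real n))"
    proof -
      have "\<exists>n::nat. norm x \<le> real n" for x :: "real^'n" by (rule real_arch_simple)
      then show ?thesis by (auto simp: UN_iff)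
    qed
    moreover have "T \<inter> cball 0 (real n) \<in> null_sets lebesgue" for n
      by (rule nullK) (use T in \<open>auto intro: closed_Int_compact\<close>)
    ultimately show ?thesis using null_sets_UN[of "\<lambda>n. T \<inter> cball 0 (real n)" lebesgue] by simp
  qed
  \<comment> \<open>Closed subsets of \<open>S\<close> are null, so \<open>S\<close> is no larger
    than what a closed inner approximation misses.\<close>
  have "emeasure lebesgue S \<le> ennreal e" if "e > 0" for e
  proof -
    obtain T where T: "closed T" "T \<subseteq> S" "S - T \<in> lmeasurable" "emeasure lebesgue (S - T) < ennreal e"
      using sets_lebesgue_inner_closed[OF S \<open>e > 0\<close>] by metis
    have "emeasure lebesgue S \<le> emeasure lebesgue T + emeasure lebesgue (S - T)"
      using T by (subst emeasure_Un_null_set[symmetric, of "S - T" lebesgue T])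
        (auto intro!: null simp: fmeasurable_def Un_absorb2 null_setsD1[OF null[OF T(1,2)]])
    then show ?thesis using null[OF T(1,2)] T(4) by (simp add: null_setsD1)
  qed
  then have "emeasure lebesgue S \<le> 0" by - (rule ennreal_le_epsilon, simp)
  then have "S \<in> null_sets lebesgue" using S by auto
  then have "AE x in lebesgue. x \<notin> S" by (rule AE_not_in)
  then show ?thesis by eventually_elim (auto simp: S_def)
qed

lemma Lloc_one_cmult: "f \<in> Lloc 1 \<Longrightarrow> (\<lambda>x. c * f x) \<in> Lloc 1"
  unfolding Lloc_one_iff by auto

lemma Lloc_one_add: "f \<in> Lloc 1 \<Longrightarrow> g \<in> Lloc 1 \<Longrightarrow> (\<lambda>x. f x + g x) \<in> Lloc 1"
  unfolding Lloc_one_iff by auto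

lemma zero_if_integral_zero:
  fixes g :: "real^'n \<Rightarrow> real"
  assumes g: "g \<in> Lloc 1" and 0: "\<And>\<psi>. \<psi> \<in> Cc_infty \<Longrightarrow> (LINT x|lebesgue. g x * \<psi> x) = 0"
  shows "AE x in lebesgue. g x = 0"
proof -
  have "AE x in lebesgue. x \<in> UNIV \<longrightarrow> g x \<le> 0"
    by (rule nonpos_if_integral_nonpos[OF g]) (simp_all add: 0)
  moreover have "AE x in lebesgue. x \<in> UNIV \<longrightarrow> (-1) * g x \<le> 0"
    by (rule nonpos_if_integral_nonpos[OF Lloc_one_cmult[OF g]]) (simp_all add: 0)
  ultimately show ?thesis by eventually_elim auto
qed

lemma weak_partial_unique:
  assumes "has_weak_partial i f g" "has_weak_partial i f h"
  shows "AE x in lebesgue. g x = h x"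
proof -
  have g: "g \<in> Lloc 1" and h: "h \<in> Lloc 1" using assms by (auto simp: has_weak_partial_def)
  have "AE x in lebesgue. g x + (-1) * h x = 0"
  proof (rule zero_if_integral_zero)
    show "(\<lambda>x. g x + (-1) * h x) \<in> Lloc 1" by (intro Lloc_one_add Lloc_one_cmult g h)
    fix \<psi> :: "real^'a \<Rightarrow> real" assume \<psi>: "\<psi> \<in> Cc_infty"
    have "(LINT x|lebesgue. g x * \<psi> x) = (LINT x|lebesgue. h x * \<psi> x)"
      using assms \<psi> by (auto simp: has_weak_partial_def)
    moreover have "(\<lambda>x. (g x + (-1) * h x) * \<psi> x) = (\<lambda>x. g x * \<psi> x - h x * \<psi> x)"
      by (auto simp: algebra_simps)
    ultimately show "(LINT x|lebesgue. (g x + (-1) * h x) * \<psi> x) = 0"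
      using Lloc_Cc_integrable[OF g \<psi>] Lloc_Cc_integrable[OF h \<psi>] by simp
  qed
  then show ?thesis by eventually_elim simp
qed

section \<open>Differentiation under the integral sign\<close>

lemma Cc_translates_compact:
  fixes X :: "nat \<Rightarrow> real^'n"
  assumes "\<psi> \<in> Cc_infty" "bounded (range X)"
  obtains L where "compact L" "\<And>n x. x \<notin> L \<Longrightarrow> \<psi> (x - X n) = 0" "\<And>n x i. x \<notin> L \<Longrightarrow> pd i \<psi> (x - X n) = 0"
proof -
  obtain K where K: "compact K" "\<And>x. x \<notin> K \<Longrightarrow> \<psi> x = 0" "\<And>i x. x \<notin> K \<Longrightarrow> pd i \<psi> x = 0"
    using Cc_compact_support[OF assms(1)] by metis
  obtain R where R: "\<And>x. x \<in> K \<Longrightarrow> norm x \<le> R"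
    using compact_imp_bounded[OF K(1)] unfolding bounded_iff by blast
  obtain M where M: "\<And>n. norm (X n) \<le> M" using assms(2) by (auto simp: bounded_iff)
  have "x - X n \<notin> K" if "x \<notin> cball 0 (R + M)" for x n
  proof
    assume "x - X n \<in> K"
    then have "norm (x - X n) \<le> R" using R by auto
    then have "norm x \<le> R + M" using M[of n] norm_triangle_sub[of x "X n"] by linarith
    then show False using that by simp
  qed
  then show thesis using that[of "cball 0 (R + M)"] K by (meson compact_cball)
qed

lemma convolution_continuous:
  fixes \<psi> :: "real^'n \<Rightarrow> real"
  assumes f: "f \<in> Lloc 1" and \<psi>: "\<psi> \<in> Cc_infty"
  shows "continuous_on UNIV (\<lambda>x. LINT y|lebesgue. f y * \<psi> (y - x))"
proof (rule continuous_at_imp_continuous_on, rule ballI)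
  fix x
  note [measurable] = Lloc_measurable[OF f]
  show "isCont (\<lambda>x. LINT y|lebesgue. f y * \<psi> (y - x)) x"
    unfolding continuous_at_sequentially
  proof (intro allI impI)
    fix X assume X: "X \<longlonglongrightarrow> x"
    obtain L where L: "compact L" "\<And>n y. y \<notin> L \<Longrightarrow> \<psi> (y - X n) = 0"
      using Cc_translates_compact[OF \<psi> convergent_imp_bounded[OF X]] by metis
    obtain B where B: "\<And>x. \<bar>\<psi> x\<bar> \<le> B" using Cc_bounded[OF \<psi>] by metis
    have m: "(\<lambda>y. \<psi> (y - z)) \<in> borel_measurable lebesgue" for z
      using Cc_measurable[OF Cc_translate[OF \<psi>]] .
    have "(\<lambda>n. LINT y|lebesgue. f y * \<psi> (y - X n)) \<longlonglongrightarrow> (LINT y|lebesgue. f y * \<psi> (y - x))"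
    proof (rule integral_dominated_convergence)
      show "integrable lebesgue (\<lambda>y. B * (indicator L y * \<bar>f y\<bar>))"
        using f L(1) by (intro integrable_mult_right) (auto simp: Lloc_def set_integrable_def)
      show "AE y in lebesgue. (\<lambda>n. f y * \<psi> (y - X n)) \<longlonglongrightarrow> f y * \<psi> (y - x)"
        by (intro AE_I2 tendsto_mult tendsto_const isCont_tendsto_compose[OF smooth_isCont[OF Cc_smooth[OF \<psi>]]]
            tendsto_diff X)
      show "AE y in lebesgue. norm (f y * \<psi> (y - X n)) \<le> B * (indicator L y * \<bar>f y\<bar>)" for n
      proof (rule AE_I2)
        fix y
        have "\<bar>f y\<bar> * \<bar>\<psi> (y - X n)\<bar> \<le> \<bar>f y\<bar> * B" by (intro mult_left_mono B) auto
        then show "norm (f y * \<psi> (y - X n)) \<le> B * (indicator L y * \<bar>f y\<bar>)"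
          using L(2)[of y n] by (cases "y \<in> L") (auto simp: abs_mult mult.commute)
      qed
    qed (use m in measurable)
    then show "((\<lambda>x. LINT y|lebesgue. f y * \<psi> (y - x)) \<circ> X) \<longlonglongrightarrow> (LINT y|lebesgue. f y * \<psi> (y - x))"
      by (simp add: o_def)
  qed
qed

text \<open>All derivatives fall on \<open>\<psi>\<close>, so local integrability of
  \<open>f\<close> suffices: by the mean value theorem the difference quotients of
  \<open>\<psi>\<close> are bounded by one constant, and along a convergent sequence they live in
  one compact set. Integration by parts, difference quotients of weakly differentiable functions and
  Morrey's argument all start from this formula.\<close>

lemma convolution_line_derivative:
  fixes \<psi> :: "real^'n \<Rightarrow> real"
  assumes f: "f \<in> Lloc 1" and \<psi>: "\<psi> \<in> Cc_infty"
  shows "((\<lambda>s. LINT x|lebesgue. f x * \<psi> (x - s *\<^sub>R y)) has_real_derivative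
    - (LINT x|lebesgue. f x * (\<Sum>i\<in>UNIV. y $ i * pd i \<psi> (x - s *\<^sub>R y)))) (at s)"
proof -
  note [measurable] = Lloc_measurable[OF f]
  have s\<psi>: "smooth \<psi>" by (rule Cc_smooth[OF \<psi>])
  have m: "(\<lambda>x. \<psi> (x - z)) \<in> borel_measurable lebesgue" for z
    using Cc_measurable[OF Cc_translate[OF \<psi>]] .
  have md: "(\<lambda>x. pd i \<psi> (x - z)) \<in> borel_measurable lebesgue" for z i
    using Cc_measurable[OF Cc_translate[OF Cc_pd[OF \<psi>]]] .
  define G where "G x r = - (\<Sum>i\<in>UNIV. y $ i * pd i \<psi> (x - r *\<^sub>R y))" for x r
  have der: "((\<lambda>r. \<psi> (x - r *\<^sub>R y)) has_real_derivative G x r) (at r)" for x r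
    using line_derivative[OF s\<psi>, of x "-y" r] by (simp add: G_def sum_negf)
  have "\<exists>B. \<forall>x. \<bar>pd i \<psi> x\<bar> \<le> B" for i using Cc_bounded[OF Cc_pd[OF \<psi>]] by metis
  then obtain b where b: "\<And>i x. \<bar>pd i \<psi> x\<bar> \<le> b i" by metis
  define B where "B = (\<Sum>i\<in>UNIV. \<bar>y $ i\<bar> * b i)"
  have GB: "\<bar>G x r\<bar> \<le> B" for x r
  proof -
    have "\<bar>G x r\<bar> \<le> (\<Sum>i\<in>UNIV. \<bar>y $ i * pd i \<psi> (x - r *\<^sub>R y)\<bar>)" unfolding G_def by (simp add: sum_abs)
    also have "\<dots> \<le> B" unfolding B_def by (intro sum_mono) (simp add: abs_mult b mult_left_mono)
    finally show ?thesis .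
  qed
  have int: "integrable lebesgue (\<lambda>x. f x * \<psi> (x - z))" for z
    by (rule Lloc_Cc_integrable[OF f Cc_translate[OF \<psi>]])
  have "((\<lambda>r. ((LINT x|lebesgue. f x * \<psi> (x - r *\<^sub>R y)) - (LINT x|lebesgue. f x * \<psi> (x - s *\<^sub>R y))) / (r - s))
      \<longlongrightarrow> (LINT x|lebesgue. f x * G x s)) (at s)"
    unfolding tendsto_at_iff_sequentially
  proof (intro allI impI)
    fix X assume X: "\<forall>i. X i \<in> UNIV - {s}" "X \<longlonglongrightarrow> s"
    define q where "q n x = (\<psi> (x - X n *\<^sub>R y) - \<psi> (x - s *\<^sub>R y)) / (X n - s)" for n x
    have "(\<lambda>n. X n *\<^sub>R y) \<longlonglongrightarrow> s *\<^sub>R y" by (intro tendsto_intros X)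
    then obtain L1 where L1: "compact L1" "\<And>n x. x \<notin> L1 \<Longrightarrow> \<psi> (x - X n *\<^sub>R y) = 0"
      using Cc_translates_compact[OF \<psi> convergent_imp_bounded] by metis
    obtain L2 where L2: "compact L2" "\<And>x. x \<notin> L2 \<Longrightarrow> \<psi> (x - s *\<^sub>R y) = 0"
      using Cc_compact_support[OF Cc_translate[OF \<psi>]] by metis
    define L where "L = L1 \<union> L2"
    have L: "compact L" using L1 L2 by (simp add: L_def compact_Un)
    have q0: "q n x = 0" if "x \<notin> L" for n x using that L1 L2 by (simp add: L_def q_def)
    have qB: "\<bar>q n x\<bar> \<le> B" for n x
    proof -
      have ne: "X n \<noteq> s" using X(1) by auto
      have "\<exists>z. q n x = G x z"
      proof (cases "X n < s")
        case True
        obtain z where "\<psi> (x - s *\<^sub>R y) - \<psi> (x - X n *\<^sub>R y) = (s - X n) * G x z"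
          using MVT2[OF True, of "\<lambda>r. \<psi> (x - r *\<^sub>R y)" "G x"] der by auto
        then have "q n x = G x z" using True unfolding q_def by (simp add: field_simps)
        then show ?thesis by blast
      next
        case False
        then have lt: "s < X n" using ne by simp
        obtain z where "\<psi> (x - X n *\<^sub>R y) - \<psi> (x - s *\<^sub>R y) = (X n - s) * G x z"
          using MVT2[OF lt, of "\<lambda>r. \<psi> (x - r *\<^sub>R y)" "G x"] der by auto
        then have "q n x = G x z" using lt unfolding q_def by (simp add: field_simps)
        then show ?thesis by blast
      qed
      then show ?thesis using GB by auto
    qed
    have mq: "q n \<in> borel_measurable lebesgue" for n unfolding q_def using m by measurable
    have mG: "(\<lambda>x. G x s) \<in> borel_measurable lebesgue" unfolding G_def using md by measurable
    have lim: "(\<lambda>n. q n x) \<longlonglongrightarrow> G x s" for x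
      using der[of x s] X unfolding has_field_derivative_iff tendsto_at_iff_sequentially
      by (auto simp: q_def o_def)
    have "(\<lambda>n. LINT x|lebesgue. f x * q n x) \<longlonglongrightarrow> (LINT x|lebesgue. f x * G x s)"
    proof (rule integral_dominated_convergence)
      show "integrable lebesgue (\<lambda>x. B * (indicator L x * \<bar>f x\<bar>))"
        using f L by (intro integrable_mult_right) (auto simp: Lloc_def set_integrable_def)
      show "AE x in lebesgue. (\<lambda>n. f x * q n x) \<longlonglongrightarrow> f x * G x s"
        by (intro AE_I2 tendsto_mult tendsto_const lim)
      show "AE x in lebesgue. norm (f x * q n x) \<le> B * (indicator L x * \<bar>f x\<bar>)" for n
      proof (rule AE_I2)
        fix x
        have "\<bar>f x\<bar> * \<bar>q n x\<bar> \<le> \<bar>f x\<bar> * B" by (intro mult_left_mono qB) auto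
        then show "norm (f x * q n x) \<le> B * (indicator L x * \<bar>f x\<bar>)"
          using q0[of x n] by (cases "x \<in> L") (auto simp: abs_mult mult.commute)
      qed
    qed (use mq mG in measurable)
    moreover have "(LINT x|lebesgue. f x * q n x) = ((LINT x|lebesgue. f x * \<psi> (x - X n *\<^sub>R y)) - (LINT x|lebesgue. f x * \<psi> (x - s *\<^sub>R y))) / (X n - s)" for n
    proof -
      have "(\<lambda>x. f x * q n x) = (\<lambda>x. (f x * \<psi> (x - X n *\<^sub>R y) - f x * \<psi> (x - s *\<^sub>R y)) / (X n - s))"
        by (auto simp: q_def algebra_simps diff_divide_distrib)
      then show ?thesis using int by simp
    qed
    ultimately show "((\<lambda>r. ((LINT x|lebesgue. f x * \<psi> (x - r *\<^sub>R y)) - (LINT x|lebesgue. f x * \<psi> (x - s *\<^sub>R y))) / (r - s)) \<circ> X)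
       \<longlonglongrightarrow> (LINT x|lebesgue. f x * G x s)" by (simp add: o_def)
  qed
  then show ?thesis unfolding has_field_derivative_iff by (simp add: G_def)
qed

text \<open>By translation invariance the integral of a shifted \<open>\<psi>\<close> is constant in
  the shift, and its derivative at 0 is minus the integral in question. No iterated integrals
  enter.\<close>

lemma integral_pd_zero:
  assumes \<psi>: "\<psi> \<in> Cc_infty" shows "(LINT x|lebesgue. pd i \<psi> x) = 0"
proof -
  have c: "(LINT x|lebesgue. 1 * \<psi> (x - s *\<^sub>R axis i 1)) = (LINT x|lebesgue. \<psi> x)" for s
    using integral_translate[OF Cc_measurable[OF \<psi>], of "- (s *\<^sub>R axis i 1)"] by simp
  have "((\<lambda>s. LINT x|lebesgue. \<psi> x) has_real_derivative
     - (LINT x|lebesgue. 1 * (\<Sum>j\<in>UNIV. axis i 1 $ j * pd j \<psi> (x - 0 *\<^sub>R axis i 1)))) (at 0)"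
    using convolution_line_derivative[OF Lloc_one_const[of 1] \<psi>, of "axis i 1" 0] unfolding c .
  from DERIV_unique[OF this DERIV_const] show ?thesis by (simp add: sum_axis)
qed

lemma integral_by_parts:
  assumes f: "f \<in> Cc_infty" and g: "smooth g"
  shows "(LINT x|lebesgue. pd i f x * g x) = - (LINT x|lebesgue. f x * pd i g x)"
proof -
  have "(LINT x|lebesgue. pd i f x * g x + f x * pd i g x) = 0"
    using integral_pd_zero[OF Cc_smooth_mult[OF f g], of i]
    by (simp add: smooth_pd_mult[OF Cc_smooth[OF f] g])
  moreover have "integrable lebesgue (\<lambda>x. pd i f x * g x)" "integrable lebesgue (\<lambda>x. f x * pd i g x)"
    by (intro Cc_integrable Cc_smooth_mult Cc_pd f g smooth_pd)+
  ultimately show ?thesis by simp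
qed

section \<open>Dense subspaces of test functions\<close>

text \<open>A positive \<open>d\<close> would make \<open>g'\<close> positive just to the right of
  0, and the mean value theorem would then produce a value above the maximum.\<close>

lemma second_derivative_at_max:
  fixes g :: "real \<Rightarrow> real"
  assumes g: "\<And>t. (g has_real_derivative g' t) (at t)" and g': "(g' has_real_derivative d) (at 0)"
    and max: "\<And>t. g t \<le> g 0"
  shows "d \<le> 0"
proof (rule ccontr)
  assume "\<not> d \<le> 0"
  then have "d > 0" by simp
  have g0: "g' 0 = 0" by (rule DERIV_local_max[OF g, of 1]) (use max in auto)
  obtain e where e: "e > 0" "\<And>h. h > 0 \<Longrightarrow> h < e \<Longrightarrow> g' 0 < g' (0 + h)"
    using DERIV_pos_inc_right[OF g' \<open>d > 0\<close>] by auto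
  obtain z where "0 < z" "z < e / 2" "g (e/2) - g 0 = (e/2 - 0) * g' z"
    using MVT2[of 0 "e/2" g g'] e(1) g by auto
  then show False using e(2)[of z] g0 max[of "e/2"] e(1) by (simp add: zero_less_mult_iff not_le)
       (smt (verit) e(1) half_gt_zero_iff mult_pos_pos)
qed

lemma cosh_ge_half_abs: "\<bar>y\<bar> / 2 \<le> cosh (y::real)"
proof -
  have "\<bar>y\<bar> \<le> exp \<bar>y\<bar>" using exp_ge_add_one_self[of "\<bar>y\<bar>"] by linarith
  also have "\<dots> \<le> exp y + exp (-y)" by (cases "y \<ge> 0") auto
  finally show ?thesis by (simp add: cosh_field_def)
qed

text \<open>A maximum principle: \<open>\<Sum>\<^sub>i cosh (x\<^sub>i / \<surd>\<epsilon>)\<close> is a positive solution that dominates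
  every bounded one at infinity.\<close>
lemma bounded_solution_nonpos:
  fixes U :: "real^'n \<Rightarrow> real"
  assumes cont: "continuous_on UNIV U" and bdd: "\<And>x. U x \<le> B" and eps: "\<epsilon> > 0"
    and d1: "\<And>x i t. ((\<lambda>t. U (x + t *\<^sub>R axis i 1)) has_real_derivative U1 i (x + t *\<^sub>R axis i 1)) (at t)"
    and d2: "\<And>x i t. ((\<lambda>t. U1 i (x + t *\<^sub>R axis i 1)) has_real_derivative U2 i (x + t *\<^sub>R axis i 1)) (at t)"
    and eq: "\<And>x. U x = \<epsilon> * (\<Sum>i\<in>UNIV. U2 i x)"
  shows "U x0 \<le> 0"
proof (rule ccontr)
  assume "\<not> U x0 \<le> 0"
  then have pos: "U x0 > 0" by simp
  define s where "s = sqrt \<epsilon>"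
  have s: "s > 0" "s\<^sup>2 = \<epsilon>" using eps by (auto simp: s_def)
  define C where "C x = (\<Sum>j\<in>UNIV. cosh (x $ j / s))" for x :: "real^'n"
  have C_ge: "norm x / (2 * s) \<le> C x" for x
  proof -
    have "norm x \<le> (\<Sum>j\<in>UNIV. \<bar>x $ j\<bar>)" by (rule norm_le_l1_cart)
    then have "norm x / (2 * s) \<le> (\<Sum>j\<in>UNIV. \<bar>x $ j\<bar>) / (2 * s)"
      using s by (intro divide_right_mono) auto
    also have "\<dots> = (\<Sum>j\<in>UNIV. \<bar>x $ j / s\<bar> / 2)" using s by (simp add: sum_divide_distrib abs_divide mult.commute)
    also have "\<dots> \<le> C x" unfolding C_def by (intro sum_mono cosh_ge_half_abs)
    finally show ?thesis .
  qed
  have C0: "C x \<ge> 0" for x unfolding C_def by (intro sum_nonneg) (simp add: cosh_real_nonneg)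
  \<comment> \<open>The barrier \<open>\<kappa> * C\<close> takes away at most half of
    \<open>U x0\<close>, so \<open>W x0\<close> stays positive.\<close>
  define \<kappa> where "\<kappa> = U x0 / (2 * (C x0 + 1))"
  have k: "\<kappa> > 0" using pos C0[of x0] by (simp add: \<kappa>_def)
  have kC: "\<kappa> * C x0 < U x0"
  proof -
    have "\<kappa> * C x0 \<le> \<kappa> * (C x0 + 1)" using k by simp
    also have "\<dots> = U x0 / 2" using C0[of x0] by (simp add: \<kappa>_def field_simps)
    finally show ?thesis using pos by simp
  qed
  define W where "W x = U x - \<kappa> * C x" for x
  have Wx0: "W x0 > 0" using kC by (simp add: W_def)
  \<comment> \<open>Beyond this radius \<open>C_ge\<close> lifts the barrier to at least
    \<open>B\<close>, whence \<open>W \<le> 0\<close> there and the maximum over the ball is a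
    global one.\<close>
  define R where "R = max (norm x0) (2 * s * \<bar>B\<bar> / \<kappa>)"
  have contC: "continuous_on S C" for S
    unfolding C_def by (intro continuous_intros) (use s in auto)
  have contW: "continuous_on (cball 0 R) W"
    unfolding W_def by (intro continuous_intros contC continuous_on_subset[OF cont]) auto
  have "R \<ge> 0" unfolding R_def using norm_ge_zero[of x0] by linarith
  then obtain z where z: "z \<in> cball 0 R" "\<And>y. y \<in> cball 0 R \<Longrightarrow> W y \<le> W z"
    using continuous_attains_sup[OF compact_cball _ contW] by auto
  have Wz: "W z > 0" using z(2)[of x0] Wx0 by (simp add: R_def)
  have zmax: "W y \<le> W z" for y
  proof (cases "y \<in> cball 0 R")
    case False
    then have "2 * s * \<bar>B\<bar> / \<kappa> < norm y" by (simp add: R_def)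
    moreover have "2 * s * B / \<kappa> \<le> 2 * s * \<bar>B\<bar> / \<kappa>"
      using k s by (intro divide_right_mono mult_left_mono) auto
    ultimately have "2 * s * B / \<kappa> \<le> norm y" by simp
    then have "B \<le> \<kappa> * (norm y / (2 * s))" using k s by (simp add: field_simps)
    also have "\<dots> \<le> \<kappa> * C y" using C_ge[of y] k by (intro mult_left_mono) auto
    finally have "W y \<le> 0" using bdd[of y] by (simp add: W_def)
    then show ?thesis using Wz by simp
  qed (use z in simp)
  \<comment> \<open>The second derivative of \<open>cosh (t / s)\<close> is
    \<open>cosh (t / s) / \<epsilon>\<close>. Summed over the directions, the second-derivative test
    at \<open>z\<close> therefore gives \<open>U z \<le> \<kappa> * C z\<close>, against
    \<open>W z > 0\<close>.\<close>
  have "U2 i z - \<kappa> * (cosh (z $ i / s) / \<epsilon>) \<le> 0" for i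
  proof (rule second_derivative_at_max)
    have c1: "((\<lambda>t. C (z + t *\<^sub>R axis i 1)) has_real_derivative sinh ((z + t *\<^sub>R axis i 1) $ i / s) / s) (at t)" for t
    proof -
      have "((\<lambda>t. C (z + t *\<^sub>R axis i 1)) has_real_derivative
        (\<Sum>j\<in>UNIV. axis i 1 $ j * (sinh ((z + t *\<^sub>R axis i 1) $ j / s) / s))) (at t)"
        unfolding C_def using s(1) by (intro DERIV_sum) (auto intro!: derivative_eq_intros)
      then show ?thesis unfolding sum_axis .
    qed
    have c2: "((\<lambda>t. sinh ((z + t *\<^sub>R axis i 1) $ i / s) / s) has_real_derivative cosh (z $ i / s) / \<epsilon>) (at 0)"
      using s(1) by (auto intro!: derivative_eq_intros simp: axis_def s(2)[symmetric] power2_eq_square)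
    show "((\<lambda>t. W (z + t *\<^sub>R axis i 1)) has_real_derivative
        U1 i (z + t *\<^sub>R axis i 1) - \<kappa> * (sinh ((z + t *\<^sub>R axis i 1) $ i / s) / s)) (at t)" for t
      unfolding W_def by (intro DERIV_diff d1 DERIV_cmult c1)
    show "((\<lambda>t. U1 i (z + t *\<^sub>R axis i 1) - \<kappa> * (sinh ((z + t *\<^sub>R axis i 1) $ i / s) / s)) has_real_derivative
        U2 i z - \<kappa> * (cosh (z $ i / s) / \<epsilon>)) (at 0)"
      using DERIV_diff[OF d2[of i z 0] DERIV_cmult[OF c2]] by simp
    show "W (z + t *\<^sub>R axis i 1) \<le> W (z + 0 *\<^sub>R axis i 1)" for t using zmax by simp
  qed
  then have "(\<Sum>i\<in>UNIV. U2 i z) \<le> (\<Sum>i\<in>UNIV. \<kappa> * (cosh (z $ i / s) / \<epsilon>))"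
    by (intro sum_mono) (simp add: algebra_simps)
  also have "\<dots> = \<kappa> * C z / \<epsilon>" by (simp add: C_def sum_distrib_left sum_divide_distrib)
  finally have "U z \<le> \<kappa> * C z" using eq[of z] eps by (simp add: field_simps)
  then show False using Wz by (simp add: W_def)
qed

section \<open>The range of 1 - \<epsilon> \<Delta> on test functions\<close>

definition laplace :: "(real^'n \<Rightarrow> real) \<Rightarrow> real^'n \<Rightarrow> real" where
  "laplace f x = (\<Sum>i\<in>UNIV. pd i (pd i f) x)"

lemma laplace_Cc: "f \<in> Cc_infty \<Longrightarrow> laplace f \<in> Cc_infty"
  using Cc_sum[of UNIV "\<lambda>i. pd i (pd i f)"] by (simp add: Cc_pd laplace_def[abs_def])

lemma laplace_lin: "smooth f \<Longrightarrow> smooth g \<Longrightarrow>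
    laplace (\<lambda>x. a * f x + b * g x) x = a * laplace f x + b * laplace g x"
  by (simp add: laplace_def smooth_pd_add smooth_pd_cmult smooth_cmult smooth_pd sum.distrib sum_distrib_left)

text \<open>Correlating \<open>u\<close> with a test function turns the distributional equation into
  a classical one. \<open>U f\<close> is bounded by Cauchy-Schwarz, its derivatives are obtained by
  moving them onto \<open>f\<close>, and orthogonality to all translates says that
  \<open>U f\<close> equals \<epsilon> times its Laplacian. The maximum principle for
  \<open>f\<close> and for its negative leaves \<open>U f 0 = 0\<close>.\<close>

lemma resolvent_orthogonal_zero:
  fixes u :: "real^'n \<Rightarrow> real"
  assumes u: "u \<in> L2 lebesgue" and eps: "\<epsilon> > 0"
    and orth: "\<And>f. f \<in> Cc_infty \<Longrightarrow> L2_inner lebesgue (\<lambda>x. f x - \<epsilon> * laplace f x) u = 0"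
  shows "AE x in lebesgue. u x = 0"
proof (rule zero_if_integral_zero)
  show ul: "u \<in> Lloc 1" by (rule L2_Lloc_one[OF u])
  define U where "U f x = (LINT y|lebesgue. u y * f (y - x))" for f :: "real^'n \<Rightarrow> real" and x
  have d1: "((\<lambda>t. U f (x + t *\<^sub>R axis i 1)) has_real_derivative - U (pd i f) (x + t *\<^sub>R axis i 1)) (at t)"
    if f: "f \<in> Cc_infty" for f x i t
    using convolution_line_derivative[OF ul Cc_translate[OF f, of x], of "axis i 1" t]
    by (simp add: U_def sum_axis smooth_pd_translate[OF Cc_smooth[OF f]] algebra_simps)
  have bound: "\<bar>U f x\<bar> \<le> L2_norm lebesgue u * L2_norm lebesgue f" if f: "f \<in> Cc_infty" for f x
  proof -
    have "L2_norm lebesgue (\<lambda>y. f (y - x)) = L2_norm lebesgue f"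
      using integral_translate[of "\<lambda>y. (f y)\<^sup>2" "-x"] Cc_measurable[OF f] by (simp add: L2_norm_eq)
    then show ?thesis
      using L2_Cauchy_Schwarz[OF u Cc_L2[OF Cc_translate[OF f, of x]]] by (simp add: U_def L2_inner_def)
  qed
  have eq: "U f x = \<epsilon> * (\<Sum>i\<in>UNIV. U (pd i (pd i f)) x)" if f: "f \<in> Cc_infty" for f x
  proof -
    let ?f = "\<lambda>y. f (y - x)"
    have cf: "?f \<in> Cc_infty" by (rule Cc_translate[OF f])
    have "laplace ?f = (\<lambda>y. \<Sum>i\<in>UNIV. pd i (pd i f) (y - x))"
      by (simp add: laplace_def fun_eq_iff smooth_pd_translate Cc_smooth f smooth_pd)
    then have "(\<lambda>y. (?f y - \<epsilon> * laplace ?f y) * u y)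
        = (\<lambda>y. u y * f (y - x) - \<epsilon> * (\<Sum>i\<in>UNIV. u y * pd i (pd i f) (y - x)))"
      by (auto simp: algebra_simps sum_distrib_left)
    moreover have "integrable lebesgue (\<lambda>y. u y * f (y - x))"
      "\<And>i. integrable lebesgue (\<lambda>y. u y * pd i (pd i f) (y - x))"
      by (intro Lloc_Cc_integrable ul Cc_translate Cc_pd f)+
    ultimately show ?thesis using orth[OF cf] unfolding L2_inner_def U_def by simp
  qed
  have le: "U f x \<le> 0" if f: "f \<in> Cc_infty" for f x
  proof (rule bounded_solution_nonpos)
    show "continuous_on UNIV (U f)" unfolding U_def[abs_def] by (rule convolution_continuous[OF ul f])
    show "U f x \<le> L2_norm lebesgue u * L2_norm lebesgue f" for x using bound[OF f, of x] by simp
    show "((\<lambda>t. U f (x + t *\<^sub>R axis i 1)) has_real_derivative - U (pd i f) (x + t *\<^sub>R axis i 1)) (at t)" for x i t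
      by (rule d1[OF f])
    show "((\<lambda>t. - U (pd i f) (x + t *\<^sub>R axis i 1)) has_real_derivative U (pd i (pd i f)) (x + t *\<^sub>R axis i 1)) (at t)" for x i t
      using DERIV_minus[OF d1[OF Cc_pd[OF f]]] by simp
  qed (use eq[OF f] eps in auto)
  fix f :: "real^'n \<Rightarrow> real" assume f: "f \<in> Cc_infty"
  have "U f 0 \<le> 0" "U (\<lambda>x. (-1) * f x) 0 \<le> 0" using le[OF f] le[OF Cc_cmult[OF f, of "-1"]] by blast+
  then show "(LINT x|lebesgue. u x * f x) = 0" by (simp add: U_def)
qed

lemma Cc_dense: "L2_dense lebesgue (Cc_infty :: (real^'n \<Rightarrow> real) set)"
proof (rule L2_dense_if_orthogonal_trivial)
  fix w :: "real^'n \<Rightarrow> real" assume w: "w \<in> L2 lebesgue" "\<And>f. f \<in> Cc_infty \<Longrightarrow> L2_inner lebesgue f w = 0"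
  show "AE x in lebesgue. w x = 0"
    by (rule zero_if_integral_zero[OF L2_Lloc_one[OF w(1)]])
      (use w(2) in \<open>simp add: L2_inner_def mult.commute\<close>)
qed (auto intro: Cc_L2 Cc_add Cc_cmult)

lemma resolvent_dense:
  fixes w :: "real^'n \<Rightarrow> real"
  assumes eps: "\<epsilon> > 0" and w: "w \<in> L2 lebesgue" and e: "e > 0"
  obtains v where "v \<in> Cc_infty" "L2_norm lebesgue (\<lambda>x. v x - \<epsilon> * laplace v x - w x) \<le> e"
proof -
  let ?D = "(\<lambda>f x. f x - \<epsilon> * laplace f x) ` (Cc_infty :: (real^'n \<Rightarrow> real) set)"
  have "L2_dense lebesgue ?D"
  proof (rule L2_dense_if_orthogonal_trivial)
    show "?D \<subseteq> L2 lebesgue" by (auto intro!: Cc_L2 Cc_diff Cc_cmult laplace_Cc)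
    show "(\<lambda>x. 0) \<in> ?D" by (rule image_eqI[of _ _ "\<lambda>x. 0"]) (auto simp: laplace_def)
    show "(\<lambda>x. a * f x + b * g x) \<in> ?D" if fg: "f \<in> ?D" "g \<in> ?D" for f g a b
    proof -
      obtain f0 g0 where 0: "f0 \<in> Cc_infty" "g0 \<in> Cc_infty" "f = (\<lambda>x. f0 x - \<epsilon> * laplace f0 x)" "g = (\<lambda>x. g0 x - \<epsilon> * laplace g0 x)"
        using fg unfolding image_iff by blast
      show ?thesis
        by (rule image_eqI[of _ _ "\<lambda>x. a * f0 x + b * g0 x"])
          (auto simp: 0 laplace_lin Cc_smooth algebra_simps intro!: Cc_add Cc_cmult)
    qed
    show "AE x in lebesgue. w x = 0" if "w \<in> L2 lebesgue" "\<And>f. f \<in> ?D \<Longrightarrow> L2_inner lebesgue f w = 0" for w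
      by (rule resolvent_orthogonal_zero[OF that(1) eps]) (use that(2) in blast)
  qed
  then obtain g where g: "\<And>n::nat. g n \<in> ?D" "L2_tendsto lebesgue g w"
    using w unfolding L2_dense_def by blast
  obtain n where n: "L2_norm lebesgue (\<lambda>x. g n x - w x) < e"
    using LIMSEQ_D[OF g(2)[unfolded L2_tendsto_def] e] by auto
  obtain v where "v \<in> Cc_infty" "g n = (\<lambda>x. v x - \<epsilon> * laplace v x)" using g(1)[of n] by auto
  then show thesis using n that[of v] by simp
qed

section \<open>Weak derivatives of products\<close>

lemma smooth_bounded_on_compact:
  assumes "smooth f" "compact K"
  obtains B where "B \<ge> 0" "\<And>x. x \<in> K \<Longrightarrow> \<bar>f x\<bar> \<le> B"
proof -
  have "bounded (f ` K)"
    by (intro compact_imp_bounded compact_continuous_image smooth_continuous assms)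
  then obtain B where "\<forall>y\<in>f ` K. norm y \<le> B" unfolding bounded_iff by blast
  then have "\<And>x. x \<in> K \<Longrightarrow> \<bar>f x\<bar> \<le> max B 0" by fastforce
  then show thesis using that[of "max B 0"] by simp
qed

lemma Lloc_powr_mono:
  assumes f: "f \<in> Lloc p" and q: "0 \<le> q" "q \<le> p" shows "f \<in> Lloc q"
  unfolding Lloc_def
proof (intro CollectI conjI allI impI)
  show m: "f \<in> borel_measurable lebesgue" using f by measurable
  fix K :: "'a set" assume K: "compact K"
  note [measurable] = m compact_sets_lebesgue[OF K]
  have "integrable lebesgue (\<lambda>x. indicator K x * \<bar>f x\<bar> powr p)"
    using f K by (auto simp: Lloc_def set_integrable_def)
  then have "integrable lebesgue (\<lambda>x. indicator K x + indicator K x * \<bar>f x\<bar> powr p)"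
    by (intro Bochner_Integration.integrable_add integrable_indicator_compact K)
  then have "integrable lebesgue (\<lambda>x. indicator K x * \<bar>f x\<bar> powr q)"
  proof (rule Bochner_Integration.integrable_bound)
    show "AE x in lebesgue. norm (indicator K x * \<bar>f x\<bar> powr q) \<le> norm (indicator K x + indicator K x * \<bar>f x\<bar> powr p)"
    proof (rule AE_I2)
      fix x
      have "\<bar>f x\<bar> powr q \<le> 1 + \<bar>f x\<bar> powr p"
      proof (cases "\<bar>f x\<bar> \<le> 1")
        case True
        then have "\<bar>f x\<bar> powr q \<le> 1" using q(1) by (intro powr_le1) auto
        then show ?thesis by (simp add: add_increasing2)
      next
        case False
        then have "\<bar>f x\<bar> powr q \<le> \<bar>f x\<bar> powr p" using q by (intro powr_mono) auto
        then show ?thesis by simp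
      qed
      then show "norm (indicator K x * \<bar>f x\<bar> powr q) \<le> norm (indicator K x + indicator K x * \<bar>f x\<bar> powr p)"
        by (auto simp: indicator_def)
    qed
  qed measurable
  then show "set_integrable lebesgue K (\<lambda>x. \<bar>f x\<bar> powr q)" by (simp add: set_integrable_def)
qed

lemma Lloc_two_L2:
  assumes f: "f \<in> Lloc 2" and K: "compact K" and g: "g \<in> borel_measurable lebesgue"
    and 0: "\<And>x. x \<notin> K \<Longrightarrow> g x = 0" and B: "AE x in lebesgue. \<bar>g x\<bar> \<le> B"
  shows "(\<lambda>x. f x * g x) \<in> L2 lebesgue"
proof -
  note [measurable] = Lloc_measurable[OF f] compact_sets_lebesgue[OF K]
  have "(\<lambda>x. indicator K x * f x) \<in> L2 lebesgue"
  proof (rule L2I)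
    have "(\<lambda>x. (indicator K x * f x)\<^sup>2) = (\<lambda>x. indicator K x * \<bar>f x\<bar> powr 2)"
      by (auto simp: indicator_def)
    then show "integrable lebesgue (\<lambda>x. (indicator K x * f x)\<^sup>2)"
      using f K by (auto simp: Lloc_def set_integrable_def)
  qed measurable
  then have "(\<lambda>x. g x * (indicator K x * f x)) \<in> L2 lebesgue"
    by (rule L2_mult_bounded[OF _ g B])
  moreover have "(\<lambda>x. g x * (indicator K x * f x)) = (\<lambda>x. f x * g x)"
    using 0 by (auto simp: fun_eq_iff indicator_def)
  ultimately show ?thesis by simp
qed

lemma Lloc_two_Cc_L2:
  assumes "f \<in> Lloc 2" "\<zeta> \<in> Cc_infty" shows "(\<lambda>x. f x * \<zeta> x) \<in> L2 lebesgue"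
proof -
  obtain K where K: "compact K" "\<And>x. x \<notin> K \<Longrightarrow> \<zeta> x = 0" using Cc_compact_support[OF assms(2)] by metis
  obtain B where B: "\<And>x. \<bar>\<zeta> x\<bar> \<le> B" using Cc_bounded[OF assms(2)] by metis
  show ?thesis by (rule Lloc_two_L2[OF assms(1) K(1) _ K(2), where B = B]) (use assms B in auto)
qed

lemma Lloc_two_mult:
  assumes f: "f \<in> Lloc 2" and g: "g \<in> Lloc 2" shows "(\<lambda>x. f x * g x) \<in> Lloc 1"
  unfolding Lloc_one_iff
proof (intro conjI allI impI)
  show "(\<lambda>x. f x * g x) \<in> borel_measurable lebesgue" using f g by measurable
  fix K :: "'a set" assume K: "compact K"
  have "(\<lambda>x. f x * indicator K x) \<in> L2 lebesgue" "(\<lambda>x. g x * indicator K x) \<in> L2 lebesgue"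
    using compact_sets_lebesgue[OF K]
    by (auto intro!: Lloc_two_L2[OF _ K, where B = 1] f g)
  from L2_mult_integrable[OF this]
  have "integrable lebesgue (\<lambda>x. f x * indicator K x * (g x * indicator K x))" .
  moreover have "(\<lambda>x. f x * indicator K x * (g x * indicator K x)) = (\<lambda>x. indicator K x *\<^sub>R (f x * g x))"
    by (auto simp: indicator_def)
  ultimately show "set_integrable lebesgue K (\<lambda>x. f x * g x)" by (simp add: set_integrable_def)
qed

lemma Lloc_one_mult_smooth:
  assumes f: "f \<in> Lloc 1" and g: "smooth g" shows "(\<lambda>x. f x * g x) \<in> Lloc 1"
  unfolding Lloc_one_iff
proof (intro conjI allI impI)
  show "(\<lambda>x. f x * g x) \<in> borel_measurable lebesgue" using f smooth_measurable[OF g] by measurable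
  fix K :: "(real^'a) set" assume K: "compact K"
  obtain B where B: "B \<ge> 0" "\<And>x. x \<in> K \<Longrightarrow> \<bar>g x\<bar> \<le> B" using smooth_bounded_on_compact[OF g K] by metis
  have "integrable lebesgue (\<lambda>x. f x * (indicator K x * g x))"
    by (rule Lloc_integrable_mult[OF f _ K, where B = B])
      (use smooth_measurable[OF g] compact_sets_lebesgue[OF K] B in \<open>auto simp: indicator_def\<close>)
  then show "set_integrable lebesgue K (\<lambda>x. f x * g x)" by (simp add: set_integrable_def mult_ac)
qed

lemma smooth_Lloc_one: "smooth g \<Longrightarrow> g \<in> Lloc 1"
  using Lloc_one_mult_smooth[OF Lloc_one_const[of 1]] by fastforce

lemma weak_partial_smooth:
  assumes "smooth g" shows "has_weak_partial i g (pd i g)"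
  unfolding has_weak_partial_def
proof (intro conjI ballI)
  fix \<psi> :: "real^'a \<Rightarrow> real" assume \<psi>: "\<psi> \<in> Cc_infty"
  show "(LINT x|lebesgue. g x * pd i \<psi> x) = - (LINT x|lebesgue. pd i g x * \<psi> x)"
    using integral_by_parts[OF \<psi> assms, of i] by (simp add: mult.commute)
qed (auto intro: smooth_Lloc_one smooth_pd assms)

lemma weak_partialD:
  assumes "has_weak_partial i f f'" "\<psi> \<in> Cc_infty"
  shows "(LINT x|lebesgue. f x * pd i \<psi> x) = - (LINT x|lebesgue. f' x * \<psi> x)"
  using assms by (auto simp: has_weak_partial_def)

lemma weak_partial_Lloc: "has_weak_partial i f f' \<Longrightarrow> f \<in> Lloc 1" "has_weak_partial i f f' \<Longrightarrow> f' \<in> Lloc 1"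
  by (auto simp: has_weak_partial_def)

lemma weak_partial_add:
  assumes "has_weak_partial i f f'" "has_weak_partial i g g'"
  shows "has_weak_partial i (\<lambda>x. f x + g x) (\<lambda>x. f' x + g' x)"
  unfolding has_weak_partial_def
proof (intro conjI ballI)
  note L = assms[THEN weak_partial_Lloc(1)] assms[THEN weak_partial_Lloc(2)]
  fix \<psi> :: "real^'a \<Rightarrow> real" assume \<psi>: "\<psi> \<in> Cc_infty"
  show "(LINT x|lebesgue. (f x + g x) * pd i \<psi> x) = - (LINT x|lebesgue. (f' x + g' x) * \<psi> x)"
    using assms[THEN weak_partialD[OF _ \<psi>]] L[THEN Lloc_Cc_integrable[OF _ \<psi>]]
      L[THEN Lloc_Cc_integrable[OF _ Cc_pd[OF \<psi>]]]
    by (simp add: distrib_right)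
qed (auto intro: Lloc_one_add assms weak_partial_Lloc)

lemma weak_partial_mult_smooth:
  assumes f: "has_weak_partial i f f'" and g: "smooth g"
  shows "has_weak_partial i (\<lambda>x. f x * g x) (\<lambda>x. f' x * g x + f x * pd i g x)"
  unfolding has_weak_partial_def
proof (intro conjI ballI)
  show "(\<lambda>x. f x * g x) \<in> Lloc 1" "(\<lambda>x. f' x * g x + f x * pd i g x) \<in> Lloc 1"
    by (intro Lloc_one_mult_smooth Lloc_one_add weak_partial_Lloc[OF f] smooth_pd g)+
  fix \<psi> :: "real^'a \<Rightarrow> real" assume \<psi>: "\<psi> \<in> Cc_infty"
  have int: "integrable lebesgue (\<lambda>x. f x * (g x * pd i \<psi> x))" "integrable lebesgue (\<lambda>x. f x * (pd i g x * \<psi> x))"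
     "integrable lebesgue (\<lambda>x. f' x * (g x * \<psi> x))"
    by (intro Lloc_Cc_integrable weak_partial_Lloc[OF f] smooth_Cc_mult g smooth_pd Cc_pd \<psi>)+
  have "(LINT x|lebesgue. f x * (pd i g x * \<psi> x + g x * pd i \<psi> x)) = - (LINT x|lebesgue. f' x * (g x * \<psi> x))"
    using weak_partialD[OF f smooth_Cc_mult[OF g \<psi>]] by (simp add: smooth_pd_mult g Cc_smooth[OF \<psi>])
  then show "(LINT x|lebesgue. f x * g x * pd i \<psi> x) = - (LINT x|lebesgue. (f' x * g x + f x * pd i g x) * \<psi> x)"
    using int by (simp add: distrib_left distrib_right mult.assoc)
qed

section \<open>Translations and difference quotients in L2\<close>

lemma L2_translate: "u \<in> L2 lebesgue \<Longrightarrow> (\<lambda>x. u (a + x)) \<in> L2 lebesgue" for a :: "'a::euclidean_space"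
  by (auto simp: L2_def measurable_compose_translate integrable_translate_iff[of "\<lambda>x. (u x)\<^sup>2"])

lemma L2_norm_translate:
  "u \<in> borel_measurable lebesgue \<Longrightarrow> L2_norm lebesgue (\<lambda>x. u (a + x)) = L2_norm lebesgue u" for a :: "'a::euclidean_space"
  using integral_translate[of "\<lambda>x. (u x)\<^sup>2" a] by (simp add: L2_norm_eq)

lemma L2_approx_Cc:
  fixes u :: "real^'n \<Rightarrow> real"
  assumes "u \<in> L2 lebesgue" "e > 0"
  obtains g where "g \<in> Cc_infty" "L2_norm lebesgue (\<lambda>x. u x - g x) < e"
proof -
  obtain g where g: "\<And>n::nat. g n \<in> Cc_infty" "L2_tendsto lebesgue g u"
    using Cc_dense assms(1) unfolding L2_dense_def by blast
  obtain n where "L2_norm lebesgue (\<lambda>x. g n x - u x) < e"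
    using LIMSEQ_D[OF g(2)[unfolded L2_tendsto_def] assms(2)] by auto
  then show thesis using that[OF g(1)[of n]] by (simp add: L2_norm_minus_commute)
qed

text \<open>For a test function \<open>g\<close> the squared norm is
  \<open>2 \<parallel>g\<parallel>\<^sup>2\<close> minus twice the correlation of \<open>g\<close>
  with its shift, and correlations are continuous. Density and translation invariance of the norm
  carry this over to \<open>u\<close>.\<close>

lemma L2_translation_continuous:
  fixes u :: "real^'n \<Rightarrow> real"
  assumes u: "u \<in> L2 lebesgue"
  shows "((\<lambda>a. L2_norm lebesgue (\<lambda>x. u (a + x) - u x)) \<longlongrightarrow> 0) (at 0)"
proof (rule tendstoI)
  fix e :: real assume e: "e > 0"
  obtain g where g: "g \<in> Cc_infty" "L2_norm lebesgue (\<lambda>x. u x - g x) < e / 3"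
    using L2_approx_Cc[OF u, of "e/3"] e by auto
  have gL: "g \<in> L2 lebesgue" by (rule Cc_L2[OF g(1)])
  have eq: "(L2_norm lebesgue (\<lambda>x. g (a + x) - g x))\<^sup>2 = 2 * (L2_norm lebesgue g)\<^sup>2 - 2 * (LINT y|lebesgue. g y * g (y - a))" for a
  proof -
    have "(LINT y|lebesgue. g y * g (y - a)) = (LINT y|lebesgue. g (a + y) * g y)"
      using integral_translate[of "\<lambda>y. g y * g (y - a)" a] Cc_measurable[OF g(1)] Cc_measurable[OF Cc_translate[OF g(1), of a]]
      by simp
    then show ?thesis
      using L2_norm_sq_lin[OF L2_translate[OF gL, of a] gL, of 1 "-1"]
      by (simp add: L2_inner_def L2_norm_translate Cc_measurable[OF g(1)])
  qed
  have "isCont (\<lambda>a. LINT y|lebesgue. g y * g (y - a)) 0"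
    using convolution_continuous[OF L2_Lloc_one[OF gL] g(1)] by (simp add: continuous_on_eq_continuous_at)
  then have "((\<lambda>a. 2 * (L2_norm lebesgue g)\<^sup>2 - 2 * (LINT y|lebesgue. g y * g (y - a))) \<longlongrightarrow>
      2 * (L2_norm lebesgue g)\<^sup>2 - 2 * (LINT y|lebesgue. g y * g (y - 0))) (at 0)"
    by (intro tendsto_intros) (simp add: isCont_def)
  then have "((\<lambda>a. (L2_norm lebesgue (\<lambda>x. g (a + x) - g x))\<^sup>2) \<longlongrightarrow> 0) (at 0)"
    using L2_norm_sq[of lebesgue g] unfolding eq by (simp add: power2_eq_square)
  then have "((\<lambda>a. sqrt ((L2_norm lebesgue (\<lambda>x. g (a + x) - g x))\<^sup>2)) \<longlongrightarrow> sqrt 0) (at 0)"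
    by (intro tendsto_intros)
  then have "((\<lambda>a. L2_norm lebesgue (\<lambda>x. g (a + x) - g x)) \<longlongrightarrow> 0) (at 0)" by simp
  then have "\<forall>\<^sub>F a in at 0. L2_norm lebesgue (\<lambda>x. g (a + x) - g x) < e / 3"
    using e by (intro order_tendstoD) auto
  then show "\<forall>\<^sub>F a in at 0. dist (L2_norm lebesgue (\<lambda>x. u (a + x) - u x)) 0 < e"
  proof eventually_elim
    case (elim a)
    note m = L2_translate[OF u, of a] L2_translate[OF gL, of a]
    have "L2_norm lebesgue (\<lambda>x. u (a + x) - g (a + x)) = L2_norm lebesgue (\<lambda>x. u x - g x)"
      using L2_norm_translate[OF L2_measurable[OF L2_diff[OF u gL]], of a] .
    then show ?case
      using L2_norm_triangle_diff[OF m u] L2_norm_triangle_diff[OF m(2) gL u] g(2) elim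
      by (simp add: L2_norm_minus_commute[of lebesgue g u])
  qed
qed

text \<open>Test functions tending to \<open>w\<close> itself are inserted, so that the limit of the
  hypothesis reads \<open>\<parallel>w\<parallel>\<^sup>2 \<le> e
  \<parallel>w\<parallel>\<close>.\<close>

lemma L2_norm_le_dual:
  fixes w :: "real^'n \<Rightarrow> real"
  assumes w: "w \<in> L2 lebesgue" and le: "\<And>\<psi>. \<psi> \<in> Cc_infty \<Longrightarrow> L2_inner lebesgue w \<psi> \<le> e * L2_norm lebesgue \<psi>" and e: "e \<ge> 0"
  shows "L2_norm lebesgue w \<le> e"
proof -
  obtain g where g: "\<And>n::nat. g n \<in> Cc_infty" "L2_tendsto lebesgue g w"
    using Cc_dense w unfolding L2_dense_def by blast
  have "L2_inner lebesgue w w \<le> e * L2_norm lebesgue w"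
  proof (rule LIMSEQ_le)
    show "(\<lambda>n. L2_inner lebesgue (g n) w) \<longlonglongrightarrow> L2_inner lebesgue w w"
      by (rule L2_inner_tendsto[OF g(2)]) (auto intro: Cc_L2 g w)
    show "(\<lambda>n. e * L2_norm lebesgue (g n)) \<longlonglongrightarrow> e * L2_norm lebesgue w"
      by (intro tendsto_mult tendsto_const L2_norm_tendsto[OF g(2)]) (auto intro: Cc_L2 g w)
    show "\<exists>N. \<forall>n\<ge>N. L2_inner lebesgue (g n) w \<le> e * L2_norm lebesgue (g n)"
      using le[OF g(1)] by (subst L2_inner_commute) blast
  qed
  then have "(L2_norm lebesgue w)\<^sup>2 \<le> e * L2_norm lebesgue w"
    unfolding L2_norm_sq by (simp add: L2_inner_def power2_eq_square)
  then show ?thesis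
    using e L2_norm_nonneg[of lebesgue w] by (cases "L2_norm lebesgue w = 0") (auto simp: power2_eq_square)
qed

text \<open>By duality it is enough to test with \<open>\<psi>\<close>. The correlation of
  \<open>f\<close> with shifts of \<open>\<psi>\<close> has a derivative given by \<open>f'\<close>,
  so the mean value theorem turns the tested quotient into a tested translate of \<open>f'\<close>
  by some \<open>z\<close> between 0 and \<open>h n\<close>. The point \<open>z\<close> depends on
  \<open>\<psi>\<close>; continuity of translations supplies a bound uniform in
  \<open>z\<close>.\<close>

lemma difference_quotient_tendsto:
  fixes f :: "real^'n \<Rightarrow> real"
  assumes f: "f \<in> L2 lebesgue" "f' \<in> L2 lebesgue" "has_weak_partial i f f'"
    and h: "\<And>n::nat. h n > 0" "h \<longlonglongrightarrow> 0"
  shows "L2_tendsto lebesgue (\<lambda>n x. (f (h n *\<^sub>R axis i 1 + x) - f x) / h n) f'"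
  unfolding L2_tendsto_def
proof (rule LIMSEQ_I)
  fix e :: real assume e: "e > 0"
  let ?a = "axis i 1 :: real^'n"
  have fl: "f \<in> Lloc 1" "f' \<in> Lloc 1" using f L2_Lloc_one by auto
  have "\<forall>\<^sub>F a in at 0. dist (L2_norm lebesgue (\<lambda>x. f' (a + x) - f' x)) 0 < e / 2"
    using tendstoD[OF L2_translation_continuous[OF f(2)], of "e/2"] e by simp
  then obtain d where d: "d > 0" "\<And>a. a \<noteq> 0 \<Longrightarrow> dist a 0 < d \<Longrightarrow> L2_norm lebesgue (\<lambda>x. f' (a + x) - f' x) < e / 2"
    unfolding eventually_at by auto
  obtain N where N: "\<And>n. n \<ge> N \<Longrightarrow> h n < d" using LIMSEQ_D[OF h(2) d(1)] h(1) by force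
  have "L2_norm lebesgue (\<lambda>x. (f (h n *\<^sub>R ?a + x) - f x) / h n - f' x) \<le> e / 2" if n: "n \<ge> N" for n
  proof -
    define w where "w x = (f (h n *\<^sub>R ?a + x) - f x) / h n - f' x" for x
    have "(\<lambda>x. (1 / h n) * (f (h n *\<^sub>R ?a + x) - f x) - f' x) \<in> L2 lebesgue"
      by (intro L2_diff L2_cmult L2_translate f)
    then have wL: "w \<in> L2 lebesgue" by (simp add: w_def[abs_def])
    have "L2_norm lebesgue w \<le> e / 2"
    proof (rule L2_norm_le_dual[OF wL])
      fix \<psi> :: "real^'n \<Rightarrow> real" assume \<psi>: "\<psi> \<in> Cc_infty"
      define F where "F s = (LINT x|lebesgue. f x * \<psi> (x - s *\<^sub>R ?a))" for s
      have shift: "(LINT x|lebesgue. g x * \<psi> (x - s *\<^sub>R ?a)) = (LINT x|lebesgue. g (s *\<^sub>R ?a + x) * \<psi> x)"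
        if "g \<in> L2 lebesgue" for g s
        using integral_translate[of "\<lambda>x. g x * \<psi> (x - s *\<^sub>R ?a)" "s *\<^sub>R ?a"] L2_measurable[OF that]
          Cc_measurable[OF Cc_translate[OF \<psi>]] by simp
      have "(F has_real_derivative (LINT x|lebesgue. f' x * \<psi> (x - s *\<^sub>R ?a))) (at s)" for s
        using convolution_line_derivative[OF fl(1) \<psi>, of ?a s] weak_partialD[OF f(3) Cc_translate[OF \<psi>], of "s *\<^sub>R ?a"]
        by (simp add: F_def[abs_def] sum_axis smooth_pd_translate Cc_smooth[OF \<psi>])
      then obtain z where z: "0 < z" "z < h n" "F (h n) - F 0 = (h n - 0) * (LINT x|lebesgue. f' x * \<psi> (x - z *\<^sub>R ?a))"
        using MVT2[OF h(1)[of n], of F "\<lambda>s. LINT x|lebesgue. f' x * \<psi> (x - s *\<^sub>R ?a)"] by auto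
      have "F (h n) - F 0 = L2_inner lebesgue (\<lambda>x. f (h n *\<^sub>R ?a + x) - f x) \<psi>"
        using L2_inner_diff[OF L2_translate[OF f(1), of "h n *\<^sub>R ?a"] f(1) Cc_L2[OF \<psi>]] shift[OF f(1)]
        by (simp add: F_def L2_inner_def)
      then have "L2_inner lebesgue (\<lambda>x. f (h n *\<^sub>R ?a + x) - f x) \<psi> = h n * L2_inner lebesgue (\<lambda>x. f' (z *\<^sub>R ?a + x)) \<psi>"
        using z(3) shift[OF f(2)] by (simp add: L2_inner_def)
      then have "L2_inner lebesgue w \<psi> = L2_inner lebesgue (\<lambda>x. f' (z *\<^sub>R ?a + x) - f' x) \<psi>"
        using L2_inner_lin[OF L2_diff[OF L2_translate[OF f(1), of "h n *\<^sub>R ?a"] f(1)] f(2) Cc_L2[OF \<psi>], of "1 / h n" "-1"]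
          L2_inner_diff[OF L2_translate[OF f(2), of "z *\<^sub>R ?a"] f(2) Cc_L2[OF \<psi>]] h(1)[of n]
        by (simp add: w_def[abs_def])
      also have "\<dots> \<le> L2_norm lebesgue (\<lambda>x. f' (z *\<^sub>R ?a + x) - f' x) * L2_norm lebesgue \<psi>"
        using L2_Cauchy_Schwarz[OF L2_diff[OF L2_translate[OF f(2), of "z *\<^sub>R ?a"] f(2)] Cc_L2[OF \<psi>]] by simp
      also have "\<dots> \<le> e / 2 * L2_norm lebesgue \<psi>"
      proof (rule mult_right_mono)
        have "z *\<^sub>R ?a \<noteq> 0" using z(1) by simp
        moreover have "dist (z *\<^sub>R ?a) 0 < d" using z N[OF n] by simp
        ultimately show "L2_norm lebesgue (\<lambda>x. f' (z *\<^sub>R ?a + x) - f' x) \<le> e / 2"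
          using d(2)[of "z *\<^sub>R ?a"] by (simp only: less_imp_le not_False_eq_True)
      qed simp
      finally show "L2_inner lebesgue w \<psi> \<le> e / 2 * L2_norm lebesgue \<psi>" .
    qed (use e in simp)
    then show ?thesis by (simp add: w_def[abs_def])
  qed
  then show "\<exists>no. \<forall>n\<ge>no. norm (L2_norm lebesgue (\<lambda>x. (f (h n *\<^sub>R ?a + x) - f x) / h n - f' x) - 0) < e"
    using e by (intro exI[of _ N] allI impI) (simp, rule le_less_trans[of _ "e/2"], simp_all)
qed

lemma L2_inner_tendsto2:
  assumes "L2_tendsto M f u" "\<And>n. f n \<in> L2 M" "u \<in> L2 M"
    "L2_tendsto M g v" "\<And>n. g n \<in> L2 M" "v \<in> L2 M"
  shows "(\<lambda>n. L2_inner M (f n) (g n)) \<longlonglongrightarrow> L2_inner M u v"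
proof -
  have "(\<lambda>n. L2_inner M (g n) (f n) - L2_inner M v (f n)) \<longlonglongrightarrow> 0"
  proof (rule Lim_null_comparison)
    show "\<forall>\<^sub>F n in sequentially. norm (L2_inner M (g n) (f n) - L2_inner M v (f n))
        \<le> L2_norm M (\<lambda>x. g n x - v x) * L2_norm M (f n)"
      using assms L2_Cauchy_Schwarz[OF L2_diff[OF assms(5,6)] assms(2)] by (simp add: L2_inner_diff)
    show "(\<lambda>n. L2_norm M (\<lambda>x. g n x - v x) * L2_norm M (f n)) \<longlonglongrightarrow> 0"
      using tendsto_mult[OF assms(4)[unfolded L2_tendsto_def] L2_norm_tendsto[OF assms(1-3)]] by simp
  qed
  from tendsto_add[OF this L2_inner_tendsto[OF assms(1-3,6)]]
  show ?thesis by (simp add: L2_inner_commute)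
qed

text \<open>A discrete product rule: the increment of \<open>f g\<close> over the step
  \<open>h n\<close> is \<open>h n\<close> times the quotient of \<open>f\<close> times the
  translate of \<open>g\<close>, plus \<open>h n\<close> times the quotient of \<open>g\<close>
  times \<open>f\<close>. Quotients and translates converge in L2, hence so do the pairings with
  \<open>\<psi>\<close>.\<close>

lemma weak_product_rule_L2:
  fixes f g :: "real^'n \<Rightarrow> real"
  assumes f: "f \<in> L2 lebesgue" "f' \<in> L2 lebesgue" "has_weak_partial i f f'"
    and g: "g \<in> L2 lebesgue" "g' \<in> L2 lebesgue" "has_weak_partial i g g'"
    and \<psi>: "\<psi> \<in> Cc_infty"
  shows "(LINT x|lebesgue. f x * g x * pd i \<psi> x) = - (LINT x|lebesgue. (f' x * g x + f x * g' x) * \<psi> x)"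
proof -
  let ?a = "axis i 1 :: real^'n"
  define h where "h n = inverse (real (Suc n))" for n
  have h: "\<And>n. h n > 0" "h \<longlonglongrightarrow> 0"
    unfolding h_def by simp (rule LIMSEQ_inverse_real_of_nat)
  define Df where "Df n x = (f (h n *\<^sub>R ?a + x) - f x) / h n" for n x
  define Dg where "Dg n x = (g (h n *\<^sub>R ?a + x) - g x) / h n" for n x
  obtain B where B: "\<And>x. \<bar>\<psi> x\<bar> \<le> B" using Cc_bounded[OF \<psi>] by metis
  have B0: "B \<ge> 0" using B[of 0] by linarith
  have m\<psi>: "u \<in> L2 lebesgue \<Longrightarrow> (\<lambda>x. \<psi> x * u x) \<in> L2 lebesgue" for u
    by (rule L2_mult_bounded[where C = B]) (use B \<psi> in auto)
  have n\<psi>: "u \<in> L2 lebesgue \<Longrightarrow> L2_norm lebesgue (\<lambda>x. \<psi> x * u x) \<le> B * L2_norm lebesgue u" for u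
    by (rule L2_norm_bounded_mult) (use B \<psi> B0 in auto)
  have DL: "Df n \<in> L2 lebesgue" "Dg n \<in> L2 lebesgue" for n
    using L2_cmult[OF L2_diff[OF L2_translate[OF f(1), of "h n *\<^sub>R ?a"] f(1)], of "1 / h n"]
      L2_cmult[OF L2_diff[OF L2_translate[OF g(1), of "h n *\<^sub>R ?a"] g(1)], of "1 / h n"]
    by (simp_all add: Df_def[abs_def] Dg_def[abs_def])
  define G where "G n x = \<psi> x * g (h n *\<^sub>R ?a + x)" for n x
  have GL: "G n \<in> L2 lebesgue" for n unfolding G_def by (intro m\<psi> L2_translate g)
  have Gt: "L2_tendsto lebesgue G (\<lambda>x. \<psi> x * g x)"
    unfolding L2_tendsto_def
  proof (rule Lim_null_comparison)
    have "L2_norm lebesgue (\<lambda>x. G n x - \<psi> x * g x) \<le> B * L2_norm lebesgue (\<lambda>x. g (h n *\<^sub>R ?a + x) - g x)" for n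
      using n\<psi>[OF L2_diff[OF L2_translate[OF g(1), of "h n *\<^sub>R ?a"] g(1)]] by (simp add: G_def right_diff_distrib)
    then show "\<forall>\<^sub>F n in sequentially. norm (L2_norm lebesgue (\<lambda>x. G n x - \<psi> x * g x)) \<le> B * L2_norm lebesgue (\<lambda>x. g (h n *\<^sub>R ?a + x) - g x)"
      by simp
    have "filterlim (\<lambda>n. h n *\<^sub>R ?a) (at 0) sequentially"
      unfolding filterlim_at
    proof
      show "\<forall>\<^sub>F n in sequentially. h n *\<^sub>R ?a \<in> UNIV \<and> h n *\<^sub>R ?a \<noteq> 0"
        using h(1) by (auto simp: less_imp_neq[symmetric])
      show "(\<lambda>n. h n *\<^sub>R ?a) \<longlonglongrightarrow> 0" using tendsto_scaleR[OF h(2) tendsto_const[of ?a]] by simp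
    qed
    from tendsto_mult_right_zero[OF filterlim_compose[OF L2_translation_continuous[OF g(1)] this]]
    show "(\<lambda>n. B * L2_norm lebesgue (\<lambda>x. g (h n *\<^sub>R ?a + x) - g x)) \<longlonglongrightarrow> 0" .
  qed
  define F where "F s = (LINT x|lebesgue. f x * g x * \<psi> (x - s *\<^sub>R ?a))" for s
  have fg: "integrable lebesgue (\<lambda>x. f x * g x)" by (rule L2_mult_integrable[OF f(1) g(1)])
  have fgl: "(\<lambda>x. f x * g x) \<in> Lloc 1"
    unfolding Lloc_one_iff set_integrable_def
    using fg compact_sets_lebesgue integrable_mult_indicator[OF _ fg] L2_measurable[OF f(1)] L2_measurable[OF g(1)]
    by (auto intro: borel_measurable_times)
  have "(F has_real_derivative - (LINT x|lebesgue. f x * g x * pd i \<psi> x)) (at 0)"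
    using convolution_line_derivative[OF fgl \<psi>, of ?a 0] by (simp add: F_def[abs_def] sum_axis)
  then have "(\<lambda>n. (F (h n) - F 0) / h n) \<longlonglongrightarrow> - (LINT x|lebesgue. f x * g x * pd i \<psi> x)"
    using h unfolding has_field_derivative_iff tendsto_at_iff_sequentially
    by (auto simp: o_def less_imp_neq[symmetric])
  moreover have "(F (h n) - F 0) / h n = L2_inner lebesgue (Df n) (G n) + L2_inner lebesgue (Dg n) (\<lambda>x. \<psi> x * f x)" for n
  proof -
    have i1: "integrable lebesgue (\<lambda>x. Df n x * G n x)" by (rule L2_mult_integrable[OF DL(1) GL])
    have i2: "integrable lebesgue (\<lambda>x. Dg n x * (\<psi> x * f x))" by (rule L2_mult_integrable[OF DL(2) m\<psi>[OF f(1)]])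
    have i3: "integrable lebesgue (\<lambda>x. f x * g x * \<psi> x)" by (rule Lloc_Cc_integrable[OF fgl \<psi>])
    have m: "(\<lambda>x. f x * g x * \<psi> (x - h n *\<^sub>R ?a)) \<in> borel_measurable lebesgue"
      using L2_measurable[OF f(1)] L2_measurable[OF g(1)] Cc_measurable[OF Cc_translate[OF \<psi>]] by measurable
    have i4: "integrable lebesgue (\<lambda>x. f (h n *\<^sub>R ?a + x) * g (h n *\<^sub>R ?a + x) * \<psi> x)"
      using integrable_translate_iff[OF m, of "h n *\<^sub>R ?a"] Lloc_Cc_integrable[OF fgl Cc_translate[OF \<psi>]] by simp
    have "F (h n) - F 0 = (LINT x|lebesgue. f (h n *\<^sub>R ?a + x) * g (h n *\<^sub>R ?a + x) * \<psi> x - f x * g x * \<psi> x)"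
      using integral_translate[OF m, of "h n *\<^sub>R ?a"] i3 i4 by (simp add: F_def)
    also have "(\<lambda>x. f (h n *\<^sub>R ?a + x) * g (h n *\<^sub>R ?a + x) * \<psi> x - f x * g x * \<psi> x)
        = (\<lambda>x. h n * (Df n x * G n x + Dg n x * (\<psi> x * f x)))"
      using h(1)[of n] by (auto simp: Df_def Dg_def G_def fun_eq_iff field_simps)
    finally show ?thesis using i1 i2 h(1)[of n] by (simp add: L2_inner_def)
  qed
  moreover have "(\<lambda>n. L2_inner lebesgue (Df n) (G n) + L2_inner lebesgue (Dg n) (\<lambda>x. \<psi> x * f x))
     \<longlonglongrightarrow> L2_inner lebesgue f' (\<lambda>x. \<psi> x * g x) + L2_inner lebesgue g' (\<lambda>x. \<psi> x * f x)"
    using difference_quotient_tendsto[OF f h] difference_quotient_tendsto[OF g h]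
    by (intro tendsto_add L2_inner_tendsto2 L2_inner_tendsto DL GL Gt m\<psi> f g)
       (simp_all add: Df_def[abs_def] Dg_def[abs_def])
  ultimately have "- (LINT x|lebesgue. f x * g x * pd i \<psi> x)
     = L2_inner lebesgue f' (\<lambda>x. \<psi> x * g x) + L2_inner lebesgue g' (\<lambda>x. \<psi> x * f x)"
    using LIMSEQ_unique by auto
  also have "\<dots> = (LINT x|lebesgue. f' x * (\<psi> x * g x) + g' x * (\<psi> x * f x))"
    unfolding L2_inner_def
    by (intro Bochner_Integration.integral_add[symmetric] L2_mult_integrable m\<psi> f g)
  finally show ?thesis by (simp add: algebra_simps)
qed

text \<open>Localisation of the L2 version: \<open>\<zeta>'\<close> is 1 on a ball whose interior
  contains every point with \<open>\<psi> \<noteq> 0\<close>. There its derivatives vanish, so that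
  cutting off \<open>f\<close> and \<open>g\<close> changes neither side.\<close>

lemma weak_product_rule:
  fixes f g :: "real^'n \<Rightarrow> real"
  assumes f: "f \<in> Lloc 2" "f' \<in> Lloc 2" "has_weak_partial i f f'"
    and g: "g \<in> Lloc 2" "g' \<in> Lloc 2" "has_weak_partial i g g'"
  shows "has_weak_partial i (\<lambda>x. f x * g x) (\<lambda>x. f' x * g x + f x * g' x)"
  unfolding has_weak_partial_def
proof (intro conjI ballI)
  show "(\<lambda>x. f x * g x) \<in> Lloc 1" "(\<lambda>x. f' x * g x + f x * g' x) \<in> Lloc 1"
    by (intro Lloc_one_add Lloc_two_mult f g)+
  fix \<psi> :: "real^'n \<Rightarrow> real" assume \<psi>: "\<psi> \<in> Cc_infty"
  obtain R where R: "R > 0" "\<And>x. \<psi> x \<noteq> 0 \<Longrightarrow> norm x < R"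
    using Cc_bounded_support[OF \<psi>] unfolding bounded_pos_less by auto
  obtain \<zeta>' :: "real^'n \<Rightarrow> real" where \<zeta>: "\<zeta>' \<in> Cc_infty" "\<And>x. x \<in> cball 0 R \<Longrightarrow> \<zeta>' x = 1"
    by (rule smooth_urysohn[OF compact_cball[of 0 R] open_UNIV]) auto
  have \<zeta>1: "\<zeta>' x = 1" "pd j \<zeta>' x = 0" if "norm x < R" for x j
    using that \<zeta>(2) by (auto intro!: pd_eq_0_open[of "ball 0 R" x \<zeta>' 1])
  have \<psi>0: "\<psi> x = 0" "pd i \<psi> x = 0" if "\<not> norm x \<le> R" for x
  proof -
    show "\<psi> x = 0" using R(2)[of x] that by force
    have "x \<in> - cball 0 R" using that by simp
    then show "pd i \<psi> x = 0" by (rule pd_eq_0_open[of _ x \<psi> 0, rotated]) (use R(2) in force)+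
  qed
  have \<psi>b: "pd i \<psi> x * \<zeta>' x = pd i \<psi> x" for x
    by (cases "norm x \<le> R") (auto simp: \<psi>0 \<zeta>(2))
  note sm = Cc_smooth[OF \<zeta>(1)]
  have prodL: "(\<lambda>x. f x * \<zeta>' x) \<in> L2 lebesgue" "(\<lambda>x. f' x * \<zeta>' x + f x * pd i \<zeta>' x) \<in> L2 lebesgue"
    "(\<lambda>x. g x * \<zeta>' x) \<in> L2 lebesgue" "(\<lambda>x. g' x * \<zeta>' x + g x * pd i \<zeta>' x) \<in> L2 lebesgue"
    by (intro L2_add Lloc_two_Cc_L2 f g \<zeta> Cc_pd)+
  have "(LINT x|lebesgue. f x * \<zeta>' x * (g x * \<zeta>' x) * pd i \<psi> x) =
    - (LINT x|lebesgue. ((f' x * \<zeta>' x + f x * pd i \<zeta>' x) * (g x * \<zeta>' x) + f x * \<zeta>' x * (g' x * \<zeta>' x + g x * pd i \<zeta>' x)) * \<psi> x)"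
    by (rule weak_product_rule_L2[OF prodL(1,2) weak_partial_mult_smooth[OF f(3) sm] prodL(3,4) weak_partial_mult_smooth[OF g(3) sm] \<psi>])
  moreover have "(\<lambda>x. f x * \<zeta>' x * (g x * \<zeta>' x) * pd i \<psi> x) = (\<lambda>x. f x * g x * pd i \<psi> x)"
  proof
    fix x
    have "f x * \<zeta>' x * (g x * \<zeta>' x) * pd i \<psi> x = f x * g x * (pd i \<psi> x * \<zeta>' x * \<zeta>' x)" by (simp add: algebra_simps)
    then show "f x * \<zeta>' x * (g x * \<zeta>' x) * pd i \<psi> x = f x * g x * pd i \<psi> x" by (simp add: \<psi>b)
  qed
  moreover have "(\<lambda>x. ((f' x * \<zeta>' x + f x * pd i \<zeta>' x) * (g x * \<zeta>' x) + f x * \<zeta>' x * (g' x * \<zeta>' x + g x * pd i \<zeta>' x)) * \<psi> x)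
     = (\<lambda>x. (f' x * g x + f x * g' x) * \<psi> x)"
  proof
    fix x
    show "((f' x * \<zeta>' x + f x * pd i \<zeta>' x) * (g x * \<zeta>' x) + f x * \<zeta>' x * (g' x * \<zeta>' x + g x * pd i \<zeta>' x)) * \<psi> x
     = (f' x * g x + f x * g' x) * \<psi> x"
      using R(2)[of x] by (cases "\<psi> x = 0") (auto simp: \<zeta>1)
  qed
  ultimately show "(LINT x|lebesgue. f x * g x * pd i \<psi> x) = - (LINT x|lebesgue. (f' x * g x + f x * g' x) * \<psi> x)"
    by simp
qed

section \<open>Morrey bounds and the Sobolev inequalities they imply\<close>

text \<open>The integral is the average of \<open>B\<close> over the cube with corner
  \<open>z\<close> and signed edge \<open>s\<close>, so this is a Morrey condition up to scale 1.
  Negative \<open>s\<close> is included because \<open>morrey_average\<close> reflects the cube.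
  Values in \<open>ennreal\<close> allow Tonelli's theorem without integrability conditions.\<close>

definition morrey :: "real \<Rightarrow> real \<Rightarrow> (real^'n \<Rightarrow> ennreal) \<Rightarrow> bool" where
  "morrey \<beta> M B \<longleftrightarrow> B \<in> borel_measurable borel \<and>
     (\<forall>z s. s \<noteq> 0 \<longrightarrow> \<bar>s\<bar> \<le> 1 \<longrightarrow>
       (\<integral>\<^sup>+y. indicator (cbox 0 One) y * B (z + s *\<^sub>R y) \<partial>lborel) \<le> ennreal (M * \<bar>s\<bar> powr (- \<beta>)))"

section \<open>Averages over cubes\<close>

lemma nn_integral_lborel_affine:
  fixes f :: "real^'n \<Rightarrow> ennreal"
  assumes [measurable]: "f \<in> borel_measurable borel" and s: "s \<noteq> 0"
  shows "(\<integral>\<^sup>+x. f x \<partial>lborel) = ennreal (\<bar>s\<bar> ^ CARD('n)) * (\<integral>\<^sup>+x. f (t + s *\<^sub>R x) \<partial>lborel)"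
  by (subst lborel_affine[OF s, of t])
     (simp add: nn_integral_density nn_integral_distr nn_integral_cmult)

lemma nn_integral_lborel_translate:
  fixes f :: "real^'n \<Rightarrow> ennreal"
  assumes "f \<in> borel_measurable borel"
  shows "(\<integral>\<^sup>+x. f (t + x) \<partial>lborel) = (\<integral>\<^sup>+x. f x \<partial>lborel)"
  using nn_integral_lborel_affine[OF assms, of 1 t] by simp

lemma nn_integral_unit_cube: "(\<integral>\<^sup>+y. indicator (cbox 0 One) y * c \<partial>lborel) = (c :: ennreal)"
  for x :: "'a::euclidean_space"
  by (subst nn_integral_multc) (auto simp: emeasure_lborel_cbox_eq)

lemma morrey_of_powr:
  fixes b :: "real^'n \<Rightarrow> real"
  assumes [measurable]: "b \<in> borel_measurable borel"
    and N: "(\<integral>\<^sup>+x. ennreal (\<bar>b x\<bar> powr p) \<partial>lborel) \<le> ennreal N" "0 \<le> N"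
    and q: "0 \<le> q" "q \<le> p" "0 < p"
  shows "morrey (q * CARD('n) / p) (1 + N) (\<lambda>x. ennreal (\<bar>b x\<bar> powr q))"
  unfolding morrey_def
proof (intro conjI allI impI)
  fix z :: "real^'n" and s :: real assume s: "s \<noteq> 0" "\<bar>s\<bar> \<le> 1"
  let ?d = "real CARD('n)"
  \<comment> \<open>Splitting at the level \<open>l\<close> replaces Hoelder's inequality. This
    value balances the two parts: both are of order
    \<open>\<bar>s\<bar> powr (- (q * ?d / p))\<close> after rescaling the integral of the p-th
    power.\<close>
  define l where "l = \<bar>s\<bar> powr (- ?d / p)"
  have l: "l > 0" using s by (simp add: l_def)
  have pw: "\<bar>t\<bar> powr q \<le> l powr q + l powr (q - p) * \<bar>t\<bar> powr p" for t
  proof (cases "\<bar>t\<bar> \<le> l")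
    case True
    then have "\<bar>t\<bar> powr q \<le> l powr q" using q by (intro powr_mono2) auto
    then show ?thesis by (simp add: add_increasing2)
  next
    case False
    then have "\<bar>t\<bar> powr (q - p) \<le> l powr (q - p)" using q l by (intro powr_mono2') auto
    then have "\<bar>t\<bar> powr (q - p) * \<bar>t\<bar> powr p \<le> l powr (q - p) * \<bar>t\<bar> powr p" by (intro mult_right_mono) auto
    moreover have "\<bar>t\<bar> powr (q - p) * \<bar>t\<bar> powr p = \<bar>t\<bar> powr q" using False l by (simp add: powr_add[symmetric])
    ultimately show ?thesis by (simp add: add_increasing)
  qed
  define I where "I = (\<integral>\<^sup>+y. ennreal (\<bar>b (z + s *\<^sub>R y)\<bar> powr p) \<partial>lborel)"
  have "ennreal (\<bar>s\<bar> ^ CARD('n)) * I \<le> ennreal N"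
    unfolding I_def using N(1) by (subst nn_integral_lborel_affine[symmetric, OF _ s(1)]) auto
  then have "ennreal (\<bar>s\<bar> powr (- ?d)) * (ennreal (\<bar>s\<bar> ^ CARD('n)) * I) \<le> ennreal (\<bar>s\<bar> powr (- ?d)) * ennreal N"
    by (intro mult_left_mono) auto
  moreover have "ennreal (\<bar>s\<bar> powr (- ?d)) * ennreal (\<bar>s\<bar> ^ CARD('n)) = 1"
    using s by (simp add: ennreal_mult[symmetric] powr_realpow[symmetric] powr_add[symmetric] del: powr_realpow)
  ultimately have I: "I \<le> ennreal (\<bar>s\<bar> powr (- ?d) * N)"
    using N(2) by (simp add: mult.assoc[symmetric] ennreal_mult)
  have "(\<integral>\<^sup>+y. indicator (cbox 0 One) y * ennreal (\<bar>b (z + s *\<^sub>R y)\<bar> powr q) \<partial>lborel)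
     \<le> (\<integral>\<^sup>+y. indicator (cbox 0 One) y * ennreal (l powr q) + ennreal (l powr (q - p)) * ennreal (\<bar>b (z + s *\<^sub>R y)\<bar> powr p) \<partial>lborel)"
  proof (rule nn_integral_mono)
    fix y :: "real^'n"
    have "ennreal (\<bar>b (z + s *\<^sub>R y)\<bar> powr q) \<le> ennreal (l powr q) + ennreal (l powr (q - p)) * ennreal (\<bar>b (z + s *\<^sub>R y)\<bar> powr p)"
      using pw[of "b (z + s *\<^sub>R y)"] by (simp add: ennreal_mult[symmetric] ennreal_plus[symmetric] ennreal_leI del: ennreal_plus)
    then show "indicator (cbox 0 One) y * ennreal (\<bar>b (z + s *\<^sub>R y)\<bar> powr q)
       \<le> indicator (cbox 0 One) y * ennreal (l powr q) + ennreal (l powr (q - p)) * ennreal (\<bar>b (z + s *\<^sub>R y)\<bar> powr p)"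
      by (auto simp: indicator_def)
  qed
  also have "\<dots> = ennreal (l powr q) + ennreal (l powr (q - p)) * I"
    unfolding I_def by (subst nn_integral_add) (auto simp: nn_integral_unit_cube nn_integral_cmult)
  also have "\<dots> \<le> ennreal (l powr q) + ennreal (l powr (q - p)) * ennreal (\<bar>s\<bar> powr (- ?d) * N)"
    by (intro add_left_mono mult_left_mono I) auto
  also have "\<dots> = ennreal (l powr q + l powr (q - p) * (\<bar>s\<bar> powr (- ?d) * N))"
    using N(2) by (simp add: ennreal_mult[symmetric] ennreal_plus[symmetric] del: ennreal_plus)
  also have "l powr q = \<bar>s\<bar> powr (- (q * ?d / p))"
    by (simp add: l_def powr_powr mult.commute)
  also have "l powr (q - p) * (\<bar>s\<bar> powr (- ?d) * N) = \<bar>s\<bar> powr (- (q * ?d / p)) * N"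
  proof -
    have "l powr (q - p) * \<bar>s\<bar> powr (- ?d) = \<bar>s\<bar> powr (- (q * ?d / p))"
      unfolding l_def powr_powr powr_add[symmetric] using q(3) by (simp add: field_simps)
    then show ?thesis by (simp add: mult.assoc[symmetric])
  qed
  finally show "(\<integral>\<^sup>+y. indicator (cbox 0 One) y * ennreal (\<bar>b (z + s *\<^sub>R y)\<bar> powr q) \<partial>lborel)
      \<le> ennreal ((1 + N) * \<bar>s\<bar> powr (- (q * ?d / p)))"
    by (simp add: algebra_simps)
qed measurable

lemma morrey_measurable [measurable_dest]: "morrey \<beta> M B \<Longrightarrow> B \<in> borel_measurable borel"
  by (simp add: morrey_def)

text \<open>A translation in \<open>x\<close> moves the shift from \<open>h\<close> to
  \<open>B\<close>. The average over \<open>y\<close> then becomes a cube average of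
  \<open>B\<close> at \<open>x\<close> with scale \<open>- s\<close>, bounded uniformly in
  \<open>x\<close>, and only the integral of \<open>h\<close> remains.\<close>

lemma morrey_average:
  fixes B h :: "real^'n \<Rightarrow> ennreal"
  assumes B: "morrey \<beta> M B" and h [measurable]: "h \<in> borel_measurable borel" and s: "s \<noteq> 0" "\<bar>s\<bar> \<le> 1"
  shows "(\<integral>\<^sup>+y. indicator (cbox 0 One) y * (\<integral>\<^sup>+x. B x * h (x + s *\<^sub>R y) \<partial>lborel) \<partial>lborel)
     \<le> ennreal (M * \<bar>s\<bar> powr (- \<beta>)) * (\<integral>\<^sup>+x. h x \<partial>lborel)"
proof -
  note [measurable] = morrey_measurable[OF B]
  have eq: "(\<integral>\<^sup>+x. B x * h (x + s *\<^sub>R y) \<partial>lborel) = (\<integral>\<^sup>+x. h x * B (x + (- s) *\<^sub>R y) \<partial>lborel)" for y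
    using nn_integral_lborel_translate[of "\<lambda>x. B x * h (x + s *\<^sub>R y)" "- (s *\<^sub>R y)"]
    by (simp add: mult.commute)
  have "(\<integral>\<^sup>+y. indicator (cbox 0 One) y * (\<integral>\<^sup>+x. B x * h (x + s *\<^sub>R y) \<partial>lborel) \<partial>lborel)
     = (\<integral>\<^sup>+y. (\<integral>\<^sup>+x. h x * (indicator (cbox 0 One) y * B (x + (- s) *\<^sub>R y)) \<partial>lborel) \<partial>lborel)"
    unfolding eq by (subst nn_integral_cmult[symmetric]) (auto simp: mult_ac)
  also have "\<dots> = (\<integral>\<^sup>+x. (\<integral>\<^sup>+y. h x * (indicator (cbox 0 One) y * B (x + (- s) *\<^sub>R y)) \<partial>lborel) \<partial>lborel)"
    by (rule lborel_pair.Fubini') measurable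
  also have "\<dots> = (\<integral>\<^sup>+x. h x * (\<integral>\<^sup>+y. (indicator (cbox 0 One) y * B (x + (- s) *\<^sub>R y)) \<partial>lborel) \<partial>lborel)"
    by (subst nn_integral_cmult) auto
  also have "\<dots> \<le> (\<integral>\<^sup>+x. h x * ennreal (M * \<bar>s\<bar> powr (- \<beta>)) \<partial>lborel)"
  proof (intro nn_integral_mono mult_left_mono)
    fix x
    show "(\<integral>\<^sup>+y. indicator (cbox 0 One) y * B (x + (- s) *\<^sub>R y) \<partial>lborel) \<le> ennreal (M * \<bar>s\<bar> powr (- \<beta>))"
      using B[unfolded morrey_def, THEN conjunct2, rule_format, of "- s" x] s by simp
  qed auto
  also have "\<dots> = ennreal (M * \<bar>s\<bar> powr (- \<beta>)) * (\<integral>\<^sup>+x. h x \<partial>lborel)"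
    by (subst nn_integral_multc) (auto simp: mult.commute)
  finally show ?thesis .
qed

text \<open>The fundamental theorem of calculus along the path \<open>r \<mapsto> t r\<^sup>m\<close>; a large exponent \<open>m\<close>
  compensates the blow-up of a Morrey bound at \<open>r = 0\<close>.\<close>
lemma ftc_power_path:
  fixes F F' :: "real \<Rightarrow> real" and m :: nat
  assumes F: "\<And>s. (F has_real_derivative F' s) (at s)" and F': "continuous_on UNIV F'" and t: "0 \<le> t" and m: "m \<ge> 1"
  shows "ennreal \<bar>F t - F 0\<bar> \<le> (\<integral>\<^sup>+r. indicator {0<..1} r * ennreal (t * m * r ^ (m - 1) * \<bar>F' (t * r ^ m)\<bar>) \<partial>lborel)" (is ?A)
    and "ennreal ((F t - F 0)\<^sup>2) \<le> (\<integral>\<^sup>+r. indicator {0<..1} r * ennreal ((t * m * r ^ (m - 1) * \<bar>F' (t * r ^ m)\<bar>)\<^sup>2) \<partial>lborel)" (is ?B)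
proof -
  define H where "H r = t * m * r ^ (m - 1) * F' (t * r ^ m)" for r :: real
  have contH: "continuous_on S H" for S
    unfolding H_def by (intro continuous_intros continuous_on_compose2[OF F']) auto
  have [measurable]: "H \<in> borel_measurable borel" by (rule borel_measurable_continuous_onI[OF contH])
  have der: "((\<lambda>r. F (t * r ^ m)) has_real_derivative H r) (at r)" for r
  proof -
    have "((\<lambda>r. t * r ^ m) has_real_derivative t * (m * r ^ (m - 1))) (at r)"
      by (auto intro!: derivative_eq_intros)
    from DERIV_chain2[OF F this] show ?thesis by (simp add: H_def mult_ac)
  qed
  \<comment> \<open>The endpoint 0 is dropped, so that \<open>r ^ m\<close> is positive wherever a
    Morrey bound, which excludes the scale 0, is applied to the result.\<close>
  have ae: "AE r::real in lborel. (indicator {0..1} r :: real) = indicator {0<..1} r"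
    using AE_lborel_singleton[of "0::real"] by eventually_elim (auto simp: indicator_def)
  have "(LINT r|lborel. indicator {0..1} r *\<^sub>R H r) = F (t * 1 ^ m) - F (t * 0 ^ m)"
    by (rule integral_FTC_Icc)
       (auto intro!: contH has_vector_derivative_at_within der[unfolded has_real_derivative_iff_has_vector_derivative])
  then have int: "F t - F 0 = (LINT r|lborel. indicator {0..1} r *\<^sub>R H r)" using m by (simp add: power_0_left)
  have inte: "integrable lborel (\<lambda>r. indicator {0..1} r *\<^sub>R H r)"
    using borel_integrable_atLeastAtMost'[OF contH] by (simp add: set_integrable_def)
  have "ennreal \<bar>F t - F 0\<bar> \<le> (\<integral>\<^sup>+r. norm (indicator {0..1} r *\<^sub>R H r) \<partial>lborel)"
    unfolding int using integral_norm_bound_ennreal[OF inte] by simp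
  also have "\<dots> = (\<integral>\<^sup>+r. indicator {0<..1} r * ennreal \<bar>H r\<bar> \<partial>lborel)"
    using ae by (intro nn_integral_cong_AE, eventually_elim) (auto simp: indicator_def split: if_splits)
  finally have 1: "ennreal \<bar>F t - F 0\<bar> \<le> (\<integral>\<^sup>+r. indicator {0<..1} r * ennreal \<bar>H r\<bar> \<partial>lborel)" .
  have eqH: "indicator {0<..1} r * ennreal (t * m * r ^ (m - 1) * \<bar>F' (t * r ^ m)\<bar>) = indicator {0<..1} r * ennreal \<bar>H r\<bar>" for r
    using t by (cases "0 < r") (auto simp: H_def abs_mult indicator_def)
  show ?A unfolding eqH by (rule 1)
  have "ennreal ((F t - F 0)\<^sup>2) = (ennreal \<bar>F t - F 0\<bar>)\<^sup>2" by (simp add: ennreal_power)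
  also have "\<dots> \<le> (\<integral>\<^sup>+r. indicator {0<..1} r * ennreal \<bar>H r\<bar> \<partial>lborel)\<^sup>2" by (intro power_mono 1) auto
  also have "\<dots> = (\<integral>\<^sup>+r. indicator {0<..1} r * (indicator {0<..1} r * ennreal \<bar>H r\<bar>) \<partial>lborel)\<^sup>2"
    by (intro arg_cong[where f = "\<lambda>x. x\<^sup>2"] nn_integral_cong) (auto simp: indicator_def)
  also have "\<dots> \<le> (\<integral>\<^sup>+r. (indicator {0<..1} (r::real))\<^sup>2 \<partial>lborel) * (\<integral>\<^sup>+r. (indicator {0<..1} r * ennreal \<bar>H r\<bar>)\<^sup>2 \<partial>lborel)"
    by (rule Cauchy_Schwarz_nn_integral) measurable
  also have "(\<integral>\<^sup>+r. (indicator {0<..1} (r::real))\<^sup>2 \<partial>lborel) = (\<integral>\<^sup>+r. indicator {0<..1} (r::real) \<partial>lborel)"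
    by (intro nn_integral_cong) (auto simp: indicator_def)
  also have "(\<integral>\<^sup>+r. indicator {0<..1} (r::real) \<partial>lborel) = 1" by simp
  also have "(\<integral>\<^sup>+r. (indicator {0<..1} r * ennreal \<bar>H r\<bar>)\<^sup>2 \<partial>lborel) =
     (\<integral>\<^sup>+r. indicator {0<..1} r * ennreal ((t * m * r ^ (m - 1) * \<bar>F' (t * r ^ m)\<bar>)\<^sup>2) \<partial>lborel)"
    by (intro nn_integral_cong) (auto simp: indicator_def H_def power_mult_distrib ennreal_power)
  finally show ?B by simp
qed

section \<open>Local boundedness from p-integrable weak derivatives\<close>

lemma unit_cube_component:
  assumes "y \<in> cbox 0 (One :: real^'n)" shows "\<bar>y $ i\<bar> \<le> 1"
proof -
  have "axis i 1 \<in> (Basis :: (real^'n) set)" by (simp add: axis_in_Basis_iff)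
  then have "0 \<le> y \<bullet> axis i 1 \<and> y \<bullet> axis i 1 \<le> One \<bullet> (axis i 1 :: real^'n)"
    using assms unfolding mem_box by fastforce
  moreover have "One \<bullet> (axis i 1 :: real^'n) = 1" by (simp add: axis_in_Basis_iff)
  ultimately show ?thesis by (simp add: inner_axis)
qed

lemma unit_cube_norm:
  assumes "y \<in> cbox 0 (One :: real^'n)" shows "norm y \<le> real CARD('n)"
proof -
  have "norm y \<le> (\<Sum>i\<in>UNIV. \<bar>y $ i\<bar>)" by (rule norm_le_l1_cart)
  also have "\<dots> \<le> (\<Sum>i\<in>(UNIV::'n set). 1)" by (intro sum_mono unit_cube_component assms)
  finally show ?thesis by simp
qed

lemma borel_version:
  fixes f :: "'a::euclidean_space \<Rightarrow> real"
  assumes "f \<in> borel_measurable lebesgue"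
  obtains g where "g \<in> borel_measurable borel" "AE x in lebesgue. f x = g x"
proof -
  obtain g where "g \<in> borel_measurable lborel" "AE x in lborel. f x = g x"
    using completion_ex_borel_measurable_real[OF assms] by auto
  then show thesis using that[of g] by (auto intro: AE_completion)
qed

lemma nn_integral_lebesgue_borel:
  "f \<in> borel_measurable borel \<Longrightarrow> (\<integral>\<^sup>+x. f x \<partial>lebesgue) = (\<integral>\<^sup>+x. f x \<partial>lborel)"
  by (simp add: nn_integral_completion)

text \<open>The exchanges of integrals take place on \<open>lborel\<close> with Borel functions,
  whereas \<open>Lloc\<close> speaks of \<open>lebesgue\<close>. The truncated function is therefore
  replaced by a Borel version with an explicit bound for the integral of its p-th power.\<close>

lemma Lloc_cutoff_borel:
  fixes f :: "real^'n \<Rightarrow> real"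
  assumes f: "f \<in> Lloc p" and K: "compact K"
  obtains g N where "g \<in> borel_measurable borel" "AE x in lebesgue. indicator K x * f x = g x"
    "(\<integral>\<^sup>+x. ennreal (\<bar>g x\<bar> powr p) \<partial>lborel) \<le> ennreal N" "0 \<le> N"
proof -
  note [measurable] = Lloc_measurable[OF f] compact_sets_lebesgue[OF K]
  obtain g where [measurable]: "g \<in> borel_measurable borel" and ae: "AE x in lebesgue. indicator K x * f x = g x"
    using borel_version[of "\<lambda>x. indicator K x * f x"] by auto
  have "integrable lebesgue (\<lambda>x. indicator K x * \<bar>f x\<bar> powr p)"
    using f K by (auto simp: Lloc_def set_integrable_def)
  then have fin: "(\<integral>\<^sup>+x. ennreal (indicator K x * \<bar>f x\<bar> powr p) \<partial>lebesgue) = ennreal (LINT x|lebesgue. indicator K x * \<bar>f x\<bar> powr p)"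
    by (rule nn_integral_eq_integral) simp
  have "(\<integral>\<^sup>+x. ennreal (\<bar>g x\<bar> powr p) \<partial>lborel) = (\<integral>\<^sup>+x. ennreal (\<bar>g x\<bar> powr p) \<partial>lebesgue)"
    by (rule nn_integral_lebesgue_borel[symmetric]) measurable
  also have "\<dots> \<le> (\<integral>\<^sup>+x. ennreal (indicator K x * \<bar>f x\<bar> powr p) \<partial>lebesgue)"
  proof (rule nn_integral_mono_AE)
    show "AE x in lebesgue. ennreal (\<bar>g x\<bar> powr p) \<le> ennreal (indicator K x * \<bar>f x\<bar> powr p)"
      using ae by eventually_elim (auto simp: indicator_def split: if_splits)
  qed
  finally show thesis
    using that[of g "LINT x|lebesgue. indicator K x * \<bar>f x\<bar> powr p"] ae fin by simp
qed

text \<open>With \<open>a = 1 - \<alpha>\<close> this is the condition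
  \<open>m - 1 - m \<alpha> \<ge> 0\<close>: the speed \<open>r ^ (m - 1)\<close> of the path
  outweighs the factor \<open>(r ^ m) powr (- \<alpha>)\<close> of a Morrey bound.\<close>

lemma exists_path_exponent:
  fixes a :: real
  assumes "a > 0" obtains m :: nat where "m \<ge> 1" "1 \<le> real m * a"
proof -
  obtain m :: nat where "1 / a \<le> real m" using real_arch_simple by blast
  then have ma: "1 \<le> real m * a" using assms by (simp add: field_simps)
  then have "m \<noteq> 0" by (intro notI) simp
  then show thesis using that[OF _ ma] by (simp add: Suc_le_eq)
qed

text \<open>The bound is proved in weak form,
  \<open>\<integral> f \<psi> \<le> C \<integral> \<psi>\<close> for nonnegative
  \<open>\<psi>\<close> supported in the ball. For each \<open>y\<close> in the unit cube this
  integral is compared with the one for \<open>\<psi>\<close> shifted by \<open>y\<close>; the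
  derivative along the shift is an integral of \<open>f'\<close>. Averaging over \<open>y\<close>
  exposes cube averages of the absolute values of \<open>f\<close> and \<open>f'\<close>, to which
  Morrey bounds apply.\<close>

lemma locally_bounded_above:
  fixes f :: "real^'n \<Rightarrow> real"
  assumes f: "f \<in> Lloc 1" and f': "\<And>i. f' i \<in> Lloc p" "\<And>i. has_weak_partial i f (f' i)" and p: "p > real CARD('n)"
  obtains C where "AE x in lebesgue. norm x < R \<longrightarrow> f x \<le> C"
proof -
  let ?d = "real CARD('n)"
  have d1: "?d \<ge> 1" using zero_less_card_finite by (simp add: Suc_le_eq)
  have p1: "p > 1" using p d1 by linarith
  \<comment> \<open>Contains the supports of all shifts of \<open>\<psi>\<close> by
    \<open>s y\<close> with 0 \<le> s \<le> 1 and \<open>y\<close> in the unit cube, whose points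
    have norm at most \<open>?d\<close>.\<close>
  define L where "L = cball (0::real^'n) (R + ?d)"
  have L: "compact L" by (simp add: L_def)
  obtain f0 N0 where f0 [measurable]: "f0 \<in> borel_measurable borel" and f0e: "AE x in lebesgue. indicator L x * f x = f0 x"
    and N0: "(\<integral>\<^sup>+x. ennreal (\<bar>f0 x\<bar> powr 1) \<partial>lborel) \<le> ennreal N0" "0 \<le> N0"
    by (rule Lloc_cutoff_borel[OF f L])
  define P where "P i g N \<longleftrightarrow> g \<in> borel_measurable borel \<and> (AE x in lebesgue. indicator L x * f' i x = g x) \<and>
     (\<integral>\<^sup>+x. ennreal (\<bar>g x\<bar> powr p) \<partial>lborel) \<le> ennreal N \<and> 0 \<le> N" for i g N
  have "\<exists>g N. P i g N" for i
    unfolding P_def by (rule Lloc_cutoff_borel[OF f'(1)[of i] L]) blast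
  then have "\<exists>g N. \<forall>i. P i (g i) (N i)" by metis
  then obtain g N where g [measurable]: "\<And>i. g i \<in> borel_measurable borel" and ge: "\<And>i. AE x in lebesgue. indicator L x * f' i x = g i x"
    and N: "\<And>i. (\<integral>\<^sup>+x. ennreal (\<bar>g i x\<bar> powr p) \<partial>lborel) \<le> ennreal (N i)" "\<And>i. 0 \<le> N i"
    unfolding P_def by blast
  define B0 where "B0 x = ennreal \<bar>f0 x\<bar>" for x
  define B where "B i x = ennreal \<bar>g i x\<bar>" for i x
  have [measurable]: "B0 \<in> borel_measurable borel" "\<And>i. B i \<in> borel_measurable borel"
    unfolding B0_def B_def by measurable
  \<comment> \<open>The large exponent \<open>?d\<close> does no harm: the bound for
    \<open>B0\<close> is used at the single scale 1.\<close>
  have mB0: "morrey ?d (1 + N0) B0"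
    using morrey_of_powr[OF f0 N0, of 1] by (simp add: B0_def[abs_def])
  have mB: "morrey (?d / p) (1 + N i) (B i)" for i
    using morrey_of_powr[OF g N, of 1] p1 by (simp add: B_def[abs_def])
  have f'1: "f' i \<in> Lloc 1" for i by (rule weak_partial_Lloc(2)[OF f'(2)])
  obtain m :: nat where m: "m \<ge> 1" "1 \<le> m * (1 - ?d / p)"
    using exists_path_exponent[of "1 - ?d / p"] p p1 by auto
  define C where "C = (1 + N0) + m * (\<Sum>i\<in>UNIV. 1 + N i)"
  have main: "(LINT x|lebesgue. f x * \<psi> x) \<le> C * (LINT x|lebesgue. \<psi> x)"
    if \<psi>: "\<psi> \<in> Cc_infty" "\<And>x. 0 \<le> \<psi> x" "\<And>x. x \<notin> ball 0 R \<Longrightarrow> \<psi> x = 0" for \<psi> :: "real^'n \<Rightarrow> real"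
  proof -
    have [measurable]: "\<psi> \<in> borel_measurable borel" by (rule smooth_borel_measurable[OF Cc_smooth[OF \<psi>(1)]])
    define I where "I = (\<integral>\<^sup>+x. ennreal (\<psi> x) \<partial>lborel)"
    have I: "I = ennreal (LINT x|lebesgue. \<psi> x)"
      unfolding I_def using nn_integral_eq_integral[OF Cc_integrable[OF \<psi>(1)]] \<psi>(2)
      by (simp add: nn_integral_lebesgue_borel[symmetric])
    have supp: "x \<in> L" if "\<psi> (x - s *\<^sub>R y) \<noteq> 0" "y \<in> cbox 0 One" "0 \<le> s" "s \<le> 1" for x y s
    proof -
      have "norm (x - s *\<^sub>R y) < R" using that(1) \<psi>(3)[of "x - s *\<^sub>R y"] by force
      moreover have "norm (s *\<^sub>R y) \<le> 1 * ?d"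
        using mult_mono[OF that(4) unit_cube_norm[OF that(2)]] that(3) by simp
      ultimately have "norm x \<le> R + ?d" using norm_triangle_sub[of x "s *\<^sub>R y"] by linarith
      then show ?thesis by (simp add: L_def)
    qed
    have bound: "ennreal \<bar>LINT x|lebesgue. h x * \<psi> (x - s *\<^sub>R y)\<bar> \<le> (\<integral>\<^sup>+x. ennreal \<bar>k x\<bar> * ennreal (\<psi> (x + (- s) *\<^sub>R y)) \<partial>lborel)"
      if h: "h \<in> Lloc 1" and k [measurable]: "k \<in> borel_measurable borel" and ae: "AE x in lebesgue. indicator L x * h x = k x"
        and y: "y \<in> cbox 0 One" "0 \<le> s" "s \<le> 1" for h k s y
    proof -
      have "ennreal \<bar>LINT x|lebesgue. h x * \<psi> (x - s *\<^sub>R y)\<bar> \<le> (\<integral>\<^sup>+x. norm (h x * \<psi> (x - s *\<^sub>R y)) \<partial>lebesgue)"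
        using integral_norm_bound_ennreal[OF Lloc_Cc_integrable[OF h Cc_translate[OF \<psi>(1)]]] by simp
      also have "\<dots> = (\<integral>\<^sup>+x. ennreal \<bar>k x\<bar> * ennreal (\<psi> (x + (- s) *\<^sub>R y)) \<partial>lebesgue)"
      proof (rule nn_integral_cong_AE)
        show "AE x in lebesgue. ennreal (norm (h x * \<psi> (x - s *\<^sub>R y))) = ennreal \<bar>k x\<bar> * ennreal (\<psi> (x + (- s) *\<^sub>R y))"
          using ae
        proof eventually_elim
          case (elim x)
          show ?case
            using elim supp[of x s y] y \<psi>(2)[of "x - s *\<^sub>R y"]
            by (cases "\<psi> (x - s *\<^sub>R y) = 0") (auto simp: abs_mult ennreal_mult)
        qed
      qed
      also have "\<dots> = (\<integral>\<^sup>+x. ennreal \<bar>k x\<bar> * ennreal (\<psi> (x + (- s) *\<^sub>R y)) \<partial>lborel)"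
        by (rule nn_integral_lebesgue_borel) measurable
      finally show ?thesis .
    qed
    have point: "ennreal (LINT x|lebesgue. f x * \<psi> x) \<le>
       (\<integral>\<^sup>+x. B0 x * ennreal (\<psi> (x + (- 1) *\<^sub>R y)) \<partial>lborel) +
       (\<integral>\<^sup>+r. indicator {0<..1} r * (ennreal (m * r ^ (m - 1)) * (\<Sum>i\<in>UNIV. \<integral>\<^sup>+x. B i x * ennreal (\<psi> (x + (- (r ^ m)) *\<^sub>R y)) \<partial>lborel)) \<partial>lborel)"
      if y: "y \<in> cbox 0 One" for y :: "real^'n"
    proof -
      define F where "F s = (LINT x|lebesgue. f x * \<psi> (x - s *\<^sub>R y))" for s
      define F' where "F' s = (\<Sum>i\<in>UNIV. y $ i * (LINT x|lebesgue. f' i x * \<psi> (x - s *\<^sub>R y)))" for s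
      have der: "(F has_real_derivative F' s) (at s)" for s
      proof -
        have "(LINT x|lebesgue. f x * (\<Sum>i\<in>UNIV. y $ i * pd i \<psi> (x - s *\<^sub>R y)))
           = (\<Sum>i\<in>UNIV. y $ i * (LINT x|lebesgue. f x * pd i \<psi> (x - s *\<^sub>R y)))"
        proof -
          have "(\<lambda>x. f x * (\<Sum>i\<in>UNIV. y $ i * pd i \<psi> (x - s *\<^sub>R y)))
             = (\<lambda>x. \<Sum>i\<in>UNIV. y $ i * (f x * pd i \<psi> (x - s *\<^sub>R y)))"
            by (simp add: sum_distrib_left mult.left_commute)
          then show ?thesis
            using Lloc_Cc_integrable[OF f Cc_translate[OF Cc_pd[OF \<psi>(1)]]] by simp
        qed
        also have "\<dots> = - F' s"
          using weak_partialD[OF f'(2) Cc_translate[OF \<psi>(1)], of _ "s *\<^sub>R y"]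
          by (simp add: F'_def smooth_pd_translate[OF Cc_smooth[OF \<psi>(1)]] sum_negf)
        finally show ?thesis
          using convolution_line_derivative[OF f \<psi>(1), of y s] by (simp add: F_def[abs_def])
      qed
      have cont: "continuous_on UNIV F'"
        unfolding F'_def
        by (intro continuous_intros continuous_on_compose2[OF convolution_continuous[OF f'1 \<psi>(1)], of UNIV "\<lambda>s. s *\<^sub>R y"]) auto
      have "F 0 \<le> \<bar>F 1\<bar> + \<bar>F 1 - F 0\<bar>" by linarith
      then have "ennreal (F 0) \<le> ennreal \<bar>F 1\<bar> + ennreal \<bar>F 1 - F 0\<bar>"
        by (simp add: ennreal_plus[symmetric] ennreal_leI del: ennreal_plus)
      also have "\<dots> \<le> (\<integral>\<^sup>+x. B0 x * ennreal (\<psi> (x + (- 1) *\<^sub>R y)) \<partial>lborel) +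
         (\<integral>\<^sup>+r. indicator {0<..1} r * ennreal (1 * m * r ^ (m - 1) * \<bar>F' (1 * r ^ m)\<bar>) \<partial>lborel)"
        using bound[OF f f0 f0e y, of 1] ftc_power_path(1)[OF der cont _ m(1), of 1]
        by (intro add_mono) (simp_all add: F_def B0_def)
      also have "\<dots> \<le> (\<integral>\<^sup>+x. B0 x * ennreal (\<psi> (x + (- 1) *\<^sub>R y)) \<partial>lborel) +
         (\<integral>\<^sup>+r. indicator {0<..1} r * (ennreal (m * r ^ (m - 1)) * (\<Sum>i\<in>UNIV. \<integral>\<^sup>+x. B i x * ennreal (\<psi> (x + (- (r ^ m)) *\<^sub>R y)) \<partial>lborel)) \<partial>lborel)"
      proof (intro add_left_mono nn_integral_mono)
        fix r :: real
        show "indicator {0<..1} r * ennreal (1 * m * r ^ (m - 1) * \<bar>F' (1 * r ^ m)\<bar>)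
          \<le> indicator {0<..1} r * (ennreal (m * r ^ (m - 1)) * (\<Sum>i\<in>UNIV. \<integral>\<^sup>+x. B i x * ennreal (\<psi> (x + (- (r ^ m)) *\<^sub>R y)) \<partial>lborel))"
        proof (cases "r \<in> {0<..1}")
          case True
          then have r: "0 \<le> r" "0 \<le> r ^ m" "r ^ m \<le> 1" by (auto simp: power_le_one)
          have "\<bar>F' (r ^ m)\<bar> \<le> (\<Sum>i\<in>UNIV. \<bar>y $ i * (LINT x|lebesgue. f' i x * \<psi> (x - (r ^ m) *\<^sub>R y))\<bar>)"
            unfolding F'_def by (rule sum_abs)
          also have "\<dots> \<le> (\<Sum>i\<in>UNIV. \<bar>LINT x|lebesgue. f' i x * \<psi> (x - (r ^ m) *\<^sub>R y)\<bar>)"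
            unfolding abs_mult by (intro sum_mono mult_left_le_one_le unit_cube_component y) auto
          finally have "ennreal \<bar>F' (r ^ m)\<bar> \<le> (\<Sum>i\<in>UNIV. ennreal \<bar>LINT x|lebesgue. f' i x * \<psi> (x - (r ^ m) *\<^sub>R y)\<bar>)"
            by (simp add: sum_ennreal ennreal_leI)
          also have "\<dots> \<le> (\<Sum>i\<in>UNIV. \<integral>\<^sup>+x. B i x * ennreal (\<psi> (x + (- (r ^ m)) *\<^sub>R y)) \<partial>lborel)"
            unfolding B_def by (intro sum_mono bound f'1 g ge y r)
          finally show ?thesis using True r
            by (auto simp: ennreal_mult intro!: mult_left_mono)
        qed simp
      qed
      finally show ?thesis by (simp add: F_def)
    qed
    have "ennreal (LINT x|lebesgue. f x * \<psi> x) = (\<integral>\<^sup>+y. indicator (cbox 0 (One::real^'n)) y * ennreal (LINT x|lebesgue. f x * \<psi> x) \<partial>lborel)"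
      by (rule nn_integral_unit_cube[symmetric])
    also have "\<dots> \<le> (\<integral>\<^sup>+y. indicator (cbox 0 (One::real^'n)) y *
       ((\<integral>\<^sup>+x. B0 x * ennreal (\<psi> (x + (- 1) *\<^sub>R y)) \<partial>lborel) +
       (\<integral>\<^sup>+r. indicator {0<..1} r * (ennreal (m * r ^ (m - 1)) * (\<Sum>i\<in>UNIV. \<integral>\<^sup>+x. B i x * ennreal (\<psi> (x + (- (r ^ m)) *\<^sub>R y)) \<partial>lborel)) \<partial>lborel)) \<partial>lborel)"
      by (intro nn_integral_mono) (use point in \<open>auto simp: indicator_def\<close>)
    also have "\<dots> = (\<integral>\<^sup>+y. indicator (cbox 0 (One::real^'n)) y * (\<integral>\<^sup>+x. B0 x * ennreal (\<psi> (x + (- 1) *\<^sub>R y)) \<partial>lborel) \<partial>lborel)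
      + (\<integral>\<^sup>+y. (\<integral>\<^sup>+r. indicator {0<..1} r * (ennreal (m * r ^ (m - 1)) * (\<Sum>i\<in>UNIV. indicator (cbox 0 (One::real^'n)) y * (\<integral>\<^sup>+x. B i x * ennreal (\<psi> (x + (- (r ^ m)) *\<^sub>R y)) \<partial>lborel))) \<partial>lborel) \<partial>lborel)"
      (is "_ = ?T1 + ?T2")
      by (subst nn_integral_add[symmetric])
         (auto simp: distrib_left nn_integral_cmult[symmetric] sum_distrib_left mult_ac intro!: nn_integral_cong)
    also have "?T2 = (\<integral>\<^sup>+r. (\<integral>\<^sup>+y. indicator {0<..1} r * (ennreal (m * r ^ (m - 1)) * (\<Sum>i\<in>UNIV. indicator (cbox 0 (One::real^'n)) y * (\<integral>\<^sup>+x. B i x * ennreal (\<psi> (x + (- (r ^ m)) *\<^sub>R y)) \<partial>lborel))) \<partial>lborel) \<partial>lborel)"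
      by (rule lborel_pair.Fubini') measurable
    also have "\<dots> = (\<integral>\<^sup>+r. indicator {0<..1} r * (ennreal (m * r ^ (m - 1)) * (\<Sum>i\<in>UNIV. \<integral>\<^sup>+y. indicator (cbox 0 (One::real^'n)) y * (\<integral>\<^sup>+x. B i x * ennreal (\<psi> (x + (- (r ^ m)) *\<^sub>R y)) \<partial>lborel) \<partial>lborel)) \<partial>lborel)"
    proof -
      have "(\<integral>\<^sup>+r. (\<integral>\<^sup>+y. indicator {0<..1} r * (ennreal (m * r ^ (m - 1)) * (\<Sum>i\<in>UNIV. J y * (\<integral>\<^sup>+x. B i x * ennreal (\<psi> (x + (- (r ^ m)) *\<^sub>R y)) \<partial>lborel))) \<partial>lborel) \<partial>lborel)
        = (\<integral>\<^sup>+r. indicator {0<..1} r * (ennreal (m * r ^ (m - 1)) * (\<Sum>i\<in>UNIV. \<integral>\<^sup>+y. J y * (\<integral>\<^sup>+x. B i x * ennreal (\<psi> (x + (- (r ^ m)) *\<^sub>R y)) \<partial>lborel) \<partial>lborel)) \<partial>lborel)"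
        if [measurable]: "J \<in> borel_measurable borel" for J :: "real^'n \<Rightarrow> ennreal"
        by (simp add: nn_integral_cmult nn_integral_sum)
      from this[of "indicator (cbox 0 One)"] show ?thesis by simp
    qed
    also have "\<dots> \<le> (\<integral>\<^sup>+r. indicator {0<..1} (r::real) * (ennreal (m * (\<Sum>i\<in>UNIV. 1 + N i)) * I) \<partial>lborel)"
    proof (rule nn_integral_mono)
      fix r :: real
      show "indicator {0<..1} r * (ennreal (m * r ^ (m - 1)) * (\<Sum>i\<in>UNIV. \<integral>\<^sup>+y. indicator (cbox 0 (One::real^'n)) y * (\<integral>\<^sup>+x. B i x * ennreal (\<psi> (x + (- (r ^ m)) *\<^sub>R y)) \<partial>lborel) \<partial>lborel))
         \<le> indicator {0<..1} r * (ennreal (m * (\<Sum>i\<in>UNIV. 1 + N i)) * I)"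
      proof (cases "r \<in> {0<..1}")
        case True
        then have r: "0 < r" "r \<le> 1" "0 < r ^ m" "r ^ m \<le> 1" by (auto simp: power_le_one)
        have "(\<Sum>i\<in>UNIV. \<integral>\<^sup>+y. indicator (cbox 0 (One::real^'n)) y * (\<integral>\<^sup>+x. B i x * ennreal (\<psi> (x + (- (r ^ m)) *\<^sub>R y)) \<partial>lborel) \<partial>lborel)
          \<le> (\<Sum>i\<in>UNIV. ennreal ((1 + N i) * \<bar>- (r ^ m)\<bar> powr (- (?d / p))) * I)"
          unfolding I_def by (intro sum_mono morrey_average[OF mB]) (use r in auto)
        also have "\<dots> = ennreal ((\<Sum>i\<in>UNIV. 1 + N i) * (r ^ m) powr (- (?d / p))) * I"
          using N(2) r by (simp add: sum_distrib_right[symmetric] sum_ennreal sum_nonneg)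
        finally have le: "(\<Sum>i\<in>UNIV. \<integral>\<^sup>+y. indicator (cbox 0 (One::real^'n)) y * (\<integral>\<^sup>+x. B i x * ennreal (\<psi> (x + (- (r ^ m)) *\<^sub>R y)) \<partial>lborel) \<partial>lborel)
          \<le> ennreal ((\<Sum>i\<in>UNIV. 1 + N i) * (r ^ m) powr (- (?d / p))) * I" .
        have SN: "0 \<le> (\<Sum>i\<in>UNIV. 1 + N i)" using N(2) by (simp add: sum_nonneg)
        \<comment> \<open>The total exponent of \<open>r\<close> is m - 1 - m d/p, nonnegative by
          the choice of \<open>m\<close>.\<close>
        have pw: "r ^ (m - 1) * (r ^ m) powr (- (?d / p)) \<le> 1"
        proof -
          have "r ^ (m - 1) * (r ^ m) powr (- (?d / p)) = r powr (real (m - 1) + m * (- (?d / p)))"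
          proof -
            have 1: "r ^ (m - 1) = r powr real (m - 1)" using r by (simp add: powr_realpow)
            have "(r ^ m) powr (- (?d / p)) = (r powr real m) powr (- (?d / p))" using r by (simp add: powr_realpow)
            then have 2: "(r ^ m) powr (- (?d / p)) = r powr (m * (- (?d / p)))" by (simp only: powr_powr)
            show ?thesis unfolding 2 by (simp only: 1 powr_add)
          qed
          also have "\<dots> \<le> 1" using r m by (intro powr_le1) (auto simp: of_nat_diff algebra_simps)
          finally show ?thesis .
        qed
        have "ennreal (m * r ^ (m - 1)) * (ennreal ((\<Sum>i\<in>UNIV. 1 + N i) * (r ^ m) powr (- (?d / p))) * I)
           = ennreal ((m * (\<Sum>i\<in>UNIV. 1 + N i)) * (r ^ (m - 1) * (r ^ m) powr (- (?d / p)))) * I"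
          using r SN by (simp add: mult.assoc[symmetric] ennreal_mult[symmetric]) (simp add: mult_ac)
        also have "\<dots> \<le> ennreal (m * (\<Sum>i\<in>UNIV. 1 + N i)) * I"
          using pw SN by (intro mult_right_mono ennreal_leI mult_left_le) auto
        finally show ?thesis using True le by (auto intro: order_trans[OF mult_left_mono])
      qed simp
    qed
    also have "\<dots> = ennreal (m * (\<Sum>i\<in>UNIV. 1 + N i)) * I"
      by (subst nn_integral_multc) auto
    also have "?T1 \<le> ennreal ((1 + N0) * \<bar>-1\<bar> powr (- ?d)) * I"
      unfolding I_def by (rule morrey_average[OF mB0]) auto
    finally have "ennreal (LINT x|lebesgue. f x * \<psi> x) \<le> ennreal (1 + N0) * I + ennreal (m * (\<Sum>i\<in>UNIV. 1 + N i)) * I"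
      by (simp add: add_mono)
    also have "\<dots> = ennreal (C * (LINT x|lebesgue. \<psi> x))"
    proof -
      have "0 \<le> (LINT x|lebesgue. \<psi> x)" using \<psi>(2) by (intro Bochner_Integration.integral_nonneg)
      moreover have "0 \<le> (\<Sum>i\<in>UNIV. 1 + N i)" using N(2) by (simp add: sum_nonneg)
      ultimately show ?thesis
        using N0(2) unfolding I C_def
        by (simp add: ennreal_mult[symmetric] ennreal_plus[symmetric] distrib_right del: ennreal_plus)
    qed
    finally show ?thesis
    proof -
      assume "ennreal (LINT x|lebesgue. f x * \<psi> x) \<le> ennreal (C * (LINT x|lebesgue. \<psi> x))"
      moreover have "0 \<le> C * (LINT x|lebesgue. \<psi> x)"
        using N0(2) N(2) \<psi>(2) by (simp add: C_def sum_nonneg)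
      ultimately show ?thesis by (auto simp: ennreal_le_iff2)
    qed
  qed
  have "AE x in lebesgue. x \<in> ball 0 R \<longrightarrow> f x + (- C) \<le> 0"
  proof (rule nonpos_if_integral_nonpos)
    show "(\<lambda>x. f x + (- C)) \<in> Lloc 1" by (intro Lloc_one_add f Lloc_one_const)
    fix \<psi> :: "real^'n \<Rightarrow> real"
    assume \<psi>: "\<psi> \<in> Cc_infty" "\<And>x. 0 \<le> \<psi> x" "\<And>x. x \<notin> ball 0 R \<Longrightarrow> \<psi> x = 0"
    have "(LINT x|lebesgue. (f x + - C) * \<psi> x) = (LINT x|lebesgue. f x * \<psi> x) - C * (LINT x|lebesgue. \<psi> x)"
      using Lloc_Cc_integrable[OF f \<psi>(1)] Cc_integrable[OF \<psi>(1)] by (simp add: algebra_simps)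
    then show "(LINT x|lebesgue. (f x + - C) * \<psi> x) \<le> 0" using main[OF \<psi>] by simp
  qed simp
  then have "AE x in lebesgue. norm x < R \<longrightarrow> f x \<le> C" by eventually_elim auto
  then show thesis by (rule that)
qed

text \<open>The double integral over \<open>x\<close> and over the increments \<open>t y\<close>, \<open>y\<close> in the unit cube, of
  \<open>g(x)\<^sup>2 \<le> 2 g(x + t y)\<^sup>2 + 2 (g(x + t y) - g(x))\<^sup>2\<close>.\<close>
lemma morrey_weighted_nn_integral:
  fixes g :: "real^'n \<Rightarrow> real" and m :: nat
  assumes B: "morrey (2 * \<alpha>) M B" "0 \<le> M" and \<alpha>: "0 \<le> \<alpha>" "\<alpha> < 1"
    and m: "m \<ge> 1" "1 \<le> real m * (1 - \<alpha>)" and g: "g \<in> Cc_infty" and t: "0 < t" "t \<le> 1"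
  shows "(\<integral>\<^sup>+x. B x * ennreal ((g x)\<^sup>2) \<partial>lborel) \<le>
    ennreal (2 * M * (t powr (- (2 * \<alpha>)) * (L2_norm lebesgue g)\<^sup>2 +
      real CARD('n) * m\<^sup>2 * t powr (2 - 2 * \<alpha>) * (\<Sum>i\<in>UNIV. (L2_norm lebesgue (pd i g))\<^sup>2)))"
proof -
  let ?d = "real CARD('n)"
  let ?Q = "indicator (cbox 0 (One :: real^'n)) :: real^'n \<Rightarrow> ennreal"
  note [measurable] = morrey_measurable[OF B(1)]
  have [measurable]: "g \<in> borel_measurable borel" by (rule smooth_borel_measurable[OF Cc_smooth[OF g]])
  have [measurable]: "pd i g \<in> borel_measurable borel" for i
    by (rule smooth_borel_measurable[OF Cc_smooth[OF Cc_pd[OF g]]])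
  define h where "h z = ennreal ((g z)\<^sup>2)" for z
  define P where "P z = ennreal (\<Sum>i\<in>UNIV. (pd i g z)\<^sup>2)" for z
  define c where "c r = ennreal (?d * (t * m * r ^ (m - 1))\<^sup>2)" for r :: real
  have [measurable]: "h \<in> borel_measurable borel" "P \<in> borel_measurable borel" "c \<in> borel_measurable borel"
    unfolding h_def P_def c_def by measurable
  have sq: "(\<integral>\<^sup>+z. ennreal ((k z)\<^sup>2) \<partial>lborel) = ennreal ((L2_norm lebesgue k)\<^sup>2)" if "k \<in> Cc_infty" for k :: "real^'n \<Rightarrow> real"
    using L2_nn_integral_sq[OF Cc_L2[OF that]] smooth_borel_measurable[OF Cc_smooth[OF that]]
    by (subst nn_integral_lebesgue_borel[symmetric]) auto
  have hI: "(\<integral>\<^sup>+z. h z \<partial>lborel) = ennreal ((L2_norm lebesgue g)\<^sup>2)" unfolding h_def by (rule sq[OF g])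
  have PI: "(\<integral>\<^sup>+z. P z \<partial>lborel) = ennreal (\<Sum>i\<in>UNIV. (L2_norm lebesgue (pd i g))\<^sup>2)"
  proof -
    have "P z = (\<Sum>i\<in>UNIV. ennreal ((pd i g z)\<^sup>2))" for z unfolding P_def by simp
    then have "(\<integral>\<^sup>+z. P z \<partial>lborel) = (\<Sum>i\<in>UNIV. ennreal ((L2_norm lebesgue (pd i g))\<^sup>2))"
      using sq[OF Cc_pd[OF g]] by (simp del: sum_ennreal add: nn_integral_sum)
    then show ?thesis by simp
  qed
  have point: "h x \<le> 2 * h (x + t *\<^sub>R y) + 2 * (\<integral>\<^sup>+r. indicator {0<..1} r * (c r * P (x + (t * r ^ m) *\<^sub>R y)) \<partial>lborel)"
    if y: "y \<in> cbox 0 One" for x y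
  proof -
    define F' where "F' s = (\<Sum>i\<in>UNIV. y $ i * pd i g (x + s *\<^sub>R y))" for s
    have der: "((\<lambda>s. g (x + s *\<^sub>R y)) has_real_derivative F' s) (at s)" for s
      unfolding F'_def by (rule line_derivative[OF Cc_smooth[OF g]])
    have cont: "continuous_on UNIV F'"
      unfolding F'_def
      by (intro continuous_intros continuous_on_compose2[OF smooth_continuous[OF Cc_smooth[OF Cc_pd[OF g]], of UNIV], of UNIV "\<lambda>s. x + s *\<^sub>R y"]) auto
    have F'le: "(F' s)\<^sup>2 \<le> ?d * (\<Sum>i\<in>UNIV. (pd i g (x + s *\<^sub>R y))\<^sup>2)" for s
    proof -
      have "(F' s)\<^sup>2 \<le> (\<Sum>i\<in>UNIV. (y $ i * pd i g (x + s *\<^sub>R y))\<^sup>2) * ?d"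
        unfolding F'_def using sum_squared_le_sum_of_squares[of "\<lambda>i. y $ i * pd i g (x + s *\<^sub>R y)" UNIV] by simp
      also have "\<dots> \<le> (\<Sum>i\<in>UNIV. (pd i g (x + s *\<^sub>R y))\<^sup>2) * ?d"
      proof (intro mult_right_mono sum_mono)
        fix i
        have "(y $ i)\<^sup>2 \<le> 1" using unit_cube_component[OF y, of i] by (simp add: abs_square_le_1)
        then show "(y $ i * pd i g (x + s *\<^sub>R y))\<^sup>2 \<le> (pd i g (x + s *\<^sub>R y))\<^sup>2"
          by (simp add: power_mult_distrib mult_left_le_one_le)
      qed simp
      finally show ?thesis by (simp add: mult.commute)
    qed
    have "(g x)\<^sup>2 \<le> 2 * (g (x + t *\<^sub>R y))\<^sup>2 + 2 * (g (x + t *\<^sub>R y) - g x)\<^sup>2"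
      using zero_le_power2[of "2 * g (x + t *\<^sub>R y) - g x"] by (simp add: power2_eq_square algebra_simps)
    then have "h x \<le> ennreal (2 * (g (x + t *\<^sub>R y))\<^sup>2 + 2 * (g (x + t *\<^sub>R y) - g x)\<^sup>2)"
      unfolding h_def by (rule ennreal_leI)
    also have "\<dots> = 2 * h (x + t *\<^sub>R y) + 2 * ennreal ((g (x + t *\<^sub>R y) - g x)\<^sup>2)"
    proof -
      have "ennreal (2 * a + 2 * b) = 2 * ennreal a + 2 * ennreal b" if "0 \<le> a" "0 \<le> b" for a b :: real
      proof -
        have "ennreal (2 * a + 2 * b) = ennreal (2 * a) + ennreal (2 * b)" using that by (intro ennreal_plus) auto
        also have "\<dots> = ennreal 2 * ennreal a + ennreal 2 * ennreal b" using that by (simp only: ennreal_mult zero_le_numeral)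
        finally show ?thesis by simp
      qed
      then show ?thesis unfolding h_def by simp
    qed
    finally have h1: "h x \<le> 2 * h (x + t *\<^sub>R y) + 2 * ennreal ((g (x + t *\<^sub>R y) - g x)\<^sup>2)" .
    have "ennreal ((g (x + t *\<^sub>R y) - g x)\<^sup>2) \<le> (\<integral>\<^sup>+r. indicator {0<..1} r * ennreal ((t * m * r ^ (m - 1) * \<bar>F' (t * r ^ m)\<bar>)\<^sup>2) \<partial>lborel)"
      using ftc_power_path(2)[OF der cont _ m(1), of t] t by simp
    also have "\<dots> \<le> (\<integral>\<^sup>+r. indicator {0<..1} r * (c r * P (x + (t * r ^ m) *\<^sub>R y)) \<partial>lborel)"
    proof (intro nn_integral_mono mult_left_mono)
      fix r
      have "(t * m * r ^ (m - 1) * \<bar>F' (t * r ^ m)\<bar>)\<^sup>2 = (t * m * r ^ (m - 1))\<^sup>2 * (F' (t * r ^ m))\<^sup>2"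
        by (simp add: power_mult_distrib)
      also have "\<dots> \<le> (t * m * r ^ (m - 1))\<^sup>2 * (?d * (\<Sum>i\<in>UNIV. (pd i g (x + (t * r ^ m) *\<^sub>R y))\<^sup>2))"
        by (intro mult_left_mono F'le) auto
      also have "\<dots> = (?d * (t * m * r ^ (m - 1))\<^sup>2) * (\<Sum>i\<in>UNIV. (pd i g (x + (t * r ^ m) *\<^sub>R y))\<^sup>2)"
        by simp
      finally show "ennreal ((t * m * r ^ (m - 1) * \<bar>F' (t * r ^ m)\<bar>)\<^sup>2) \<le> c r * P (x + (t * r ^ m) *\<^sub>R y)"
        unfolding c_def P_def by (simp only: ennreal_mult[symmetric] ennreal_leI sum_nonneg zero_le_power2 mult_nonneg_nonneg of_nat_0_le_iff)
    qed auto
    finally show ?thesis by (intro order_trans[OF h1] add_left_mono mult_left_mono) auto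
  qed
  have "(\<integral>\<^sup>+x. B x * h x \<partial>lborel) = (\<integral>\<^sup>+y. ?Q y * (\<integral>\<^sup>+x. B x * h x \<partial>lborel) \<partial>lborel)"
    by (rule nn_integral_unit_cube[symmetric])
  also have "\<dots> \<le> (\<integral>\<^sup>+y. ?Q y * (\<integral>\<^sup>+x. B x * (2 * h (x + t *\<^sub>R y) + 2 * (\<integral>\<^sup>+r. indicator {0<..1} r * (c r * P (x + (t * r ^ m) *\<^sub>R y)) \<partial>lborel)) \<partial>lborel) \<partial>lborel)"
  proof (rule nn_integral_mono)
    fix y :: "real^'n"
    show "?Q y * (\<integral>\<^sup>+x. B x * h x \<partial>lborel) \<le> ?Q y * (\<integral>\<^sup>+x. B x * (2 * h (x + t *\<^sub>R y) + 2 * (\<integral>\<^sup>+r. indicator {0<..1} r * (c r * P (x + (t * r ^ m) *\<^sub>R y)) \<partial>lborel)) \<partial>lborel)"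
      by (cases "y \<in> cbox 0 One") (auto intro!: nn_integral_mono mult_left_mono point)
  qed
  also have "\<dots> = 2 * (\<integral>\<^sup>+y. ?Q y * (\<integral>\<^sup>+x. B x * h (x + t *\<^sub>R y) \<partial>lborel) \<partial>lborel)
     + 2 * (\<integral>\<^sup>+r. indicator {0<..1} r * (c r * (\<integral>\<^sup>+y. ?Q y * (\<integral>\<^sup>+x. B x * P (x + (t * r ^ m) *\<^sub>R y) \<partial>lborel) \<partial>lborel)) \<partial>lborel)"
  proof -
    have inner: "(\<integral>\<^sup>+x. B x * (\<integral>\<^sup>+r. indicator {0<..1} r * (c r * P (x + (t * r ^ m) *\<^sub>R y)) \<partial>lborel) \<partial>lborel)
      = (\<integral>\<^sup>+r. indicator {0<..1} r * (c r * (\<integral>\<^sup>+x. B x * P (x + (t * r ^ m) *\<^sub>R y) \<partial>lborel)) \<partial>lborel)" for y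
    proof -
      have "(\<integral>\<^sup>+x. B x * (\<integral>\<^sup>+r. indicator {0<..1} r * (c r * P (x + (t * r ^ m) *\<^sub>R y)) \<partial>lborel) \<partial>lborel)
        = (\<integral>\<^sup>+x. (\<integral>\<^sup>+r. indicator {0<..1} r * (c r * (B x * P (x + (t * r ^ m) *\<^sub>R y))) \<partial>lborel) \<partial>lborel)"
        by (subst nn_integral_cmult[symmetric]) (auto simp: mult_ac)
      also have "\<dots> = (\<integral>\<^sup>+r. (\<integral>\<^sup>+x. indicator {0<..1} r * (c r * (B x * P (x + (t * r ^ m) *\<^sub>R y))) \<partial>lborel) \<partial>lborel)"
        by (rule lborel_pair.Fubini') measurable
      finally show ?thesis by (simp add: nn_integral_cmult)
    qed
    have "(\<integral>\<^sup>+y. J y * (\<integral>\<^sup>+x. B x * (2 * h (x + t *\<^sub>R y) + 2 * (\<integral>\<^sup>+r. indicator {0<..1} r * (c r * P (x + (t * r ^ m) *\<^sub>R y)) \<partial>lborel)) \<partial>lborel) \<partial>lborel)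
     = 2 * (\<integral>\<^sup>+y. J y * (\<integral>\<^sup>+x. B x * h (x + t *\<^sub>R y) \<partial>lborel) \<partial>lborel)
     + 2 * (\<integral>\<^sup>+r. indicator {0<..1} r * (c r * (\<integral>\<^sup>+y. J y * (\<integral>\<^sup>+x. B x * P (x + (t * r ^ m) *\<^sub>R y) \<partial>lborel) \<partial>lborel)) \<partial>lborel)"
      if [measurable]: "J \<in> borel_measurable borel" for J :: "real^'n \<Rightarrow> ennreal"
    proof -
      have "(\<integral>\<^sup>+x. B x * (2 * h (x + t *\<^sub>R y) + 2 * (\<integral>\<^sup>+r. indicator {0<..1} r * (c r * P (x + (t * r ^ m) *\<^sub>R y)) \<partial>lborel)) \<partial>lborel)
        = 2 * (\<integral>\<^sup>+x. B x * h (x + t *\<^sub>R y) \<partial>lborel) + 2 * (\<integral>\<^sup>+r. indicator {0<..1} r * (c r * (\<integral>\<^sup>+x. B x * P (x + (t * r ^ m) *\<^sub>R y) \<partial>lborel)) \<partial>lborel)" for y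
        by (simp add: distrib_left mult.left_commute[of _ 2] nn_integral_add nn_integral_cmult inner)
      note e = this
      have "(\<integral>\<^sup>+y. J y * (\<integral>\<^sup>+x. B x * (2 * h (x + t *\<^sub>R y) + 2 * (\<integral>\<^sup>+r. indicator {0<..1} r * (c r * P (x + (t * r ^ m) *\<^sub>R y)) \<partial>lborel)) \<partial>lborel) \<partial>lborel)
        = 2 * (\<integral>\<^sup>+y. J y * (\<integral>\<^sup>+x. B x * h (x + t *\<^sub>R y) \<partial>lborel) \<partial>lborel) + 2 * (\<integral>\<^sup>+y. J y * (\<integral>\<^sup>+r. indicator {0<..1} r * (c r * (\<integral>\<^sup>+x. B x * P (x + (t * r ^ m) *\<^sub>R y) \<partial>lborel)) \<partial>lborel) \<partial>lborel)"
        unfolding e by (simp add: distrib_left mult.left_commute[of _ 2] nn_integral_add nn_integral_cmult)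
      also have "(\<integral>\<^sup>+y. J y * (\<integral>\<^sup>+r. indicator {0<..1} r * (c r * (\<integral>\<^sup>+x. B x * P (x + (t * r ^ m) *\<^sub>R y) \<partial>lborel)) \<partial>lborel) \<partial>lborel)
        = (\<integral>\<^sup>+y. (\<integral>\<^sup>+r. indicator {0<..1} r * (c r * (J y * (\<integral>\<^sup>+x. B x * P (x + (t * r ^ m) *\<^sub>R y) \<partial>lborel))) \<partial>lborel) \<partial>lborel)"
        by (subst nn_integral_cmult[symmetric]) (auto simp: mult_ac)
      also have "\<dots> = (\<integral>\<^sup>+r. (\<integral>\<^sup>+y. indicator {0<..1} r * (c r * (J y * (\<integral>\<^sup>+x. B x * P (x + (t * r ^ m) *\<^sub>R y) \<partial>lborel))) \<partial>lborel) \<partial>lborel)"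
        by (rule lborel_pair.Fubini') measurable
      finally show ?thesis by (simp add: nn_integral_cmult)
    qed
    from this[of ?Q] show ?thesis by simp
  qed
  \<comment> \<open>The values at the shifted point use the Morrey bound at scale \<open>t\<close>,
    the increments use it at scale \<open>t * r ^ m\<close>.\<close>
  also have "\<dots> \<le> 2 * (ennreal (M * t powr (- (2 * \<alpha>))) * ennreal ((L2_norm lebesgue g)\<^sup>2))
    + 2 * (ennreal (?d * m\<^sup>2 * t powr (2 - 2 * \<alpha>) * M) * ennreal (\<Sum>i\<in>UNIV. (L2_norm lebesgue (pd i g))\<^sup>2))"
  proof (intro add_mono mult_left_mono)
    show "(\<integral>\<^sup>+y. ?Q y * (\<integral>\<^sup>+x. B x * h (x + t *\<^sub>R y) \<partial>lborel) \<partial>lborel) \<le> ennreal (M * t powr (- (2 * \<alpha>))) * ennreal ((L2_norm lebesgue g)\<^sup>2)"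
      using morrey_average[OF B(1), of h t] t by (simp add: hI)
    have "(\<integral>\<^sup>+r. indicator {0<..1} r * (c r * (\<integral>\<^sup>+y. ?Q y * (\<integral>\<^sup>+x. B x * P (x + (t * r ^ m) *\<^sub>R y) \<partial>lborel) \<partial>lborel)) \<partial>lborel)
      \<le> (\<integral>\<^sup>+r. indicator {0<..1} (r::real) * (ennreal (?d * m\<^sup>2 * t powr (2 - 2 * \<alpha>) * M) * ennreal (\<Sum>i\<in>UNIV. (L2_norm lebesgue (pd i g))\<^sup>2)) \<partial>lborel)"
    proof (rule nn_integral_mono)
      fix r :: real
      show "indicator {0<..1} r * (c r * (\<integral>\<^sup>+y. ?Q y * (\<integral>\<^sup>+x. B x * P (x + (t * r ^ m) *\<^sub>R y) \<partial>lborel) \<partial>lborel))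
         \<le> indicator {0<..1} r * (ennreal (?d * m\<^sup>2 * t powr (2 - 2 * \<alpha>) * M) * ennreal (\<Sum>i\<in>UNIV. (L2_norm lebesgue (pd i g))\<^sup>2))"
      proof (cases "r \<in> {0<..1}")
        case True
        then have r: "0 < r" "r \<le> 1" "0 < r ^ m" "r ^ m \<le> 1" by (auto simp: power_le_one)
        have tr: "0 < t * r ^ m" "t * r ^ m \<le> 1" using t r by (auto simp: mult_le_one)
        \<comment> \<open>The exponent of \<open>r\<close> is 2 (m - 1) - 2 m \<alpha>, twice the
          quantity made nonnegative by the choice of \<open>m\<close>; the exponent of
          \<open>t\<close> is 2 - 2 \<alpha>.\<close>
        have pw: "(t * m * r ^ (m - 1))\<^sup>2 * (t * r ^ m) powr (- (2 * \<alpha>)) \<le> m\<^sup>2 * t powr (2 - 2 * \<alpha>)"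
        proof -
          have 1: "(r ^ (m - 1))\<^sup>2 = r powr (2 * real (m - 1))"
          proof -
            have "(r ^ (m - 1))\<^sup>2 = r ^ (2 * (m - 1))" by (simp only: power_mult[symmetric] mult.commute)
            also have "\<dots> = r powr real (2 * (m - 1))" using r by (simp only: powr_realpow)
            finally show ?thesis by simp
          qed
          have "(t * r ^ m) powr (- (2 * \<alpha>)) = t powr (- (2 * \<alpha>)) * (r powr real m) powr (- (2 * \<alpha>))"
            using t r by (simp add: powr_mult powr_realpow)
          then have 2: "(t * r ^ m) powr (- (2 * \<alpha>)) = t powr (- (2 * \<alpha>)) * r powr (real m * (- (2 * \<alpha>)))"
            by (simp only: powr_powr)
          have 3: "t\<^sup>2 = t powr 2" using t by simp
          have "(t * m * r ^ (m - 1))\<^sup>2 * (t * r ^ m) powr (- (2 * \<alpha>))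
            = m\<^sup>2 * (t\<^sup>2 * t powr (- (2 * \<alpha>))) * ((r ^ (m - 1))\<^sup>2 * r powr (real m * (- (2 * \<alpha>))))"
            unfolding 2 power_mult_distrib by (simp only: mult_ac of_nat_power)
          also have "\<dots> = m\<^sup>2 * t powr (2 + (- (2 * \<alpha>))) * r powr (2 * real (m - 1) + real m * (- (2 * \<alpha>)))"
            by (simp only: 1 3 powr_add)
          also have "\<dots> \<le> m\<^sup>2 * t powr (2 + (- (2 * \<alpha>))) * 1"
            using m r by (intro mult_left_mono powr_le1) (auto simp: of_nat_diff algebra_simps)
          finally show ?thesis by simp
        qed
        have "c r * (\<integral>\<^sup>+y. ?Q y * (\<integral>\<^sup>+x. B x * P (x + (t * r ^ m) *\<^sub>R y) \<partial>lborel) \<partial>lborel)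
           \<le> c r * (ennreal (M * \<bar>t * r ^ m\<bar> powr (- (2 * \<alpha>))) * (\<integral>\<^sup>+x. P x \<partial>lborel))"
        proof (intro mult_left_mono morrey_average[OF B(1)])
          show "t * r ^ m \<noteq> 0" "\<bar>t * r ^ m\<bar> \<le> 1" using tr by linarith+
        qed auto
        also have "\<dots> = ennreal (?d * M * ((t * m * r ^ (m - 1))\<^sup>2 * (t * r ^ m) powr (- (2 * \<alpha>)))) * (\<integral>\<^sup>+x. P x \<partial>lborel)"
        proof -
          have "ennreal (?d * M * ((t * m * r ^ (m - 1))\<^sup>2 * (t * r ^ m) powr (- (2 * \<alpha>)))) = c r * ennreal (M * \<bar>t * r ^ m\<bar> powr (- (2 * \<alpha>)))"
            unfolding c_def using tr B(2) by (subst ennreal_mult[symmetric]) (auto simp: mult_ac)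
          then show ?thesis by (simp add: mult.assoc)
        qed
        also have "\<dots> \<le> ennreal (?d * M * (m\<^sup>2 * t powr (2 - 2 * \<alpha>))) * (\<integral>\<^sup>+x. P x \<partial>lborel)"
          using B(2) by (intro mult_right_mono ennreal_leI mult_left_mono pw) auto
        finally show ?thesis using True by (simp add: PI mult_ac)
      qed simp
    qed
    also have "\<dots> = ennreal (?d * m\<^sup>2 * t powr (2 - 2 * \<alpha>) * M) * ennreal (\<Sum>i\<in>UNIV. (L2_norm lebesgue (pd i g))\<^sup>2)"
      by (subst nn_integral_multc) auto
    finally show "(\<integral>\<^sup>+r. indicator {0<..1} r * (c r * (\<integral>\<^sup>+y. ?Q y * (\<integral>\<^sup>+x. B x * P (x + (t * r ^ m) *\<^sub>R y) \<partial>lborel) \<partial>lborel)) \<partial>lborel)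
       \<le> ennreal (?d * m\<^sup>2 * t powr (2 - 2 * \<alpha>) * M) * ennreal (\<Sum>i\<in>UNIV. (L2_norm lebesgue (pd i g))\<^sup>2)" .
  qed auto
  also have "\<dots> = ennreal (2 * M * (t powr (- (2 * \<alpha>)) * (L2_norm lebesgue g)\<^sup>2 +
      ?d * m\<^sup>2 * t powr (2 - 2 * \<alpha>) * (\<Sum>i\<in>UNIV. (L2_norm lebesgue (pd i g))\<^sup>2)))"
  proof -
    have e2: "(2::ennreal) = ennreal 2" by simp
    have n: "0 \<le> (\<Sum>i\<in>UNIV. (L2_norm lebesgue (pd i g))\<^sup>2)" by (simp add: sum_nonneg)
    show ?thesis
      unfolding e2 using B(2) n
      by (simp only: ennreal_mult[symmetric] ennreal_plus[symmetric] mult_nonneg_nonneg zero_le_power2 powr_ge_zero of_nat_0_le_iff zero_le_numeral add_nonneg_nonneg)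
         (simp add: algebra_simps)
  qed
  finally show ?thesis by (simp add: h_def)
qed

text \<open>Multiplication by \<open>b\<close> is small relative to the gradient, with the length
  scale \<open>t\<close> left free: smaller \<open>t\<close> improves the gradient term and worsens
  the other one. It is used with \<open>t = 1\<close> for plain bounds and with
  \<open>t = \<sigma>\<close>, the scale of the resolvent, for smallness.\<close>

definition form_small :: "real \<Rightarrow> real \<Rightarrow> (real^'n \<Rightarrow> real) \<Rightarrow> bool" where
  "form_small \<kappa> C b \<longleftrightarrow> b \<in> borel_measurable lebesgue \<and> 0 \<le> C \<and>
     (\<forall>g\<in>Cc_infty. \<forall>t. 0 < t \<longrightarrow> t \<le> 1 \<longrightarrow> (\<lambda>x. b x * g x) \<in> L2 lebesgue \<and>
        L2_norm lebesgue (\<lambda>x. b x * g x) \<le>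
          C * (t powr (\<kappa> - 1) * L2_norm lebesgue g + t powr \<kappa> * (\<Sum>i\<in>UNIV. L2_norm lebesgue (pd i g))))"

lemma sum_squares_le_square_sum:
  fixes a :: "'i \<Rightarrow> real"
  assumes "\<And>i. i \<in> I \<Longrightarrow> 0 \<le> a i" "finite I" shows "(\<Sum>i\<in>I. (a i)\<^sup>2) \<le> (\<Sum>i\<in>I. a i)\<^sup>2"
proof -
  have "(\<Sum>i\<in>I. (a i)\<^sup>2) \<le> (\<Sum>i\<in>I. a i * (\<Sum>j\<in>I. a j))"
    unfolding power2_eq_square by (intro sum_mono mult_left_mono member_le_sum assms) (use assms in auto)
  then show ?thesis by (simp add: sum_distrib_right power2_eq_square)
qed

text \<open>The square of \<open>b\<close> has Morrey exponent \<open>2 * \<alpha>\<close> with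
  \<open>\<alpha> = d / p < 1\<close>, and the weighted integral inequality at scale
  \<open>t\<close> is, up to constants, the square of the claim with \<kappa> = 1 -
  \<alpha>.\<close>

lemma Lloc_form_small:
  fixes b :: "real^'n \<Rightarrow> real"
  assumes b: "b \<in> Lloc p" and K: "compact K" and 0: "\<And>x. x \<notin> K \<Longrightarrow> b x = 0"
    and p: "p > real CARD('n)" "p \<ge> 2"
  obtains C where "form_small (1 - real CARD('n) / p) C b"
proof -
  let ?d = "real CARD('n)"
  define \<alpha> where "\<alpha> = ?d / p"
  have \<alpha>: "0 \<le> \<alpha>" "\<alpha> < 1" using p by (auto simp: \<alpha>_def)
  note [measurable] = Lloc_measurable[OF b]
  obtain b' N where b' [measurable]: "b' \<in> borel_measurable borel" and be: "AE x in lebesgue. indicator K x * b x = b' x"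
    and N: "(\<integral>\<^sup>+x. ennreal (\<bar>b' x\<bar> powr p) \<partial>lborel) \<le> ennreal N" "0 \<le> N"
    by (rule Lloc_cutoff_borel[OF b K])
  have be': "AE x in lebesgue. b x = b' x" using be
  proof eventually_elim
    case (elim x)
    then show ?case using 0[of x] by (cases "x \<in> K") auto
  qed
  have "morrey (2 * \<alpha>) (1 + N) (\<lambda>x. ennreal ((b' x)\<^sup>2))"
    using morrey_of_powr[OF b' N, of 2] p by (simp add: \<alpha>_def)
  note mor = this
  obtain m :: nat where m: "m \<ge> 1" "1 \<le> real m * (1 - \<alpha>)"
    using exists_path_exponent[of "1 - \<alpha>"] \<alpha> by auto
  \<comment> \<open>The factor \<open>?d * m\<^sup>2\<close> of the gradient term is at least 1, so
    it may be put in front of the other term as well.\<close>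
  define C where "C = sqrt (2 * (1 + N) * (?d * m\<^sup>2))"
  have d1: "?d * m\<^sup>2 \<ge> 1"
  proof -
    have "1 \<le> CARD('n) * m\<^sup>2" using m(1) by (simp add: Suc_le_eq)
    then show ?thesis by (metis of_nat_1 of_nat_le_iff of_nat_mult)
  qed
  have C: "C \<ge> 0" "C\<^sup>2 = 2 * (1 + N) * (?d * m\<^sup>2)" using N(2) by (auto simp: C_def)
  have "form_small (1 - \<alpha>) C b"
    unfolding form_small_def
  proof (intro conjI ballI allI impI)
    fix g :: "real^'n \<Rightarrow> real" and t :: real assume g: "g \<in> Cc_infty" and t: "0 < t" "t \<le> 1"
    define X where "X = t powr (- \<alpha>) * L2_norm lebesgue g"
    define Y where "Y = t powr (1 - \<alpha>) * (\<Sum>i\<in>UNIV. L2_norm lebesgue (pd i g))"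
    have XY: "X \<ge> 0" "Y \<ge> 0" by (auto simp: X_def Y_def sum_nonneg)
    have [measurable]: "g \<in> borel_measurable borel" "g \<in> borel_measurable lebesgue"
      using Cc_measurable[OF g] smooth_borel_measurable[OF Cc_smooth[OF g]] by auto
    have "(\<integral>\<^sup>+x. ennreal ((b x * g x)\<^sup>2) \<partial>lebesgue) = (\<integral>\<^sup>+x. ennreal ((b' x)\<^sup>2) * ennreal ((g x)\<^sup>2) \<partial>lebesgue)"
      using be' by (intro nn_integral_cong_AE, eventually_elim) (simp add: power_mult_distrib ennreal_mult)
    also have "\<dots> = (\<integral>\<^sup>+x. ennreal ((b' x)\<^sup>2) * ennreal ((g x)\<^sup>2) \<partial>lborel)"
      by (rule nn_integral_lebesgue_borel) measurable
    also have "\<dots> \<le> ennreal (2 * (1 + N) * (t powr (- (2 * \<alpha>)) * (L2_norm lebesgue g)\<^sup>2 +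
      ?d * m\<^sup>2 * t powr (2 - 2 * \<alpha>) * (\<Sum>i\<in>UNIV. (L2_norm lebesgue (pd i g))\<^sup>2)))"
      by (rule morrey_weighted_nn_integral[OF mor _ \<alpha> m g t]) (use N in simp)
    also have "\<dots> \<le> ennreal ((C * (X + Y))\<^sup>2)"
    proof (rule ennreal_leI)
      have e1: "t powr (- (2 * \<alpha>)) = (t powr (- \<alpha>))\<^sup>2" "t powr (2 - 2 * \<alpha>) = (t powr (1 - \<alpha>))\<^sup>2"
        by (simp_all add: power2_eq_square powr_add[symmetric])
      have "t powr (- (2 * \<alpha>)) * (L2_norm lebesgue g)\<^sup>2 = X\<^sup>2"
        by (simp add: X_def e1 power_mult_distrib)
      moreover have "t powr (2 - 2 * \<alpha>) * (\<Sum>i\<in>UNIV. (L2_norm lebesgue (pd i g))\<^sup>2) \<le> Y\<^sup>2"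
        unfolding Y_def e1 power_mult_distrib by (intro mult_left_mono sum_squares_le_square_sum) auto
      ultimately have "t powr (- (2 * \<alpha>)) * (L2_norm lebesgue g)\<^sup>2 + ?d * m\<^sup>2 * t powr (2 - 2 * \<alpha>) * (\<Sum>i\<in>UNIV. (L2_norm lebesgue (pd i g))\<^sup>2)
        \<le> (?d * m\<^sup>2) * X\<^sup>2 + (?d * m\<^sup>2) * Y\<^sup>2"
      proof -
        assume a: "t powr (- (2 * \<alpha>)) * (L2_norm lebesgue g)\<^sup>2 = X\<^sup>2"
          and b: "t powr (2 - 2 * \<alpha>) * (\<Sum>i\<in>UNIV. (L2_norm lebesgue (pd i g))\<^sup>2) \<le> Y\<^sup>2"
        have "1 * X\<^sup>2 \<le> (?d * m\<^sup>2) * X\<^sup>2" by (intro mult_right_mono d1) simp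
        moreover have "(?d * m\<^sup>2) * (t powr (2 - 2 * \<alpha>) * (\<Sum>i\<in>UNIV. (L2_norm lebesgue (pd i g))\<^sup>2)) \<le> (?d * m\<^sup>2) * Y\<^sup>2"
          by (intro mult_left_mono b) simp
        ultimately show ?thesis unfolding a by (simp only: mult.assoc mult_1_left add_mono)
      qed
      also have "\<dots> \<le> (?d * m\<^sup>2) * (X + Y)\<^sup>2"
      proof -
        have "X\<^sup>2 + Y\<^sup>2 \<le> (X + Y)\<^sup>2" using XY by (simp add: power2_sum)
        then show ?thesis using d1 mult_left_mono[of "X\<^sup>2 + Y\<^sup>2" "(X + Y)\<^sup>2" "?d * m\<^sup>2"] by (simp add: distrib_left)
      qed
      finally have "2 * (1 + N) * (t powr (- (2 * \<alpha>)) * (L2_norm lebesgue g)\<^sup>2 + ?d * m\<^sup>2 * t powr (2 - 2 * \<alpha>) * (\<Sum>i\<in>UNIV. (L2_norm lebesgue (pd i g))\<^sup>2))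
        \<le> 2 * (1 + N) * ((?d * m\<^sup>2) * (X + Y)\<^sup>2)" using N(2) by (intro mult_left_mono) auto
      also have "\<dots> = (C * (X + Y))\<^sup>2" by (simp add: power_mult_distrib C(2))
      finally show "2 * (1 + N) * (t powr (- (2 * \<alpha>)) * (L2_norm lebesgue g)\<^sup>2 + ?d * m\<^sup>2 * t powr (2 - 2 * \<alpha>) * (\<Sum>i\<in>UNIV. (L2_norm lebesgue (pd i g))\<^sup>2))
        \<le> (C * (X + Y))\<^sup>2" .
    qed
    finally have le: "(\<integral>\<^sup>+x. ennreal ((b x * g x)\<^sup>2) \<partial>lebesgue) \<le> ennreal ((C * (X + Y))\<^sup>2)" .
    have meas: "(\<lambda>x. b x * g x) \<in> borel_measurable lebesgue" by measurable
    have "0 \<le> C * (X + Y)" using C XY by simp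
    from L2I_nn_integral[OF meas le this]
    show "(\<lambda>x. b x * g x) \<in> L2 lebesgue"
      "L2_norm lebesgue (\<lambda>x. b x * g x) \<le> C * (t powr (1 - \<alpha> - 1) * L2_norm lebesgue g + t powr (1 - \<alpha>) * (\<Sum>i\<in>UNIV. L2_norm lebesgue (pd i g)))"
      by (auto simp: X_def Y_def)
  qed (use C in measurable)
  then show thesis by (intro that) (simp add: \<alpha>_def)
qed

section \<open>The energy estimate\<close>

abbreviation nrm :: "(real^'n \<Rightarrow> real) \<Rightarrow> real" where "nrm \<equiv> L2_norm lebesgue"
abbreviation inn :: "(real^'n \<Rightarrow> real) \<Rightarrow> (real^'n \<Rightarrow> real) \<Rightarrow> real" where "inn \<equiv> L2_inner lebesgue"

text \<open>The operator \<open>div (c \<nabla>f)\<close> in nondivergence form, where \<open>dc k i j\<close> is the weak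
  derivative \<open>\<partial>\<^sub>k c\<^sub>i\<^sub>j\<close>.\<close>
definition divop :: "('n::finite \<Rightarrow> 'n \<Rightarrow> real^'n \<Rightarrow> real) \<Rightarrow> ('n \<Rightarrow> 'n \<Rightarrow> 'n \<Rightarrow> real^'n \<Rightarrow> real)
    \<Rightarrow> (real^'n \<Rightarrow> real) \<Rightarrow> real^'n \<Rightarrow> real" where
  "divop c dc f x = (\<Sum>i\<in>UNIV. \<Sum>j\<in>UNIV. c i j x * pd i (pd j f) x + dc i i j x * pd j f x)"

text \<open>The weak derivative of \<open>c i j\<close> is tested with \<open>v * pd j f\<close>;
  the product rule for that test function leaves precisely the two kinds of terms of
  \<open>divop\<close>.\<close>

lemma divop_green:
  assumes wc: "\<And>k i j. has_weak_partial k (c i j) (dc k i j)" and v: "v \<in> Cc_infty" and f: "f \<in> Cc_infty"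
  shows "integrable lebesgue (\<lambda>x. v x * divop c dc f x)"
    and "(LINT x|lebesgue. v x * divop c dc f x) =
      - (LINT x|lebesgue. (\<Sum>i\<in>UNIV. \<Sum>j\<in>UNIV. c i j x * (pd i v x * pd j f x)))"
proof -
  have i1: "integrable lebesgue (\<lambda>x. c i j x * (pd i v x * pd j f x))"
    "integrable lebesgue (\<lambda>x. c i j x * (v x * pd i (pd j f) x))"
    "integrable lebesgue (\<lambda>x. dc i i j x * (v x * pd j f x))" for i j
    by (intro Lloc_Cc_integrable weak_partial_Lloc[OF wc] Cc_mult Cc_pd v f)+
  have eq: "(LINT x|lebesgue. c i j x * (v x * pd i (pd j f) x)) + (LINT x|lebesgue. dc i i j x * (v x * pd j f x))
      = - (LINT x|lebesgue. c i j x * (pd i v x * pd j f x))" for i j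
  proof -
    have "(LINT x|lebesgue. c i j x * (pd i v x * pd j f x + v x * pd i (pd j f) x)) = - (LINT x|lebesgue. dc i i j x * (v x * pd j f x))"
      using weak_partialD[OF wc[of i i j] Cc_mult[OF v Cc_pd[OF f, of j]]]
      by (simp add: smooth_pd_mult Cc_smooth v f Cc_pd)
    then show ?thesis using i1[of i j] by (simp add: distrib_left)
  qed
  have d: "(\<lambda>x. v x * divop c dc f x) = (\<lambda>x. \<Sum>i\<in>UNIV. \<Sum>j\<in>UNIV. c i j x * (v x * pd i (pd j f) x) + dc i i j x * (v x * pd j f x))"
    unfolding divop_def by (simp add: sum_distrib_left algebra_simps)
  show "integrable lebesgue (\<lambda>x. v x * divop c dc f x)" unfolding d using i1 by simp
  show "(LINT x|lebesgue. v x * divop c dc f x) =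
      - (LINT x|lebesgue. (\<Sum>i\<in>UNIV. \<Sum>j\<in>UNIV. c i j x * (pd i v x * pd j f x)))"
    unfolding d using i1 by (simp add: eq sum_negf)
qed

text \<open>The quantifier over \<open>\<xi>\<close> stands inside the almost-everywhere statement,
  so that the vector may be a gradient at the same point. Bounds and ellipticity are global because
  they are applied to approximations without prescribed support. The quantitative integrability of
  \<open>dc\<close> is retained only in the form \<open>dc_small\<close>.\<close>

locale elliptic =
  fixes c :: "'n::finite \<Rightarrow> 'n \<Rightarrow> real^'n \<Rightarrow> real"
    and dc :: "'n \<Rightarrow> 'n \<Rightarrow> 'n \<Rightarrow> real^'n \<Rightarrow> real"
    and \<Lambda> \<nu> \<kappa> K :: real
  assumes weak_c: "has_weak_partial k (c i j) (dc k i j)"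
    and c_sym: "c i j x = c j i x"
    and c_bdd: "AE x in lebesgue. \<bar>c i j x\<bar> \<le> \<Lambda>"
    and c_ell: "AE x in lebesgue. \<forall>\<xi>. \<nu> * (\<Sum>i\<in>UNIV. (\<xi> i)\<^sup>2) \<le> (\<Sum>i\<in>UNIV. \<Sum>j\<in>UNIV. c i j x * (\<xi> i * \<xi> j))"
    and \<nu>: "\<nu> > 0" and \<Lambda>: "\<Lambda> \<ge> 0" and \<kappa>: "0 < \<kappa>" "\<kappa> \<le> 1"
    and dc_small: "form_small \<kappa> K (dc k i j)"
begin

abbreviation Lop :: "(real^'n \<Rightarrow> real) \<Rightarrow> real^'n \<Rightarrow> real" where
  "Lop \<equiv> divop c dc"

definition Qform :: "(real^'n \<Rightarrow> real) \<Rightarrow> (real^'n \<Rightarrow> real) \<Rightarrow> real" where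
  "Qform v f = (LINT x|lebesgue. (\<Sum>i\<in>UNIV. \<Sum>j\<in>UNIV. c i j x * (pd i v x * pd j f x)))"

section \<open>Bounds for the individual terms in the scale \<sigma>\<close>

lemma K_nonneg: "K \<ge> 0" using dc_small by (auto simp: form_small_def)

lemma c_measurable [measurable]: "c i j \<in> borel_measurable lebesgue"
  using Lloc_measurable[OF weak_partial_Lloc(1)[OF weak_c]] .

lemma dc_measurable [measurable]: "dc k i j \<in> borel_measurable lebesgue"
  using Lloc_measurable[OF weak_partial_Lloc(2)[OF weak_c]] .

lemma c_L2: "F \<in> L2 lebesgue \<Longrightarrow> (\<lambda>x. c i j x * F x) \<in> L2 lebesgue"
  by (rule L2_mult_bounded[OF _ c_measurable c_bdd])

lemma c_nrm: "F \<in> L2 lebesgue \<Longrightarrow> nrm (\<lambda>x. c i j x * F x) \<le> \<Lambda> * nrm F"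
  by (rule L2_norm_bounded_mult[OF _ c_measurable c_bdd \<Lambda>])

lemma dc_L2: "g \<in> Cc_infty \<Longrightarrow> (\<lambda>x. dc k i j x * g x) \<in> L2 lebesgue"
  using dc_small[of k i j] by (auto simp: form_small_def dest!: bspec[of _ _ g] spec[of _ 1])

lemma dc_nrm:
  "g \<in> Cc_infty \<Longrightarrow> 0 < t \<Longrightarrow> t \<le> 1 \<Longrightarrow>
    nrm (\<lambda>x. dc k i j x * g x) \<le> K * (t powr (\<kappa> - 1) * nrm g + t powr \<kappa> * (\<Sum>l\<in>UNIV. nrm (pd l g)))"
  using dc_small[of k i j] by (simp add: form_small_def)

lemma Lop_L2:
  assumes f: "f \<in> Cc_infty" shows "Lop f \<in> L2 lebesgue"
  unfolding divop_def[abs_def] by (intro L2_sum L2_add c_L2 dc_L2 Cc_L2 Cc_pd f)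

lemma green:
  assumes "v \<in> Cc_infty" "f \<in> Cc_infty"
  shows "inn v (Lop f) = - Qform v f"
  using divop_green(2)[of c dc, OF weak_c assms] by (simp add: L2_inner_def Qform_def)

text \<open>The energy norm attached to the resolvent with
  \<open>\<epsilon> = \<sigma>\<^sup>2\<close>. The weight \<sigma> on the second derivatives is the
  one for which it stays bounded as \<sigma> tends to 0.\<close>

definition X :: "real \<Rightarrow> (real^'n \<Rightarrow> real) \<Rightarrow> real" where
  "X \<sigma> v = nrm v + (\<Sum>i\<in>UNIV. nrm (pd i v)) + \<sigma> * (\<Sum>i\<in>UNIV. \<Sum>j\<in>UNIV. nrm (pd i (pd j v)))"

lemma X_bounds:
  assumes "\<sigma> \<ge> 0"
  shows "X \<sigma> v \<ge> 0" "nrm v \<le> X \<sigma> v" "nrm (pd i v) \<le> X \<sigma> v" "nrm v + (\<Sum>i\<in>UNIV. nrm (pd i v)) \<le> X \<sigma> v"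
    "\<sigma> * (\<Sum>l\<in>UNIV. nrm (pd l (pd j v))) \<le> X \<sigma> v" "\<sigma> * nrm (pd i (pd j v)) \<le> X \<sigma> v"
    "\<sigma> * (\<Sum>l\<in>UNIV. nrm (pd l (pd l v))) \<le> X \<sigma> v"
proof -
  have s: "(\<Sum>i\<in>UNIV. nrm (pd i v)) \<ge> 0" "(\<Sum>i\<in>UNIV. \<Sum>j\<in>UNIV. nrm (pd i (pd j v))) \<ge> 0"
    by (auto intro!: sum_nonneg)
  have S: "0 \<le> \<sigma> * (\<Sum>i\<in>UNIV. \<Sum>j\<in>UNIV. nrm (pd i (pd j v)))" using s assms by simp
  have 1: "nrm (pd i v) \<le> (\<Sum>i\<in>UNIV. nrm (pd i v))" for i by (rule member_le_sum) auto
  have 2: "(\<Sum>l\<in>UNIV. nrm (pd l (pd j v))) \<le> (\<Sum>i\<in>UNIV. \<Sum>j\<in>UNIV. nrm (pd i (pd j v)))" for j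
    by (intro sum_mono member_le_sum) auto
  have 3: "nrm (pd i (pd j v)) \<le> (\<Sum>l\<in>UNIV. nrm (pd l (pd j v)))" for i j by (rule member_le_sum) auto
  have 4: "(\<Sum>l\<in>UNIV. nrm (pd l (pd l v))) \<le> (\<Sum>i\<in>UNIV. \<Sum>j\<in>UNIV. nrm (pd i (pd j v)))"
    by (intro sum_mono member_le_sum) auto
  have n: "nrm v \<ge> 0" by simp
  show "X \<sigma> v \<ge> 0" "nrm v \<le> X \<sigma> v" "nrm (pd i v) \<le> X \<sigma> v" "nrm v + (\<Sum>i\<in>UNIV. nrm (pd i v)) \<le> X \<sigma> v"
    using s S n 1[of i] unfolding X_def by linarith+
  show "\<sigma> * (\<Sum>l\<in>UNIV. nrm (pd l (pd j v))) \<le> X \<sigma> v" 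
    using mult_left_mono[OF 2[of j] assms] s n unfolding X_def by linarith
  then show "\<sigma> * nrm (pd i (pd j v)) \<le> X \<sigma> v" using mult_left_mono[OF 3[of i j] assms] by linarith
  show "\<sigma> * (\<Sum>l\<in>UNIV. nrm (pd l (pd l v))) \<le> X \<sigma> v"
    using mult_left_mono[OF 4 assms] s n unfolding X_def by linarith
qed

lemma powr_ge_self: "0 < \<sigma> \<Longrightarrow> \<sigma> \<le> 1 \<Longrightarrow> \<sigma> \<le> \<sigma> powr \<kappa>"
  using powr_mono'[of \<kappa> 1 \<sigma>] \<kappa> by simp

text \<open>\<open>dc_small\<close> at the scale \<open>t = \<sigma>\<close>: the factor \<sigma> in
  front turns \<open>\<sigma> powr (\<kappa> - 1)\<close> into \<open>\<sigma> powr \<kappa>\<close>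
  and supplies the weight of the second derivatives in \<open>X\<close>.\<close>

lemma dc_pd_nrm:
  assumes v: "v \<in> Cc_infty" and \<sigma>: "0 < \<sigma>" "\<sigma> \<le> 1"
  shows "\<sigma> * nrm (\<lambda>x. dc k i j x * pd l v x) \<le> 2 * K * \<sigma> powr \<kappa> * X \<sigma> v"
proof -
  have "nrm (\<lambda>x. dc k i j x * pd l v x) \<le> K * (\<sigma> powr (\<kappa> - 1) * nrm (pd l v) + \<sigma> powr \<kappa> * (\<Sum>l'\<in>UNIV. nrm (pd l' (pd l v))))"
    by (rule dc_nrm[OF Cc_pd[OF v] \<sigma>])
  then have "\<sigma> * nrm (\<lambda>x. dc k i j x * pd l v x) \<le> \<sigma> * (K * (\<sigma> powr (\<kappa> - 1) * nrm (pd l v) + \<sigma> powr \<kappa> * (\<Sum>l'\<in>UNIV. nrm (pd l' (pd l v)))))"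
    using \<sigma> by (intro mult_left_mono) auto
  also have "\<dots> = K * ((\<sigma> * \<sigma> powr (\<kappa> - 1)) * nrm (pd l v) + \<sigma> powr \<kappa> * (\<sigma> * (\<Sum>l'\<in>UNIV. nrm (pd l' (pd l v)))))"
    by (simp add: algebra_simps)
  also have "\<sigma> * \<sigma> powr (\<kappa> - 1) = \<sigma> powr \<kappa>" using \<sigma> powr_add[of \<sigma> 1 "\<kappa> - 1"] by simp
  also have "K * (\<sigma> powr \<kappa> * nrm (pd l v) + \<sigma> powr \<kappa> * (\<sigma> * (\<Sum>l'\<in>UNIV. nrm (pd l' (pd l v)))))
     \<le> K * (\<sigma> powr \<kappa> * X \<sigma> v + \<sigma> powr \<kappa> * X \<sigma> v)"
    using \<sigma> K_nonneg by (intro mult_left_mono add_mono X_bounds) auto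
  finally show ?thesis by (simp add: algebra_simps)
qed

lemma dc_self_nrm:
  assumes v: "v \<in> Cc_infty" and \<sigma>: "0 < \<sigma>"
  shows "nrm (\<lambda>x. dc k i j x * v x) \<le> K * X \<sigma> v"
proof -
  have "nrm (\<lambda>x. dc k i j x * v x) \<le> K * (nrm v + (\<Sum>l\<in>UNIV. nrm (pd l v)))"
    using dc_nrm[OF v, of 1] by simp
  also have "\<dots> \<le> K * X \<sigma> v" using K_nonneg \<sigma> by (intro mult_left_mono X_bounds) auto
  finally show ?thesis .
qed

lemma dc_pd_self_nrm:
  assumes f: "f \<in> Cc_infty" and \<sigma>: "0 < \<sigma>" "\<sigma> \<le> 1"
  shows "\<sigma> * nrm (\<lambda>x. dc k i j x * f x) \<le> K * \<sigma> powr \<kappa> * X \<sigma> f"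
proof -
  have "\<sigma> * nrm (\<lambda>x. dc k i j x * f x) \<le> \<sigma> powr \<kappa> * (K * X \<sigma> f)"
    using \<sigma> powr_ge_self dc_self_nrm[OF f] by (intro mult_mono) auto
  then show ?thesis by (simp add: mult_ac)
qed

text \<open>Two instances occur: the constant 1 for the global bound and
  \<open>\<theta>\<^sup>2\<close> for the local inequality. The first is the reason why smoothness
  with bounds stands in place of compact support.\<close>

definition mild :: "real \<Rightarrow> (real^'n \<Rightarrow> real) \<Rightarrow> bool" where
  "mild Z \<zeta> \<longleftrightarrow> smooth \<zeta> \<and> (\<forall>x. 0 \<le> \<zeta> x) \<and> (\<forall>x. \<bar>\<zeta> x\<bar> \<le> Z) \<and> (\<forall>i x. \<bar>pd i \<zeta> x\<bar> \<le> Z) \<and> (\<forall>i j x. \<bar>pd i (pd j \<zeta>) x\<bar> \<le> Z)"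

lemma mild_nonneg: "mild Z \<zeta> \<Longrightarrow> Z \<ge> 0"
  unfolding mild_def by (meson abs_ge_zero order_trans)

lemma bounded_smooth_L2:
  assumes "smooth \<theta>" "\<And>x. \<bar>\<theta> x\<bar> \<le> Z" "F \<in> L2 lebesgue"
  shows "(\<lambda>x. \<theta> x * F x) \<in> L2 lebesgue" "nrm (\<lambda>x. \<theta> x * F x) \<le> Z * nrm F"
proof -
  have Z: "Z \<ge> 0" using assms(2)[of 0] by linarith
  show "(\<lambda>x. \<theta> x * F x) \<in> L2 lebesgue"
    by (rule L2_mult_bounded[OF assms(3) smooth_measurable[OF assms(1)], of Z]) (simp add: assms)
  show "nrm (\<lambda>x. \<theta> x * F x) \<le> Z * nrm F"
    by (rule L2_norm_bounded_mult[OF assms(3) smooth_measurable[OF assms(1)] _ Z]) (simp add: assms)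
qed

text \<open>Since \<sigma> \<le> 1, the factor \<sigma> is at most
  \<open>\<sigma> powr \<kappa>\<close>. The constant is enlarged to the one of
  \<open>dc_term_bound\<close>, so that all lower-order terms are treated alike.\<close>

lemma c_term_bound:
  assumes \<theta>: "smooth \<theta>" "\<And>x. \<bar>\<theta> x\<bar> \<le> Z" and F: "F \<in> L2 lebesgue" "nrm F \<le> B" and \<sigma>: "0 < \<sigma>" "\<sigma> \<le> 1"
  shows "(\<lambda>x. c i j x * (\<theta> x * F x)) \<in> L2 lebesgue"
    "\<sigma> * nrm (\<lambda>x. c i j x * (\<theta> x * F x)) \<le> Z * (\<Lambda> + 2 * K) * \<sigma> powr \<kappa> * B"
proof -
  have Z: "Z \<ge> 0" using \<theta>(2)[of 0] by linarith
  note L = bounded_smooth_L2[OF \<theta> F(1)]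
  show "(\<lambda>x. c i j x * (\<theta> x * F x)) \<in> L2 lebesgue" by (rule c_L2[OF L(1)])
  have B: "0 \<le> B" using F(2) L2_norm_nonneg[of lebesgue F] by linarith
  have "nrm (\<lambda>x. c i j x * (\<theta> x * F x)) \<le> \<Lambda> * (Z * B)"
    using c_nrm[OF L(1), of i j] L(2) mult_left_mono[OF F(2) Z] mult_left_mono[of "nrm (\<lambda>x. \<theta> x * F x)" "Z * B" \<Lambda>] \<Lambda> by linarith
  then have "\<sigma> * nrm (\<lambda>x. c i j x * (\<theta> x * F x)) \<le> \<sigma> powr \<kappa> * (\<Lambda> * (Z * B))"
    using \<sigma> powr_ge_self by (intro mult_mono) auto
  also have "\<dots> \<le> \<sigma> powr \<kappa> * ((\<Lambda> + 2 * K) * (Z * B))"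
    using K_nonneg Z B by (intro mult_left_mono mult_right_mono) auto
  finally show "\<sigma> * nrm (\<lambda>x. c i j x * (\<theta> x * F x)) \<le> Z * (\<Lambda> + 2 * K) * \<sigma> powr \<kappa> * B"
    by (simp add: mult_ac)
qed

lemma dc_term_bound:
  assumes \<theta>: "smooth \<theta>" "\<And>x. \<bar>\<theta> x\<bar> \<le> Z" and f: "f \<in> Cc_infty"
    and B: "\<sigma> * nrm (\<lambda>x. dc k i j x * f x) \<le> 2 * K * \<sigma> powr \<kappa> * B" "0 \<le> B" and \<sigma>: "0 < \<sigma>"
  shows "(\<lambda>x. dc k i j x * (\<theta> x * f x)) \<in> L2 lebesgue"
    "\<sigma> * nrm (\<lambda>x. dc k i j x * (\<theta> x * f x)) \<le> Z * (\<Lambda> + 2 * K) * \<sigma> powr \<kappa> * B"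
proof -
  have Z: "Z \<ge> 0" using \<theta>(2)[of 0] by linarith
  note L = bounded_smooth_L2[OF \<theta> dc_L2[OF f, of k i j]]
  show "(\<lambda>x. dc k i j x * (\<theta> x * f x)) \<in> L2 lebesgue" using L(1) by (simp add: mult.left_commute)
  have "\<sigma> * nrm (\<lambda>x. dc k i j x * (\<theta> x * f x)) \<le> \<sigma> * (Z * nrm (\<lambda>x. dc k i j x * f x))"
    using L(2) \<sigma> by (intro mult_left_mono) (simp_all add: mult.left_commute)
  also have "\<dots> = Z * (\<sigma> * nrm (\<lambda>x. dc k i j x * f x))" by simp
  also have "\<dots> \<le> Z * (2 * K * \<sigma> powr \<kappa> * B)" by (intro mult_left_mono B Z)
  also have "\<dots> \<le> Z * ((\<Lambda> + 2 * K) * \<sigma> powr \<kappa> * B)"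
    using \<Lambda> Z B(2) by (intro mult_left_mono mult_right_mono) auto
  finally show "\<sigma> * nrm (\<lambda>x. dc k i j x * (\<theta> x * f x)) \<le> Z * (\<Lambda> + 2 * K) * \<sigma> powr \<kappa> * B" by (simp add: mult_ac)
qed

lemma inner_sigma_bound:
  assumes "F \<in> L2 lebesgue" "G \<in> L2 lebesgue" "\<sigma> > 0" "\<sigma> * nrm F \<le> a" "\<sigma> * nrm G \<le> b" "0 \<le> a"
  shows "\<bar>\<sigma>\<^sup>2 * inn F G\<bar> \<le> a * b"
proof -
  have "\<bar>\<sigma>\<^sup>2 * inn F G\<bar> \<le> \<sigma>\<^sup>2 * (nrm F * nrm G)"
    using L2_Cauchy_Schwarz[OF assms(1,2)] by (simp add: abs_mult mult_left_mono)
  also have "\<dots> = (\<sigma> * nrm F) * (\<sigma> * nrm G)" by (simp add: power2_eq_square)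
  also have "\<dots> \<le> a * b" using assms by (intro mult_mono) auto
  finally show ?thesis .
qed

text \<open>Two integrations by parts move the derivatives from \<open>v\<^sub>k\<^sub>k v\<^sub>i\<^sub>j\<close> to \<open>v\<^sub>i\<^sub>k v\<^sub>j\<^sub>k\<close>; the third
  derivatives cancel.\<close>
lemma second_order_identity:
  assumes v: "v \<in> Cc_infty" and \<zeta>: "mild Z \<zeta>"
  shows "(LINT x|lebesgue. c i j x * (\<zeta> x * pd k (pd k v) x * pd i (pd j v) x)) =
    (LINT x|lebesgue. c i j x * (\<zeta> x * pd i (pd k v) x * pd j (pd k v) x))
    + inn (\<lambda>x. c i j x * (pd i \<zeta> x * pd k v x)) (pd j (pd k v))
    - inn (\<lambda>x. c i j x * (pd k \<zeta> x * pd k v x)) (pd i (pd j v))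
    + inn (\<lambda>x. dc i i j x * (\<zeta> x * pd k v x)) (pd j (pd k v))
    - inn (\<lambda>x. dc k i j x * (\<zeta> x * pd k v x)) (pd i (pd j v))"
proof -
  have s\<zeta>: "smooth \<zeta>" using \<zeta> by (simp add: mild_def)
  note sv = Cc_smooth[OF v]
  have cp: "(\<lambda>x. \<zeta> x * pd k v x * pd a (pd b v) x) \<in> Cc_infty" for a b
    by (intro Cc_mult smooth_Cc_mult s\<zeta> Cc_pd v)
  have pdp: "pd l (\<lambda>x. \<zeta> x * pd k v x * pd a (pd b v) x) =
     (\<lambda>x. pd l \<zeta> x * pd k v x * pd a (pd b v) x + \<zeta> x * pd l (pd k v) x * pd a (pd b v) x + \<zeta> x * pd k v x * pd l (pd a (pd b v)) x)" for l a b
    by (simp add: smooth_pd_mult smooth_mult smooth_pd s\<zeta> sv distrib_right)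
  have int: "integrable lebesgue (\<lambda>x. c i j x * (pd l \<zeta> x * pd k v x * pd a (pd b v) x))"
    "integrable lebesgue (\<lambda>x. c i j x * (\<zeta> x * pd l (pd k v) x * pd a (pd b v) x))"
    "integrable lebesgue (\<lambda>x. c i j x * (\<zeta> x * pd k v x * pd l (pd a (pd b v)) x))" for l a b
    by (intro Lloc_Cc_integrable weak_partial_Lloc[OF weak_c] Cc_mult smooth_Cc_mult s\<zeta> smooth_pd Cc_pd v)+
  have E: "(LINT x|lebesgue. c i j x * (pd l \<zeta> x * pd k v x * pd a (pd b v) x)) +
     (LINT x|lebesgue. c i j x * (\<zeta> x * pd l (pd k v) x * pd a (pd b v) x)) +
     (LINT x|lebesgue. c i j x * (\<zeta> x * pd k v x * pd l (pd a (pd b v)) x)) =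
     - (LINT x|lebesgue. dc l i j x * (\<zeta> x * pd k v x * pd a (pd b v) x))" for l a b
    using weak_partialD[OF weak_c[of l i j] cp[of a b]] int[of l a b] unfolding pdp distrib_left by simp
  \<comment> \<open>The instances of \<open>E\<close> with \<open>l = k\<close> and with
    \<open>l = i\<close> contain the same third derivative, which drops out of their
    difference.\<close>
  have comm: "pd k (pd i (pd j v)) = pd i (pd j (pd k v))"
    using pd_commute[OF sv, of k j] pd_commute[OF smooth_pd[OF sv, of j], of k i] by simp
  show ?thesis
    using E[of k i j] E[of i j k] unfolding comm L2_inner_def by (simp add: mult.assoc)
qed

text \<open>Each of the four correction terms pairs a factor that, multiplied by \<sigma>, is of
  order \<open>\<sigma> powr \<kappa> * X \<sigma> v\<close> with a second derivative of
  \<open>v\<close>, which multiplied by \<sigma> is at most \<open>X \<sigma> v\<close>.\<close>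

lemma second_order_lower:
  assumes v: "v \<in> Cc_infty" and \<zeta>: "mild Z \<zeta>" and \<sigma>: "0 < \<sigma>" "\<sigma> \<le> 1"
  shows "\<sigma>\<^sup>2 * (LINT x|lebesgue. c i j x * (\<zeta> x * pd k (pd k v) x * pd i (pd j v) x)) \<ge>
    \<sigma>\<^sup>2 * (LINT x|lebesgue. c i j x * (\<zeta> x * pd i (pd k v) x * pd j (pd k v) x))
    - 4 * (Z * (\<Lambda> + 2 * K) * \<sigma> powr \<kappa> * X \<sigma> v * X \<sigma> v)"
proof -
  have z: "smooth \<zeta>" "\<And>x. \<bar>\<zeta> x\<bar> \<le> Z" "\<And>i. smooth (pd i \<zeta>)" "\<And>i x. \<bar>pd i \<zeta> x\<bar> \<le> Z"
    using \<zeta> smooth_pd by (auto simp: mild_def)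
  have s0: "0 \<le> \<sigma>" using \<sigma> by simp
  note Xb = X_bounds[OF s0, where v = v]
  have Z: "Z \<ge> 0" by (rule mild_nonneg[OF \<zeta>])
  define a where "a = Z * (\<Lambda> + 2 * K) * \<sigma> powr \<kappa> * X \<sigma> v"
  have a: "0 \<le> a" unfolding a_def using Z \<Lambda> K_nonneg Xb(1) by simp
  have L: "pd a (pd b v) \<in> L2 lebesgue" "pd k v \<in> L2 lebesgue" for a b by (intro Cc_L2 Cc_pd v)+
  have c: "\<bar>\<sigma>\<^sup>2 * inn (\<lambda>x. c i j x * (pd l \<zeta> x * pd k v x)) (pd p (pd q v))\<bar> \<le> a * X \<sigma> v" for l p q
    using c_term_bound[OF z(3,4)[of l] L(2) Xb(3) \<sigma>, of i j]
    by (intro inner_sigma_bound L \<sigma> Xb a) (auto simp: a_def)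
  have d: "\<bar>\<sigma>\<^sup>2 * inn (\<lambda>x. dc l i j x * (\<zeta> x * pd k v x)) (pd p (pd q v))\<bar> \<le> a * X \<sigma> v" for l p q
    using dc_term_bound[OF z(1,2) Cc_pd[OF v] dc_pd_nrm[OF v \<sigma>] Xb(1) \<sigma>(1), of l i j k]
    by (intro inner_sigma_bound L \<sigma> Xb a) (auto simp: a_def)
  show ?thesis
    unfolding second_order_identity[OF v \<zeta>, of i j k] a_def[symmetric]
    using c[of i j k] c[of k i j] d[of i j k] d[of k i j] unfolding right_diff_distrib distrib_left by linarith
qed

text \<open>Write \<open>w = v - \<sigma>\<^sup>2 \<Delta>v - E\<close>. Green's formula turns the
  part \<open>v\<close> into \<open>Qform\<close>. The Laplacian against the second-order part of
  \<open>Lop (\<zeta> v)\<close> yields the coercive term, and against the rest a term of order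
  \<open>\<sigma> powr \<kappa>\<close>. The constant depends on \<open>Z\<close> and the parameters
  of the locale alone, so it is fixed before \<sigma> is made small.\<close>

lemma energy_lower_bound:
  assumes Z: "Z \<ge> 0"
  obtains C where "C \<ge> 0" "\<And>v \<zeta> \<sigma> w. v \<in> Cc_infty \<Longrightarrow> mild Z \<zeta> \<Longrightarrow> 0 < \<sigma> \<Longrightarrow> \<sigma> \<le> 1 \<Longrightarrow> w \<in> L2 lebesgue \<Longrightarrow>
     nrm (\<lambda>x. v x - \<sigma>\<^sup>2 * laplace v x - w x) \<le> \<sigma>\<^sup>2 \<Longrightarrow>
     - inn w (Lop (\<lambda>x. \<zeta> x * v x)) \<ge> Qform v (\<lambda>x. \<zeta> x * v x)
       + \<nu> * \<sigma>\<^sup>2 * (\<Sum>k\<in>UNIV. \<Sum>i\<in>UNIV. LINT x|lebesgue. \<zeta> x * (pd i (pd k v) x)\<^sup>2) - C * \<sigma> powr \<kappa> * (1 + (X \<sigma> v)\<^sup>2)"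
proof -
  let ?d = "real CARD('n)"
  define M where "M = Z * (\<Lambda> + 2 * K)"
  have M: "M \<ge> 0" using Z \<Lambda> K_nonneg by (simp add: M_def)
  \<comment> \<open>\<open>C1\<close> counts the four errors of \<open>second_order_lower\<close>
    over three indices, \<open>C2\<close> the five summands of \<open>G\<close> over two, and
    \<open>C3\<close> bounds \<sigma> times all of \<open>Lop (\<zeta> v)\<close>.\<close>
  define C1 where "C1 = ?d * (?d * (4 * M * ?d))"
  define C2 where "C2 = ?d * (?d * (5 * M))"
  define C3 where "C3 = ?d * (?d * (\<Lambda> * Z)) + C2"
  have C123: "C1 \<ge> 0" "C2 \<ge> 0" "C3 \<ge> 0" using M Z \<Lambda> by (auto simp: C1_def C2_def C3_def)
  show thesis
  proof (rule that[of "C1 + C2 + C3"])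
    show "0 \<le> C1 + C2 + C3" using C123 by simp
    fix v \<zeta> w :: "real^'n \<Rightarrow> real" and \<sigma> :: real
    assume v: "v \<in> Cc_infty" and \<zeta>: "mild Z \<zeta>" and \<sigma>: "0 < \<sigma>" "\<sigma> \<le> 1" and w: "w \<in> L2 lebesgue"
      and e: "nrm (\<lambda>x. v x - \<sigma>\<^sup>2 * laplace v x - w x) \<le> \<sigma>\<^sup>2"
    define Y where "Y = X \<sigma> v"
    define s where "s = \<sigma> powr \<kappa>"
    have s0: "0 \<le> \<sigma>" using \<sigma> by simp
    note Xb = X_bounds[OF s0, where v = v]
    have Y: "Y \<ge> 0" and s: "s \<ge> 0" "\<sigma> \<le> s" "s \<le> 1"
      using Xb(1) powr_ge_self[OF \<sigma>] \<sigma> \<kappa> by (auto simp: Y_def s_def intro: powr_le1)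
    have z: "smooth \<zeta>" "\<And>x. \<bar>\<zeta> x\<bar> \<le> Z" "\<And>i. smooth (pd i \<zeta>)" "\<And>i x. \<bar>pd i \<zeta> x\<bar> \<le> Z"
       "\<And>i j. smooth (pd i (pd j \<zeta>))" "\<And>i j x. \<bar>pd i (pd j \<zeta>) x\<bar> \<le> Z" "\<And>x. 0 \<le> \<zeta> x"
      using \<zeta> by (auto simp: mild_def smooth_pd)
    note sv = Cc_smooth[OF v]
    have zv: "(\<lambda>x. \<zeta> x * v x) \<in> Cc_infty" by (rule smooth_Cc_mult[OF z(1) v])
    \<comment> \<open>\<open>P\<close> carries the second derivatives of \<open>v\<close>; the
      summands of \<open>G\<close> have at most one derivative on \<open>v\<close>. Multiplied by
      \<sigma>, the norm of \<open>P\<close> is merely of order \<open>Y\<close>, that of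
      \<open>G\<close> of order \<open>s * Y\<close>.\<close>
    define P where "P x = (\<Sum>i\<in>UNIV. \<Sum>j\<in>UNIV. c i j x * (\<zeta> x * pd i (pd j v) x))" for x
    define G where "G x = (\<Sum>i\<in>UNIV. \<Sum>j\<in>UNIV. c i j x * (pd i (pd j \<zeta>) x * v x) + c i j x * (pd j \<zeta> x * pd i v x)
       + c i j x * (pd i \<zeta> x * pd j v x) + dc i i j x * (\<zeta> x * pd j v x) + dc i i j x * (pd j \<zeta> x * v x))" for x
    have LPG: "Lop (\<lambda>x. \<zeta> x * v x) = (\<lambda>x. P x + G x)"
    proof
      fix x
      have "pd i (pd j (\<lambda>x. \<zeta> x * v x)) x = pd i (pd j \<zeta>) x * v x + pd j \<zeta> x * pd i v x + pd i \<zeta> x * pd j v x + \<zeta> x * pd i (pd j v) x" for i j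
        by (simp add: smooth_pd_mult smooth_pd_add smooth_mult smooth_pd z(1) sv)
      then show "Lop (\<lambda>x. \<zeta> x * v x) x = P x + G x"
        unfolding divop_def P_def G_def
        by (simp add: smooth_pd_mult z(1) sv sum.distrib[symmetric] algebra_simps)
    qed
    have L: "v \<in> L2 lebesgue" "pd i v \<in> L2 lebesgue" "pd i (pd j v) \<in> L2 lebesgue" for i j
      by (intro Cc_L2 Cc_pd v)+
    have t1: "(\<lambda>x. c i j x * (pd i (pd j \<zeta>) x * v x)) \<in> L2 lebesgue" "\<sigma> * nrm (\<lambda>x. c i j x * (pd i (pd j \<zeta>) x * v x)) \<le> M * s * Y" for i j
      using c_term_bound[OF z(5,6)[of i j] L(1) Xb(2) \<sigma>, of i j] by (auto simp: M_def s_def Y_def)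
    have t2: "(\<lambda>x. c i j x * (pd k \<zeta> x * pd l v x)) \<in> L2 lebesgue" "\<sigma> * nrm (\<lambda>x. c i j x * (pd k \<zeta> x * pd l v x)) \<le> M * s * Y" for i j k l
      using c_term_bound[OF z(3,4)[of k] L(2) Xb(3) \<sigma>, of i j l] by (auto simp: M_def s_def Y_def)
    have t3: "(\<lambda>x. dc i i j x * (\<zeta> x * pd j v x)) \<in> L2 lebesgue" "\<sigma> * nrm (\<lambda>x. dc i i j x * (\<zeta> x * pd j v x)) \<le> M * s * Y" for i j
      using dc_term_bound[OF z(1,2) Cc_pd[OF v] dc_pd_nrm[OF v \<sigma>] Xb(1) \<sigma>(1), of i i j j] by (auto simp: M_def s_def Y_def)
    have t4: "(\<lambda>x. dc i i j x * (pd j \<zeta> x * v x)) \<in> L2 lebesgue" "\<sigma> * nrm (\<lambda>x. dc i i j x * (pd j \<zeta> x * v x)) \<le> M * s * Y" for i j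
    proof -
      have "\<sigma> * nrm (\<lambda>x. dc i i j x * v x) \<le> 2 * K * \<sigma> powr \<kappa> * X \<sigma> v"
      proof -
        have "0 \<le> K * \<sigma> powr \<kappa> * X \<sigma> v" using K_nonneg Xb(1) by simp
        moreover have "2 * K * \<sigma> powr \<kappa> * X \<sigma> v = 2 * (K * \<sigma> powr \<kappa> * X \<sigma> v)" by (simp only: mult.assoc)
        ultimately show ?thesis using dc_pd_self_nrm[OF v \<sigma>, of i i j] by linarith
      qed
      from dc_term_bound[OF z(3,4)[of j] v this Xb(1) \<sigma>(1)]
      show "(\<lambda>x. dc i i j x * (pd j \<zeta> x * v x)) \<in> L2 lebesgue" "\<sigma> * nrm (\<lambda>x. dc i i j x * (pd j \<zeta> x * v x)) \<le> M * s * Y"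
        by (auto simp: M_def s_def Y_def)
    qed
    have tri: "\<sigma> * nrm (\<lambda>x. F x + H x) \<le> a + b" if "F \<in> L2 lebesgue" "H \<in> L2 lebesgue" "\<sigma> * nrm F \<le> a" "\<sigma> * nrm H \<le> b" for F H a b
      using mult_left_mono[OF L2_norm_triangle[OF that(1,2)] s0] that(3,4) by (simp add: distrib_left)
    have trisum: "\<sigma> * nrm (\<lambda>x. \<Sum>j\<in>UNIV. F j x) \<le> ?d * a" if "\<And>j::'n. F j \<in> L2 lebesgue" "\<And>j. \<sigma> * nrm (F j) \<le> a" for F a
    proof -
      have "\<sigma> * nrm (\<lambda>x. \<Sum>j\<in>UNIV. F j x) \<le> \<sigma> * (\<Sum>j\<in>UNIV. nrm (F j))"
        by (intro mult_left_mono L2_norm_sum that s0)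
      also have "\<dots> \<le> (\<Sum>j\<in>(UNIV::'n set). a)" unfolding sum_distrib_left by (intro sum_mono that)
      finally show ?thesis by simp
    qed
    have GL: "G \<in> L2 lebesgue" unfolding G_def[abs_def]
      by (intro L2_sum L2_add t1 t2 t3 t4)
    have Gn: "\<sigma> * nrm G \<le> C2 * s * Y"
    proof -
      have "\<sigma> * nrm G \<le> ?d * (?d * (M * s * Y + M * s * Y + M * s * Y + M * s * Y + M * s * Y))"
        unfolding G_def[abs_def] by (intro trisum tri L2_sum L2_add t1 t2 t3 t4)
      then show ?thesis by (simp add: C2_def algebra_simps)
    qed
    have PL: "P \<in> L2 lebesgue" unfolding P_def[abs_def]
      by (intro L2_sum c_L2 bounded_smooth_L2[OF z(1,2)] L)
    have Pn: "\<sigma> * nrm P \<le> ?d * (?d * (\<Lambda> * Z)) * Y"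
    proof -
      have "\<sigma> * nrm (\<lambda>x. c i j x * (\<zeta> x * pd i (pd j v) x)) \<le> \<Lambda> * Z * Y" for i j
      proof -
        have b: "nrm (\<lambda>x. \<zeta> x * pd i (pd j v) x) \<le> Z * nrm (pd i (pd j v))" by (rule bounded_smooth_L2[OF z(1,2) L(3)])
        have "nrm (\<lambda>x. c i j x * (\<zeta> x * pd i (pd j v) x)) \<le> \<Lambda> * (Z * nrm (pd i (pd j v)))"
          using c_nrm[OF bounded_smooth_L2(1)[OF z(1,2) L(3)[of i j]], of i j] mult_left_mono[OF b \<Lambda>] by linarith
        then have "\<sigma> * nrm (\<lambda>x. c i j x * (\<zeta> x * pd i (pd j v) x)) \<le> \<sigma> * (\<Lambda> * (Z * nrm (pd i (pd j v))))"
          by (intro mult_left_mono s0)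
        also have "\<dots> = (\<Lambda> * Z) * (\<sigma> * nrm (pd i (pd j v)))" by (simp add: mult_ac)
        also have "\<dots> \<le> (\<Lambda> * Z) * Y" unfolding Y_def using \<Lambda> Z by (intro mult_left_mono Xb) auto
        finally show ?thesis .
      qed
      then have "\<sigma> * nrm P \<le> ?d * (?d * (\<Lambda> * Z * Y))"
        unfolding P_def[abs_def] by (intro trisum L2_sum c_L2 bounded_smooth_L2[OF z(1,2)] L)
      then show ?thesis by (simp add: mult_ac)
    qed
    have lap: "laplace v \<in> L2 lebesgue" "\<sigma> * nrm (laplace v) \<le> Y"
    proof -
      show "laplace v \<in> L2 lebesgue" by (rule Cc_L2[OF laplace_Cc[OF v]])
      have "nrm (laplace v) \<le> (\<Sum>l\<in>UNIV. nrm (pd l (pd l v)))"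
        unfolding laplace_def[abs_def] by (rule L2_norm_sum) (rule L)
      then show "\<sigma> * nrm (laplace v) \<le> Y"
        using mult_left_mono[OF _ s0] Xb(7) unfolding Y_def by (meson order_trans)
    qed
    have LG: "\<bar>\<sigma>\<^sup>2 * inn (laplace v) G\<bar> \<le> Y * (C2 * s * Y)"
      by (rule inner_sigma_bound[OF lap(1) GL \<sigma>(1) lap(2) Gn Y])
    define E where "E x = v x - \<sigma>\<^sup>2 * laplace v x - w x" for x
    have EL: "E \<in> L2 lebesgue" unfolding E_def by (intro L2_diff L2_cmult L lap w)
    \<comment> \<open>The tolerance \<open>\<sigma>\<^sup>2\<close> provides one factor \<sigma> for
      the second derivatives in \<open>P\<close> and a spare one, which is at most
      \<open>s\<close>.\<close>
    have EPG: "inn E (\<lambda>x. P x + G x) \<ge> - (C3 * s * (1 + Y\<^sup>2))"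
    proof -
      have PGL: "(\<lambda>x. P x + G x) \<in> L2 lebesgue" by (intro L2_add PL GL)
      have C3Y: "\<sigma> * nrm (\<lambda>x. P x + G x) \<le> C3 * Y"
      proof -
        have "C2 * s * Y \<le> C2 * 1 * Y" using C123 Y s by (intro mult_right_mono mult_left_mono) auto
        then show ?thesis using tri[OF PL GL Pn Gn] by (simp add: C3_def distrib_right)
      qed
      have "\<bar>inn E (\<lambda>x. P x + G x)\<bar> \<le> nrm E * nrm (\<lambda>x. P x + G x)" by (rule L2_Cauchy_Schwarz[OF EL PGL])
      also have "\<dots> \<le> \<sigma>\<^sup>2 * nrm (\<lambda>x. P x + G x)"
        using e by (intro mult_right_mono) (auto simp: E_def[abs_def])
      also have "\<dots> = \<sigma> * (\<sigma> * nrm (\<lambda>x. P x + G x))" by (simp add: power2_eq_square)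
      also have "\<dots> \<le> s * (C3 * (1 + Y\<^sup>2))"
      proof (rule mult_mono[OF s(2)])
        have "0 \<le> (Y - 1)\<^sup>2" by simp
        then have "Y \<le> 1 + Y\<^sup>2" using Y by (simp add: power2_diff)
        then have "C3 * Y \<le> C3 * (1 + Y\<^sup>2)" using C123 by (intro mult_left_mono) auto
        then show "\<sigma> * nrm (\<lambda>x. P x + G x) \<le> C3 * (1 + Y\<^sup>2)" using C3Y by linarith
      qed (use s0 s in auto)
      finally show ?thesis by (simp add: mult_ac)
    qed
    have intc: "integrable lebesgue (\<lambda>x. c i j x * (\<zeta> x * pd a (pd b v) x * pd p (pd q v) x))" for i j a b p q
      by (intro Lloc_Cc_integrable weak_partial_Lloc[OF weak_c] Cc_mult smooth_Cc_mult z Cc_pd v)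
    have intz: "integrable lebesgue (\<lambda>x. \<zeta> x * (pd i (pd k v) x)\<^sup>2)" for i k
      unfolding power2_eq_square by (intro Cc_integrable smooth_Cc_mult z Cc_mult Cc_pd v)
    have LP: "\<sigma>\<^sup>2 * inn (laplace v) P \<ge> \<nu> * \<sigma>\<^sup>2 * (\<Sum>k\<in>UNIV. \<Sum>i\<in>UNIV. LINT x|lebesgue. \<zeta> x * (pd i (pd k v) x)\<^sup>2) - C1 * s * Y\<^sup>2"
    proof -
      have "inn (laplace v) P = (\<Sum>k\<in>UNIV. \<Sum>i\<in>UNIV. \<Sum>j\<in>UNIV. LINT x|lebesgue. c i j x * (\<zeta> x * pd k (pd k v) x * pd i (pd j v) x))"
      proof -
        have "(\<lambda>x. laplace v x * P x) = (\<lambda>x. \<Sum>k\<in>UNIV. \<Sum>i\<in>UNIV. \<Sum>j\<in>UNIV. c i j x * (\<zeta> x * pd k (pd k v) x * pd i (pd j v) x))"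
          unfolding laplace_def P_def sum_distrib_right unfolding sum_distrib_left by (simp add: mult_ac)
        then show ?thesis unfolding L2_inner_def using intc by simp
      qed
      then have fA: "\<sigma>\<^sup>2 * inn (laplace v) P = (\<Sum>k\<in>UNIV. \<Sum>i\<in>UNIV. \<Sum>j\<in>UNIV. \<sigma>\<^sup>2 * (LINT x|lebesgue. c i j x * (\<zeta> x * pd k (pd k v) x * pd i (pd j v) x)))"
        by (simp add: sum_distrib_left)
      have fB: "(\<Sum>k\<in>UNIV. \<Sum>i\<in>UNIV. \<Sum>j\<in>UNIV. \<sigma>\<^sup>2 * (LINT x|lebesgue. c i j x * (\<zeta> x * pd k (pd k v) x * pd i (pd j v) x))) \<ge> (\<Sum>k\<in>UNIV. \<Sum>i\<in>UNIV. \<Sum>j\<in>UNIV. \<sigma>\<^sup>2 * (LINT x|lebesgue. c i j x * (\<zeta> x * pd i (pd k v) x * pd j (pd k v) x)) - 4 * (M * s * Y * Y))"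
        unfolding M_def s_def Y_def by (intro sum_mono second_order_lower[OF v \<zeta> \<sigma>])
      have fC: "(\<Sum>k\<in>UNIV. \<Sum>i\<in>UNIV. \<Sum>j\<in>UNIV. \<sigma>\<^sup>2 * (LINT x|lebesgue. c i j x * (\<zeta> x * pd i (pd k v) x * pd j (pd k v) x)) - 4 * (M * s * Y * Y))
        = \<sigma>\<^sup>2 * (\<Sum>k\<in>UNIV. \<Sum>i\<in>UNIV. \<Sum>j\<in>UNIV. LINT x|lebesgue. c i j x * (\<zeta> x * pd i (pd k v) x * pd j (pd k v) x)) - C1 * s * Y\<^sup>2"
        by (simp add: sum_subtractf sum_distrib_left C1_def power2_eq_square mult_ac)
      \<comment> \<open>Ellipticity with \<xi> the gradient of \<open>pd k v\<close>, for each
        \<open>k\<close>.\<close>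
      have fD: "(\<Sum>k\<in>UNIV. \<Sum>i\<in>UNIV. \<Sum>j\<in>UNIV. LINT x|lebesgue. c i j x * (\<zeta> x * pd i (pd k v) x * pd j (pd k v) x))
         \<ge> (\<Sum>k\<in>UNIV. \<nu> * (\<Sum>i\<in>UNIV. LINT x|lebesgue. \<zeta> x * (pd i (pd k v) x)\<^sup>2))"
      proof (rule sum_mono)
        fix k
        have "\<nu> * (\<Sum>i\<in>UNIV. LINT x|lebesgue. \<zeta> x * (pd i (pd k v) x)\<^sup>2) = (LINT x|lebesgue. (\<Sum>i\<in>UNIV. \<nu> * (\<zeta> x * (pd i (pd k v) x)\<^sup>2)))"
          using intz by (simp add: sum_distrib_left)
        also have "\<dots> \<le> (LINT x|lebesgue. (\<Sum>i\<in>UNIV. \<Sum>j\<in>UNIV. c i j x * (\<zeta> x * pd i (pd k v) x * pd j (pd k v) x)))"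
        proof (rule integral_mono_AE)
          show "AE x in lebesgue. (\<Sum>i\<in>UNIV. \<nu> * (\<zeta> x * (pd i (pd k v) x)\<^sup>2)) \<le> (\<Sum>i\<in>UNIV. \<Sum>j\<in>UNIV. c i j x * (\<zeta> x * pd i (pd k v) x * pd j (pd k v) x))"
            using c_ell
          proof eventually_elim
            case (elim x)
            have "\<zeta> x * (\<nu> * (\<Sum>i\<in>UNIV. (pd i (pd k v) x)\<^sup>2)) \<le> \<zeta> x * (\<Sum>i\<in>UNIV. \<Sum>j\<in>UNIV. c i j x * (pd i (pd k v) x * pd j (pd k v) x))"
              by (rule mult_left_mono[OF elim[rule_format, of "\<lambda>i. pd i (pd k v) x"] z(7)])
            then show ?case by (simp add: sum_distrib_left mult_ac)
          qed
        qed (use intz intc in auto)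
        also have "\<dots> = (\<Sum>i\<in>UNIV. \<Sum>j\<in>UNIV. LINT x|lebesgue. c i j x * (\<zeta> x * pd i (pd k v) x * pd j (pd k v) x))"
          using intc by simp
        finally show "\<nu> * (\<Sum>i\<in>UNIV. LINT x|lebesgue. \<zeta> x * (pd i (pd k v) x)\<^sup>2) \<le> (\<Sum>i\<in>UNIV. \<Sum>j\<in>UNIV. LINT x|lebesgue. c i j x * (\<zeta> x * pd i (pd k v) x * pd j (pd k v) x))" .
      qed
      have fE: "\<nu> * \<sigma>\<^sup>2 * (\<Sum>k\<in>UNIV. \<Sum>i\<in>UNIV. LINT x|lebesgue. \<zeta> x * (pd i (pd k v) x)\<^sup>2)
         = \<sigma>\<^sup>2 * (\<Sum>k\<in>UNIV. \<nu> * (\<Sum>i\<in>UNIV. LINT x|lebesgue. \<zeta> x * (pd i (pd k v) x)\<^sup>2))"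
        by (simp add: sum_distrib_left mult_ac)
      show ?thesis unfolding fE using fA fB fC mult_left_mono[OF fD zero_le_power2[of \<sigma>]] by linarith
    qed
    have "inn w (Lop (\<lambda>x. \<zeta> x * v x)) = inn v (Lop (\<lambda>x. \<zeta> x * v x)) - \<sigma>\<^sup>2 * inn (laplace v) (\<lambda>x. P x + G x) - inn E (\<lambda>x. P x + G x)"
    proof -
      have w_eq: "w = (\<lambda>x. 1 * (1 * v x + (- \<sigma>\<^sup>2) * laplace v x) + (-1) * E x)" by (auto simp: E_def)
      show ?thesis
        unfolding LPG
        by (subst w_eq, subst L2_inner_lin, intro L2_lin L lap, rule EL, intro L2_add PL GL,
            subst L2_inner_lin, rule L, rule lap, intro L2_add PL GL) simp
    qed
    moreover have "inn v (Lop (\<lambda>x. \<zeta> x * v x)) = - Qform v (\<lambda>x. \<zeta> x * v x)" by (rule green[OF v zv])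
    moreover have "inn (laplace v) (\<lambda>x. P x + G x) = inn (laplace v) P + inn (laplace v) G"
      using L2_inner_lin[OF PL GL lap(1), of 1 1] by (simp add: L2_inner_commute)
    ultimately have "- inn w (Lop (\<lambda>x. \<zeta> x * v x)) = Qform v (\<lambda>x. \<zeta> x * v x) + \<sigma>\<^sup>2 * inn (laplace v) P + \<sigma>\<^sup>2 * inn (laplace v) G + inn E (\<lambda>x. P x + G x)"
      by (simp add: distrib_left)
    moreover have "(C1 + C2 + C3) * s * (1 + Y\<^sup>2) = C1 * s + C1 * s * Y\<^sup>2 + C2 * s + Y * (C2 * s * Y) + C3 * s * (1 + Y\<^sup>2)"
      by (simp add: power2_eq_square algebra_simps)
    moreover have "0 \<le> C1 * s" "0 \<le> C2 * s" using C123 s by simp_all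
    ultimately show "- inn w (Lop (\<lambda>x. \<zeta> x * v x)) \<ge> Qform v (\<lambda>x. \<zeta> x * v x)
       + \<nu> * \<sigma>\<^sup>2 * (\<Sum>k\<in>UNIV. \<Sum>i\<in>UNIV. LINT x|lebesgue. \<zeta> x * (pd i (pd k v) x)\<^sup>2) - (C1 + C2 + C3) * \<sigma> powr \<kappa> * (1 + (X \<sigma> v)\<^sup>2)"
      using LP LG EPG unfolding s_def[symmetric] Y_def[symmetric] by linarith
  qed
qed

end

section \<open>Uniform bounds for the approximations as \<sigma> tends to 0\<close>

lemma inn_laplace:
  assumes v: "v \<in> Cc_infty" shows "inn (laplace v) v = - (\<Sum>i\<in>UNIV. (nrm (pd i v))\<^sup>2)"
proof -
  have "(LINT x|lebesgue. pd i (pd i v) x * v x) = - (nrm (pd i v))\<^sup>2" for i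
    unfolding L2_norm_sq using integral_by_parts[OF Cc_pd[OF v] Cc_smooth[OF v], of i i]
    by (simp add: power2_eq_square)
  moreover have "integrable lebesgue (\<lambda>x. pd i (pd i v) x * v x)" for i
    by (intro Cc_integrable Cc_mult Cc_pd v)
  ultimately show ?thesis
    unfolding L2_inner_def laplace_def by (simp add: sum_distrib_right sum_negf)
qed

text \<open>Pairing \<open>v - \<sigma>\<^sup>2 \<Delta>v\<close> with \<open>v\<close> gives
  \<open>\<parallel>v\<parallel>\<^sup>2\<close> plus a nonnegative gradient term. This controls the
  zeroth-order part of \<open>X\<close> independently of \<sigma>.\<close>

lemma nrm_resolvent_le:
  assumes v: "v \<in> Cc_infty" shows "nrm v \<le> nrm (\<lambda>x. v x - \<sigma>\<^sup>2 * laplace v x)"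
proof -
  have L: "v \<in> L2 lebesgue" "laplace v \<in> L2 lebesgue" by (intro Cc_L2 laplace_Cc v)+
  have L': "(\<lambda>x. v x - \<sigma>\<^sup>2 * laplace v x) \<in> L2 lebesgue" by (intro L2_diff L2_cmult L)
  have "inn (\<lambda>x. v x - \<sigma>\<^sup>2 * laplace v x) v = (nrm v)\<^sup>2 + \<sigma>\<^sup>2 * (\<Sum>i\<in>UNIV. (nrm (pd i v))\<^sup>2)"
    using L2_inner_lin[OF L L(1), of 1 "- \<sigma>\<^sup>2"] inn_laplace[OF v]
    by (simp add: L2_norm_sq) (simp add: L2_inner_def power2_eq_square)
  moreover have "0 \<le> \<sigma>\<^sup>2 * (\<Sum>i\<in>UNIV. (nrm (pd i v))\<^sup>2)" by (simp add: sum_nonneg)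
  ultimately have "(nrm v)\<^sup>2 \<le> nrm (\<lambda>x. v x - \<sigma>\<^sup>2 * laplace v x) * nrm v"
    using L2_Cauchy_Schwarz[OF L' L(1)] by linarith
  then have "nrm v * nrm v \<le> nrm (\<lambda>x. v x - \<sigma>\<^sup>2 * laplace v x) * nrm v"
    by (simp add: power2_eq_square)
  then show ?thesis
    using mult_right_le_imp_le[of "nrm v" "nrm v"] by (cases "nrm v = 0") (auto simp: less_le)
qed

text \<open>The conclusion is the body of \<open>mild\<close>, spelled out because the lemma stands
  outside the locale.\<close>

lemma Cc_mild:
  fixes \<zeta> :: "real^'n \<Rightarrow> real"
  assumes \<zeta>: "\<zeta> \<in> Cc_infty" and pos: "\<And>x. 0 \<le> \<zeta> x"
  obtains Z where "Z \<ge> 0" "(smooth \<zeta> \<and> (\<forall>x. 0 \<le> \<zeta> x) \<and> (\<forall>x. \<bar>\<zeta> x\<bar> \<le> Z) \<and> (\<forall>i x. \<bar>pd i \<zeta> x\<bar> \<le> Z) \<and> (\<forall>i j x. \<bar>pd i (pd j \<zeta>) x\<bar> \<le> Z))"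
proof -
  obtain B0 where B0: "\<And>x. \<bar>\<zeta> x\<bar> \<le> B0" using Cc_bounded[OF \<zeta>] by metis
  have "\<exists>b. \<forall>x. \<bar>pd i \<zeta> x\<bar> \<le> b" for i using Cc_bounded[OF Cc_pd[OF \<zeta>]] by metis
  then obtain B1 where B1: "\<And>i x. \<bar>pd i \<zeta> x\<bar> \<le> B1 i" by metis
  have "\<exists>b. \<forall>x. \<bar>pd i (pd j \<zeta>) x\<bar> \<le> b" for i j using Cc_bounded[OF Cc_pd[OF Cc_pd[OF \<zeta>]]] by metis
  then obtain B2 where B2: "\<And>i j x. \<bar>pd i (pd j \<zeta>) x\<bar> \<le> B2 i j" by metis
  define Z where "Z = B0 + (\<Sum>i\<in>UNIV. B1 i) + (\<Sum>i\<in>UNIV. \<Sum>j\<in>UNIV. B2 i j)"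
  have n: "0 \<le> B0" "\<And>i. 0 \<le> B1 i" "\<And>i j. 0 \<le> B2 i j"
    using order_trans[OF abs_ge_zero B0] order_trans[OF abs_ge_zero B1] order_trans[OF abs_ge_zero B2] by blast+
  have s: "0 \<le> (\<Sum>i\<in>UNIV. B1 i)" "0 \<le> (\<Sum>i\<in>UNIV. \<Sum>j\<in>UNIV. B2 i j)" by (auto intro!: sum_nonneg n)
  have m1: "B1 i \<le> (\<Sum>i\<in>UNIV. B1 i)" for i by (rule member_le_sum) (auto simp: n)
  have m2: "B2 i j \<le> (\<Sum>i\<in>UNIV. \<Sum>j\<in>UNIV. B2 i j)" for i j
  proof -
    have "B2 i j \<le> (\<Sum>j\<in>UNIV. B2 i j)" by (rule member_le_sum) (auto simp: n)
    also have "\<dots> \<le> (\<Sum>i\<in>UNIV. \<Sum>j\<in>UNIV. B2 i j)" by (rule member_le_sum[of i UNIV "\<lambda>i. \<Sum>j\<in>UNIV. B2 i j"]) (auto simp: n sum_nonneg)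
    finally show ?thesis .
  qed
  show thesis
  proof (rule that[of Z], goal_cases)
    case 1 then show ?case using s n by (simp add: Z_def)
  next
    case 2
    have "\<bar>\<zeta> x\<bar> \<le> Z" for x using B0[of x] s unfolding Z_def by linarith
    moreover have "\<bar>pd i \<zeta> x\<bar> \<le> Z" for i x using B1[of i x] m1[of i] s n(1) unfolding Z_def by linarith
    moreover have "\<bar>pd i (pd j \<zeta>) x\<bar> \<le> Z" for i j x using B2[of i j x] m2[of i j] s n(1) unfolding Z_def by linarith
    ultimately show ?case using pos Cc_smooth[OF \<zeta>] by blast
  qed
qed

context elliptic
begin

lemma Qform_self_ge:
  assumes v: "v \<in> Cc_infty" shows "Qform v v \<ge> \<nu> * (\<Sum>i\<in>UNIV. (nrm (pd i v))\<^sup>2)"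
proof -
  have i1: "integrable lebesgue (\<lambda>x. (pd i v x)\<^sup>2)" for i by (rule L2_integrable[OF Cc_L2[OF Cc_pd[OF v]]])
  have i2: "integrable lebesgue (\<lambda>x. c i j x * (pd i v x * pd j v x))" for i j
    by (intro Lloc_Cc_integrable weak_partial_Lloc[OF weak_c] Cc_mult Cc_pd v)
  have "\<nu> * (\<Sum>i\<in>UNIV. (nrm (pd i v))\<^sup>2) = (LINT x|lebesgue. \<nu> * (\<Sum>i\<in>UNIV. (pd i v x)\<^sup>2))"
    using i1 by (simp add: L2_norm_sq)
  also have "\<dots> \<le> Qform v v" unfolding Qform_def
  proof (rule integral_mono_AE)
    show "AE x in lebesgue. \<nu> * (\<Sum>i\<in>UNIV. (pd i v x)\<^sup>2) \<le> (\<Sum>i\<in>UNIV. \<Sum>j\<in>UNIV. c i j x * (pd i v x * pd j v x))"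
      using c_ell
    proof eventually_elim
      case (elim x)
      show ?case by (rule elim[rule_format, of "\<lambda>i. pd i v x"])
    qed
  qed (use i1 i2 in auto)
  finally show ?thesis .
qed

text \<open>Cauchy-Schwarz for sums: the 3 belongs to the three parts of \<open>X\<close>, and the
  square of the dimension covers the double sum as well as the single one.\<close>

lemma X_sq_le:
  assumes "\<sigma> \<ge> 0"
  shows "(X \<sigma> v)\<^sup>2 \<le> 3 * (real CARD('n))\<^sup>2 * ((nrm v)\<^sup>2 + (\<Sum>i\<in>UNIV. (nrm (pd i v))\<^sup>2) + \<sigma>\<^sup>2 * (\<Sum>k\<in>UNIV. \<Sum>i\<in>UNIV. (nrm (pd i (pd k v)))\<^sup>2))"
proof -
  let ?d = "real CARD('n)"
  have d: "?d \<ge> 1" using zero_less_card_finite[where 'a='n] by (simp add: Suc_le_eq)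
  then have d2: "?d\<^sup>2 \<ge> 1" "?d\<^sup>2 \<ge> ?d" by (simp_all only: one_le_power self_le_power zero_less_numeral)
  define a where "a = nrm v"
  define b where "b = (\<Sum>i\<in>UNIV. nrm (pd i v))"
  define e where "e = (\<Sum>k\<in>UNIV. \<Sum>i\<in>UNIV. nrm (pd i (pd k v)))"
  have e_swap: "(\<Sum>i\<in>UNIV. \<Sum>j\<in>UNIV. nrm (pd i (pd j v))) = e" unfolding e_def by (rule sum.swap)
  have 1: "(a + b + \<sigma> * e)\<^sup>2 \<le> 3 * (a\<^sup>2 + b\<^sup>2 + (\<sigma> * e)\<^sup>2)"
    using sum_squares_ge_zero[of "a - b" "b - \<sigma> * e"] zero_le_power2[of "a - \<sigma> * e"]
    by (simp add: power2_eq_square algebra_simps)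
  have b2: "b\<^sup>2 \<le> ?d\<^sup>2 * (\<Sum>i\<in>UNIV. (nrm (pd i v))\<^sup>2)"
  proof -
    have "b\<^sup>2 \<le> (\<Sum>i\<in>UNIV. (nrm (pd i v))\<^sup>2) * ?d"
      unfolding b_def using sum_squared_le_sum_of_squares[of "\<lambda>i. nrm (pd i v)" UNIV] by simp
    also have "\<dots> \<le> (\<Sum>i\<in>UNIV. (nrm (pd i v))\<^sup>2) * ?d\<^sup>2" by (intro mult_left_mono d2 sum_nonneg) auto
    finally show ?thesis by (simp add: mult.commute)
  qed
  have e2: "e\<^sup>2 \<le> ?d\<^sup>2 * (\<Sum>k\<in>UNIV. \<Sum>i\<in>UNIV. (nrm (pd i (pd k v)))\<^sup>2)"
  proof -
    have "e\<^sup>2 \<le> (\<Sum>k\<in>UNIV. (\<Sum>i\<in>UNIV. nrm (pd i (pd k v)))\<^sup>2) * ?d"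
      unfolding e_def using sum_squared_le_sum_of_squares[of "\<lambda>k. \<Sum>i\<in>UNIV. nrm (pd i (pd k v))" UNIV] by simp
    also have "\<dots> \<le> (\<Sum>k\<in>UNIV. (\<Sum>i\<in>UNIV. (nrm (pd i (pd k v)))\<^sup>2) * ?d) * ?d"
    proof (intro mult_right_mono sum_mono)
      fix k
      show "(\<Sum>i\<in>UNIV. nrm (pd i (pd k v)))\<^sup>2 \<le> (\<Sum>i\<in>UNIV. (nrm (pd i (pd k v)))\<^sup>2) * ?d"
        using sum_squared_le_sum_of_squares[of "\<lambda>i. nrm (pd i (pd k v))" UNIV] by simp
    qed simp
    finally show ?thesis by (simp add: sum_distrib_left[symmetric] power2_eq_square mult_ac)
  qed
  have "(X \<sigma> v)\<^sup>2 \<le> 3 * (a\<^sup>2 + b\<^sup>2 + (\<sigma> * e)\<^sup>2)"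
    using 1 unfolding X_def e_swap a_def b_def by simp
  also have "\<dots> \<le> 3 * (?d\<^sup>2 * a\<^sup>2 + ?d\<^sup>2 * (\<Sum>i\<in>UNIV. (nrm (pd i v))\<^sup>2) + \<sigma>\<^sup>2 * (?d\<^sup>2 * (\<Sum>k\<in>UNIV. \<Sum>i\<in>UNIV. (nrm (pd i (pd k v)))\<^sup>2)))"
  proof (intro mult_left_mono add_mono b2)
    show "a\<^sup>2 \<le> ?d\<^sup>2 * a\<^sup>2" using mult_right_mono[OF d2(1), of "a\<^sup>2"] by simp
    show "(\<sigma> * e)\<^sup>2 \<le> \<sigma>\<^sup>2 * (?d\<^sup>2 * (\<Sum>k\<in>UNIV. \<Sum>i\<in>UNIV. (nrm (pd i (pd k v)))\<^sup>2))"
      unfolding power_mult_distrib by (intro mult_left_mono e2) simp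
  qed simp
  finally show ?thesis by (simp add: a_def algebra_simps)
qed

text \<open>Hypothesis \<open>T\<close> says that \<open>Lop\<close>, applied to \<open>w\<close> in
  the weak sense, involves at most first derivatives of the test function. The cutoff is the
  constant 1, so the energy estimate controls full norms; its error is absorbed for small \<sigma>,
  the linear term \<open>T * Y\<close> by Young's inequality.\<close>

lemma energy_bounded:
  assumes w: "w \<in> L2 lebesgue"
    and T: "\<And>f. f \<in> Cc_infty \<Longrightarrow> \<bar>inn w (Lop f)\<bar> \<le> T * (nrm f + (\<Sum>i\<in>UNIV. nrm (pd i f)))" "T \<ge> 0"
  obtains X0 \<sigma>0 where "0 < \<sigma>0" "\<sigma>0 \<le> 1" "0 \<le> X0"
    "\<And>v \<sigma>. v \<in> Cc_infty \<Longrightarrow> 0 < \<sigma> \<Longrightarrow> \<sigma> \<le> \<sigma>0 \<Longrightarrow> nrm (\<lambda>x. v x - \<sigma>\<^sup>2 * laplace v x - w x) \<le> \<sigma>\<^sup>2 \<Longrightarrow> X \<sigma> v \<le> X0"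
proof -
  have mild1: "mild 1 (\<lambda>x. 1)" by (simp add: mild_def)
  obtain C where C: "C \<ge> 0" "\<And>v \<zeta> \<sigma> w. v \<in> Cc_infty \<Longrightarrow> mild 1 \<zeta> \<Longrightarrow> 0 < \<sigma> \<Longrightarrow> \<sigma> \<le> 1 \<Longrightarrow> w \<in> L2 lebesgue \<Longrightarrow>
     nrm (\<lambda>x. v x - \<sigma>\<^sup>2 * laplace v x - w x) \<le> \<sigma>\<^sup>2 \<Longrightarrow>
     - inn w (Lop (\<lambda>x. \<zeta> x * v x)) \<ge> Qform v (\<lambda>x. \<zeta> x * v x)
       + \<nu> * \<sigma>\<^sup>2 * (\<Sum>k\<in>UNIV. \<Sum>i\<in>UNIV. LINT x|lebesgue. \<zeta> x * (pd i (pd k v) x)\<^sup>2) - C * \<sigma> powr \<kappa> * (1 + (X \<sigma> v)\<^sup>2)"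
    using energy_lower_bound[of 1] by auto
  define n where "n = 3 * (real CARD('n))\<^sup>2"
  have n: "n > 0" by (simp add: n_def)
  \<comment> \<open>Chosen so that \<open>n * (C + 1) * b = \<nu> / 4\<close>. The square of
    \<open>Y\<close> then appears twice on the right with the coefficient \<open>\<nu> / 4\<close>,
    and half of \<open>\<nu> * Y\<^sup>2\<close> is left over.\<close>
  define b where "b = \<nu> / (4 * n * (C + 1))"
  have b: "b > 0" using \<nu> n C(1) by (simp add: b_def)
  define \<sigma>0 where "\<sigma>0 = min 1 (b powr (1 / \<kappa>))"
  have s0: "0 < \<sigma>0" "\<sigma>0 \<le> 1" using b by (auto simp: \<sigma>0_def)
  define W where "W = nrm w + 1"
  define R where "R = n * \<nu> * W\<^sup>2 + \<nu> / 4 + n\<^sup>2 * T\<^sup>2 / \<nu>"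
  have R: "R \<ge> 0" using n \<nu> by (simp add: R_def)
  show thesis
  proof (rule that[of \<sigma>0 "sqrt (2 * R / \<nu>)"])
    show "0 \<le> sqrt (2 * R / \<nu>)" using R \<nu> by simp
    fix v :: "real^'n \<Rightarrow> real" and \<sigma> :: real
    assume v: "v \<in> Cc_infty" and \<sigma>: "0 < \<sigma>" "\<sigma> \<le> \<sigma>0" and e: "nrm (\<lambda>x. v x - \<sigma>\<^sup>2 * laplace v x - w x) \<le> \<sigma>\<^sup>2"
    define Y where "Y = X \<sigma> v"
    have \<sigma>': "0 \<le> \<sigma>" "\<sigma> \<le> 1" using \<sigma> s0 by auto
    have Y: "Y \<ge> 0" unfolding Y_def by (rule X_bounds(1)[OF \<sigma>'(1)])
    have "\<sigma> powr \<kappa> \<le> (b powr (1 / \<kappa>)) powr \<kappa>"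
      using \<sigma> \<kappa> by (intro powr_mono2) (auto simp: \<sigma>0_def)
    then have sb: "\<sigma> powr \<kappa> \<le> b" using b \<kappa> by (simp add: powr_powr)
    define G1 where "G1 = (\<Sum>i\<in>UNIV. (nrm (pd i v))\<^sup>2)"
    define H2 where "H2 = (\<Sum>k\<in>UNIV. \<Sum>i\<in>UNIV. (nrm (pd i (pd k v)))\<^sup>2)"
    have "- inn w (Lop (\<lambda>x. 1 * v x)) \<ge> Qform v (\<lambda>x. 1 * v x)
       + \<nu> * \<sigma>\<^sup>2 * (\<Sum>k\<in>UNIV. \<Sum>i\<in>UNIV. LINT x|lebesgue. 1 * (pd i (pd k v) x)\<^sup>2) - C * \<sigma> powr \<kappa> * (1 + (X \<sigma> v)\<^sup>2)"
      by (rule C(2)[OF v mild1 \<sigma>(1) \<sigma>'(2) w e])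
    then have low: "- inn w (Lop v) \<ge> Qform v v + \<nu> * \<sigma>\<^sup>2 * H2 - C * \<sigma> powr \<kappa> * (1 + Y\<^sup>2)"
      unfolding H2_def L2_norm_sq Y_def by simp
    have "- inn w (Lop v) \<le> T * (nrm v + (\<Sum>i\<in>UNIV. nrm (pd i v)))" using T(1)[OF v] by linarith
    also have "\<dots> \<le> T * Y" unfolding Y_def by (intro mult_left_mono X_bounds(4)[OF \<sigma>'(1)] T(2))
    finally have up: "- inn w (Lop v) \<le> T * Y" .
    have Q: "Qform v v \<ge> \<nu> * G1" unfolding G1_def by (rule Qform_self_ge[OF v])
    have a: "nrm v \<le> W"
    proof -
      have L: "(\<lambda>x. v x - \<sigma>\<^sup>2 * laplace v x) \<in> L2 lebesgue" by (intro L2_diff L2_cmult Cc_L2 laplace_Cc v)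
      have "\<sigma>\<^sup>2 \<le> 1" using \<sigma>' by (simp add: power_le_one)
      then show ?thesis using nrm_resolvent_le[OF v, of \<sigma>] L2_norm_le_add[OF L w] e unfolding W_def by linarith
    qed
    then have a2: "(nrm v)\<^sup>2 \<le> W\<^sup>2" by (intro power_mono) auto
    have "Y\<^sup>2 \<le> n * ((nrm v)\<^sup>2 + G1 + \<sigma>\<^sup>2 * H2)"
      unfolding Y_def n_def G1_def H2_def by (rule X_sq_le[OF \<sigma>'(1)])
    then have "\<nu> * Y\<^sup>2 \<le> \<nu> * (n * ((nrm v)\<^sup>2 + G1 + \<sigma>\<^sup>2 * H2))" using \<nu> by (intro mult_left_mono) auto
    also have "\<dots> = n * (\<nu> * (nrm v)\<^sup>2 + (\<nu> * G1 + \<nu> * \<sigma>\<^sup>2 * H2))" by (simp add: algebra_simps)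
    also have "\<dots> \<le> n * (\<nu> * W\<^sup>2 + (T * Y + C * \<sigma> powr \<kappa> * (1 + Y\<^sup>2)))"
    proof (rule mult_left_mono)
      have "\<nu> * (nrm v)\<^sup>2 \<le> \<nu> * W\<^sup>2" using a2 \<nu> by (intro mult_left_mono) auto
      then show "\<nu> * (nrm v)\<^sup>2 + (\<nu> * G1 + \<nu> * \<sigma>\<^sup>2 * H2) \<le> \<nu> * W\<^sup>2 + (T * Y + C * \<sigma> powr \<kappa> * (1 + Y\<^sup>2))"
        using low up Q by linarith
    qed (use n in auto)
    also have "\<dots> = n * \<nu> * W\<^sup>2 + n * T * Y + n * (C * \<sigma> powr \<kappa>) * (1 + Y\<^sup>2)" by (simp add: algebra_simps)
    also have "\<dots> \<le> n * \<nu> * W\<^sup>2 + (\<nu> / 4 * Y\<^sup>2 + n\<^sup>2 * T\<^sup>2 / \<nu>) + \<nu> / 4 * (1 + Y\<^sup>2)"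
    proof (intro add_mono order_refl mult_right_mono)
      \<comment> \<open>Young's inequality with the weight that leaves exactly
        \<open>\<nu> / 4 * Y\<^sup>2\<close>.\<close>
      have "0 \<le> (\<nu> / 2 * Y - n * T)\<^sup>2" by simp
      then have "n * T * Y * \<nu> \<le> \<nu>\<^sup>2 / 4 * Y\<^sup>2 + n\<^sup>2 * T\<^sup>2" by (simp add: power2_eq_square algebra_simps)
      then have "n * T * Y \<le> (\<nu>\<^sup>2 / 4 * Y\<^sup>2 + n\<^sup>2 * T\<^sup>2) / \<nu>" using \<nu> by (simp add: pos_le_divide_eq)
      also have "\<dots> = \<nu> / 4 * Y\<^sup>2 + n\<^sup>2 * T\<^sup>2 / \<nu>" using \<nu> by (simp add: add_divide_distrib power2_eq_square)
      finally show "n * T * Y \<le> \<nu> / 4 * Y\<^sup>2 + n\<^sup>2 * T\<^sup>2 / \<nu>" .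
      have "n * (C * \<sigma> powr \<kappa>) \<le> n * ((C + 1) * b)" using n C(1) sb b by (intro mult_left_mono mult_mono) auto
      also have "\<dots> = \<nu> / 4"
      proof -
        have "b * (4 * n * (C + 1)) = \<nu>" using n C(1) by (simp add: b_def)
        then show ?thesis by (simp add: algebra_simps)
      qed
      finally show "n * (C * \<sigma> powr \<kappa>) \<le> \<nu> / 4" .
    qed simp
    finally have "\<nu> * Y\<^sup>2 \<le> 2 * R" by (simp add: R_def algebra_simps)
    then have "Y\<^sup>2 \<le> 2 * R / \<nu>" using \<nu> by (simp add: pos_le_divide_eq mult.commute)
    then show "X \<sigma> v \<le> sqrt (2 * R / \<nu>)" unfolding Y_def by (rule real_le_rsqrt)
  qed (use s0 in auto)
qed

text \<open>By the symmetry of \<open>c\<close>, the integrand of the left side equals \<open>c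
  \<nabla>(\<theta> v) \<nabla>(\<theta> v) - v\<^sup>2 c \<nabla>\<theta> \<nabla>\<theta>\<close>.
  Dropping the first, nonnegative, term leaves a bound free of derivatives of \<open>v\<close>,
  which passes to the limit in L2.\<close>

lemma Qform_cutoff_ge:
  assumes v: "v \<in> Cc_infty" and \<theta>: "\<theta> \<in> Cc_infty"
  shows "Qform v (\<lambda>x. (\<theta> x)\<^sup>2 * v x) \<ge> - (LINT x|lebesgue. (v x)\<^sup>2 * (\<Sum>i\<in>UNIV. \<Sum>j\<in>UNIV. c i j x * (pd i \<theta> x * pd j \<theta> x)))"
proof -
  have s: "smooth \<theta>" "smooth v" using v \<theta> Cc_smooth by auto
  have pdj: "pd j (\<lambda>x. (\<theta> x)\<^sup>2 * v x) = (\<lambda>x. 2 * \<theta> x * pd j \<theta> x * v x + (\<theta> x)\<^sup>2 * pd j v x)" for j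
    unfolding power2_eq_square by (simp add: smooth_pd_mult smooth_mult s) (simp add: algebra_simps)
  have Cc1: "(\<lambda>x. pd i v x * (2 * \<theta> x * pd j \<theta> x * v x + (\<theta> x)\<^sup>2 * pd j v x)) \<in> Cc_infty" for i j
    by (intro Cc_mult Cc_pd v Cc_add Cc_smooth_mult Cc_cmult smooth_Cc_mult smooth_power s \<theta> smooth_pd smooth_cmult smooth_mult)
  have i1: "integrable lebesgue (\<lambda>x. c i j x * (pd i v x * (2 * \<theta> x * pd j \<theta> x * v x + (\<theta> x)\<^sup>2 * pd j v x)))" for i j
    by (rule Lloc_Cc_integrable[OF weak_partial_Lloc(1)[OF weak_c] Cc1])
  have Cc2: "(\<lambda>x. (v x)\<^sup>2 * (pd i \<theta> x * pd j \<theta> x)) \<in> Cc_infty" for i j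
    by (intro smooth_Cc_mult smooth_power s Cc_mult Cc_pd \<theta>)
  have i2: "integrable lebesgue (\<lambda>x. c i j x * ((v x)\<^sup>2 * (pd i \<theta> x * pd j \<theta> x)))" for i j
    by (rule Lloc_Cc_integrable[OF weak_partial_Lloc(1)[OF weak_c] Cc2])
  have eq2: "(\<lambda>x. (v x)\<^sup>2 * (\<Sum>i\<in>UNIV. \<Sum>j\<in>UNIV. c i j x * (pd i \<theta> x * pd j \<theta> x))) = (\<lambda>x. \<Sum>i\<in>UNIV. \<Sum>j\<in>UNIV. c i j x * ((v x)\<^sup>2 * (pd i \<theta> x * pd j \<theta> x)))"
    by (simp add: sum_distrib_left mult_ac)
  have "0 \<le> (LINT x|lebesgue. (\<Sum>i\<in>UNIV. \<Sum>j\<in>UNIV. c i j x * (pd i v x * (2 * \<theta> x * pd j \<theta> x * v x + (\<theta> x)\<^sup>2 * pd j v x)))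
     + (\<Sum>i\<in>UNIV. \<Sum>j\<in>UNIV. c i j x * ((v x)\<^sup>2 * (pd i \<theta> x * pd j \<theta> x))))"
  proof (rule integral_nonneg_AE)
    show "AE x in lebesgue. 0 \<le> (\<Sum>i\<in>UNIV. \<Sum>j\<in>UNIV. c i j x * (pd i v x * (2 * \<theta> x * pd j \<theta> x * v x + (\<theta> x)\<^sup>2 * pd j v x)))
     + (\<Sum>i\<in>UNIV. \<Sum>j\<in>UNIV. c i j x * ((v x)\<^sup>2 * (pd i \<theta> x * pd j \<theta> x)))"
      using c_ell
    proof eventually_elim
      case (elim x)
      \<comment> \<open>The gradient of \<open>\<theta> v\<close> at \<open>x\<close>.\<close>
      define \<xi> where "\<xi> i = \<theta> x * pd i v x + v x * pd i \<theta> x" for i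
      have "0 \<le> \<nu> * (\<Sum>i\<in>UNIV. (\<xi> i)\<^sup>2)" using \<nu> by (simp add: sum_nonneg)
      then have "0 \<le> (\<Sum>i\<in>UNIV. \<Sum>j\<in>UNIV. c i j x * (\<xi> i * \<xi> j))" using elim[rule_format, of \<xi>] by linarith
      also have "\<dots> = (\<Sum>i\<in>UNIV. \<Sum>j\<in>UNIV. c i j x * ((\<theta> x)\<^sup>2 * (pd i v x * pd j v x))) +
         (\<Sum>i\<in>UNIV. \<Sum>j\<in>UNIV. c i j x * (\<theta> x * v x * (pd i v x * pd j \<theta> x))) +
         (\<Sum>i\<in>UNIV. \<Sum>j\<in>UNIV. c i j x * (\<theta> x * v x * (pd i \<theta> x * pd j v x))) +
         (\<Sum>i\<in>UNIV. \<Sum>j\<in>UNIV. c i j x * ((v x)\<^sup>2 * (pd i \<theta> x * pd j \<theta> x)))"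
        by (simp add: \<xi>_def sum.distrib[symmetric] power2_eq_square algebra_simps)
      also have "(\<Sum>i\<in>UNIV. \<Sum>j\<in>UNIV. c i j x * (\<theta> x * v x * (pd i \<theta> x * pd j v x))) = (\<Sum>i\<in>UNIV. \<Sum>j\<in>UNIV. c i j x * (\<theta> x * v x * (pd i v x * pd j \<theta> x)))"
        by (subst sum.swap) (simp add: c_sym[of _ _ x] mult_ac)
      finally show ?case by (simp add: sum.distrib[symmetric] power2_eq_square algebra_simps)
    qed
  qed
  also have "\<dots> = Qform v (\<lambda>x. (\<theta> x)\<^sup>2 * v x) + (LINT x|lebesgue. (v x)\<^sup>2 * (\<Sum>i\<in>UNIV. \<Sum>j\<in>UNIV. c i j x * (pd i \<theta> x * pd j \<theta> x)))"
    unfolding eq2 Qform_def pdj using i1 i2 by (intro Bochner_Integration.integral_add Bochner_Integration.integrable_sum)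
  finally show ?thesis by linarith
qed

text \<open>The approximations \<open>v n\<close> solve \<open>v - \<sigma>\<^sup>2 \<Delta> v = w\<close> up to a small error with \<open>\<sigma> \<rightarrow> 0\<close>.\<close>
lemma local_energy_inequality:
  assumes w: "w \<in> L2 lebesgue"
    and T: "\<And>f. f \<in> Cc_infty \<Longrightarrow> \<bar>inn w (Lop f)\<bar> \<le> T * (nrm f + (\<Sum>i\<in>UNIV. nrm (pd i f)))" "T \<ge> 0"
    and \<theta>: "\<theta> \<in> Cc_infty"
  obtains v \<delta> where "\<And>n::nat. v n \<in> Cc_infty" "L2_tendsto lebesgue v w" "\<delta> \<longlonglongrightarrow> 0"
    "\<And>n. inn w (Lop (\<lambda>x. (\<theta> x)\<^sup>2 * v n x)) \<le> (LINT x|lebesgue. (v n x)\<^sup>2 * (\<Sum>i\<in>UNIV. \<Sum>j\<in>UNIV. c i j x * (pd i \<theta> x * pd j \<theta> x))) + \<delta> n"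
proof -
  have \<zeta>: "(\<lambda>x. (\<theta> x)\<^sup>2) \<in> Cc_infty" unfolding power2_eq_square by (intro Cc_mult \<theta>)
  obtain Z where Z: "Z \<ge> 0" "mild Z (\<lambda>x. (\<theta> x)\<^sup>2)"
    unfolding mild_def by (rule Cc_mild[OF \<zeta>]) auto
  obtain C where C: "C \<ge> 0" "\<And>v \<zeta> \<sigma> w. v \<in> Cc_infty \<Longrightarrow> mild Z \<zeta> \<Longrightarrow> 0 < \<sigma> \<Longrightarrow> \<sigma> \<le> 1 \<Longrightarrow> w \<in> L2 lebesgue \<Longrightarrow>
     nrm (\<lambda>x. v x - \<sigma>\<^sup>2 * laplace v x - w x) \<le> \<sigma>\<^sup>2 \<Longrightarrow>
     - inn w (Lop (\<lambda>x. \<zeta> x * v x)) \<ge> Qform v (\<lambda>x. \<zeta> x * v x)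
       + \<nu> * \<sigma>\<^sup>2 * (\<Sum>k\<in>UNIV. \<Sum>i\<in>UNIV. LINT x|lebesgue. \<zeta> x * (pd i (pd k v) x)\<^sup>2) - C * \<sigma> powr \<kappa> * (1 + (X \<sigma> v)\<^sup>2)"
    using energy_lower_bound[OF Z(1)] by auto
  obtain \<sigma>0 X0 where X0: "0 < \<sigma>0" "\<sigma>0 \<le> 1" "0 \<le> X0"
    "\<And>v \<sigma>. v \<in> Cc_infty \<Longrightarrow> 0 < \<sigma> \<Longrightarrow> \<sigma> \<le> \<sigma>0 \<Longrightarrow> nrm (\<lambda>x. v x - \<sigma>\<^sup>2 * laplace v x - w x) \<le> \<sigma>\<^sup>2 \<Longrightarrow> X \<sigma> v \<le> X0"
  proof (rule energy_bounded[OF w T])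
    fix X0 \<sigma>0
    assume "0 < \<sigma>0" "\<sigma>0 \<le> 1" "0 \<le> X0"
      "\<And>v \<sigma>. v \<in> Cc_infty \<Longrightarrow> 0 < \<sigma> \<Longrightarrow> \<sigma> \<le> \<sigma>0 \<Longrightarrow> nrm (\<lambda>x. v x - \<sigma>\<^sup>2 * laplace v x - w x) \<le> \<sigma>\<^sup>2 \<Longrightarrow> X \<sigma> v \<le> X0"
    then show thesis by (rule that)
  qed
  define \<sigma> where "\<sigma> n = \<sigma>0 * inverse (real (Suc n))" for n
  have \<sigma>: "0 < \<sigma> n" "\<sigma> n \<le> \<sigma>0" for n using X0(1) by (auto simp: \<sigma>_def field_simps)
  have \<sigma>lim: "\<sigma> \<longlonglongrightarrow> 0" unfolding \<sigma>_def using tendsto_mult_right_zero[OF LIMSEQ_inverse_real_of_nat] .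
  have "\<exists>v. v \<in> Cc_infty \<and> nrm (\<lambda>x. v x - (\<sigma> n)\<^sup>2 * laplace v x - w x) \<le> (\<sigma> n)\<^sup>2" for n
    by (rule resolvent_dense[of "(\<sigma> n)\<^sup>2" w "(\<sigma> n)\<^sup>2"]) (use \<sigma>(1)[of n] w in auto)
  then obtain v where v: "\<And>n. v n \<in> Cc_infty" "\<And>n. nrm (\<lambda>x. v n x - (\<sigma> n)\<^sup>2 * laplace (v n) x - w x) \<le> (\<sigma> n)\<^sup>2"
    by metis
  have XX0: "X (\<sigma> n) (v n) \<le> X0" for n by (rule X0(4)[OF v(1) \<sigma> v(2)])
  have s1: "\<sigma> n \<le> 1" for n using \<sigma>(2)[of n] X0(2) by linarith
  define \<delta> where "\<delta> n = C * (1 + X0\<^sup>2) * \<sigma> n powr \<kappa>" for n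
  show thesis
  proof (rule that[of v \<delta>])
    show "L2_tendsto lebesgue v w"
      unfolding L2_tendsto_def
    proof (rule Lim_null_comparison)
      \<comment> \<open>The uniform bound on \<open>X\<close> controls only \<sigma> times the
        Laplacian; the second factor \<sigma> in \<open>\<sigma>\<^sup>2 \<Delta>v\<close> makes the
        difference tend to 0.\<close>
      have "nrm (\<lambda>x. v n x - w x) \<le> (\<sigma> n)\<^sup>2 + \<sigma> n * X0" for n
      proof -
        have L: "v n \<in> L2 lebesgue" "laplace (v n) \<in> L2 lebesgue" by (intro Cc_L2 laplace_Cc v)+
        have "nrm (laplace (v n)) \<le> (\<Sum>l\<in>UNIV. nrm (pd l (pd l (v n))))"
          unfolding laplace_def[abs_def] by (rule L2_norm_sum) (intro Cc_L2 Cc_pd v)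
        then have "\<sigma> n * nrm (laplace (v n)) \<le> \<sigma> n * (\<Sum>l\<in>UNIV. nrm (pd l (pd l (v n))))"
          using \<sigma>(1)[of n] by (intro mult_left_mono) auto
        also have "\<dots> \<le> X0" using X_bounds(7)[of "\<sigma> n" "v n"] \<sigma>(1)[of n] XX0[of n] by linarith
        finally have "\<sigma> n * (\<sigma> n * nrm (laplace (v n))) \<le> \<sigma> n * X0" using \<sigma>(1)[of n] by (intro mult_left_mono) auto
        moreover have "nrm (\<lambda>x. (\<sigma> n)\<^sup>2 * laplace (v n) x) = \<sigma> n * (\<sigma> n * nrm (laplace (v n)))"
          by (simp add: L2_norm_cmult power2_eq_square)
        moreover have "nrm (\<lambda>x. (v n x - (\<sigma> n)\<^sup>2 * laplace (v n) x - w x) + (\<sigma> n)\<^sup>2 * laplace (v n) x) \<le> nrm (\<lambda>x. v n x - (\<sigma> n)\<^sup>2 * laplace (v n) x - w x) + nrm (\<lambda>x. (\<sigma> n)\<^sup>2 * laplace (v n) x)"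
          by (intro L2_norm_triangle L2_diff L2_cmult L w)
        ultimately show ?thesis using v(2)[of n] by simp
      qed
      then show "\<forall>\<^sub>F n in sequentially. norm (nrm (\<lambda>x. v n x - w x)) \<le> (\<sigma> n)\<^sup>2 + \<sigma> n * X0" by simp
      have "(\<lambda>n. (\<sigma> n)\<^sup>2 + \<sigma> n * X0) \<longlonglongrightarrow> 0\<^sup>2 + 0 * X0" by (intro tendsto_intros \<sigma>lim)
      then show "(\<lambda>n. (\<sigma> n)\<^sup>2 + \<sigma> n * X0) \<longlonglongrightarrow> 0" by simp
    qed
    have "(\<lambda>n. \<sigma> n powr \<kappa>) \<longlonglongrightarrow> 0 powr \<kappa>"
      using \<sigma>lim \<kappa>(1) \<sigma>(1) by (intro tendsto_powr' tendsto_const) (auto intro!: always_eventually less_imp_le)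
    then show "\<delta> \<longlonglongrightarrow> 0" unfolding \<delta>_def using tendsto_mult_right_zero by fastforce
    show "inn w (Lop (\<lambda>x. (\<theta> x)\<^sup>2 * v n x)) \<le> (LINT x|lebesgue. (v n x)\<^sup>2 * (\<Sum>i\<in>UNIV. \<Sum>j\<in>UNIV. c i j x * (pd i \<theta> x * pd j \<theta> x))) + \<delta> n" for n
    proof -
      \<comment> \<open>The coercive term has served to bound \<open>X\<close>; here only its sign
        is used.\<close>
      have "0 \<le> (\<Sum>k\<in>UNIV. \<Sum>i\<in>UNIV. LINT x|lebesgue. (\<theta> x)\<^sup>2 * (pd i (pd k (v n)) x)\<^sup>2)"
        by (intro sum_nonneg Bochner_Integration.integral_nonneg) auto
      then have 1: "0 \<le> \<nu> * (\<sigma> n)\<^sup>2 * (\<Sum>k\<in>UNIV. \<Sum>i\<in>UNIV. LINT x|lebesgue. (\<theta> x)\<^sup>2 * (pd i (pd k (v n)) x)\<^sup>2)"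
        using \<nu> by simp
      have "(X (\<sigma> n) (v n))\<^sup>2 \<le> X0\<^sup>2" using XX0[of n] X_bounds(1)[of "\<sigma> n" "v n"] \<sigma>(1)[of n] by (intro power_mono) auto
      then have 2: "C * \<sigma> n powr \<kappa> * (1 + (X (\<sigma> n) (v n))\<^sup>2) \<le> \<delta> n"
        using mult_left_mono[of "1 + (X (\<sigma> n) (v n))\<^sup>2" "1 + X0\<^sup>2" "C * \<sigma> n powr \<kappa>"] C(1) by (simp add: \<delta>_def mult_ac)
      show ?thesis
        using C(2)[OF v(1)[of n] Z(2) \<sigma>(1)[of n] s1[of n] w v(2)[of n]] Qform_cutoff_ge[OF v(1)[of n] \<theta>] 1 2 by linarith
    qed
  qed (rule v(1))
qed

end

section \<open>A criterion for essential self-adjointness\<close>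

lemma L2_tendsto_const: "L2_tendsto M (\<lambda>n. f) f"
  by (simp add: L2_tendsto_def L2_norm_eq)

lemma L2_tendsto_add:
  assumes "L2_tendsto M f u" "\<And>n. f n \<in> L2 M" "u \<in> L2 M" "L2_tendsto M g v" "\<And>n. g n \<in> L2 M" "v \<in> L2 M"
  shows "L2_tendsto M (\<lambda>n x. f n x + g n x) (\<lambda>x. u x + v x)"
  unfolding L2_tendsto_def
proof (rule Lim_null_comparison)
  have "L2_norm M (\<lambda>x. f n x + g n x - (u x + v x)) \<le> L2_norm M (\<lambda>x. f n x - u x) + L2_norm M (\<lambda>x. g n x - v x)" for n
    using L2_norm_triangle[OF L2_diff[OF assms(2,3)] L2_diff[OF assms(5,6)], of n n] by (simp add: algebra_simps)
  then show "\<forall>\<^sub>F n in sequentially. norm (L2_norm M (\<lambda>x. f n x + g n x - (u x + v x)))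
     \<le> L2_norm M (\<lambda>x. f n x - u x) + L2_norm M (\<lambda>x. g n x - v x)" by simp
  show "(\<lambda>n. L2_norm M (\<lambda>x. f n x - u x) + L2_norm M (\<lambda>x. g n x - v x)) \<longlonglongrightarrow> 0"
    using tendsto_add[OF assms(1,4)[unfolded L2_tendsto_def]] by simp
qed

lemma L2_tendsto_cong:
  assumes "L2_tendsto M f u" "\<And>n. f n \<in> borel_measurable M" "\<And>n. g n \<in> borel_measurable M"
    "u \<in> borel_measurable M" "v \<in> borel_measurable M"
    "\<And>n. AE x in M. g n x = f n x" "AE x in M. v x = u x"
  shows "L2_tendsto M g v"
proof -
  have "L2_norm M (\<lambda>x. g n x - v x) = L2_norm M (\<lambda>x. f n x - u x)" for n
  proof (rule L2_norm_cong_AE)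
    show "AE x in M. g n x - v x = f n x - u x" using assms(6)[of n] assms(7) by eventually_elim simp
  qed (use assms in measurable)
  then show ?thesis using assms(1) by (simp add: L2_tendsto_def)
qed

lemma L2_closure_graphI:
  assumes "u \<in> L2 M" "v \<in> L2 M" "\<And>n. f n \<in> D" "L2_tendsto M f u" "L2_tendsto M (\<lambda>n. T (f n)) v"
  shows "(u, v) \<in> L2_closure M (graph_on D T)"
proof -
  have "(f n, T (f n)) \<in> graph_on D T" for n using assms(3) by (auto simp: graph_on_def)
  then have "\<exists>g. (\<forall>n. (f n, g n) \<in> graph_on D T) \<and> L2_tendsto M f u \<and> L2_tendsto M g v"
    using assms(4,5) by (intro exI[of _ "\<lambda>n. T (f n)"]) simp
  then show ?thesis using assms(1,2) unfolding L2_closure_def by blast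
qed

text \<open>Density of the range of \<open>T - 1\<close> together with \<open>\<parallel>f\<parallel> \<le> \<parallel>T f - f\<parallel>\<close> shows that each element of the
  adjoint is a limit of elements of the graph.\<close>
lemma essentially_self_adjoint_criterion:
  assumes op: "L2_operator M D T" and dense: "L2_dense M D"
    and sym: "\<And>f g. f \<in> D \<Longrightarrow> g \<in> D \<Longrightarrow> L2_inner M (T f) g = L2_inner M f (T g)"
    and diss: "\<And>f. f \<in> D \<Longrightarrow> L2_inner M (T f) f \<le> 0"
    and orth: "\<And>w. w \<in> L2 M \<Longrightarrow> (\<And>f. f \<in> D \<Longrightarrow> L2_inner M (\<lambda>x. T f x - f x) w = 0) \<Longrightarrow> AE x in M. w x = 0"
  shows "essentially_self_adjoint M D T"
  unfolding essentially_self_adjoint_def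
proof (intro conjI op dense)
  have DL: "f \<in> L2 M" and TL: "T f \<in> L2 M" if "f \<in> D" for f
    using op that by (auto simp: L2_operator_def)
  have lin: "(\<lambda>x. a * f x + b * g x) \<in> D" "AE x in M. T (\<lambda>x. a * f x + b * g x) x = a * T f x + b * T g x"
    if "f \<in> D" "g \<in> D" for f g a b
    using op that by (auto simp: L2_operator_def)
  have D0: "(\<lambda>x. 0) \<in> D" using op by (simp add: L2_operator_def)
  let ?G = "graph_on D T"
  let ?C = "L2_closure M ?G"
  show "L2_adjoint M ?C = ?C"
  proof
    show "?C \<subseteq> L2_adjoint M ?C"
    proof (rule subrelI)
      fix u v assume "(u, v) \<in> ?C"
      then obtain f g where uv: "u \<in> L2 M" "v \<in> L2 M" and fg: "\<And>n::nat. (f n, g n) \<in> ?G" "L2_tendsto M f u" "L2_tendsto M g v"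
        unfolding L2_closure_def by blast
      have f: "f n \<in> D" "g n = T (f n)" for n using fg(1)[of n] by (auto simp: graph_on_def)
      have "L2_inner M v' u = L2_inner M u' v" if uvC: "(u', v') \<in> ?C" for u' v'
      proof -
        obtain f' g' where uv': "u' \<in> L2 M" "v' \<in> L2 M" and fg': "\<And>n::nat. (f' n, g' n) \<in> ?G" "L2_tendsto M f' u'" "L2_tendsto M g' v'"
          using uvC unfolding L2_closure_def by blast
        have f': "f' n \<in> D" "g' n = T (f' n)" for n using fg'(1)[of n] by (auto simp: graph_on_def)
        have "(\<lambda>n. L2_inner M (g' n) (f n)) \<longlonglongrightarrow> L2_inner M v' u"
          by (rule L2_inner_tendsto2[OF fg'(3) _ uv'(2) fg(2) _ uv(1)]) (auto simp: f' f DL TL)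
        moreover have "(\<lambda>n. L2_inner M (f' n) (g n)) \<longlonglongrightarrow> L2_inner M u' v"
          by (rule L2_inner_tendsto2[OF fg'(2) _ uv'(1) fg(3) _ uv(2)]) (auto simp: f' f DL TL)
        moreover have "L2_inner M (g' n) (f n) = L2_inner M (f' n) (g n)" for n using sym f f' by simp
        ultimately show ?thesis using LIMSEQ_unique by auto
      qed
      then show "(u, v) \<in> L2_adjoint M ?C" using uv unfolding L2_adjoint_def by blast
    qed
    show "L2_adjoint M ?C \<subseteq> ?C"
    proof (rule subrelI)
      fix u v assume uvA: "(u, v) \<in> L2_adjoint M ?C"
      then have u: "u \<in> L2 M" and v: "v \<in> L2 M" by (auto simp: L2_adjoint_def)
      have adj: "L2_inner M (T f) u = L2_inner M f v" if "f \<in> D" for f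
      proof -
        have "(f, T f) \<in> ?C"
          by (rule L2_closure_graphI[where f = "\<lambda>_. f"]) (simp_all add: that DL TL L2_tendsto_const)
        then show ?thesis using uvA unfolding L2_adjoint_def by blast
      qed
      \<comment> \<open>\<open>T\<close> is linear only up to null sets, so the literal range of
        \<open>T - 1\<close> need not be a subspace; its saturation within \<open>L2 M\<close> is
        one.\<close>
      define D' where "D' = {h \<in> L2 M. \<exists>f\<in>D. AE x in M. h x = T f x - f x}"
      have dense': "L2_dense M D'"
      proof (rule L2_dense_if_orthogonal_trivial)
        show "D' \<subseteq> L2 M" by (auto simp: D'_def)
        have "AE x in M. T (\<lambda>x. 0) x = 0" using op D0 by (auto simp: L2_operator_def)
        then show "(\<lambda>x. 0) \<in> D'" using D0 L2_zero unfolding D'_def by force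
        show "(\<lambda>x. a * h x + b * k x) \<in> D'" if hk: "h \<in> D'" "k \<in> D'" for h k a b
        proof -
          obtain f g where f: "f \<in> D" "AE x in M. h x = T f x - f x" and g: "g \<in> D" "AE x in M. k x = T g x - g x"
            using hk by (auto simp: D'_def)
          have "AE x in M. a * h x + b * k x = T (\<lambda>x. a * f x + b * g x) x - (a * f x + b * g x)"
            using f(2) g(2) lin(2)[OF f(1) g(1), of a b]
          proof eventually_elim
            case (elim x)
            show ?case unfolding elim by (simp add: algebra_simps)
          qed
          moreover have "(\<lambda>x. a * h x + b * k x) \<in> L2 M" using hk by (intro L2_lin) (auto simp: D'_def)
          ultimately show ?thesis using lin(1)[OF f(1) g(1), of a b] unfolding D'_def by blast
        qed
        show "AE x in M. w x = 0" if w: "w \<in> L2 M" "\<And>h. h \<in> D' \<Longrightarrow> L2_inner M h w = 0" for w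
        proof (rule orth[OF w(1) w(2)])
          fix f assume f: "f \<in> D"
          show "(\<lambda>x. T f x - f x) \<in> D'"
            unfolding D'_def using f L2_diff[OF TL[OF f] DL[OF f]] by (auto intro!: bexI[of _ f])
        qed
      qed
      have "(\<lambda>x. v x - u x) \<in> L2 M" by (intro L2_diff u v)
      then obtain h where h: "\<And>n::nat. h n \<in> D'" "L2_tendsto M h (\<lambda>x. v x - u x)"
        using dense' unfolding L2_dense_def by blast
      have "\<exists>f. f \<in> D \<and> (AE x in M. h n x = T f x - f x)" for n using h(1)[of n] by (auto simp: D'_def)
      then obtain f where f: "\<And>n. f n \<in> D" "\<And>n. AE x in M. h n x = T (f n) x - f n x" by metis
      have hL: "h n \<in> L2 M" for n using h(1) by (auto simp: D'_def)
      have fL: "f n \<in> L2 M" "T (f n) \<in> L2 M" for n using f(1) DL TL by auto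
      \<comment> \<open>Dissipativity makes \<open>T - 1\<close> expansive, so that convergence of
        the images forces the preimages \<open>f n\<close> to be Cauchy.\<close>
      have est: "L2_norm M (\<lambda>x. f m x - f n x) \<le> L2_norm M (\<lambda>x. h m x - h n x)" for m n
      proof -
        let ?e = "\<lambda>x. 1 * f m x + (-1) * f n x"
        have e: "?e \<in> D" by (rule lin(1)[OF f(1) f(1)])
        have "AE x in M. h m x - h n x = T ?e x - ?e x"
          using f(2)[of m] f(2)[of n] lin(2)[OF f(1)[of m] f(1)[of n], of 1 "-1"] by eventually_elim simp
        then have eq: "L2_norm M (\<lambda>x. h m x - h n x) = L2_norm M (\<lambda>x. T ?e x - ?e x)"
          using L2_measurable[OF hL] L2_measurable[OF DL[OF e]] L2_measurable[OF TL[OF e]]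
          by (intro L2_norm_cong_AE borel_measurable_diff) auto
        have "L2_inner M (\<lambda>x. T ?e x - ?e x) ?e = L2_inner M (T ?e) ?e - (L2_norm M ?e)\<^sup>2"
          using L2_inner_diff[OF TL[OF e] DL[OF e] DL[OF e]] unfolding L2_norm_sq by (simp add: L2_inner_def power2_eq_square)
        then have "(L2_norm M ?e)\<^sup>2 \<le> \<bar>L2_inner M (\<lambda>x. T ?e x - ?e x) ?e\<bar>" using diss[OF e] by linarith
        also have "\<dots> \<le> L2_norm M (\<lambda>x. T ?e x - ?e x) * L2_norm M ?e"
          by (intro L2_Cauchy_Schwarz L2_diff TL DL e)
        finally have "L2_norm M ?e * L2_norm M ?e \<le> L2_norm M (\<lambda>x. T ?e x - ?e x) * L2_norm M ?e"
          by (simp add: power2_eq_square)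
        then have "L2_norm M ?e \<le> L2_norm M (\<lambda>x. T ?e x - ?e x)"
          using mult_right_le_imp_le[of "L2_norm M ?e" "L2_norm M ?e"] by (cases "L2_norm M ?e = 0") (auto simp: less_le)
        then show ?thesis unfolding eq by simp
      qed
      obtain u0 where u0: "u0 \<in> L2 M" "L2_tendsto M f u0"
      proof (rule L2_complete[OF fL(1)])
        fix e :: real assume e: "e > 0"
        obtain N where N: "\<And>n. n \<ge> N \<Longrightarrow> L2_norm M (\<lambda>x. h n x - (v x - u x)) < e / 2"
          using LIMSEQ_D[OF h(2)[unfolded L2_tendsto_def], of "e/2"] e by auto
        have "L2_norm M (\<lambda>x. f m x - f n x) < e" if mn: "m \<ge> N" "n \<ge> N" for m n
        proof -
          have "L2_norm M (\<lambda>x. h m x - h n x) \<le> L2_norm M (\<lambda>x. h m x - (v x - u x)) + L2_norm M (\<lambda>x. (v x - u x) - h n x)"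
            by (intro L2_norm_triangle_diff hL L2_diff u v)
          also have "L2_norm M (\<lambda>x. (v x - u x) - h n x) = L2_norm M (\<lambda>x. h n x - (v x - u x))"
            by (rule L2_norm_minus_commute)
          finally show ?thesis using est[of m n] N[OF mn(1)] N[OF mn(2)] by linarith
        qed
        then show "\<exists>N. \<forall>m\<ge>N. \<forall>n\<ge>N. L2_norm M (\<lambda>x. f m x - f n x) < e" by blast
      qed
      have hf: "L2_tendsto M (\<lambda>n x. h n x + f n x) (\<lambda>x. (v x - u x) + u0 x)"
        by (rule L2_tendsto_add[OF h(2) hL _ u0(2) fL(1) u0(1)]) (intro L2_diff u v)
      \<comment> \<open>By symmetry the limit \<open>u0\<close> obeys the adjoint relation of
        \<open>u\<close> with \<open>v\<close> replaced by \<open>v - u + u0\<close>. Subtracting,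
        \<open>u0 - u\<close> is orthogonal to the range of \<open>T - 1\<close>.\<close>
      have "AE x in M. u0 x - u x = 0"
      proof (rule orth)
        show "(\<lambda>x. u0 x - u x) \<in> L2 M" by (intro L2_diff u u0)
        fix g assume g: "g \<in> D"
        have gL: "g \<in> L2 M" "T g \<in> L2 M" "(\<lambda>x. T g x - g x) \<in> L2 M" using g DL TL by (auto intro: L2_diff)
        have Tf: "L2_tendsto M (\<lambda>n. T (f n)) (\<lambda>x. (v x - u x) + u0 x)"
        proof (rule L2_tendsto_cong[OF hf])
          show "AE x in M. T (f n) x = h n x + f n x" for n using f(2)[of n] by eventually_elim simp
        qed (use L2_measurable[OF hL] L2_measurable[OF fL(1)] L2_measurable[OF fL(2)] L2_measurable[OF u] L2_measurable[OF v] L2_measurable[OF u0(1)] in auto)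
        have vuL: "(\<lambda>x. (v x - u x) + u0 x) \<in> L2 M" by (intro L2_add L2_diff u v u0)
        have "(\<lambda>n. L2_inner M (f n) (T g)) \<longlonglongrightarrow> L2_inner M u0 (T g)"
          by (rule L2_inner_tendsto[OF u0(2) fL(1) u0(1) gL(2)])
        moreover have "(\<lambda>n. L2_inner M (T (f n)) g) \<longlonglongrightarrow> L2_inner M (\<lambda>x. (v x - u x) + u0 x) g"
          by (rule L2_inner_tendsto[OF Tf fL(2) vuL gL(1)])
        moreover have "L2_inner M (f n) (T g) = L2_inner M (T (f n)) g" for n using sym[OF f(1) g] by simp
        ultimately have "L2_inner M u0 (T g) = L2_inner M (\<lambda>x. (v x - u x) + u0 x) g"
          using LIMSEQ_unique by auto
        also have "\<dots> = L2_inner M v g - L2_inner M u g + L2_inner M u0 g"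
          using L2_inner_lin[OF L2_diff[OF v u] u0(1) gL(1), of 1 1] L2_inner_diff[OF v u gL(1)] by simp
        finally have "L2_inner M u0 (T g) = L2_inner M v g - L2_inner M u g + L2_inner M u0 g" .
        then have "L2_inner M (T g) u0 - L2_inner M g u0 = L2_inner M (T g) u - L2_inner M g u"
          using adj[OF g] by (simp add: L2_inner_commute)
        then have "L2_inner M (\<lambda>x. T g x - g x) u0 = L2_inner M (\<lambda>x. T g x - g x) u"
          using L2_inner_diff[OF gL(2) gL(1)] u0(1) u by simp
        then show "L2_inner M (\<lambda>x. T g x - g x) (\<lambda>x. u0 x - u x) = 0"
          using L2_inner_diff[OF u0(1) u gL(3)] by (simp add: L2_inner_commute)
      qed
      then have ae: "AE x in M. u x = u0 x" by eventually_elim simp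
      have "L2_tendsto M f u"
        by (rule L2_tendsto_cong[OF u0(2)]) (use ae L2_measurable[OF fL(1)] L2_measurable[OF u] L2_measurable[OF u0(1)] in auto)
      moreover have "L2_tendsto M (\<lambda>n. T (f n)) v"
      proof (rule L2_tendsto_cong[OF hf])
        show "AE x in M. T (f n) x = h n x + f n x" for n using f(2)[of n] by eventually_elim simp
        show "AE x in M. v x = v x - u x + u0 x" using ae by eventually_elim simp
      qed (use L2_measurable[OF hL] L2_measurable[OF fL(1)] L2_measurable[OF fL(2)] L2_measurable[OF u] L2_measurable[OF v] L2_measurable[OF u0(1)] in auto)
      ultimately show "(u, v) \<in> ?C"
        using L2_closure_graphI[where f = f and T = T, OF u v f(1)] by blast
    qed
  qed
qed

section \<open>Local integrability of the coefficients\<close>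

lemma Lloc_bound:
  fixes f :: "'a::euclidean_space \<Rightarrow> real"
  assumes g: "g \<in> Lloc p" and f: "f \<in> borel_measurable lebesgue" and p: "0 \<le> p"
    and le: "\<And>K. compact K \<Longrightarrow> \<exists>C. AE x in lebesgue. x \<in> K \<longrightarrow> \<bar>f x\<bar> \<le> C * \<bar>g x\<bar>"
  shows "f \<in> Lloc p"
  unfolding Lloc_def
proof (intro CollectI conjI allI impI f)
  fix K :: "'a set" assume K: "compact K"
  note [measurable] = f Lloc_measurable[OF g] compact_sets_lebesgue[OF K]
  obtain C where C: "AE x in lebesgue. x \<in> K \<longrightarrow> \<bar>f x\<bar> \<le> C * \<bar>g x\<bar>" using le[OF K] by blast
  have "integrable lebesgue (\<lambda>x. \<bar>C\<bar> powr p * (indicator K x * \<bar>g x\<bar> powr p))"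
    using g K by (intro integrable_mult_right) (auto simp: Lloc_def set_integrable_def)
  then have "integrable lebesgue (\<lambda>x. indicator K x * \<bar>f x\<bar> powr p)"
  proof (rule Bochner_Integration.integrable_bound)
    show "AE x in lebesgue. norm (indicator K x * \<bar>f x\<bar> powr p) \<le> norm (\<bar>C\<bar> powr p * (indicator K x * \<bar>g x\<bar> powr p))"
      using C
    proof eventually_elim
      case (elim x)
      show ?case
      proof (cases "x \<in> K")
        case True
        then have "\<bar>f x\<bar> \<le> \<bar>C\<bar> * \<bar>g x\<bar>"
          using elim mult_right_mono[OF abs_ge_self[of C], of "\<bar>g x\<bar>"] by simp
        then have "\<bar>f x\<bar> powr p \<le> (\<bar>C\<bar> * \<bar>g x\<bar>) powr p" using p by (intro powr_mono2) auto
        also have "\<dots> = \<bar>C\<bar> powr p * \<bar>g x\<bar> powr p" by (simp add: powr_mult)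
        finally show ?thesis using True by simp
      qed simp
    qed
  qed measurable
  then show "set_integrable lebesgue K (\<lambda>x. \<bar>f x\<bar> powr p)" by (simp add: set_integrable_def)
qed

lemma Lloc_add:
  fixes f g :: "'a::euclidean_space \<Rightarrow> real"
  assumes f: "f \<in> Lloc p" and g: "g \<in> Lloc p" and p: "0 \<le> p"
  shows "(\<lambda>x. f x + g x) \<in> Lloc p"
  unfolding Lloc_def
proof (intro CollectI conjI allI impI)
  note [measurable] = Lloc_measurable[OF f] Lloc_measurable[OF g]
  show "(\<lambda>x. f x + g x) \<in> borel_measurable lebesgue" by measurable
  fix K :: "'a set" assume K: "compact K"
  note [measurable] = compact_sets_lebesgue[OF K]
  have "integrable lebesgue (\<lambda>x. 2 powr p * (indicator K x * \<bar>f x\<bar> powr p + indicator K x * \<bar>g x\<bar> powr p))"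
    using f g K by (intro integrable_mult_right Bochner_Integration.integrable_add) (auto simp: Lloc_def set_integrable_def)
  then have "integrable lebesgue (\<lambda>x. indicator K x * \<bar>f x + g x\<bar> powr p)"
  proof (rule Bochner_Integration.integrable_bound)
    have "\<bar>a + b\<bar> powr p \<le> 2 powr p * (\<bar>a\<bar> powr p + \<bar>b\<bar> powr p)" for a b :: real
    proof -
      have "\<bar>a + b\<bar> powr p \<le> (2 * max \<bar>a\<bar> \<bar>b\<bar>) powr p" using p by (intro powr_mono2) auto
      also have "\<dots> = 2 powr p * (max \<bar>a\<bar> \<bar>b\<bar>) powr p" by (simp add: powr_mult)
      also have "\<dots> \<le> 2 powr p * (\<bar>a\<bar> powr p + \<bar>b\<bar> powr p)"
        by (intro mult_left_mono) (auto simp: max_def)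
      finally show ?thesis .
    qed
    note pt = this
    show "AE x in lebesgue. norm (indicator K x * \<bar>f x + g x\<bar> powr p) \<le> norm (2 powr p * (indicator K x * \<bar>f x\<bar> powr p + indicator K x * \<bar>g x\<bar> powr p))"
    proof (rule AE_I2)
      fix x
      show "norm (indicator K x * \<bar>f x + g x\<bar> powr p) \<le> norm (2 powr p * (indicator K x * \<bar>f x\<bar> powr p + indicator K x * \<bar>g x\<bar> powr p))"
        using pt[of "f x" "g x"] by (cases "x \<in> K") auto
    qed
  qed measurable
  then show "set_integrable lebesgue K (\<lambda>x. \<bar>f x + g x\<bar> powr p)" by (simp add: set_integrable_def)
qed

lemma Lloc_zero: "(\<lambda>x. 0) \<in> Lloc p"
  by (simp add: Lloc_def set_integrable_def)

lemma Lloc_sum: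
  fixes f :: "'i \<Rightarrow> 'a::euclidean_space \<Rightarrow> real"
  assumes "0 \<le> p" "\<And>j. j \<in> J \<Longrightarrow> f j \<in> Lloc p"
  shows "(\<lambda>x. \<Sum>j\<in>J. f j x) \<in> Lloc p"
  using assms(2) by (induction J rule: infinite_finite_induct) (simp_all add: Lloc_zero Lloc_add assms(1))

lemma Lloc_mult_bounded:
  fixes f g :: "'a::euclidean_space \<Rightarrow> real"
  assumes f: "f \<in> Lloc p" and g: "g \<in> Linf_loc" and p: "0 \<le> p"
  shows "(\<lambda>x. g x * f x) \<in> Lloc p"
proof (rule Lloc_bound[OF f _ p])
  show "(\<lambda>x. g x * f x) \<in> borel_measurable lebesgue" using f g by (auto simp: Linf_loc_def)
  fix K :: "'a set" assume K: "compact K"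
  obtain C where C: "AE x in lebesgue. x \<in> K \<longrightarrow> \<bar>g x\<bar> \<le> C" using g K by (auto simp: Linf_loc_def)
  have "AE x in lebesgue. x \<in> K \<longrightarrow> \<bar>g x * f x\<bar> \<le> C * \<bar>f x\<bar>"
    using C by eventually_elim (simp add: abs_mult mult_right_mono)
  then show "\<exists>C. AE x in lebesgue. x \<in> K \<longrightarrow> \<bar>g x * f x\<bar> \<le> C * \<bar>f x\<bar>" by blast
qed

lemma Lloc_const: "(\<lambda>x. c) \<in> Lloc p"
  by (auto simp: Lloc_def set_integrable_def intro!: integrable_mult_left integrable_indicator_compact)

lemma Linf_loc_Lloc:
  assumes "g \<in> Linf_loc" "0 \<le> p" shows "g \<in> Lloc p"
  using Lloc_mult_bounded[OF Lloc_const[of 1] assms] by simp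

lemma Linf_loc_mult:
  assumes "f \<in> Linf_loc" "g \<in> Linf_loc" shows "(\<lambda>x. f x * g x) \<in> Linf_loc"
  unfolding Linf_loc_def
proof (intro CollectI conjI allI impI)
  show "(\<lambda>x. f x * g x) \<in> borel_measurable lebesgue" using assms by (auto simp: Linf_loc_def)
  fix K :: "'a set" assume K: "compact K"
  obtain C D where C: "AE x in lebesgue. x \<in> K \<longrightarrow> \<bar>f x\<bar> \<le> C" "AE x in lebesgue. x \<in> K \<longrightarrow> \<bar>g x\<bar> \<le> D"
    using assms K unfolding Linf_loc_def by blast
  have "AE x in lebesgue. x \<in> K \<longrightarrow> \<bar>f x * g x\<bar> \<le> \<bar>C\<bar> * \<bar>D\<bar>"
    using C
  proof eventually_elim
    case (elim x)
    show ?case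
    proof
      assume "x \<in> K"
      then have "\<bar>f x\<bar> \<le> \<bar>C\<bar>" "\<bar>g x\<bar> \<le> \<bar>D\<bar>" using elim by auto
      then show "\<bar>f x * g x\<bar> \<le> \<bar>C\<bar> * \<bar>D\<bar>" unfolding abs_mult by (intro mult_mono) auto
    qed
  qed
  then show "\<exists>C. AE x in lebesgue. x \<in> K \<longrightarrow> \<bar>f x * g x\<bar> \<le> C" by blast
qed

lemma smooth_Linf_loc:
  assumes "smooth g" shows "g \<in> Linf_loc"
  unfolding Linf_loc_def
proof (intro CollectI conjI allI impI)
  show "g \<in> borel_measurable lebesgue" by (rule smooth_measurable[OF assms])
  fix K :: "(real^'a) set" assume "compact K"
  then obtain B where "\<And>x. x \<in> K \<Longrightarrow> \<bar>g x\<bar> \<le> B" using smooth_bounded_on_compact[OF assms] by metis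
  then have "AE x in lebesgue. x \<in> K \<longrightarrow> \<bar>g x\<bar> \<le> B" by simp
  then show "\<exists>C. AE x in lebesgue. x \<in> K \<longrightarrow> \<bar>g x\<bar> \<le> C" by blast
qed

lemma has_weak_partial_weak_pd: "has_weak_partial i f g \<Longrightarrow> has_weak_partial i f (weak_pd i f)"
  unfolding weak_pd_def by (rule someI[of "has_weak_partial i f"])

text \<open>Lets the finitely many derivatives of the coefficients share one constant.\<close>

lemma form_small_mono:
  assumes b: "form_small \<kappa> C b" and CD: "C \<le> D" shows "form_small \<kappa> D b"
  unfolding form_small_def
proof (intro conjI ballI allI impI)
  show "b \<in> borel_measurable lebesgue" "0 \<le> D" using b CD by (auto simp: form_small_def)
  fix g :: "real^'a \<Rightarrow> real" and t :: real assume gt: "g \<in> Cc_infty" "0 < t" "t \<le> 1"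
  let ?N = "t powr (\<kappa> - 1) * nrm g + t powr \<kappa> * (\<Sum>i\<in>UNIV. nrm (pd i g))"
  have "0 \<le> ?N" by (simp add: sum_nonneg)
  then have "C * ?N \<le> D * ?N" by (rule mult_right_mono[OF CD])
  then show "(\<lambda>x. b x * g x) \<in> L2 lebesgue" "nrm (\<lambda>x. b x * g x) \<le> D * ?N"
    using b gt unfolding form_small_def by fastforce+
qed

section \<open>The weighted operator\<close>

locale weighted_operator =
  fixes A :: "real^'n \<Rightarrow> real^'n^'n" and \<phi> \<rho> :: "real^'n \<Rightarrow> real" and p :: real
  assumes card: "CARD('n) \<ge> 2"
    and \<phi>: "\<phi> \<in> H1loc 2"
    and \<rho>_def: "\<rho> = (\<lambda>x. (\<phi> x)\<^sup>2)"
    and recip: "recip_Linf_loc \<rho>"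
    and sym: "\<And>x. transpose (A x) = A x"
    and ell: "locally_strictly_elliptic A"
    and A_bdd: "\<And>i j. (\<lambda>x. A x $ i $ j) \<in> Linf"
    and p: "p > real CARD('n)"
    and A_H1: "\<And>i j. (\<lambda>x. A x $ i $ j) \<in> H1loc p"
    and grad_\<rho>: "(\<lambda>x. norm (weak_grad \<rho> x)) \<in> Lloc p"
begin

abbreviation \<mu> where "\<mu> \<equiv> weighted \<rho>"

definition a :: "'n \<Rightarrow> 'n \<Rightarrow> real^'n \<Rightarrow> real" where "a i j x = A x $ i $ j"
definition c :: "'n \<Rightarrow> 'n \<Rightarrow> real^'n \<Rightarrow> real" where "c i j x = \<rho> x * a i j x"
definition dc :: "'n \<Rightarrow> 'n \<Rightarrow> 'n \<Rightarrow> real^'n \<Rightarrow> real" where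
  "dc k i j x = weak_pd k \<rho> x * a i j x + \<rho> x * weak_pd k (a i j) x"

section \<open>Weak derivatives of the weight and of the coefficients\<close>

lemma p2: "p > 2" using card p by linarith

lemma a_sym: "a i j = a j i"
proof
  fix x
  have "A x $ i $ j = transpose (A x) $ i $ j" by (simp add: sym)
  also have "\<dots> = A x $ j $ i" by (simp add: transpose_def)
  finally show "a i j x = a j i x" by (simp add: a_def)
qed

lemma c_sym: "c i j x = c j i x"
  unfolding c_def a_sym[of i j] ..

text \<open>The choice made by \<open>weak_pd\<close> is meaningful only if some weak derivative
  exists; the product rule for \<phi> times \<phi> provides one.\<close>

lemma weak_\<rho>: "has_weak_partial k \<rho> (weak_pd k \<rho>)"
proof -
  obtain g where g: "g \<in> Lloc 2" "has_weak_partial k \<phi> g" and \<phi>2: "\<phi> \<in> Lloc 2" using \<phi> unfolding H1loc_def by blast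
  have "has_weak_partial k (\<lambda>x. \<phi> x * \<phi> x) (\<lambda>x. g x * \<phi> x + \<phi> x * g x)"
    by (rule weak_product_rule[OF \<phi>2 g \<phi>2 g])
  then show ?thesis by (intro has_weak_partial_weak_pd) (simp add: \<rho>_def power2_eq_square)
qed

lemma weak_pd_\<rho>_Lloc: "weak_pd k \<rho> \<in> Lloc p"
proof (rule Lloc_bound[OF grad_\<rho>])
  show "weak_pd k \<rho> \<in> borel_measurable lebesgue" using weak_partial_Lloc(2)[OF weak_\<rho>] by measurable
  have "\<bar>weak_pd k \<rho> x\<bar> \<le> 1 * \<bar>norm (weak_grad \<rho> x)\<bar>" for x
    using component_le_norm_cart[of "weak_grad \<rho> x" k] by (simp add: weak_grad_def)
  then show "\<exists>C. AE x in lebesgue. x \<in> K \<longrightarrow> \<bar>weak_pd k \<rho> x\<bar> \<le> C * \<bar>norm (weak_grad \<rho> x)\<bar>" for K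
    by (intro exI[of _ 1]) auto
qed (use p2 in simp)

lemma \<rho>_nonneg: "\<rho> x \<ge> 0" by (simp add: \<rho>_def)

lemma \<rho>_measurable [measurable]: "\<rho> \<in> borel_measurable lebesgue"
  using Lloc_measurable[OF weak_partial_Lloc(1)[OF weak_\<rho>]] .

lemma \<rho>_pos: "AE x in lebesgue. \<rho> x > 0"
  using recip unfolding recip_Linf_loc_def by (auto elim!: eventually_mono simp: less_le \<rho>_nonneg)

lemma inv_\<rho>: "(\<lambda>x. 1 / \<rho> x) \<in> Linf_loc"
  using recip by (simp add: recip_Linf_loc_def)

text \<open>Morrey's bound gives the upper side, nonnegativity the lower. Together with
  \<open>inv_\<rho>\<close> the weight is then comparable to 1 on compact sets, so that \<rho> A
  inherits local bounds and local ellipticity from \<open>A\<close>.\<close>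

lemma \<rho>_Linf_loc: "\<rho> \<in> Linf_loc"
  unfolding Linf_loc_def
proof (intro CollectI conjI allI impI \<rho>_measurable)
  fix K :: "(real^'n) set" assume K: "compact K"
  obtain R where R: "\<And>x. x \<in> K \<Longrightarrow> norm x < R"
    using compact_imp_bounded[OF K] unfolding bounded_pos_less by blast
  obtain C where "AE x in lebesgue. norm x < R \<longrightarrow> \<rho> x \<le> C"
    by (rule locally_bounded_above[OF weak_partial_Lloc(1)[OF weak_\<rho>] weak_pd_\<rho>_Lloc weak_\<rho> p])
  then have "AE x in lebesgue. x \<in> K \<longrightarrow> \<bar>\<rho> x\<bar> \<le> C"
    by eventually_elim (use R \<rho>_nonneg in auto)
  then show "\<exists>C. AE x in lebesgue. x \<in> K \<longrightarrow> \<bar>\<rho> x\<bar> \<le> C" by blast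
qed

text \<open>The version selected by \<open>weak_pd\<close> need not be the one for which the
  hypothesis asserts integrability; by uniqueness they agree almost everywhere.\<close>

lemma weak_a: "has_weak_partial k (a i j) (weak_pd k (a i j))" and weak_pd_a_Lloc: "weak_pd k (a i j) \<in> Lloc p"
proof -
  obtain g where g: "g \<in> Lloc p" "has_weak_partial k (a i j) g" using A_H1[of i j] unfolding H1loc_def a_def[abs_def] by blast
  show w: "has_weak_partial k (a i j) (weak_pd k (a i j))" by (rule has_weak_partial_weak_pd[OF g(2)])
  have "AE x in lebesgue. weak_pd k (a i j) x = g x" by (rule weak_partial_unique[OF w g(2)])
  then have "AE x in lebesgue. x \<in> K \<longrightarrow> \<bar>weak_pd k (a i j) x\<bar> \<le> 1 * \<bar>g x\<bar>" for K by eventually_elim simp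
  then show "weak_pd k (a i j) \<in> Lloc p"
    using p2 Lloc_measurable[OF weak_partial_Lloc(2)[OF w]] by (intro Lloc_bound[OF g(1)]) (auto intro: exI[of _ 1])
qed

lemma a_measurable [measurable]: "a i j \<in> borel_measurable lebesgue"
  using Lloc_measurable[OF weak_partial_Lloc(1)[OF weak_a]] .

lemma a_bounded: obtains \<Lambda> where "\<Lambda> \<ge> 0" "\<And>i j. AE x in lebesgue. \<bar>a i j x\<bar> \<le> \<Lambda>"
proof -
  have "\<exists>C. AE x in lebesgue. \<bar>a i j x\<bar> \<le> C" for i j using A_bdd[of i j] by (simp add: Linf_def a_def)
  then obtain C where C: "\<And>i j. AE x in lebesgue. \<bar>a i j x\<bar> \<le> C i j" by metis
  define L where "L = (\<Sum>i\<in>UNIV. \<Sum>j\<in>UNIV. \<bar>C i j\<bar>)"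
  have "\<bar>C i j\<bar> \<le> L" for i j
  proof -
    have "\<bar>C i j\<bar> \<le> (\<Sum>j\<in>UNIV. \<bar>C i j\<bar>)" by (rule member_le_sum) auto
    also have "\<dots> \<le> L" unfolding L_def by (rule member_le_sum[of i UNIV "\<lambda>i. \<Sum>j\<in>UNIV. \<bar>C i j\<bar>"]) (auto simp: sum_nonneg)
    finally show ?thesis .
  qed
  note CL = this
  have "AE x in lebesgue. \<bar>a i j x\<bar> \<le> L" for i j
    using C[of i j] by eventually_elim (use CL[of i j] in linarith)
  moreover have "L \<ge> 0" unfolding L_def by (intro sum_nonneg) auto
  ultimately show thesis using that by blast
qed

lemma a_Linf_loc: "a i j \<in> Linf_loc"
proof -
  obtain \<Lambda> where "\<And>i j. AE x in lebesgue. \<bar>a i j x\<bar> \<le> \<Lambda>" using a_bounded by metis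
  from this[of i j] have "AE x in lebesgue. x \<in> K \<longrightarrow> \<bar>a i j x\<bar> \<le> \<Lambda>" for K by eventually_elim simp
  then show ?thesis unfolding Linf_loc_def by (auto intro: a_measurable)
qed

lemma weak_c: "has_weak_partial k (c i j) (dc k i j)"
  unfolding c_def[abs_def] dc_def[abs_def]
  using p2 by (intro weak_product_rule Linf_loc_Lloc \<rho>_Linf_loc a_Linf_loc weak_\<rho> weak_a
      Lloc_powr_mono[OF weak_pd_\<rho>_Lloc] Lloc_powr_mono[OF weak_pd_a_Lloc]) auto

lemma c_Linf_loc: "c i j \<in> Linf_loc"
  unfolding c_def[abs_def] by (intro Linf_loc_mult \<rho>_Linf_loc a_Linf_loc)

lemma dc_Lloc: "dc k i j \<in> Lloc p"
proof -
  have "(\<lambda>x. a i j x * weak_pd k \<rho> x + \<rho> x * weak_pd k (a i j) x) \<in> Lloc p"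
    using p2 by (intro Lloc_add Lloc_mult_bounded weak_pd_\<rho>_Lloc weak_pd_a_Lloc a_Linf_loc \<rho>_Linf_loc) auto
  then show ?thesis by (simp add: dc_def[abs_def] mult.commute)
qed

lemma drift_Lloc: "drift A \<rho> i \<in> Lloc p"
proof -
  have "(\<lambda>x. \<Sum>j\<in>UNIV. weak_pd j (a i j) x + (a i j x * (1 / \<rho> x)) * weak_pd j \<rho> x) \<in> Lloc p"
    using p2 by (intro Lloc_sum Lloc_add Lloc_mult_bounded Linf_loc_mult weak_pd_\<rho>_Lloc weak_pd_a_Lloc a_Linf_loc inv_\<rho>) auto
  then show ?thesis by (simp add: drift_def[abs_def] a_def[abs_def])
qed

text \<open>Where \<rho> > 0, the product \<open>\<rho> b\<^sub>i\<close> is the sum over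
  \<open>j\<close> of \<open>\<partial>\<^sub>j (\<rho> a\<^sub>i\<^sub>j)\<close>. Symmetry of
  \<open>a\<close> brings the indices into the order used by \<open>divop\<close>, and symmetry of
  mixed derivatives matches the second-order parts.\<close>

lemma op_S_divop:
  assumes "f \<in> Cc_infty" shows "AE x in lebesgue. \<rho> x * op_S A \<rho> f x = divop c dc f x"
  using \<rho>_pos
proof eventually_elim
  case (elim x)
  have "\<rho> x * drift A \<rho> i x = (\<Sum>j\<in>UNIV. dc j j i x)" for i
    using elim a_sym[of _ i] unfolding drift_def sum_distrib_left
    by (intro sum.cong) (auto simp: dc_def a_def[abs_def] field_simps)
  then have "\<rho> x * (\<Sum>i\<in>UNIV. drift A \<rho> i x * pd i f x) = (\<Sum>i\<in>UNIV. \<Sum>j\<in>UNIV. dc j j i x * pd i f x)"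
    unfolding sum_distrib_left by (simp add: mult.assoc[symmetric] sum_distrib_right[symmetric])
  also have "\<dots> = (\<Sum>i\<in>UNIV. \<Sum>j\<in>UNIV. dc i i j x * pd j f x)" by (rule sum.swap)
  finally have 1: "\<rho> x * (\<Sum>i\<in>UNIV. drift A \<rho> i x * pd i f x) = (\<Sum>i\<in>UNIV. \<Sum>j\<in>UNIV. dc i i j x * pd j f x)" .
  have 2: "\<rho> x * (\<Sum>i\<in>UNIV. \<Sum>j\<in>UNIV. A x $ i $ j * pd j (pd i f) x) = (\<Sum>i\<in>UNIV. \<Sum>j\<in>UNIV. c i j x * pd i (pd j f) x)"
    unfolding sum_distrib_left
    by (intro sum.cong) (auto simp: c_def a_def pd_commute[OF Cc_smooth[OF assms]])
  show ?case unfolding op_S_def divop_def distrib_left sum.distrib 1 2 by simp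
qed

lemma op_S_measurable: "f \<in> Cc_infty \<Longrightarrow> op_S A \<rho> f \<in> borel_measurable lebesgue"
proof -
  assume f: "f \<in> Cc_infty"
  have [measurable]: "pd i f \<in> borel_measurable lebesgue" "pd i (pd j f) \<in> borel_measurable lebesgue" for i j
    by (intro Cc_measurable Cc_pd f)+
  have [measurable]: "drift A \<rho> i \<in> borel_measurable lebesgue" for i using Lloc_measurable[OF drift_Lloc] .
  have [measurable]: "(\<lambda>x. A x $ i $ j) \<in> borel_measurable lebesgue" for i j using a_measurable[of i j] by (simp add: a_def[abs_def])
  show "op_S A \<rho> f \<in> borel_measurable lebesgue" unfolding op_S_def[abs_def] by measurable
qed

subsection \<open>The measure\<close>

text \<open>The density is positive almost everywhere, so both measures have the same null
  sets.\<close>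

lemma AE_\<mu>: "(AE x in \<mu>. P x) \<longleftrightarrow> (AE x in lebesgue. P x)"
proof -
  have "(AE x in \<mu>. P x) \<longleftrightarrow> (AE x in lebesgue. 0 < ennreal (\<rho> x) \<longrightarrow> P x)"
    unfolding weighted_def by (rule AE_density) measurable
  also have "\<dots> \<longleftrightarrow> (AE x in lebesgue. P x)"
  proof
    assume "AE x in lebesgue. 0 < ennreal (\<rho> x) \<longrightarrow> P x"
    then show "AE x in lebesgue. P x" using \<rho>_pos by eventually_elim simp
  qed (auto elim: eventually_mono)
  finally show ?thesis .
qed

lemma \<mu>_measurable: "f \<in> borel_measurable \<mu> \<longleftrightarrow> f \<in> borel_measurable lebesgue"
  unfolding weighted_def by simp

lemma \<mu>_integral: "f \<in> borel_measurable lebesgue \<Longrightarrow> (LINT x|\<mu>. f x) = (LINT x|lebesgue. \<rho> x * f x)"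
  unfolding weighted_def by (subst integral_density) (auto simp: \<rho>_nonneg)

lemma \<mu>_integrable: "f \<in> borel_measurable lebesgue \<Longrightarrow> integrable \<mu> f \<longleftrightarrow> integrable lebesgue (\<lambda>x. \<rho> x * f x)"
  unfolding weighted_def by (subst integrable_density) (auto simp: \<rho>_nonneg)

lemma L2_\<mu>: "f \<in> L2 \<mu> \<longleftrightarrow> f \<in> borel_measurable lebesgue \<and> integrable lebesgue (\<lambda>x. \<rho> x * (f x)\<^sup>2)"
  unfolding L2_def by (auto simp: \<mu>_measurable \<mu>_integrable)

lemma inner_\<mu>: "f \<in> borel_measurable lebesgue \<Longrightarrow> g \<in> borel_measurable lebesgue \<Longrightarrow>
    L2_inner \<mu> f g = (LINT x|lebesgue. \<rho> x * (f x * g x))"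
  unfolding L2_inner_def by (rule \<mu>_integral) measurable

lemma Cc_L2_\<mu>: "f \<in> Cc_infty \<Longrightarrow> f \<in> L2 \<mu>"
  unfolding L2_\<mu> power2_eq_square
  by (intro conjI Cc_measurable Lloc_Cc_integrable Cc_mult weak_partial_Lloc(1)[OF weak_\<rho>])

text \<open>On compact sets \<open>\<rho>\<close> is bounded below, so \<open>L\<^sup>2(\<mu>)\<close> embeds locally into \<open>L\<^sup>2(dx)\<close>.\<close>
lemma L2_\<mu>_local:
  assumes u: "u \<in> L2 \<mu>" and g: "g \<in> Linf_loc" and K: "compact K" "\<And>x. x \<notin> K \<Longrightarrow> g x = 0"
  shows "(\<lambda>x. u x * g x) \<in> L2 lebesgue"
proof (rule L2I)
  have um: "u \<in> borel_measurable lebesgue" and ui: "integrable lebesgue (\<lambda>x. \<rho> x * (u x)\<^sup>2)" using u by (auto simp: L2_\<mu>)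
  have gm: "g \<in> borel_measurable lebesgue" using g by (simp add: Linf_loc_def)
  show m: "(\<lambda>x. u x * g x) \<in> borel_measurable lebesgue" using um gm by measurable
  obtain C where C: "AE x in lebesgue. x \<in> K \<longrightarrow> \<bar>g x\<bar> \<le> C" using g K by (auto simp: Linf_loc_def)
  obtain D where D: "AE x in lebesgue. x \<in> K \<longrightarrow> \<bar>1 / \<rho> x\<bar> \<le> D" using inv_\<rho> K by (auto simp: Linf_loc_def)
  have "integrable lebesgue (\<lambda>x. (C\<^sup>2 * D) * (\<rho> x * (u x)\<^sup>2))" by (rule integrable_mult_right[OF ui])
  then show "integrable lebesgue (\<lambda>x. (u x * g x)\<^sup>2)"
  proof (rule Bochner_Integration.integrable_bound)
    show "AE x in lebesgue. norm ((u x * g x)\<^sup>2) \<le> norm ((C\<^sup>2 * D) * (\<rho> x * (u x)\<^sup>2))"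
      using C D \<rho>_pos
    proof eventually_elim
      case (elim x)
      show ?case
      proof (cases "x \<in> K")
        case True
        have "(g x)\<^sup>2 \<le> C\<^sup>2" using elim True by (metis abs_ge_zero order_trans power2_abs power_mono)
        moreover have "1 \<le> D * \<rho> x" using elim True by (simp add: field_simps)
        ultimately have "(g x)\<^sup>2 * 1 \<le> C\<^sup>2 * (D * \<rho> x)" by (intro mult_mono) auto
        then have "(g x)\<^sup>2 * (u x)\<^sup>2 \<le> C\<^sup>2 * (D * \<rho> x) * (u x)\<^sup>2" by (intro mult_right_mono) auto
        then show ?thesis by (simp add: power_mult_distrib mult_ac)
      qed (simp add: K(2))
    qed
  qed (use m in measurable)
qed

lemma divop_L2:
  assumes f: "f \<in> Cc_infty" shows "divop c dc f \<in> L2 lebesgue"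
proof -
  have "c i j \<in> Lloc 2" "dc k i j \<in> Lloc 2" for i j k
    using p2 Lloc_powr_mono[OF dc_Lloc] Linf_loc_Lloc[OF c_Linf_loc] by auto
  then show ?thesis
    unfolding divop_def[abs_def] by (intro L2_sum L2_add Lloc_two_Cc_L2 Cc_pd f)
qed

lemma divop_zero:
  assumes "\<And>i. pd i f x = 0" "\<And>i j. pd i (pd j f) x = 0" shows "divop c dc f x = 0"
  unfolding divop_def by (simp add: assms)

text \<open>By \<open>op_S_divop\<close> the integrand is \<open>1 / \<rho>\<close> times the square
  of \<open>divop c dc f\<close>; the first factor is bounded on the support of \<open>f\<close>,
  and the second is integrable because the coefficients are locally square integrable.\<close>

lemma op_S_L2:
  assumes f: "f \<in> Cc_infty" shows "op_S A \<rho> f \<in> L2 \<mu>"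
  unfolding L2_\<mu>
proof (intro conjI op_S_measurable f)
  obtain K where K: "compact K" "\<And>i x. x \<notin> K \<Longrightarrow> pd i f x = 0" using Cc_compact_support[OF f] by metis
  have K2: "pd i (pd j f) x = 0" if "x \<notin> K" for i j x
    by (rule pd_eq_0_open[of "- K" x "pd j f" 0]) (use that K in \<open>auto intro: compact_imp_closed\<close>)
  obtain D where D: "AE x in lebesgue. x \<in> K \<longrightarrow> \<bar>1 / \<rho> x\<bar> \<le> D" using inv_\<rho> K by (auto simp: Linf_loc_def)
  have "integrable lebesgue (\<lambda>x. D * (divop c dc f x)\<^sup>2)" by (intro integrable_mult_right L2_integrable divop_L2 f)
  then show "integrable lebesgue (\<lambda>x. \<rho> x * (op_S A \<rho> f x)\<^sup>2)"
  proof (rule Bochner_Integration.integrable_bound)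
    show "AE x in lebesgue. norm (\<rho> x * (op_S A \<rho> f x)\<^sup>2) \<le> norm (D * (divop c dc f x)\<^sup>2)"
      using D op_S_divop[OF f] \<rho>_pos
    proof eventually_elim
      case (elim x)
      have eq: "\<rho> x * (op_S A \<rho> f x)\<^sup>2 = (1 / \<rho> x) * (divop c dc f x)\<^sup>2"
        using elim by (simp add: elim(2)[symmetric] power2_eq_square)
      show ?case
      proof (cases "x \<in> K")
        case True
        then have "1 / \<rho> x \<le> D" using elim by auto
        then have "(1 / \<rho> x) * (divop c dc f x)\<^sup>2 \<le> D * (divop c dc f x)\<^sup>2" by (intro mult_right_mono) auto
        moreover have "0 \<le> (1 / \<rho> x) * (divop c dc f x)\<^sup>2" using elim by simp
        ultimately show ?thesis unfolding eq real_norm_def by linarith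
      next
        case False
        then have "divop c dc f x = 0" using K(2) K2 by (intro divop_zero)
        then show ?thesis unfolding eq by simp
      qed
    qed
    show "(\<lambda>x. \<rho> x * (op_S A \<rho> f x)\<^sup>2) \<in> borel_measurable lebesgue" using op_S_measurable[OF f] by measurable
  qed
qed

section \<open>Symmetry, sign and dense domain of the operator\<close>

lemma inner_op_S:
  assumes f: "f \<in> Cc_infty" and g: "g \<in> borel_measurable lebesgue"
  shows "L2_inner \<mu> (op_S A \<rho> f) g = (LINT x|lebesgue. g x * divop c dc f x)"
proof -
  have "L2_inner \<mu> (op_S A \<rho> f) g = (LINT x|lebesgue. \<rho> x * (op_S A \<rho> f x * g x))"
    by (rule inner_\<mu>[OF op_S_measurable[OF f] g])
  also have "\<dots> = (LINT x|lebesgue. g x * divop c dc f x)"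
  proof (rule integral_cong_AE)
    show "AE x in lebesgue. \<rho> x * (op_S A \<rho> f x * g x) = g x * divop c dc f x"
      using op_S_divop[OF f] by eventually_elim (simp add: mult_ac)
  qed (use op_S_measurable[OF f] g L2_measurable[OF divop_L2[OF f]] in measurable)
  finally show ?thesis .
qed

lemma matrix_form: "\<rho> x * (y \<bullet> (A x *v z)) = (\<Sum>i\<in>UNIV. \<Sum>j\<in>UNIV. c i j x * (y $ i * z $ j))"
  by (simp add: inner_vec_def matrix_vector_mult_def c_def a_def sum_distrib_left mult_ac)

lemma form_B_eq: "form_B A \<rho> f g = (LINT x|lebesgue. (\<Sum>i\<in>UNIV. \<Sum>j\<in>UNIV. c i j x * (pd i f x * pd j g x)))"
  unfolding form_B_def by (simp add: mult.commute[of _ "\<rho> _"] matrix_form grad_def)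

lemma form_B_sym: "form_B A \<rho> f g = form_B A \<rho> g f"
proof -
  have "(\<Sum>i\<in>UNIV. \<Sum>j\<in>UNIV. c i j x * (pd i f x * pd j g x)) = (\<Sum>i\<in>UNIV. \<Sum>j\<in>UNIV. c i j x * (pd i g x * pd j f x))" for x
    by (subst sum.swap, intro sum.cong refl) (subst c_sym, simp)
  then show ?thesis unfolding form_B_eq by simp
qed

lemma inner_op_S_form:
  assumes f: "f \<in> Cc_infty" and g: "g \<in> Cc_infty"
  shows "L2_inner \<mu> (op_S A \<rho> f) g = - form_B A \<rho> g f"
  using inner_op_S[OF f Cc_measurable[OF g]] divop_green(2)[of c dc, OF weak_c g f] by (simp add: form_B_eq)

lemma form_B_nonneg: "form_B A \<rho> f f \<ge> 0"
  unfolding form_B_def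
proof (rule Bochner_Integration.integral_nonneg)
  fix x
  \<comment> \<open>Ellipticity is taken on the compact set that consists of the single point
    \<open>x\<close>.\<close>
  obtain k where "k > 0" "\<forall>z\<in>{x}. \<forall>y. y \<bullet> (A z *v y) \<ge> k * (norm y)\<^sup>2"
    using ell unfolding locally_strictly_elliptic_def by (metis finite.emptyI finite.insertI finite_imp_compact)
  then have "0 \<le> grad f x \<bullet> (A x *v grad f x)"
    by (smt (verit) mult_nonneg_nonneg singletonI zero_le_power2)
  then show "0 \<le> (grad f x \<bullet> (A x *v grad f x)) * \<rho> x" using \<rho>_nonneg by simp
qed

lemma op_S_lin:
  assumes "f \<in> Cc_infty" "g \<in> Cc_infty"
  shows "op_S A \<rho> (\<lambda>x. s * f x + t * g x) = (\<lambda>x. s * op_S A \<rho> f x + t * op_S A \<rho> g x)"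
proof
  fix x
  have s: "smooth f" "smooth g" using assms Cc_smooth by auto
  have 1: "pd i (\<lambda>x. s * f x + t * g x) = (\<lambda>x. s * pd i f x + t * pd i g x)" if "smooth f" "smooth g" for i and f g :: "real^'n \<Rightarrow> real"
    using that by (simp add: smooth_pd_add smooth_pd_cmult smooth_cmult)
  show "op_S A \<rho> (\<lambda>x. s * f x + t * g x) x = s * op_S A \<rho> f x + t * op_S A \<rho> g x"
    unfolding op_S_def 1[OF s] 1[OF smooth_pd[OF s(1)] smooth_pd[OF s(2)]]
    by (simp add: sum_distrib_left sum.distrib distrib_left mult_ac)
qed

lemma op_S_operator: "L2_operator \<mu> Cc_infty (op_S A \<rho>)"
  unfolding L2_operator_def
proof (intro conjI ballI allI impI)
  fix f :: "real^'n \<Rightarrow> real" assume f: "f \<in> Cc_infty" "AE x in \<mu>. f x = 0"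
  \<comment> \<open>A continuous function that vanishes almost everywhere vanishes identically, so
    the operator is well defined on classes.\<close>
  have "f x = 0" for x
  proof -
    have "closed {x. f x = 0}"
      by (intro closed_Collect_eq smooth_continuous[OF Cc_smooth[OF f(1)]] continuous_on_const)
    moreover have "AE x in lebesgue. x \<in> {x. f x = 0}" using f(2) unfolding AE_\<mu> by simp
    ultimately have "x \<in> {x. f x = 0}" by (rule mem_closed_if_AE_lebesgue)
    then show ?thesis by simp
  qed
  then have "f = (\<lambda>x. 0)" by auto
  then show "AE x in \<mu>. op_S A \<rho> f x = 0" by (simp add: op_S_def)
qed (auto simp: Cc_L2_\<mu> op_S_L2 op_S_lin intro: Cc_add Cc_cmult)

text \<open>Orthogonality to test functions in \<open>L2 \<mu>\<close> says that
  \<open>\<rho> w\<close> annihilates them with respect to Lebesgue measure. The fundamental lemma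
  applies, since \<open>w\<close> is locally square integrable for Lebesgue measure and \<rho> is
  locally bounded.\<close>

lemma Cc_dense_\<mu>: "L2_dense \<mu> Cc_infty"
proof (rule L2_dense_if_orthogonal_trivial)
  fix w assume w: "w \<in> L2 \<mu>" "\<And>f. f \<in> Cc_infty \<Longrightarrow> L2_inner \<mu> f w = 0"
  have wm [measurable]: "w \<in> borel_measurable lebesgue" using w(1) by (simp add: L2_\<mu>)
  have "AE x in lebesgue. \<rho> x * w x = 0"
  proof (rule zero_if_integral_zero)
    show "(\<lambda>x. \<rho> x * w x) \<in> Lloc 1"
      unfolding Lloc_one_iff
    proof (intro conjI allI impI)
      fix K :: "(real^'n) set" assume K: "compact K"
      have "(\<lambda>x. indicator K x * \<rho> x) \<in> Linf_loc"
        using \<rho>_Linf_loc compact_sets_lebesgue[OF K]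
        by (intro Linf_loc_mult) (auto simp: Linf_loc_def indicator_def intro!: exI[of _ 1])
      then have "(\<lambda>x. w x * (indicator K x * \<rho> x)) \<in> L2 lebesgue"
        by (rule L2_\<mu>_local[OF w(1) _ K]) simp
      from L2_Lloc_one[OF this] K have "set_integrable lebesgue K (\<lambda>x. w x * (indicator K x * \<rho> x))"
        by (simp add: Lloc_one_iff)
      moreover have "(\<lambda>x. indicator K x *\<^sub>R (w x * (indicator K x * \<rho> x))) = (\<lambda>x. indicator K x *\<^sub>R (\<rho> x * w x))"
        by (auto simp: indicator_def)
      ultimately show "set_integrable lebesgue K (\<lambda>x. \<rho> x * w x)" by (simp only: set_integrable_def)
    qed measurable
    show "(LINT x|lebesgue. \<rho> x * w x * f x) = 0" if "f \<in> Cc_infty" for f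
      using w(2)[OF that] inner_\<mu>[OF Cc_measurable[OF that] wm] by (simp add: mult_ac)
  qed
  then have "AE x in lebesgue. w x = 0" using \<rho>_pos by eventually_elim simp
  then show "AE x in \<mu>. w x = 0" by (simp add: AE_\<mu>)
qed (auto intro: Cc_L2_\<mu> Cc_add Cc_cmult)

end

section \<open>Localisation and the limit of large radii\<close>

lemma divop_mult:
  assumes h: "smooth h" and f: "smooth f"
  shows "divop c dc (\<lambda>x. h x * f x) x = h x * divop c dc f x +
    (\<Sum>i\<in>UNIV. \<Sum>j\<in>UNIV. c i j x * pd i (pd j h) x * f x + c i j x * pd j h x * pd i f x
       + c i j x * pd i h x * pd j f x + pd j h x * (dc i i j x * f x))"
  unfolding divop_def sum_distrib_left sum.distrib[symmetric]
  by (simp add: smooth_pd_mult smooth_pd_add smooth_mult smooth_pd h f) (simp add: algebra_simps)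

lemma powr_one_mult_sum: "(1::real) powr s * y + 1 powr t * z = y + z"
  by simp

context weighted_operator
begin

text \<open>Three nested cutoffs with gaps between them: \<open>\<theta>\<close> lives within radius
  2R; \<open>w\<close> equals \<open>u\<close> up to 3R and vanishes beyond 6R; the coefficients
  \<open>ct\<close> equal \<open>c\<close> up to 7R and are the identity beyond 14R. Across the
  gaps, products of one cutoff with derivatives of the next vanish. Derivatives of
  \<open>\<eta>2\<close> and \<open>\<eta>3\<close> influence only constants that disappear in the
  limit, so just the bound \<open>B\<close> for the gradient of \<open>\<theta>\<close>
  survives.\<close>

lemma local_energy:
  fixes \<theta> \<eta>2 \<eta>3 :: "real^'n \<Rightarrow> real" and R B \<Lambda> :: real
  assumes R: "R > 0"
    and \<theta>: "\<theta> \<in> Cc_infty" "\<And>x. norm x \<ge> 2 * R \<Longrightarrow> \<theta> x = 0" "\<And>i x. \<bar>pd i \<theta> x\<bar> \<le> B"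
    and \<eta>2: "\<eta>2 \<in> Cc_infty" "\<And>x. norm x \<le> 3 * R \<Longrightarrow> \<eta>2 x = 1" "\<And>x. norm x \<ge> 6 * R \<Longrightarrow> \<eta>2 x = 0"
    and \<eta>3: "\<eta>3 \<in> Cc_infty" "\<And>x. 0 \<le> \<eta>3 x" "\<And>x. \<eta>3 x \<le> 1" "\<And>x. norm x \<le> 7 * R \<Longrightarrow> \<eta>3 x = 1" "\<And>x. norm x \<ge> 14 * R \<Longrightarrow> \<eta>3 x = 0"
    and \<Lambda>: "\<Lambda> \<ge> 0" "\<And>i j. AE x in lebesgue. \<bar>a i j x\<bar> \<le> \<Lambda>"
    and u: "u \<in> L2 \<mu>" and eq: "\<And>f. f \<in> Cc_infty \<Longrightarrow> (LINT x|lebesgue. u x * divop c dc f x) = (LINT x|lebesgue. u x * (\<rho> x * f x))"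
  shows "(LINT x|lebesgue. \<rho> x * (u x)\<^sup>2 * (\<theta> x)\<^sup>2) \<le> (real CARD('n))\<^sup>2 * \<Lambda> * B\<^sup>2 * (LINT x|lebesgue. \<rho> x * (u x)\<^sup>2)"
proof -
  let ?d = "real CARD('n)"
  define \<kappa> where "\<kappa> = 1 - ?d / p"
  have \<kappa>: "0 < \<kappa>" "\<kappa> \<le> 1" using p p2 by (auto simp: \<kappa>_def)
  have um [measurable]: "u \<in> borel_measurable lebesgue" and ui: "integrable lebesgue (\<lambda>x. \<rho> x * (u x)\<^sup>2)" using u by (auto simp: L2_\<mu>)
  note s2 = Cc_smooth[OF \<eta>2(1)] and s3 = Cc_smooth[OF \<eta>3(1)] and s\<theta> = Cc_smooth[OF \<theta>(1)]
  \<comment> \<open>The identity matrix, switched on where \<open>\<eta>3\<close> is switched off.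
    Outside \<open>K3\<close> the new coefficients are constant, which gives \<open>dct\<close> the
    compact support required by \<open>Lloc_form_small\<close>.\<close>
  define E where "E i j x = (if i = j then 1 else 0) * (1 - \<eta>3 x)" for i j :: 'n and x
  define ct where "ct i j x = c i j x * \<eta>3 x + E i j x" for i j x
  define dct where "dct k i j x = (dc k i j x * \<eta>3 x + c i j x * pd k \<eta>3 x) + pd k (E i j) x" for k i j x
  have sE: "smooth (E i j)" for i j unfolding E_def[abs_def] by (intro smooth_cmult smooth_diff smooth_const s3)
  have weak: "has_weak_partial k (ct i j) (dct k i j)" for k i j
    unfolding ct_def[abs_def] dct_def[abs_def]
    by (intro weak_partial_add weak_partial_mult_smooth weak_c s3 weak_partial_smooth sE)
  define K3 where "K3 = cball (0::real^'n) (14 * R)"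
  have K3: "compact K3" by (simp add: K3_def)
  have out3: "\<eta>3 x = 0" "pd k \<eta>3 x = 0" "pd k (E i j) x = 0" if "x \<notin> K3" for x k i j
  proof -
    have o: "open (- K3)" "x \<in> - K3" using that by (auto simp: K3_def)
    have z: "\<eta>3 y = 0" if "y \<in> - K3" for y using that \<eta>3(5)[of y] by (simp add: K3_def)
    show "\<eta>3 x = 0" by (rule z[OF o(2)])
    show "pd k \<eta>3 x = 0" by (rule pd_eq_0_open[OF o z])
    show "pd k (E i j) x = 0"
      by (rule pd_eq_0_open[OF o, of _ "(if i = j then 1 else 0)"]) (simp add: E_def z)
  qed
  have in3: "ct i j x = c i j x" "dct k i j x = dc k i j x" if "norm x < 7 * R" for x i j k
  proof -
    have o: "open (ball 0 (7 * R))" "x \<in> ball 0 (7 * R)" using that by auto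
    have z: "\<eta>3 y = 1" if "y \<in> ball 0 (7 * R)" for y using that \<eta>3(4)[of y] by simp
    have "pd k \<eta>3 x = 0" by (rule pd_eq_0_open[OF o z])
    moreover have "pd k (E i j) x = 0" by (rule pd_eq_0_open[OF o, of _ 0]) (simp add: E_def z)
    ultimately show "ct i j x = c i j x" "dct k i j x = dc k i j x"
      using z[OF o(2)] by (simp_all add: ct_def dct_def E_def)
  qed
  have dctL: "dct k i j \<in> Lloc p" for k i j
  proof -
    have "(\<lambda>x. (\<eta>3 x * dc k i j x + c i j x * pd k \<eta>3 x) + pd k (E i j) x) \<in> Lloc p"
      using p2 by (intro Lloc_add Lloc_mult_bounded Linf_loc_Lloc[OF Linf_loc_mult] Linf_loc_Lloc[OF smooth_Linf_loc]
          smooth_Linf_loc dc_Lloc c_Linf_loc s3 sE smooth_pd) auto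
    then show ?thesis by (simp add: dct_def[abs_def] mult.commute[of "\<eta>3 _"])
  qed
  have dct0: "dct k i j x = 0" if "x \<notin> K3" for k i j x using out3[OF that] by (simp add: dct_def)
  have "\<exists>C. form_small \<kappa> C (dct k i j)" for k i j
    unfolding \<kappa>_def by (rule Lloc_form_small[OF dctL K3 dct0 p]) (use p2 in auto)
  then obtain CC where CC: "\<And>k i j. form_small \<kappa> (CC k i j) (dct k i j)" by metis
  define K where "K = Max (range (\<lambda>(k, i, j). CC k i j))"
  have small: "form_small \<kappa> K (dct k i j)" for k i j
    by (rule form_small_mono[OF CC]) (auto simp: K_def intro!: Max_ge image_eqI[of _ _ "(k, i, j)"])
  obtain Cr where Cr: "AE x in lebesgue. x \<in> K3 \<longrightarrow> \<bar>\<rho> x\<bar> \<le> Cr" using \<rho>_Linf_loc K3 by (auto simp: Linf_loc_def)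
  obtain Di where Di: "AE x in lebesgue. x \<in> K3 \<longrightarrow> \<bar>1 / \<rho> x\<bar> \<le> Di" using inv_\<rho> K3 by (auto simp: Linf_loc_def)
  define L where "L = \<bar>Cr\<bar> * \<Lambda> + 1"
  have L0: "L \<ge> 0" using \<Lambda>(1) by (simp add: L_def)
  have bdd: "AE x in lebesgue. \<bar>ct i j x\<bar> \<le> L" for i j
    using Cr \<Lambda>(2)[of i j]
  proof eventually_elim
    case (elim x)
    have e: "\<bar>E i j x\<bar> \<le> 1" using \<eta>3(2,3)[of x] by (auto simp: E_def)
    show ?case
    proof (cases "x \<in> K3")
      case True
      have "\<bar>c i j x * \<eta>3 x\<bar> \<le> (\<bar>Cr\<bar> * \<Lambda>) * 1"
        unfolding c_def abs_mult using elim True \<eta>3(2,3)[of x] \<Lambda>(1) by (intro mult_mono) auto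
      then show ?thesis using e unfolding ct_def L_def by linarith
    next
      case False
      have "0 \<le> \<bar>Cr\<bar> * \<Lambda>" using \<Lambda>(1) by simp
      then show ?thesis using e out3(1)[OF False] unfolding ct_def L_def by simp
    qed
  qed
  have "\<exists>k>0. \<forall>x\<in>K3. \<forall>y. y \<bullet> (A x *v y) \<ge> k * (norm y)\<^sup>2"
    by (rule ell[unfolded locally_strictly_elliptic_def, rule_format, OF K3])
  then obtain k where k: "k > 0" "\<And>x y. x \<in> K3 \<Longrightarrow> y \<bullet> (A x *v y) \<ge> k * (norm y)\<^sup>2" by metis
  \<comment> \<open>The minimum with 1 serves the identity part. The quotient is a lower bound for
    \<rho> times the ellipticity constant of \<open>A\<close> on \<open>K3\<close>; the summand 1
    keeps its denominator positive.\<close>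
  define \<nu> where "\<nu> = min 1 (k / (\<bar>Di\<bar> + 1))"
  have \<nu>: "\<nu> > 0" using k(1) by (simp add: \<nu>_def)
  have ellt: "AE x in lebesgue. \<forall>\<xi>. \<nu> * (\<Sum>i\<in>UNIV. (\<xi> i)\<^sup>2) \<le> (\<Sum>i\<in>UNIV. \<Sum>j\<in>UNIV. ct i j x * (\<xi> i * \<xi> j))"
    using Di \<rho>_pos
  proof eventually_elim
    case (elim x)
    show ?case
    proof
      fix \<xi> :: "'n \<Rightarrow> real"
      define S where "S = (\<Sum>i\<in>UNIV. (\<xi> i)\<^sup>2)"
      have S: "S \<ge> 0" by (simp add: S_def sum_nonneg)
      have S': "(norm (vec_lambda \<xi>))\<^sup>2 = S" by (simp add: S_def norm_vec_def L2_set_def sum_nonneg)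
      define P where "P = (\<Sum>i\<in>UNIV. \<Sum>j\<in>UNIV. c i j x * (\<xi> i * \<xi> j))"
      have split: "(\<Sum>i\<in>UNIV. \<Sum>j\<in>UNIV. ct i j x * (\<xi> i * \<xi> j)) = \<eta>3 x * P + (1 - \<eta>3 x) * S"
      proof -
        have "(\<Sum>i\<in>UNIV. \<Sum>j\<in>UNIV. E i j x * (\<xi> i * \<xi> j)) = (\<Sum>i\<in>UNIV. \<Sum>j\<in>UNIV. if j = i then (1 - \<eta>3 x) * (\<xi> i * \<xi> j) else 0)"
          by (intro sum.cong refl) (simp add: E_def)
        also have "\<dots> = (1 - \<eta>3 x) * S" by (simp add: S_def sum_distrib_left power2_eq_square)
        finally have 1: "(\<Sum>i\<in>UNIV. \<Sum>j\<in>UNIV. E i j x * (\<xi> i * \<xi> j)) = (1 - \<eta>3 x) * S" .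
        have 2: "(\<Sum>i\<in>UNIV. \<Sum>j\<in>UNIV. c i j x * \<eta>3 x * (\<xi> i * \<xi> j)) = \<eta>3 x * P"
          by (simp add: P_def sum_distrib_left mult_ac)
        show ?thesis unfolding ct_def distrib_right sum.distrib 1 2 ..
      qed
      have "\<eta>3 x * P \<ge> \<eta>3 x * (\<nu> * S)"
      proof (cases "x \<in> K3")
        case True
        have "1 / \<rho> x \<le> \<bar>Di\<bar> + 1" using elim True by auto
        then have r: "1 / (\<bar>Di\<bar> + 1) \<le> \<rho> x" using elim(2) by (simp add: field_simps)
        have "P = \<rho> x * (vec_lambda \<xi> \<bullet> (A x *v vec_lambda \<xi>))" by (simp add: matrix_form P_def)
        moreover have "\<rho> x * (vec_lambda \<xi> \<bullet> (A x *v vec_lambda \<xi>)) \<ge> \<rho> x * (k * S)"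
          using k(2)[OF True, of "vec_lambda \<xi>"] elim(2) unfolding S' by (intro mult_left_mono) auto
        moreover have "\<rho> x * (k * S) \<ge> 1 / (\<bar>Di\<bar> + 1) * (k * S)" using r k(1) S by (intro mult_right_mono) auto
        moreover have "1 / (\<bar>Di\<bar> + 1) * (k * S) \<ge> \<nu> * S"
          using S mult_right_mono[of \<nu> "k / (\<bar>Di\<bar> + 1)" S] by (simp add: \<nu>_def)
        ultimately have "\<nu> * S \<le> P" by linarith
        then show ?thesis using \<eta>3(2)[of x] by (intro mult_left_mono)
      next
        case False then show ?thesis using out3(1) by simp
      qed
      moreover have "(1 - \<eta>3 x) * S \<ge> (1 - \<eta>3 x) * (\<nu> * S)"
        using \<eta>3(3)[of x] mult_right_mono[of \<nu> 1 S] S by (intro mult_left_mono) (auto simp: \<nu>_def)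
      ultimately show "\<nu> * (\<Sum>i\<in>UNIV. (\<xi> i)\<^sup>2) \<le> (\<Sum>i\<in>UNIV. \<Sum>j\<in>UNIV. ct i j x * (\<xi> i * \<xi> j))"
        unfolding split S_def[symmetric] by (simp add: algebra_simps)
    qed
  qed
  have symt: "ct i j x = ct j i x" for i j x unfolding ct_def E_def c_sym[of i j] by simp
  interpret el: elliptic ct dct L \<nu> \<kappa> K
    by unfold_locales (fact weak symt bdd ellt \<nu> L0 \<kappa> small)+

  define w where "w x = u x * \<eta>2 x" for x
  define K2 where "K2 = cball (0::real^'n) (6 * R)"
  have K2: "compact K2" by (simp add: K2_def)
  have out2: "\<eta>2 x = 0" "pd k \<eta>2 x = 0" "pd k (pd l \<eta>2) x = 0" if "x \<notin> K2" for x k l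
  proof -
    have o: "open (- K2)" "x \<in> - K2" using that by (auto simp: K2_def)
    have z: "\<eta>2 y = 0" if "y \<in> - K2" for y using that \<eta>2(3)[of y] by (simp add: K2_def)
    have z': "pd l \<eta>2 y = 0" if "y \<in> - K2" for y by (rule pd_eq_0_open[OF o(1) that z])
    show "\<eta>2 x = 0" by (rule z[OF o(2)])
    show "pd k \<eta>2 x = 0" by (rule pd_eq_0_open[OF o z])
    show "pd k (pd l \<eta>2) x = 0" by (rule pd_eq_0_open[OF o z'])
  qed
  have norm7: "norm x < 7 * R" if "x \<in> K2" for x using that R by (simp add: K2_def)
  note loc = L2_\<mu>_local[OF u _ K2]
  have wL: "w \<in> L2 lebesgue" unfolding w_def by (rule loc[OF smooth_Linf_loc[OF s2]]) (simp add: out2)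
  define U1 where "U1 x = u x * (\<rho> x * \<eta>2 x)" for x
  define V2 where "V2 i j x = u x * (c i j x * pd i (pd j \<eta>2) x)" for i j x
  define V3 where "V3 i j l x = u x * (c i j x * pd l \<eta>2 x)" for i j l x
  define V4 where "V4 j x = u x * pd j \<eta>2 x" for j x
  have VL: "U1 \<in> L2 lebesgue" "V2 i j \<in> L2 lebesgue" "V3 i j l \<in> L2 lebesgue" "V4 j \<in> L2 lebesgue" for i j l
  proof -
    show "U1 \<in> L2 lebesgue" unfolding U1_def[abs_def]
      by (rule loc[OF Linf_loc_mult[OF \<rho>_Linf_loc smooth_Linf_loc[OF s2]]]) (simp add: out2)
    show "V2 i j \<in> L2 lebesgue" unfolding V2_def[abs_def]
      by (rule loc[OF Linf_loc_mult[OF c_Linf_loc smooth_Linf_loc[OF smooth_pd[OF smooth_pd[OF s2]]]]]) (simp add: out2)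
    show "V3 i j l \<in> L2 lebesgue" unfolding V3_def[abs_def]
      by (rule loc[OF Linf_loc_mult[OF c_Linf_loc smooth_Linf_loc[OF smooth_pd[OF s2]]]]) (simp add: out2)
    show "V4 j \<in> L2 lebesgue" unfolding V4_def[abs_def]
      by (rule loc[OF smooth_Linf_loc[OF smooth_pd[OF s2]]]) (simp add: out2)
  qed
  \<comment> \<open>\<open>U1\<close> stems from the zeroth-order side of the equation, the
    \<open>V\<close> terms from derivatives of \<open>\<eta>2\<close>; the factor \<open>K\<close>
    bounds multiplication by \<open>dct\<close> at scale 1.\<close>
  define T where "T = nrm U1 + (\<Sum>i\<in>UNIV. \<Sum>j\<in>UNIV. nrm (V2 i j) + nrm (V3 i j j) + nrm (V3 i j i) + nrm (V4 j) * K)"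
  have T0: "T \<ge> 0" unfolding T_def using el.K_nonneg by (intro add_nonneg_nonneg sum_nonneg mult_nonneg_nonneg) auto
  have Tb: "\<bar>inn w (divop ct dct f)\<bar> \<le> T * (nrm f + (\<Sum>i\<in>UNIV. nrm (pd i f)))" if f: "f \<in> Cc_infty" for f
  proof -
    define N where "N = nrm f + (\<Sum>i\<in>UNIV. nrm (pd i f))"
    define r where "r i j x = V2 i j x * f x + V3 i j j x * pd i f x + V3 i j i x * pd j f x + V4 j x * (dct i i j x * f x)" for i j x
    have fL: "f \<in> L2 lebesgue" "pd i f \<in> L2 lebesgue" "(\<lambda>x. dct i i j x * f x) \<in> L2 lebesgue" for i j
      by (intro Cc_L2 Cc_pd f el.dc_L2)+
    have fN: "nrm f \<le> N" "nrm (pd i f) \<le> N" "nrm (\<lambda>x. dct i i j x * f x) \<le> K * N" for i j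
    proof -
      have "nrm (pd i f) \<le> (\<Sum>i\<in>UNIV. nrm (pd i f))" by (rule member_le_sum) auto
      then show "nrm (pd i f) \<le> N" unfolding N_def using L2_norm_nonneg[of lebesgue f] by linarith
      show "nrm f \<le> N" unfolding N_def by (simp add: sum_nonneg)
      show "nrm (\<lambda>x. dct i i j x * f x) \<le> K * N"
        using el.dc_nrm[OF f zero_less_one order_refl, of i i j] unfolding powr_one_mult_sum N_def .
    qed
    have ip: "\<bar>inn V g\<bar> \<le> nrm V * M" if "V \<in> L2 lebesgue" "g \<in> L2 lebesgue" "nrm g \<le> M" for V g M
      using L2_Cauchy_Schwarz[OF that(1,2)] mult_left_mono[OF that(3), of "nrm V"] by simp
    have ri: "integrable lebesgue (r i j)" for i j
      unfolding r_def[abs_def] by (intro Bochner_Integration.integrable_add L2_mult_integrable VL fL)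
    have rint: "(LINT x|lebesgue. r i j x) = inn (V2 i j) f + inn (V3 i j j) (pd i f) + inn (V3 i j i) (pd j f) + inn (V4 j) (\<lambda>x. dct i i j x * f x)" for i j
      unfolding r_def[abs_def] L2_inner_def using L2_mult_integrable[OF VL(2) fL(1)] L2_mult_integrable[OF VL(3) fL(2)] L2_mult_integrable[OF VL(4) fL(3)]
      by simp
    \<comment> \<open>The cutoff is moved from \<open>u\<close> onto \<open>f\<close>. The
      commutator \<open>r\<close> contains at most first derivatives of \<open>f\<close>, which is
      exactly what hypothesis \<open>T\<close> of the energy bound permits.\<close>
    have pt: "u x * divop c dc (\<lambda>x. \<eta>2 x * f x) x = w x * divop ct dct f x + (\<Sum>i\<in>UNIV. \<Sum>j\<in>UNIV. r i j x)" for x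
    proof (cases "x \<in> K2")
      case True
      note e = in3[OF norm7[OF True]]
      have "divop ct dct f x = divop c dc f x" by (simp add: divop_def e)
      then show ?thesis
        unfolding divop_mult[OF s2 Cc_smooth[OF f]]
        by (simp add: w_def r_def V2_def V3_def V4_def e distrib_left sum_distrib_left mult_ac)
    next
      case False
      then show ?thesis
        unfolding divop_mult[OF s2 Cc_smooth[OF f]] by (simp add: out2 w_def r_def V2_def V3_def V4_def)
    qed
    have wi: "integrable lebesgue (\<lambda>x. w x * divop ct dct f x)" by (rule L2_mult_integrable[OF wL el.Lop_L2[OF f]])
    have "(LINT x|lebesgue. u x * divop c dc (\<lambda>x. \<eta>2 x * f x) x) = (LINT x|lebesgue. u x * (\<rho> x * (\<eta>2 x * f x)))"
      by (rule eq[OF Cc_mult[OF \<eta>2(1) f]])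
    then have "inn w (divop ct dct f) + (\<Sum>i\<in>UNIV. \<Sum>j\<in>UNIV. LINT x|lebesgue. r i j x) = inn U1 f"
      unfolding pt using wi ri by (simp add: L2_inner_def U1_def mult_ac)
    then have "inn w (divop ct dct f) = inn U1 f - (\<Sum>i\<in>UNIV. \<Sum>j\<in>UNIV. LINT x|lebesgue. r i j x)" by simp
    then have "\<bar>inn w (divop ct dct f)\<bar> \<le> \<bar>inn U1 f\<bar> + \<bar>\<Sum>i\<in>UNIV. \<Sum>j\<in>UNIV. LINT x|lebesgue. r i j x\<bar>" by linarith
    also have "\<bar>\<Sum>i\<in>UNIV. \<Sum>j\<in>UNIV. LINT x|lebesgue. r i j x\<bar> \<le> (\<Sum>i\<in>UNIV. \<Sum>j\<in>UNIV. \<bar>LINT x|lebesgue. r i j x\<bar>)"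
      by (rule order_trans[OF sum_abs]) (intro sum_mono sum_abs)
    also have "\<dots> \<le> (\<Sum>i\<in>UNIV. \<Sum>j\<in>UNIV. nrm (V2 i j) * N + nrm (V3 i j j) * N + nrm (V3 i j i) * N + nrm (V4 j) * (K * N))"
    proof (intro sum_mono)
      fix i j
      show "\<bar>LINT x|lebesgue. r i j x\<bar> \<le> nrm (V2 i j) * N + nrm (V3 i j j) * N + nrm (V3 i j i) * N + nrm (V4 j) * (K * N)"
        unfolding rint
        using ip[OF VL(2)[of i j] fL(1) fN(1)] ip[OF VL(3)[of i j j] fL(2)[of i] fN(2)[of i]]
          ip[OF VL(3)[of i j i] fL(2)[of j] fN(2)[of j]] ip[OF VL(4)[of j] fL(3)[of i j] fN(3)[of i j]]
        by linarith
    qed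
    also have "\<bar>inn U1 f\<bar> \<le> nrm U1 * N" by (rule ip[OF VL(1) fL(1) fN(1)])
    finally show ?thesis
      unfolding N_def[symmetric] T_def by (simp add: distrib_right sum_distrib_right mult.assoc)
  qed

  have B0: "B \<ge> 0" by (rule order_trans[OF abs_ge_zero \<theta>(3)])
  define q where "q x = (\<Sum>i\<in>UNIV. \<Sum>j\<in>UNIV. ct i j x * (pd i \<theta> x * pd j \<theta> x))" for x
  obtain v \<delta> where v: "\<And>n::nat. v n \<in> Cc_infty" "L2_tendsto lebesgue v w" and \<delta>: "\<delta> \<longlonglongrightarrow> 0"
    and le: "\<And>n. inn w (divop ct dct (\<lambda>x. (\<theta> x)\<^sup>2 * v n x)) \<le> (LINT x|lebesgue. (v n x)\<^sup>2 * q x) + \<delta> n"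
  proof (rule el.local_energy_inequality[OF wL Tb T0 \<theta>(1)])
    fix v and \<delta> :: "nat \<Rightarrow> real"
    assume "\<And>n. v n \<in> Cc_infty" "L2_tendsto lebesgue v w" "\<delta> \<longlonglongrightarrow> 0"
      "\<And>n. inn w (divop ct dct (\<lambda>x. (\<theta> x)\<^sup>2 * v n x)) \<le> (LINT x|lebesgue. (v n x)\<^sup>2 *
        (\<Sum>i\<in>UNIV. \<Sum>j\<in>UNIV. ct i j x * (pd i \<theta> x * pd j \<theta> x))) + \<delta> n"
    then show thesis unfolding q_def[symmetric] by (rule that)
  qed
  define U where "U x = u x * (\<rho> x * (\<theta> x)\<^sup>2)" for x
  have s\<theta>2: "smooth (\<lambda>x. (\<theta> x)\<^sup>2)" by (rule smooth_power[OF s\<theta>])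
  have UL: "U \<in> L2 lebesgue" unfolding U_def[abs_def]
  proof (rule loc[OF Linf_loc_mult[OF \<rho>_Linf_loc smooth_Linf_loc[OF s\<theta>2]]])
    show "\<rho> x * (\<theta> x)\<^sup>2 = 0" if "x \<notin> K2" for x using that R \<theta>(2)[of x] by (simp add: K2_def)
  qed
  \<comment> \<open>On the support of \<open>\<theta>\<close> the cutoff \<open>\<eta>2\<close> is 1
    and the coefficients are the original ones, so the equation for \<open>u\<close> applies without
    commutator.\<close>
  have lhs: "inn w (divop ct dct (\<lambda>x. (\<theta> x)\<^sup>2 * v n x)) = inn (v n) U" for n
  proof -
    define f where "f x = (\<theta> x)\<^sup>2 * v n x" for x
    have f: "f \<in> Cc_infty" unfolding f_def by (rule smooth_Cc_mult[OF s\<theta>2 v(1)])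
    have "w x * divop ct dct f x = u x * divop c dc f x" for x
    proof (cases "norm x < 3 * R")
      case True
      then have "norm x < 7 * R" using R by simp
      note e = in3[OF this]
      have "divop ct dct f x = divop c dc f x" by (simp add: divop_def e)
      then show ?thesis using \<eta>2(2)[of x] True by (simp add: w_def)
    next
      case False
      have o: "open (- cball 0 (2 * R) :: (real^'n) set)" "x \<in> - cball 0 (2 * R)" using False R by auto
      have z: "f y = 0" if "y \<in> - cball 0 (2 * R)" for y using that \<theta>(2)[of y] by (simp add: f_def)
      have z': "pd j f y = 0" if "y \<in> - cball 0 (2 * R)" for j y by (rule pd_eq_0_open[OF o(1) that z])
      have "pd i (pd j f) x = 0" for i j by (rule pd_eq_0_open[OF o z'])
      then show ?thesis using z'[OF o(2)] by (simp add: divop_def)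
    qed
    then have "inn w (divop ct dct f) = (LINT x|lebesgue. u x * (\<rho> x * f x))"
      unfolding L2_inner_def using eq[OF f] by simp
    then show ?thesis by (simp add: f_def[abs_def] L2_inner_def U_def mult_ac)
  qed
  have qm [measurable]: "q \<in> borel_measurable lebesgue"
    unfolding q_def[abs_def] using Cc_measurable[OF Cc_pd[OF \<theta>(1)]] by measurable
  define Q where "Q = (\<Sum>i\<in>(UNIV::'n set). \<Sum>j\<in>(UNIV::'n set). L * (B * B))"
  have qb: "AE x in lebesgue. \<bar>q x\<bar> \<le> Q"
  proof -
    have "AE x in lebesgue. \<forall>i\<in>UNIV. \<forall>j\<in>UNIV. \<bar>ct i j x\<bar> \<le> L" by (intro AE_finite_allI) (auto simp: bdd)
    then show ?thesis
    proof eventually_elim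
      case (elim x)
      have "\<bar>q x\<bar> \<le> (\<Sum>i\<in>UNIV. \<Sum>j\<in>UNIV. \<bar>ct i j x * (pd i \<theta> x * pd j \<theta> x)\<bar>)"
        unfolding q_def by (rule order_trans[OF sum_abs]) (intro sum_mono sum_abs)
      also have "\<dots> \<le> Q" unfolding Q_def abs_mult
        by (intro sum_mono mult_mono \<theta>(3) L0) (use elim B0 in auto)
      finally show ?case .
    qed
  qed
  have Q0: "Q \<ge> 0" unfolding Q_def using L0 B0 by (intro sum_nonneg mult_nonneg_nonneg) auto
  have vL: "v n \<in> L2 lebesgue" for n by (rule Cc_L2[OF v(1)])
  have qt: "L2_tendsto lebesgue (\<lambda>n x. q x * v n x) (\<lambda>x. q x * w x)"
    unfolding L2_tendsto_def
  proof (rule Lim_null_comparison)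
    have "nrm (\<lambda>x. q x * v n x - q x * w x) \<le> Q * nrm (\<lambda>x. v n x - w x)" for n
      using L2_norm_bounded_mult[OF L2_diff[OF vL wL] qm qb Q0, of n] by (simp add: right_diff_distrib)
    then show "\<forall>\<^sub>F n in sequentially. norm (nrm (\<lambda>x. q x * v n x - q x * w x)) \<le> Q * nrm (\<lambda>x. v n x - w x)" by simp
    show "(\<lambda>n. Q * nrm (\<lambda>x. v n x - w x)) \<longlonglongrightarrow> 0" using tendsto_mult_right_zero[OF v(2)[unfolded L2_tendsto_def]] .
  qed
  have qL: "F \<in> L2 lebesgue \<Longrightarrow> (\<lambda>x. q x * F x) \<in> L2 lebesgue" for F by (rule L2_mult_bounded[OF _ qm qb])
  \<comment> \<open>Both sides involve \<open>v n\<close> without derivatives, so L2 convergence to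
    \<open>w\<close> suffices for the limit.\<close>
  have "inn w U \<le> inn (\<lambda>x. q x * w x) w + 0"
  proof (rule LIMSEQ_le)
    show "(\<lambda>n. inn (v n) U) \<longlonglongrightarrow> inn w U" by (rule L2_inner_tendsto[OF v(2) vL wL UL])
    show "(\<lambda>n. inn (\<lambda>x. q x * v n x) (v n) + \<delta> n) \<longlonglongrightarrow> inn (\<lambda>x. q x * w x) w + 0"
      by (intro tendsto_add \<delta> L2_inner_tendsto2[OF qt _ _ v(2)] qL vL wL)
    have "inn (v n) U \<le> inn (\<lambda>x. q x * v n x) (v n) + \<delta> n" for n
      using le[of n] unfolding lhs by (simp add: L2_inner_def power2_eq_square mult_ac)
    then show "\<exists>N. \<forall>n\<ge>N. inn (v n) U \<le> inn (\<lambda>x. q x * v n x) (v n) + \<delta> n" by blast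
  qed
  moreover have "inn w U = (LINT x|lebesgue. \<rho> x * (u x)\<^sup>2 * (\<theta> x)\<^sup>2)"
  proof -
    have "w x * U x = \<rho> x * (u x)\<^sup>2 * (\<theta> x)\<^sup>2" for x
    proof (cases "norm x \<le> 3 * R")
      case True then show ?thesis using \<eta>2(2)[of x] by (simp add: w_def U_def power2_eq_square)
    next
      case False then show ?thesis using \<theta>(2)[of x] R by (simp add: U_def)
    qed
    then show ?thesis by (simp add: L2_inner_def)
  qed
  moreover have "inn (\<lambda>x. q x * w x) w \<le> (LINT x|lebesgue. ?d\<^sup>2 * \<Lambda> * B\<^sup>2 * (\<rho> x * (u x)\<^sup>2))"
    unfolding L2_inner_def
  proof (rule integral_mono_AE)
    show "integrable lebesgue (\<lambda>x. q x * w x * w x)" by (rule L2_mult_integrable[OF qL[OF wL] wL])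
    show "integrable lebesgue (\<lambda>x. ?d\<^sup>2 * \<Lambda> * B\<^sup>2 * (\<rho> x * (u x)\<^sup>2))" by (rule integrable_mult_right[OF ui])
    have "AE x in lebesgue. \<forall>i\<in>UNIV. \<forall>j\<in>UNIV. \<bar>a i j x\<bar> \<le> \<Lambda>" by (intro AE_finite_allI) (auto simp: \<Lambda>)
    then show "AE x in lebesgue. q x * w x * w x \<le> ?d\<^sup>2 * \<Lambda> * B\<^sup>2 * (\<rho> x * (u x)\<^sup>2)"
    proof eventually_elim
      case (elim x)
      show ?case
      proof (cases "norm x \<le> 2 * R")
        case True
        have n: "norm x < 7 * R" "norm x \<le> 3 * R" using True R by auto
        have "(\<Sum>i\<in>UNIV. \<Sum>j\<in>UNIV. a i j x * (pd i \<theta> x * pd j \<theta> x)) \<le> (\<Sum>i\<in>(UNIV::'n set). \<Sum>j\<in>(UNIV::'n set). \<Lambda> * (B * B))"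
        proof (intro sum_mono)
          fix i j
          have "\<bar>a i j x * (pd i \<theta> x * pd j \<theta> x)\<bar> \<le> \<Lambda> * (B * B)"
            unfolding abs_mult by (intro mult_mono \<theta>(3) \<Lambda>(1)) (use elim B0 in auto)
          then show "a i j x * (pd i \<theta> x * pd j \<theta> x) \<le> \<Lambda> * (B * B)" by linarith
        qed
        also have "\<dots> = ?d\<^sup>2 * \<Lambda> * B\<^sup>2" by (simp add: power2_eq_square)
        finally have "(\<rho> x * (u x)\<^sup>2) * (\<Sum>i\<in>UNIV. \<Sum>j\<in>UNIV. a i j x * (pd i \<theta> x * pd j \<theta> x)) \<le> (\<rho> x * (u x)\<^sup>2) * (?d\<^sup>2 * \<Lambda> * B\<^sup>2)"
          using \<rho>_nonneg by (intro mult_left_mono) auto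
        moreover have "q x * w x * w x = (\<rho> x * (u x)\<^sup>2) * (\<Sum>i\<in>UNIV. \<Sum>j\<in>UNIV. a i j x * (pd i \<theta> x * pd j \<theta> x))"
          using \<eta>2(2)[OF n(2)] by (simp add: q_def in3(1)[OF n(1)] c_def w_def sum_distrib_left sum_distrib_right power2_eq_square mult_ac)
        ultimately show ?thesis by (simp add: mult_ac)
      next
        case False
        have o: "open (- cball 0 (2 * R) :: (real^'n) set)" "x \<in> - cball 0 (2 * R)" using False by auto
        have z: "\<theta> y = 0" if "y \<in> - cball 0 (2 * R)" for y using that \<theta>(2)[of y] by simp
        have "pd i \<theta> x = 0" for i by (rule pd_eq_0_open[OF o z])
        then have "q x = 0" by (simp add: q_def)
        then show ?thesis using \<rho>_nonneg \<Lambda>(1) by simp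
      qed
    qed
  qed
  ultimately show ?thesis by simp
qed

text \<open>With \<open>\<theta>\<close> the cutoff of radius R, the right side of
  \<open>local_energy\<close> is of order \<open>I / R\<^sup>2\<close>, because the entries of
  \<open>A\<close> are globally bounded, while the left side tends to \<open>I\<close>.\<close>

lemma range_orthogonal_zero:
  assumes u: "u \<in> L2 \<mu>" and orth: "\<And>f. f \<in> Cc_infty \<Longrightarrow> L2_inner \<mu> (\<lambda>x. op_S A \<rho> f x - f x) u = 0"
  shows "AE x in \<mu>. u x = 0"
proof -
  have um [measurable]: "u \<in> borel_measurable lebesgue" and ui: "integrable lebesgue (\<lambda>x. \<rho> x * (u x)\<^sup>2)" using u by (auto simp: L2_\<mu>)
  have eq: "(LINT x|lebesgue. u x * divop c dc f x) = (LINT x|lebesgue. u x * (\<rho> x * f x))" if f: "f \<in> Cc_infty" for f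
    using orth[OF f] inner_op_S[OF f um] inner_\<mu>[OF Cc_measurable[OF f] um]
    by (simp add: L2_inner_diff[OF op_S_L2[OF f] Cc_L2_\<mu>[OF f] u] mult_ac)
  obtain \<Lambda> where \<Lambda>: "\<Lambda> \<ge> 0" "\<And>i j. AE x in lebesgue. \<bar>a i j x\<bar> \<le> \<Lambda>"
  proof (rule a_bounded)
    fix \<Lambda> assume "\<Lambda> \<ge> 0" "\<And>i j. AE x in lebesgue. \<bar>a i j x\<bar> \<le> \<Lambda>"
    then show thesis by (rule that)
  qed
  obtain \<eta> :: "real \<Rightarrow> real^'n \<Rightarrow> real" and C where \<eta>:
    "\<And>R. R > 0 \<Longrightarrow> \<eta> R \<in> Cc_infty" "\<And>R x. 0 \<le> \<eta> R x" "\<And>R x. \<eta> R x \<le> 1"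
    "\<And>R x. R > 0 \<Longrightarrow> norm x \<le> R \<Longrightarrow> \<eta> R x = 1" "\<And>R x. R > 0 \<Longrightarrow> norm x \<ge> 2 * R \<Longrightarrow> \<eta> R x = 0"
    "\<And>R x i. R > 0 \<Longrightarrow> \<bar>pd i (\<eta> R) x\<bar> \<le> C / R"
  proof (rule cutoff_exists)
    fix \<eta> :: "real \<Rightarrow> real^'n \<Rightarrow> real" and C
    assume "\<And>R. R > 0 \<Longrightarrow> \<eta> R \<in> Cc_infty" "\<And>R x. 0 \<le> \<eta> R x" "\<And>R x. \<eta> R x \<le> 1"
      "\<And>R x. R > 0 \<Longrightarrow> norm x \<le> R \<Longrightarrow> \<eta> R x = 1" "\<And>R x. R > 0 \<Longrightarrow> norm x \<ge> 2 * R \<Longrightarrow> \<eta> R x = 0"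
      "\<And>R x i. R > 0 \<Longrightarrow> \<bar>pd i (\<eta> R) x\<bar> \<le> C / R"
    then show thesis by (rule that)
  qed
  define I where "I = (LINT x|lebesgue. \<rho> x * (u x)\<^sup>2)"
  define R where "R n = real (Suc n)" for n
  have R: "R n > 0" for n by (simp add: R_def)
  have est: "(LINT x|lebesgue. \<rho> x * (u x)\<^sup>2 * (\<eta> (R n) x)\<^sup>2) \<le> (real CARD('n))\<^sup>2 * \<Lambda> * (C / R n)\<^sup>2 * I" for n
    unfolding I_def
    \<comment> \<open>Cutoffs of radii R, 3R and 7R vanish beyond 2R, 6R and 14R, as the three
      nested regions demand.\<close>
    by (rule local_energy[OF R[of n], of "\<eta> (R n)" "C / R n" "\<eta> (3 * R n)" "\<eta> (7 * R n)" \<Lambda> u])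
       (use R[of n] \<eta> \<Lambda> u eq in auto)
  have "(\<lambda>n. LINT x|lebesgue. \<rho> x * (u x)\<^sup>2 * (\<eta> (R n) x)\<^sup>2) \<longlonglongrightarrow> I"
    unfolding I_def
  proof (rule integral_dominated_convergence[OF _ _ ui])
    have [measurable]: "\<eta> (R n) \<in> borel_measurable lebesgue" for n using Cc_measurable[OF \<eta>(1)[OF R]] .
    show "(\<lambda>x. \<rho> x * (u x)\<^sup>2) \<in> borel_measurable lebesgue" by measurable
    show "(\<lambda>x. \<rho> x * (u x)\<^sup>2 * (\<eta> (R n) x)\<^sup>2) \<in> borel_measurable lebesgue" for n by measurable
    show "AE x in lebesgue. (\<lambda>n. \<rho> x * (u x)\<^sup>2 * (\<eta> (R n) x)\<^sup>2) \<longlonglongrightarrow> \<rho> x * (u x)\<^sup>2"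
    proof (rule AE_I2)
      fix x :: "real^'n"
      obtain N :: nat where N: "norm x \<le> real N" using real_arch_simple by blast
      have "\<rho> x * (u x)\<^sup>2 * (\<eta> (R n) x)\<^sup>2 = \<rho> x * (u x)\<^sup>2" if "n \<ge> N" for n
        using \<eta>(4)[OF R[of n], of x] N that by (simp add: R_def)
      then show "(\<lambda>n. \<rho> x * (u x)\<^sup>2 * (\<eta> (R n) x)\<^sup>2) \<longlonglongrightarrow> \<rho> x * (u x)\<^sup>2"
        by (intro tendsto_eventually) (auto simp: eventually_sequentially)
    qed
    show "AE x in lebesgue. norm (\<rho> x * (u x)\<^sup>2 * (\<eta> (R n) x)\<^sup>2) \<le> \<rho> x * (u x)\<^sup>2" for n
    proof (rule AE_I2)
      fix x :: "real^'n"
      have "(\<eta> (R n) x)\<^sup>2 \<le> 1" using \<eta>(2,3)[of "R n" x] by (simp add: power_le_one)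
      then show "norm (\<rho> x * (u x)\<^sup>2 * (\<eta> (R n) x)\<^sup>2) \<le> \<rho> x * (u x)\<^sup>2"
        using mult_left_mono[of "(\<eta> (R n) x)\<^sup>2" 1 "\<rho> x * (u x)\<^sup>2"] \<rho>_nonneg[of x] by (simp add: abs_mult)
    qed
  qed
  moreover have "(\<lambda>n. (real CARD('n))\<^sup>2 * \<Lambda> * (C / R n)\<^sup>2 * I) \<longlonglongrightarrow> (real CARD('n))\<^sup>2 * \<Lambda> * 0\<^sup>2 * I"
  proof (intro tendsto_intros)
    show "(\<lambda>n. C / R n) \<longlonglongrightarrow> 0"
      using tendsto_mult_right_zero[OF LIMSEQ_inverse_real_of_nat, of C] by (simp add: R_def divide_inverse)
  qed
  ultimately have "I \<le> (real CARD('n))\<^sup>2 * \<Lambda> * 0\<^sup>2 * I" by (rule LIMSEQ_le) (use est in blast)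
  then have "I \<le> 0" by simp
  moreover have "0 \<le> I" unfolding I_def using \<rho>_nonneg by (intro Bochner_Integration.integral_nonneg) auto
  ultimately have "I = 0" by simp
  then have "AE x in lebesgue. \<rho> x * (u x)\<^sup>2 = 0"
    unfolding I_def using integral_nonneg_eq_0_iff_AE[OF ui] \<rho>_nonneg by simp
  then have "AE x in lebesgue. u x = 0" using \<rho>_pos by eventually_elim simp
  then show ?thesis by (simp add: AE_\<mu>)
qed

lemma essentially_self_adjoint_op_S: "essentially_self_adjoint \<mu> Cc_infty (op_S A \<rho>)"
proof (rule essentially_self_adjoint_criterion[OF op_S_operator Cc_dense_\<mu>])
  fix f g :: "real^'n \<Rightarrow> real" assume f: "f \<in> Cc_infty" and g: "g \<in> Cc_infty"
  show "L2_inner \<mu> (op_S A \<rho> f) g = L2_inner \<mu> f (op_S A \<rho> g)"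
    using inner_op_S_form[OF f g] inner_op_S_form[OF g f] by (simp add: form_B_sym L2_inner_commute[of _ f])
  show "L2_inner \<mu> (op_S A \<rho> f) f \<le> 0"
    using inner_op_S_form[OF f f] form_B_nonneg by simp
qed (fact range_orthogonal_zero)

lemma form_B_op_S:
  assumes f: "f \<in> Cc_infty" and g: "g \<in> Cc_infty"
  shows "form_B A \<rho> f g = L2_inner \<mu> (\<lambda>x. - op_S A \<rho> f x) g"
  using inner_op_S_form[OF f g] form_B_sym[of f g] by (simp add: L2_inner_def)

end

theorem theorem4p5:
  fixes A :: "real^'n \<Rightarrow> real^'n^'n"
    and \<phi> \<rho> :: "real^'n \<Rightarrow> real"
    and p :: real
  assumes "CARD('n) \<ge> 2"
    and "\<phi> \<in> H1loc 2"
    and "\<rho> = (\<lambda>x. (\<phi> x)\<^sup>2)"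
    and "recip_Linf_loc \<rho>"
    and "\<And>x. transpose (A x) = A x"
    and "locally_strictly_elliptic A"
    and "\<And>i j. (\<lambda>x. A x $ i $ j) \<in> Linf"
    and "p > real CARD('n)"
    and "\<And>i j. (\<lambda>x. A x $ i $ j) \<in> H1loc p"
    and "(\<lambda>x. norm (weak_grad \<rho> x)) \<in> Lloc p"
  shows "(\<forall>i. drift A \<rho> i \<in> Lloc p)
    \<and> (\<forall>f\<in>Cc_infty. \<forall>g\<in>Cc_infty.
         form_B A \<rho> f g = L2_inner (weighted \<rho>) (\<lambda>x. - op_S A \<rho> f x) g)
    \<and> essentially_self_adjoint (weighted \<rho>) Cc_infty (op_S A \<rho>)"
proof -
  interpret weighted_operator A \<phi> \<rho> p by (rule weighted_operator.intro) (fact assms)+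
  show ?thesis using drift_Lloc form_B_op_S essentially_self_adjoint_op_S by blast
qed

end
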